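(* Let $s>0$, $p_i,q_i\in(1,\infty)$, $\frac1{p_i}+\frac1{q_i}=1$, $i=1,2$. Then, for functions $f,g$ on $\mathbb{R}^d$, $$\|D^s(fg)\|_{\mathcal{H}^1}\lesssim \|D^sf\|_{L^{p_1}}\|g\|_{L^{q_1}}+\|f\|_{L^{p_2}}\|D^sg\|_{L^{q_2}}.$$
   Context: $X\lesssim Y$ means $X\le CY$ for some constant $C>0$, here independent of $f$ and $g$. $\mathcal{F}f(\xi)=\int_{\mathbb{R}^d}e^{-ix\cdot\xi}f(x)\,dx$ is the Fourier transform and $D^s=\mathcal{F}^{-1}|\xi|^s\mathcal{F}$. $\mathcal{H}^1=\mathcal{H}^1(\mathbb{R}^d)$ is the Hardy space, whose norm is equivalent to that of the homogeneous Triebel-Lizorkin space $\dot F^0_{1,2}(\mathbb{R}^d)$, $$\|h\|_{\dot F^0_{1,2}}=\Big\|\Big(\sum_{k\in\mathbb{Z}}|\dot P_kh|^2\Big)^{1/2}\Big\|_{L^1(\mathbb{R}^d)}.$$ Here $\dot P_k=\mathcal{F}^{-1}\chi(\xi/2^k)\mathcal{F}$, with $\chi(\xi)=\eta(\xi)-\eta(2\xi)$, where $\eta\in C_0^\infty(\mathbb{R}^d)$ is a fixed non-negative, radial, radially decreasing function with $\operatorname{supp}\eta\subset\{|\xi|\le1.1\}$ and $\eta\equiv1$ on $\{|\xi|\le1\}$. *)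

theory Defs
  imports "HOL-Analysis.Analysis"
begin

section \<open>Smooth functions and Schwartz functions\<close>

fun iter_deriv :: "'a list \<Rightarrow> ('a::euclidean_space \<Rightarrow> 'b::real_normed_vector) \<Rightarrow> 'a \<Rightarrow> 'b" where
  "iter_deriv [] f = f"
| "iter_deriv (v # vs) f = (\<lambda>x. frechet_derivative (iter_deriv vs f) (at x) v)"

text \<open>Every iterated partial derivative is required to be Frechet differentiable everywhere, hence
  continuous, so this is \<open>C\<^sup>\<infinity>\<close> on the whole space.\<close>

definition smooth :: "('a::euclidean_space \<Rightarrow> 'b::real_normed_vector) \<Rightarrow> bool" where
  "smooth f \<longleftrightarrow> (\<forall>vs\<in>lists Basis. \<forall>x. iter_deriv vs f differentiable (at x))"

definition schwartz :: "('a::euclidean_space \<Rightarrow> complex) set" where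
  "schwartz = {\<phi>. smooth \<phi> \<and>
     (\<forall>vs\<in>lists Basis. \<forall>N::nat. \<exists>B. \<forall>x. (1 + norm x) ^ N * norm (iter_deriv vs \<phi> x) \<le> B)}"

section \<open>Fourier transform and Fourier multipliers\<close>

definition fourier :: "('a::euclidean_space \<Rightarrow> complex) \<Rightarrow> 'a \<Rightarrow> complex" where
  "fourier f \<xi> = (LINT x|lborel. exp (- \<i> * complex_of_real (x \<bullet> \<xi>)) * f x)"

definition inv_fourier :: "('a::euclidean_space \<Rightarrow> complex) \<Rightarrow> 'a \<Rightarrow> complex" where
  "inv_fourier f x = complex_of_real (1 / (2 * pi) ^ DIM('a)) *
     (LINT \<xi>|lborel. exp (\<i> * complex_of_real (x \<bullet> \<xi>)) * f \<xi>)"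

text \<open>The operator \<open>D\<^sup>s\<close> on Schwartz functions.\<close>

definition frac_D :: "real \<Rightarrow> ('a::euclidean_space \<Rightarrow> complex) \<Rightarrow> 'a \<Rightarrow> complex" where
  "frac_D s \<phi> = inv_fourier (\<lambda>\<xi>. complex_of_real (norm \<xi> powr s) * fourier \<phi> \<xi>)"

text \<open>For a function \<open>h\<close> that is not a Schwartz function, \<open>D\<^sup>s h\<close> is a distribution, given as a
  functional on test functions. As \<open>|\<xi>|\<^sup>s\<close> is even, \<open>D\<^sup>s\<close> is its own transpose for the bilinear
  pairing \<open>\<integral> h \<phi>\<close>. Since \<open>|\<xi>|\<^sup>s\<close> is in general not smooth at the origin, \<open>frac_D s \<phi>\<close> need not
  be a Schwartz function but only decays like \<open>|x|\<close> to the power \<open>-d-s\<close>; so one has to say for which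
  \<open>h\<close> the pairing makes sense (it does for \<open>h\<close> in any \<open>L\<^sup>r\<close>, \<open>1 \<le> r \<le> \<infinity>\<close>).\<close>

definition has_frac_D_distr :: "real \<Rightarrow> ('a::euclidean_space \<Rightarrow> complex) \<Rightarrow> bool" where
  "has_frac_D_distr s h \<longleftrightarrow> (\<forall>\<phi>\<in>schwartz. integrable lborel (\<lambda>x. h x * frac_D s \<phi> x))"

definition frac_D_distr ::
  "real \<Rightarrow> ('a::euclidean_space \<Rightarrow> complex) \<Rightarrow> ('a \<Rightarrow> complex) \<Rightarrow> complex" where
  "frac_D_distr s h \<phi> = (LINT x|lborel. h x * frac_D s \<phi> x)"

definition distr_eq_fun ::
  "(('a::euclidean_space \<Rightarrow> complex) \<Rightarrow> complex) \<Rightarrow> ('a \<Rightarrow> complex) \<Rightarrow> bool" where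
  "distr_eq_fun u F \<longleftrightarrow>
     (\<forall>\<phi>\<in>schwartz. integrable lborel (\<lambda>x. F x * \<phi> x) \<and> u \<phi> = (LINT x|lborel. F x * \<phi> x))"

text \<open>\<open>F\<close> is the function \<open>D\<^sup>s f\<close>.\<close>

definition is_frac_D ::
  "real \<Rightarrow> ('a::euclidean_space \<Rightarrow> complex) \<Rightarrow> ('a \<Rightarrow> complex) \<Rightarrow> bool" where
  "is_frac_D s f F \<longleftrightarrow> has_frac_D_distr s f \<and> distr_eq_fun (frac_D_distr s f) F"

section \<open>Lebesgue spaces\<close>

definition Lp_space :: "real \<Rightarrow> ('a::euclidean_space \<Rightarrow> complex) set" where
  "Lp_space p = {f \<in> borel_measurable lborel. integrable lborel (\<lambda>x. norm (f x) powr p)}"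

definition Lp_norm :: "real \<Rightarrow> ('a::euclidean_space \<Rightarrow> complex) \<Rightarrow> real" where
  "Lp_norm p f = (LINT x|lborel. norm (f x) powr p) powr (1 / p)"

section \<open>Littlewood--Paley projections and the Hardy space norm\<close>

definition lp_cutoff :: "('a::euclidean_space \<Rightarrow> real) \<Rightarrow> bool" where
  "lp_cutoff \<eta> \<longleftrightarrow>
     smooth \<eta> \<and>
     (\<forall>\<xi>. 0 \<le> \<eta> \<xi>) \<and>
     (\<forall>\<xi> \<zeta>. norm \<xi> = norm \<zeta> \<longrightarrow> \<eta> \<xi> = \<eta> \<zeta>) \<and>
     (\<forall>\<xi> \<zeta>. norm \<xi> \<le> norm \<zeta> \<longrightarrow> \<eta> \<zeta> \<le> \<eta> \<xi>) \<and>
     closure {\<xi>. \<eta> \<xi> \<noteq> 0} \<subseteq> {\<xi>. norm \<xi> \<le> 1.1} \<and>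
     (\<forall>\<xi>. norm \<xi> \<le> 1 \<longrightarrow> \<eta> \<xi> = 1)"

definition lp_chi :: "('a::euclidean_space \<Rightarrow> real) \<Rightarrow> 'a \<Rightarrow> real" where
  "lp_chi \<eta> \<xi> = \<eta> \<xi> - \<eta> (2 *\<^sub>R \<xi>)"

definition lp_kernel :: "('a::euclidean_space \<Rightarrow> real) \<Rightarrow> int \<Rightarrow> 'a \<Rightarrow> complex" where
  "lp_kernel \<eta> k = inv_fourier (\<lambda>\<xi>. complex_of_real (lp_chi \<eta> (\<xi> /\<^sub>R (2 powi k))))"

text \<open>The multiplier \<open>\<F>\<^sup>-\<^sup>1 \<chi>(\<xi>/2\<^sup>k) \<F>\<close> acts on a tempered distribution \<open>u\<close> by convolution with the
  Schwartz function \<open>lp_kernel \<eta> k\<close>; the result is the smooth function below.\<close>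

definition lp_proj ::
  "('a::euclidean_space \<Rightarrow> real) \<Rightarrow> int \<Rightarrow> (('a \<Rightarrow> complex) \<Rightarrow> complex) \<Rightarrow> 'a \<Rightarrow> complex" where
  "lp_proj \<eta> k u x = u (\<lambda>y. lp_kernel \<eta> k (x - y))"

text \<open>The Hardy space norm, as the norm of the homogeneous Triebel--Lizorkin space with
  indices \<open>0\<close>, \<open>1\<close>, \<open>2\<close>. The supremum over finite sets of frequencies is the (possibly infinite)
  square function \<open>(\<Sum>\<^sub>k |P\<^sub>k u(x)|\<^sup>2)\<^sup>1\<^sup>/\<^sup>2\<close>.\<close>

definition hardy_norm ::
  "('a::euclidean_space \<Rightarrow> real) \<Rightarrow> (('a \<Rightarrow> complex) \<Rightarrow> complex) \<Rightarrow> ennreal" where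
  "hardy_norm \<eta> u =
     (\<integral>\<^sup>+ x. (SUP K\<in>{K::int set. finite K}. ennreal (L2_set (\<lambda>k. norm (lp_proj \<eta> k u x)) K)) \<partial>lborel)"

end

theory Submission
 imports Defs "HOL-Probability.Probability"
begin

text \<open>Write \<open>f\<^sub>j\<close> and \<open>g\<^sub>j\<close> for the parts of \<open>f\<close> and \<open>g\<close> at frequencies up to \<open>2\<^sup>j\<close>, and \<open>a\<^sub>j = f\<^sub>j - f\<^sub>j\<^sub>-\<^sub>1\<close>,
 \<open>b\<^sub>j = g\<^sub>j - g\<^sub>j\<^sub>-\<^sub>1\<close> for their Littlewood--Paley pieces. Then \<open>fg\<close> is the limit of \<open>f\<^sub>ng\<^sub>n - f\<^sub>-\<^sub>n\<^sub>-\<^sub>1g\<^sub>-\<^sub>n\<^sub>-\<^sub>1\<close>, a sum of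
 increments \<open>f\<^sub>jg\<^sub>j - f\<^sub>j\<^sub>-\<^sub>1g\<^sub>j\<^sub>-\<^sub>1\<close>, and each increment splits into \<open>a\<^sub>jg\<^sub>j\<^sub>-\<^sub>3\<close>, \<open>f\<^sub>j\<^sub>-\<^sub>3b\<^sub>j\<close> and five products
 of pieces of comparable frequency (\<open>paraproduct_decomposition\<close>). On the piece of frequency \<open>2\<^sup>k\<close> of a
 product, \<open>D\<^sup>s\<close> costs \<open>2\<^sup>k\<^sup>s\<close>; writing \<open>a\<^sub>j\<close> as \<open>2\<^sup>-\<^sup>j\<^sup>s\<close> times a piece of \<open>D\<^sup>s f\<close> (\<open>frac_D_piece\<close>) earns
 \<open>2\<^sup>-\<^sup>j\<^sup>s\<close> back.

 The product \<open>a\<^sub>jg\<^sub>j\<^sub>-\<^sub>3\<close> has frequency about \<open>2\<^sup>j\<close>, so \<open>k\<close> and \<open>j\<close> differ by at most one, and the square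
 function in \<open>k\<close> is bounded, on average over translates, by the square function of \<open>D\<^sup>s f\<close> times the maximal
 function of \<open>g\<close> (\<open>high_low\<close>). The term with \<open>f\<close> and \<open>g\<close> exchanged gives the second summand of the estimate. A product of
 comparable pieces has frequency at most a multiple of \<open>2\<^sup>j\<close>; since \<open>s > 0\<close> the sum of
 \<open>2\<^sup>(\<^sup>k\<^sup>-\<^sup>j\<^sup>)\<^sup>s\<close> over such \<open>k\<close> converges, and the Cauchy--Schwarz inequality in \<open>j\<close> leaves a product of two square
 functions (\<open>high_high\<close>). In each case Hoelder's inequality ends the proof.

 Two theorems of harmonic analysis carry these bounds: the maximal theorem (\<open>maximal_theorem\<close>), from
 Vitali's covering lemma, and the square function estimate in \<open>L\<^sup>p\<close> for every \<open>p > 1\<close>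
 (\<open>square_function_Lp\<close>). For the latter, Khintchine's inequality replaces the square function by sums of
 pieces with random signs. Such a sum is bounded in mean square because pieces of distant frequencies are
 orthogonal (\<open>kfam_L2\<close>); for \<open>p < 2\<close> the Calderon--Zygmund decomposition turns this and Hoermander's
 condition (\<open>kfam_hoermander\<close>) into a distribution inequality (\<open>cz_distribution\<close>), and \<open>p > 2\<close> follows by
 duality. Both theorems pass from distribution functions to \<open>L\<^sup>p\<close> by \<open>strong_type_of_distribution_bound\<close>.

 The bounds hold for \<open>f\<^sub>ng\<^sub>n - f\<^sub>-\<^sub>n\<^sub>-\<^sub>1g\<^sub>-\<^sub>n\<^sub>-\<^sub>1\<close> uniformly in \<open>n\<close>. These functions converge almost everywhere
 (\<open>conv_dk_tendsto_AE\<close>) and have a common majorant (\<open>product_dominated\<close>), so Fatou's lemma gives the estimate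
 for \<open>fg\<close>. The pairing of \<open>fg\<close> with \<open>D\<^sup>s \<phi>\<close> is absolutely convergent by the same majorant, because \<open>D\<^sup>s \<phi>\<close> is
 bounded and integrable for every Schwartz function \<open>\<phi>\<close> (\<open>frac_D_nice\<close>).\<close>

text \<open>All integrals over the space are with respect to Lebesgue measure: \<open>NN\<close> is the integral of an extended
 nonnegative function, \<open>LI\<close> the Bochner integral.\<close>

abbreviation nn_lborel :: "('a::euclidean_space => ennreal) => ennreal" (binder "NN " 10)
 where "nn_lborel F \<equiv> nn_integral lborel F"

abbreviation int_lborel :: "('a::euclidean_space => 'b::{banach, second_countable_topology}) => 'b" (binder "LI " 10)
 where "int_lborel F \<equiv> integral\<^sup>L lborel F"

abbreviation meas :: "('a::topological_space => 'b::topological_space) => bool"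
 where "meas f \<equiv> f \<in> borel_measurable borel"

abbreviation enorm :: "'a::real_normed_vector => ennreal" where "enorm x \<equiv> ennreal (norm x)"

abbreviation cx :: "real => complex" where "cx \<equiv> of_real"

section \<open>Change of variables\<close>

lemma nn_integral_lborel_affine:
 fixes f :: "'a::euclidean_space => ennreal"
 assumes [measurable]: "meas f" and c: "c ~= 0"
 shows "(NN x. f (t + c *\<^sub>R x)) = ennreal (1 / \<bar>c\<bar> ^ DIM('a)) * (NN x. f x)"
proof -
 have "(NN x. f x) = ennreal (\<bar>c\<bar> ^ DIM('a)) * (NN x. f (t + c *\<^sub>R x))" by (subst lborel_affine[OF c, of t])
    (simp add: nn_integral_density nn_integral_distr nn_integral_cmult)
 then have "ennreal (1 / \<bar>c\<bar> ^ DIM('a)) * (NN x. f x)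
   = (ennreal (1 / \<bar>c\<bar> ^ DIM('a)) * ennreal (\<bar>c\<bar> ^ DIM('a))) * (NN x. f (t + c *\<^sub>R x))" by (simp add: mult.assoc)
 also have "ennreal (1 / \<bar>c\<bar> ^ DIM('a)) * ennreal (\<bar>c\<bar> ^ DIM('a)) = 1" using c by (simp add: ennreal_mult'[symmetric])
 finally show ?thesis by simp
qed

lemma integrable_lborel_affine:
 fixes f :: "'a::euclidean_space => 'b::{banach, second_countable_topology}"
 assumes f: "integrable lborel f" and c: "c ~= 0"
 shows "integrable lborel (%x. f (t + c *\<^sub>R x))"
proof -
 have [measurable]: "meas f" using borel_measurable_integrable[OF f] by simp
 show ?thesis using f unfolding integrable_iff_bounded by (auto simp: nn_integral_lborel_affine[OF _ c, of "%x. enorm (f x)"] ennreal_mult_less_top)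
qed

lemma integrable_lborel_affine_iff:
 fixes f :: "'a::euclidean_space => 'b::{banach, second_countable_topology}"
 assumes c: "c ~= 0"
 shows "integrable lborel (%x. f (t + c *\<^sub>R x)) \<longleftrightarrow> integrable lborel f"
proof
 assume "integrable lborel (%x. f (t + c *\<^sub>R x))"
 from integrable_lborel_affine[OF this, of "1/c" "-(1/c) *\<^sub>R t"] c
 show "integrable lborel f" by (simp add: algebra_simps)
qed (rule integrable_lborel_affine[OF _ c])

lemma integral_lborel_affine:
 fixes f :: "'a::euclidean_space => 'b::{banach, second_countable_topology}"
 assumes c: "c ~= 0"
 shows "(\<integral>x. f (t + c *\<^sub>R x) \<partial>lborel) = (1 / \<bar>c\<bar> ^ DIM('a)) *\<^sub>R (\<integral>x. f x \<partial>lborel)"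
proof cases
 assume f: "integrable lborel f"
 then have [measurable]: "meas f" using borel_measurable_integrable[OF f] by simp
 have "(\<integral>x. f x \<partial>lborel) = (\<bar>c\<bar> ^ DIM('a)) *\<^sub>R (\<integral>x. f (t + c *\<^sub>R x) \<partial>lborel)"
  using integrable_lborel_affine[OF f c, of t] by (subst lborel_affine[OF c, of t]) (simp add: integral_density integral_distr)
 then show ?thesis using c by simp
next
 assume "\<not> integrable lborel f" with c show ?thesis by (simp add: integrable_lborel_affine_iff not_integrable_integral_eq)
qed

lemma lborel_translate:
 fixes a :: "'a::euclidean_space" and g :: "'a => ennreal" and f :: "'a => 'b::{banach, second_countable_topology}"
 shows nn_integral_translate: "meas g ==> (NN x. g (x - a)) = (NN x. g x)"
  and nn_integral_reflect: "meas g ==> (NN x. g (a - x)) = (NN x. g x)"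
  and integral_translate: "(\<integral>x. f (x - a) \<partial>lborel) = (\<integral>x. f x \<partial>lborel)"
  and integral_reflect: "(\<integral>x. f (a - x) \<partial>lborel) = (\<integral>x. f x \<partial>lborel)"
  and integrable_translate: "integrable lborel (%x. f (x - a)) \<longleftrightarrow> integrable lborel f"
  and integrable_reflect: "integrable lborel (%x. f (a - x)) \<longleftrightarrow> integrable lborel f"
 using nn_integral_lborel_affine[of g 1 "-a"] nn_integral_lborel_affine[of g "-1" a]
  integral_lborel_affine[of 1 f "-a"] integral_lborel_affine[of "-1" f a]
  integrable_lborel_affine_iff[of 1 f "-a"] integrable_lborel_affine_iff[of "-1" f a] by (simp_all add: minus_diff_commute)

section \<open>Power integrals\<close>

definition pint :: "real => ('a::euclidean_space => 'b::real_normed_vector) => ennreal" where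
 "pint p F = (NN x. ennreal (norm (F x) powr p))"

lemma Lp_space_iff:
 "f \<in> Lp_space p \<longleftrightarrow> meas f & pint p f < \<infinity>" unfolding Lp_space_def pint_def integrable_iff_bounded by auto

lemma pint_eq_Lp_norm:
 assumes "f \<in> Lp_space p" "p > 0"
 shows "pint p f = ennreal (Lp_norm p f powr p)"
proof -
 have i: "integrable lborel (%x. norm (f x) powr p)" using assms by (auto simp: Lp_space_def)
 then have "pint p f = ennreal (LI x. norm (f x) powr p)" unfolding pint_def by (subst nn_integral_eq_integral) auto
 moreover have "0 <= (LI x. norm (f x) powr p)" by (intro integral_nonneg_AE) auto
 ultimately show ?thesis using \<open>p > 0\<close> by (simp add: Lp_norm_def powr_powr)
qed

lemma Lp_norm_nonneg: "0 <= Lp_norm p f" by (simp add: Lp_norm_def)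

lemma pint_cmult:
 fixes F :: "'a::euclidean_space => real"
 assumes [measurable]: "meas F" and "c >= 0"
 shows "pint p (%x. c * F x) = ennreal (c powr p) * pint p F"
proof -
 have "ennreal (norm (c * F x) powr p) = ennreal (c powr p) * ennreal (norm (F x) powr p)" for x
  using \<open>c >= 0\<close> by (simp add: abs_mult powr_mult ennreal_mult)
 then show ?thesis unfolding pint_def by (simp add: nn_integral_cmult)
qed

text \<open>This form of Young's inequality tolerates \<open>1/r + 1/q < 1\<close>, because the summand 1 is integrable against
 the kernels to which it is applied.\<close>

lemma mult_le_one_plus_powr:
 fixes u v :: real
 assumes "u >= 0" "v >= 0" "r > 0" "q > 0" "1 / r + 1 / q <= 1"
 shows "u * v <= 1 + u powr r + v powr q"
proof -
 define m where "m = max (u powr r) (v powr q)"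
 have m0: "m >= 0" by (simp add: m_def le_max_iff_disj)
 have "u = (u powr r) powr (1/r)" using assms by (simp add: powr_powr)
 also have "... <= m powr (1/r)" using assms by (intro powr_mono2) (auto simp: m_def)
 finally have u: "u <= m powr (1/r)" .
 have "v = (v powr q) powr (1/q)" using assms by (simp add: powr_powr)
 also have "... <= m powr (1/q)" using assms by (intro powr_mono2) (auto simp: m_def)
 finally have v: "v <= m powr (1/q)" .
 have "u * v <= m powr (1/r) * m powr (1/q)" using u v assms by (intro mult_mono) auto
 also have "... = m powr (1/r+1/q)" by (simp add: powr_add)
 also have "... <= 1 + m"
 proof (cases "m <= 1")
  case True
  then have "m powr (1/r+1/q) <= 1" using m0 assms by (intro powr_le1) auto
  then show ?thesis using m0 by simp
 next
  case False
  then have "m powr (1/r+1/q) <= m powr 1" using assms by (intro powr_mono) auto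
  then show ?thesis using False by simp
 qed
 also have "... <= 1 + u powr r + v powr q" by (auto simp: m_def)
 finally show ?thesis .
qed

lemma le_one_plus_powr:
 fixes u :: real
 assumes "u >= 0" "r >= 1"
 shows "u <= 1 + u powr r"
proof (cases "u <= 1")
 case False
 then have "u powr 1 <= u powr r" using assms by (intro powr_mono) auto
 then show ?thesis using False by simp
qed (use powr_ge_zero[of u r] in linarith)

lemma nn_Hoelder:
 fixes F :: "'a::euclidean_space => real" and G :: "'a => real"
 assumes [measurable]: "meas F" "meas G"
 assumes pq: "1 < p" "1 < q" "1 / p + 1 / q = 1"
 assumes F: "pint p F <= ennreal (a powr p)" and G: "pint q G <= ennreal (b powr q)"
 assumes ab: "a >= 0" "b >= 0"
 shows "(NN x. ennreal \<bar>F x * G x\<bar>) <= ennreal (a * b)"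
proof -
 have *: "(NN x. ennreal \<bar>F x * G x\<bar>) <= ennreal ((a + e) * (b + e))" if e: "e > 0" for e
 proof -
  define A where "A = a + e"
  define B where "B = b + e"
  have A: "A > 0" "B > 0" using ab e by (auto simp: A_def B_def)
  have FA: "pint p F <= ennreal (A powr p)" by (rule order_trans[OF F]) (intro ennreal_leI powr_mono2, use ab e pq in \<open>auto simp: A_def\<close>)
  have GB: "pint q G <= ennreal (B powr q)" by (rule order_trans[OF G]) (intro ennreal_leI powr_mono2, use ab e pq in \<open>auto simp: B_def\<close>)
  have pw: "\<bar>F x * G x\<bar> <= (A * B / (p * A powr p)) * \<bar>F x\<bar> powr p + (A * B / (q * B powr q)) * \<bar>G x\<bar> powr q" for x
  proof -
   have "(\<bar>F x\<bar> / A) * (\<bar>G x\<bar> / B) <= (\<bar>F x\<bar> / A) powr p / p + (\<bar>G x\<bar> / B) powr q / q"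
    using A by (intro Youngs_inequality pq) auto
   also have "... = \<bar>F x\<bar> powr p / (p * A powr p) + \<bar>G x\<bar> powr q / (q * B powr q)" using A by (simp add: powr_divide field_simps)
   finally have "(A * B) * ((\<bar>F x\<bar> / A) * (\<bar>G x\<bar> / B)) <= (A * B) * (\<bar>F x\<bar> powr p / (p * A powr p) + \<bar>G x\<bar> powr q / (q * B powr q))"
    using A by (intro mult_left_mono) auto
   then show ?thesis using A by (simp add: abs_mult algebra_simps)
  qed
  have "(NN x. ennreal \<bar>F x * G x\<bar>)
   <= (NN x. ennreal (A * B / (p * A powr p)) * ennreal (\<bar>F x\<bar> powr p) + ennreal (A * B / (q * B powr q)) * ennreal (\<bar>G x\<bar> powr q))"
   using pw A pq by (intro nn_integral_mono) (auto simp: ennreal_mult'[symmetric] ennreal_plus[symmetric] simp del: ennreal_plus intro!: ennreal_leI)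
  also have "... = ennreal (A * B / (p * A powr p)) * pint p F + ennreal (A * B / (q * B powr q)) * pint q G"
   by (simp add: nn_integral_add nn_integral_cmult pint_def)
  also have "... <= ennreal (A * B / (p * A powr p)) * ennreal (A powr p) + ennreal (A * B / (q * B powr q)) * ennreal (B powr q)"
   by (intro add_mono mult_left_mono FA GB) auto
  also have "... = ennreal (A * B / (p * A powr p) * A powr p + A * B / (q * B powr q) * B powr q)"
   using A pq by (simp add: ennreal_mult'[symmetric] ennreal_plus[symmetric] del: ennreal_plus)
  also have "A * B / (p * A powr p) * A powr p + A * B / (q * B powr q) * B powr q = A * B * (1/p + 1/q)" using A by (simp add: field_simps)
  finally show ?thesis using pq by (simp add: A_def B_def)
 qed
 show ?thesis
 proof (rule ennreal_le_epsilon)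
  fix e :: real assume e: "0 < e"
  define d where "d = min 1 (e / (a + b + 1))"
  have d: "d > 0" "d <= 1" using e ab by (auto simp: d_def)
  have "d <= e / (a + b + 1)" by (simp add: d_def)
  then have d3: "d * (a + b + 1) <= e" using ab by (simp add: pos_le_divide_eq)
  have "(a + d) * (b + d) = a * b + d * (a + b + d)" by (simp add: algebra_simps)
  also have "... <= a * b + d * (a + b + 1)" using d by (intro add_left_mono mult_left_mono) auto
  also have "... <= a * b + e" using d3 by simp
  finally have "ennreal ((a + d) * (b + d)) <= ennreal (a * b + e)" by (rule ennreal_leI)
  from order_trans[OF *[OF d(1)] this]
  show "(NN x. ennreal \<bar>F x * G x\<bar>) <= ennreal (a * b) + ennreal e" using ab e by (simp add: ennreal_plus[symmetric] del: ennreal_plus)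
 qed
qed

lemma minus_triangle: "norm (a + b) powr p <= 2 powr p * (norm a powr p + norm b powr p)" if "p >= 0" for a b :: "'b::real_normed_vector"
proof -
 have "norm (a + b) powr p <= (2 * max (norm a) (norm b)) powr p" using norm_triangle_ineq[of a b] that by (intro powr_mono2) auto
 also have "... = 2 powr p * max (norm a) (norm b) powr p" by (simp add: powr_mult le_max_iff_disj)
 also have "max (norm a) (norm b) powr p <= norm a powr p + norm b powr p" by (auto simp: max_def)
 finally show ?thesis by (simp add: mult_left_mono)
qed

section \<open>Strong type bounds from distribution functions\<close>

text \<open>With \<open>u = N / l\<close>, the contribution of a value \<open>N\<close> to the measure of a level set at height \<open>l\<close> that comes
 from a weak type one bound for the values above \<open>l\<close> and a weak type \<open>q\<close> bound for the others.\<close>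
definition kap :: "real => real => real" where
 "kap q u = (if u > 1 then u else u powr q)"

lemma kap_nonneg: "u >= 0 ==> 0 <= kap q u" by (simp add: kap_def)

lemma kap_measurable [measurable]: "meas (kap q)" unfolding kap_def by measurable

lemma nn_integral_powr_initial:
 fixes a c :: real
 assumes "a > -1" "c >= 0"
 shows "(NN l. ennreal (l powr a) * indicator {0..c} l) = ennreal (c powr (a+1) / (a+1))"
 by (rule nn_integral_has_integral_lebesgue'[OF _ has_integral_powr_from_0]) (use assms in auto)

lemma nn_integral_powr_tail:
 fixes a c :: real
 assumes "a < -1" "c > 0"
 shows "(NN l. ennreal (l powr a) * indicator {c..} l) = ennreal (- (c powr (a+1)) / (a+1))"
 by (rule nn_integral_has_integral_lebesgue'[OF _ has_integral_powr_to_inf]) (use assms in auto)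

text \<open>The integral converges at 0 because \<open>p > 1\<close>, as the integrand is linear in \<open>N / l\<close> for \<open>l < N\<close>, and at
 infinity because \<open>p < q\<close>.\<close>
lemma nn_integral_kap:
 fixes N :: real
 assumes "1 < p" "p < q" "N >= 0"
 shows "(NN l. ennreal (p * l powr (p - 1)) * indicator {0<..} l * ennreal (kap q (N / l)))
  <= ennreal ((p / (p - 1) + p / (q - p)) * N powr p)"
proof (cases "N = 0")
 case True
 then show ?thesis using assms by (simp add: kap_def)
next
 case False
 with assms have N: "N > 0" by simp
 have pw: "ennreal (p * l powr (p - 1)) * indicator {0<..} l * ennreal (kap q (N / l))
   <= ennreal (p * N) * (ennreal (l powr (p - 2)) * indicator {0..N} l)
    + ennreal (p * N powr q) * (ennreal (l powr (p - 1 - q)) * indicator {N..} l)" for l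
 proof (cases "l > 0")
  case l: True
  show ?thesis
  proof (cases "N / l > 1")
   case True
   have "p * l powr (p - 1) * kap q (N / l) = p * N * l powr (p - 2)" using True l powr_diff[of l "p-1" 1] by (simp add: kap_def)
   then show ?thesis using True l assms N by (simp add: ennreal_mult'[symmetric] kap_def pos_less_divide_eq)
  next
   case F: False
   have "p * l powr (p - 1) * kap q (N / l) = p * N powr q * l powr (p - 1 - q)"
    using F l N by (simp add: kap_def powr_divide powr_diff del: mult_cancel_left)
   moreover have "l >= N" using F l by (simp add: not_less pos_divide_le_eq)
   ultimately have "ennreal (p * l powr (p - 1)) * indicator {0<..} l * ennreal (kap q (N / l))
     = ennreal (p * N powr q) * (ennreal (l powr (p - 1 - q)) * indicator {N..} l)"
    using l assms N by (simp add: ennreal_mult'[symmetric] kap_nonneg del: mult_cancel_left)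
   then show ?thesis by (metis add_increasing order_refl zero_le)
  qed
 qed simp
 have "(NN l. ennreal (p * l powr (p - 1)) * indicator {0<..} l * ennreal (kap q (N / l)))
  <= (NN l. ennreal (p * N) * (ennreal (l powr (p - 2)) * indicator {0..N} l)
    + ennreal (p * N powr q) * (ennreal (l powr (p - 1 - q)) * indicator {N..} l))" by (intro nn_integral_mono pw)
 also have "... = ennreal (p * N) * ennreal (N powr (p - 1) / (p - 1))
    + ennreal (p * N powr q) * ennreal (N powr (p - q) / (q - p))"
  using nn_integral_powr_initial[of "p-2" N] nn_integral_powr_tail[of "p-1-q" N] assms N
  by (simp add: nn_integral_add nn_integral_cmult minus_divide_right)
 also have "... = ennreal (p * N * (N powr (p - 1) / (p - 1)) + p * N powr q * (N powr (p - q) / (q - p)))"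
  using assms N by (simp add: ennreal_mult'[symmetric] ennreal_plus[symmetric] del: ennreal_plus)
 also have "p * N * (N powr (p - 1) / (p - 1)) + p * N powr q * (N powr (p - q) / (q - p))
   = (p / (p - 1) + p / (q - p)) * N powr p"
 proof -
  have "N * N powr (p - 1) = N powr p" using N by (simp add: powr_diff)
  moreover have "N powr q * N powr (p - q) = N powr p" by (simp add: powr_add[symmetric])
  moreover have "p * N * (N powr (p - 1) / (p - 1)) + p * N powr q * (N powr (p - q) / (q - p))
    = p / (p - 1) * (N * N powr (p - 1)) + p / (q - p) * (N powr q * N powr (p - q))" by simp
  ultimately show ?thesis by (simp only: distrib_right)
 qed
 finally show ?thesis .
qed

text \<open>A single substitute for real interpolation: a bound on the distribution function of \<open>F\<close> which is
 of weak type one against the large values of \<open>N\<close> and of weak type \<open>q\<close> against its small values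
 integrates to a bound in every intermediate power, by Fubini's theorem.\<close>

lemma strong_type_of_distribution_bound:
 fixes F N :: "'a::euclidean_space => real"
 assumes [measurable]: "meas F" "meas N"
  and F0: "!!x. F x >= 0" and N0: "!!x. N x >= 0"
  and p: "1 < p" "p < q" and C: "C >= 0"
  and D: "!!l. l > 0 ==> emeasure lborel {x. l < F x} <= ennreal C * (NN x. ennreal (kap q (N x / l)))"
 shows "pint p F <= ennreal (C * (p / (p - 1) + p / (q - p))) * pint p N"
proof -
 define w where "w l = ennreal (p * l powr (p - 1)) * indicator {0<..} l" for l
 have [measurable]: "meas w" unfolding w_def by measurable
 have 1: "ennreal (F x powr p) = (NN l. w l * indicator {x. l < F x} x)" for x
 proof -
  have "(NN l. w l * indicator {x. l < F x} x) = (NN l. ennreal p * (ennreal (l powr (p - 1)) * indicator {0..F x} l))"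
  proof (rule nn_integral_cong_AE)
   have "AE l in lborel. l ~= 0" "AE l in lborel. l ~= F x" by (rule AE_lborel_singleton)+
   then show "AE l in lborel. w l * indicator {x. l < F x} x = ennreal p * (ennreal (l powr (p - 1)) * indicator {0..F x} l)"
    by eventually_elim (use p in \<open>auto simp: w_def indicator_def ennreal_mult' split: if_splits\<close>)
  qed
  also have "... = ennreal p * ennreal (F x powr p / p)" using p F0[of x] nn_integral_powr_initial[of "p-1" "F x"] by (simp add: nn_integral_cmult)
  also have "... = ennreal (F x powr p)" using p by (simp add: ennreal_mult'[symmetric])
  finally show ?thesis ..
 qed
 have "pint p F = (NN x. (NN l. w l * indicator {x. l < F x} x))" unfolding pint_def using F0 by (intro nn_integral_cong) (simp add: 1[symmetric])
 also have "... = (NN l. (NN x. w l * indicator {x. l < F x} x))"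
 proof (rule lborel_pair.Fubini')
  have "(%(l, x). w l * indicator {z. fst z < F (snd z)} (l, x)) \<in> borel_measurable (lborel \<Otimes>\<^sub>M lborel)" by measurable
  then show "(%(l, x). w l * indicator {x. l < F x} x) \<in> borel_measurable (lborel \<Otimes>\<^sub>M lborel)"
   by (simp add: indicator_def case_prod_unfold cong: if_cong)
 qed
 also have "... = (NN l. w l * emeasure lborel {x. l < F x})" by (intro nn_integral_cong) (simp add: nn_integral_cmult_indicator)
 also have "... <= (NN l. w l * (ennreal C * (NN x. ennreal (kap q (N x / l)))))"
  by (intro nn_integral_mono) (auto simp: w_def indicator_def intro!: mult_left_mono D)
 also have "... = (NN l. (NN x. ennreal C * (w l * ennreal (kap q (N x / l)))))" by (intro nn_integral_cong) (simp add: nn_integral_cmult ac_simps)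
 also have "... = (NN x. (NN l. ennreal C * (w l * ennreal (kap q (N x / l)))))" by (rule lborel_pair.Fubini') simp
 also have "... <= (NN x. ennreal C * ennreal ((p / (p - 1) + p / (q - p)) * N x powr p))"
 proof (intro nn_integral_mono)
  fix x
  have "(NN l. ennreal C * (w l * ennreal (kap q (N x / l))))
    = ennreal C * (NN l. w l * ennreal (kap q (N x / l)))" by (simp add: nn_integral_cmult)
  also have "... <= ennreal C * ennreal ((p / (p - 1) + p / (q - p)) * N x powr p)"
   using nn_integral_kap[OF p N0[of x]] by (intro mult_left_mono) (auto simp: w_def)
  finally show "(NN l. ennreal C * (w l * ennreal (kap q (N x / l))))
    <= ennreal C * ennreal ((p / (p - 1) + p / (q - p)) * N x powr p)" .
 qed
 also have "... = (NN x. ennreal (C * (p / (p - 1) + p / (q - p))) * ennreal (N x powr p))"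
  using C p by (intro nn_integral_cong) (simp add: ennreal_mult'[symmetric] mult.assoc)
 also have "... = ennreal (C * (p / (p - 1) + p / (q - p))) * pint p N" using N0 by (simp add: nn_integral_cmult pint_def)
 finally show ?thesis .
qed

section \<open>The weight (1 + |x|)^(-d-1)\<close>

text \<open>Every Schwartz function is bounded by a multiple of this integrable function, and a translation of the
 argument costs only a power of its length (\<open>wgt_shift\<close>).\<close>
definition wgt :: "'a::euclidean_space => real" where
 "wgt x = 1 / (1 + norm x) ^ (DIM('a) + 1)"

lemma wgt_pos: "wgt x > 0" unfolding wgt_def by (intro divide_pos_pos zero_less_power) (auto simp: add_pos_nonneg)
lemma wgt_nonneg: "wgt x >= 0" using wgt_pos[of x] by simp
lemma wgt_le_1: "wgt (x::'a::euclidean_space) <= 1"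
proof -
 have "1 <= (1 + norm x) ^ (DIM('a) + 1)" by (rule one_le_power) simp
 then show ?thesis unfolding wgt_def by (subst divide_le_eq_1) linarith
qed
lemma wgt_measurable [measurable]: "meas wgt" unfolding wgt_def by measurable
lemma wgt_minus: "wgt (-x) = wgt x" by (simp add: wgt_def)
lemma wgt_shift: "wgt (x + h) <= (1 + norm h) ^ (DIM('a) + 1) * wgt (x::'a::euclidean_space)"
proof -
 have "1 + norm x <= (1 + norm h) * (1 + norm (x + h))"
 proof -
  have "norm x <= norm (x + h) + norm h" using norm_triangle_ineq4[of "x+h" h] by simp
  moreover have "0 <= norm h * norm (x + h)" by simp
  ultimately show ?thesis by (simp add: distrib_left distrib_right del: mult_nonneg_nonneg)
 qed
 then have "(1 + norm x) ^ (DIM('a) + 1) <= ((1 + norm h) * (1 + norm (x + h))) ^ (DIM('a) + 1)" by (intro power_mono) auto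
 moreover have "1 + norm x > 0" "1 + norm (x + h) > 0" by (auto simp: add_pos_nonneg)
 ultimately show ?thesis unfolding wgt_def power_mult_distrib by (simp add: pos_divide_le_eq pos_le_divide_eq mult.commute del: power_Suc)
qed

lemma balls_in_sets_borel [measurable]:
 "ball x r \<in> sets borel" "cball (x::'a::euclidean_space) r \<in> sets borel" by simp_all

text \<open>On the shell of radius \<open>2\<^sup>n\<close> the weight has size \<open>2\<^sup>-\<^sup>n\<^sup>(\<^sup>d\<^sup>+\<^sup>1\<^sup>)\<close>, which turns the growth \<open>r\<^sup>d\<close> of the ball integrals
 into a geometric series.\<close>
lemma nn_integral_wgt:
 fixes h :: "'a::euclidean_space => ennreal" and K :: ennreal
 assumes [measurable]: "meas h"
 assumes K: "!!r. r > 0 ==> (NN x. h x * indicator (ball 0 r) x) <= K * ennreal (r ^ DIM('a))"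
 shows "(NN x. ennreal (wgt x) * h x) <= ennreal (2 ^ (DIM('a) + 2)) * K"
proof -
 let ?d = "DIM('a)"
 define c where "c n = (2::real) ^ (?d + 1) * (1 / 2 ^ n) ^ (?d + 1)" for n :: nat
 have c0: "c n >= 0" for n by (simp add: c_def)
 have ex: "\<exists>n::nat. x \<in> ball 0 (2 ^ n) & wgt x <= c n" for x :: 'a
 proof -
  have E: "\<exists>n::nat. norm x < 2 ^ n" using real_arch_pow[of 2 "norm x"] by auto
  define n where "n = (LEAST n::nat. norm x < 2 ^ n)"
  have n: "norm x < 2 ^ n" unfolding n_def using E by (rule LeastI_ex)
  have "wgt x <= c n"
  proof (cases n)
   case 0
   have "(1::real) <= 2 ^ (?d + 1)" by (rule one_le_power) simp
   then show ?thesis using wgt_le_1[of x] 0 by (simp add: c_def)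
  next
   case (Suc m)
   have "\<not> norm x < 2 ^ m" using not_less_Least[of m "%n. norm x < 2 ^ n"] Suc by (simp add: n_def)
   then have "wgt x <= 1 / (2 ^ m) ^ (?d + 1)"
    unfolding wgt_def by (intro divide_left_mono power_mono mult_pos_pos zero_less_power) (auto simp: add_pos_nonneg)
   also have "... = c n" by (simp add: c_def Suc power_divide power_mult_distrib)
   finally show ?thesis .
  qed
  with n show ?thesis by auto
 qed
 have "(NN x. ennreal (wgt x) * h x) <= (NN x. (\<Sum>n. ennreal (c n) * (h x * indicator (ball 0 (2 ^ n)) x)))"
 proof (intro nn_integral_mono)
  fix x :: 'a
  obtain n where n: "x \<in> ball 0 (2 ^ n)" "wgt x <= c n" using ex by blast
  have "ennreal (wgt x) * h x <= ennreal (c n) * (h x * indicator (ball 0 (2 ^ n)) x)" using n by (auto intro!: mult_right_mono ennreal_leI)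
  also have "... = (\<Sum>n\<in>{n}. ennreal (c n) * (h x * indicator (ball 0 (2 ^ n)) x))" by simp
  also have "... <= (\<Sum>n. ennreal (c n) * (h x * indicator (ball 0 (2 ^ n)) x))" by (rule sum_le_suminf) auto
  finally show "ennreal (wgt x) * h x <= (\<Sum>n. ennreal (c n) * (h x * indicator (ball 0 (2 ^ n)) x))" .
 qed
 also have "... = (\<Sum>n. ennreal (c n) * (NN x. h x * indicator (ball 0 (2 ^ n)) x))"
 proof -
  have m: "(%x. h x * indicator (ball 0 (2 ^ n)) x) \<in> borel_measurable lborel" for n :: nat by measurable
  show ?thesis by (subst nn_integral_suminf) (use m in \<open>auto simp: nn_integral_cmult intro!: suminf_cong\<close>)
 qed
 also have "... <= (\<Sum>n. ennreal (2 ^ (?d + 1) * (1 / 2) ^ n) * K)"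
 proof (rule suminf_le)
  fix n
  have "ennreal (c n) * (NN x. h x * indicator (ball 0 (2 ^ n)) x) <= ennreal (c n) * (K * ennreal ((2 ^ n) ^ ?d))" by (intro mult_left_mono K) auto
  also have "... = ennreal (c n * (2 ^ n) ^ ?d) * K" by (simp add: ennreal_mult' c0 ac_simps)
  also have "c n * (2 ^ n) ^ ?d = 2 ^ (?d + 1) * (1 / 2) ^ n" by (simp add: c_def power_divide)
  finally show "ennreal (c n) * (NN x. h x * indicator (ball 0 (2 ^ n)) x) <= ennreal (2 ^ (?d + 1) * (1 / 2) ^ n) * K" .
 qed auto
 also have "... = (\<Sum>n. ennreal (2 ^ (?d + 1) * (1 / 2) ^ n)) * K" by simp
 also have "(\<Sum>n. ennreal (2 ^ (?d + 1) * (1 / 2) ^ n)) = ennreal (2 ^ (?d + 1) * 2)"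
 proof (rule suminf_ennreal_eq)
  have "(%n. (1/2::real) ^ n) sums (1 / (1 - 1/2))" by (rule geometric_sums) simp
  from sums_mult[OF this, of "2 ^ (?d + 1)"] show "(%n. 2 ^ (?d + 1) * (1 / 2::real) ^ n) sums (2 ^ (?d + 1) * 2)" by simp
 qed simp
 finally show ?thesis by simp
qed

lemma emeasure_ball_le:
 assumes "r > 0"
 shows "emeasure lborel (ball (x::'a::euclidean_space) r) <= ennreal (2 ^ DIM('a)) * ennreal (r ^ DIM('a))"
proof -
 have "ball x r \<subseteq> cbox (x - r *\<^sub>R One) (x + r *\<^sub>R One)"
 proof
  fix y assume y: "y \<in> ball x r"
  show "y \<in> cbox (x - r *\<^sub>R One) (x + r *\<^sub>R One)" unfolding mem_box
  proof
   fix b :: 'a assume b: "b \<in> Basis"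
   have "\<bar>(y - x) \<bullet> b\<bar> <= norm (y - x)" using b by (rule Basis_le_norm)
   also have "... < r" using y by (simp add: dist_norm norm_minus_commute)
   finally show "(x - r *\<^sub>R One) \<bullet> b <= y \<bullet> b & y \<bullet> b <= (x + r *\<^sub>R One) \<bullet> b"
    using b by (auto simp: algebra_simps)
  qed
 qed
 then have "emeasure lborel (ball x r) <= emeasure lborel (cbox (x - r *\<^sub>R One) (x + r *\<^sub>R One))" by (intro emeasure_mono) auto
 also have "... = ennreal ((2 * r) ^ DIM('a))" using assms by (subst emeasure_lborel_cbox) (auto simp: inner_diff_left inner_add_left)
 finally show ?thesis using assms by (simp add: power_mult_distrib ennreal_mult)
qed

lemma integrable_wgt: "integrable lborel (wgt :: 'a::euclidean_space => real)"
proof -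
 have "(NN x. ennreal (wgt (x::'a)) * 1) <= ennreal (2 ^ (DIM('a) + 2)) * ennreal (2 ^ DIM('a))"
  by (rule nn_integral_wgt) (auto intro: emeasure_ball_le)
 also have "... < \<infinity>" by (simp add: ennreal_mult_less_top)
 finally show ?thesis by (simp add: integrable_iff_bounded wgt_nonneg)
qed

section \<open>Partial derivatives and Schwartz functions\<close>

definition pd :: "'a::euclidean_space => ('a => 'b::real_normed_vector) => 'a => 'b" where
 "pd v f = (%x. frechet_derivative f (at x) v)"

lemma iter_deriv_snoc: "iter_deriv (vs @ [b]) f = iter_deriv vs (pd b f)" by (induction vs) (auto simp: pd_def)

lemma pd_eqI: "(f has_derivative f') (at x) ==> pd v f x = f' v" by (simp add: pd_def frechet_derivative_at[symmetric])

lemma pd_has_derivative: "f differentiable (at x) ==> (f has_derivative (%v. pd v f x)) (at x)" by (simp add: pd_def frechet_derivative_works)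

lemma differentiable_imp_has_pd:
 "\<forall>x. f differentiable (at x) ==> (f has_derivative (%v. pd v f x)) (at x)" by (intro pd_has_derivative) auto

text \<open>Both classes below are characterised by recursion on the order of differentiation, with the
 innermost derivative taken first; this turns the product rule into a one step induction.\<close>

fun Cn :: "nat => ('a::euclidean_space => 'b::real_normed_vector) => bool" where
 "Cn 0 f \<longleftrightarrow> (\<forall>x. f differentiable (at x))"
| "Cn (Suc n) f \<longleftrightarrow> (\<forall>x. f differentiable (at x)) & (\<forall>b\<in>Basis. Cn n (pd b f))"

lemma Cn_iff: "Cn n f \<longleftrightarrow> (\<forall>vs\<in>lists Basis. length vs <= n --> (\<forall>x. iter_deriv vs f differentiable (at x)))"
proof (induction n arbitrary: f)
 case 0
 then show ?case by auto
next
 case (Suc n)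
 show ?case
 proof
  assume L: "Cn (Suc n) f"
  show "\<forall>vs\<in>lists Basis. length vs <= Suc n --> (\<forall>x. iter_deriv vs f differentiable (at x))"
  proof (intro ballI impI allI)
   fix vs :: "'a list" and x
   assume vs: "vs \<in> lists Basis" "length vs <= Suc n"
   show "iter_deriv vs f differentiable (at x)"
   proof (cases vs rule: rev_cases)
    case Nil
    then show ?thesis using L by simp
   next
    case (snoc ws b)
    then have "Cn n (pd b f)" using vs L by simp
    then show ?thesis using vs snoc unfolding Suc.IH by (simp add: iter_deriv_snoc)
   qed
  qed
 next
  assume R: "\<forall>vs\<in>lists Basis. length vs <= Suc n --> (\<forall>x. iter_deriv vs f differentiable (at x))"
  have "Cn n (pd b f)" if b: "b \<in> Basis" for b unfolding Suc.IH
  proof (intro ballI impI)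
   fix vs :: "'a list" assume "vs \<in> lists Basis" "length vs <= n"
   then show "\<forall>x. iter_deriv vs (pd b f) differentiable (at x)" using R[rule_format, of "vs @ [b]"] b by (simp add: iter_deriv_snoc)
  qed
  then show "Cn (Suc n) f" using R[rule_format, of "[]"] by simp
 qed
qed

lemma smooth_iff_Cn: "smooth f \<longleftrightarrow> (\<forall>n. Cn n f)" unfolding smooth_def Cn_iff by blast

lemma Cn_differentiable: "Cn n f ==> f differentiable (at x)" by (cases n) auto

lemma Cn_mono: "Cn (Suc n) f ==> Cn n f" unfolding Cn_iff by auto

lemma pd_add: "\<forall>x. f differentiable (at x) ==> \<forall>x. g differentiable (at x) ==> pd v (%x. f x + g x) = (%x. pd v f x + pd v g x)"
 by (rule ext) (rule pd_eqI[OF has_derivative_add[OF differentiable_imp_has_pd differentiable_imp_has_pd]])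

lemma pd_mult:
 fixes f g :: "'a::euclidean_space => complex"
 shows "\<forall>x. f differentiable (at x) ==> \<forall>x. g differentiable (at x) ==> pd v (%x. f x * g x) = (%x. f x * pd v g x + pd v f x * g x)"
 by (rule ext) (rule pd_eqI[OF has_derivative_mult[OF differentiable_imp_has_pd differentiable_imp_has_pd]])

lemma pd_cmult:
 fixes f :: "'a::euclidean_space => complex"
 shows "\<forall>x. f differentiable (at x) ==> pd v (%x. c * f x) = (%x. c * pd v f x)"
 by (rule ext) (rule pd_eqI[OF has_derivative_mult_right[OF differentiable_imp_has_pd]])

lemma pd_of_real:
 fixes f :: "'a::euclidean_space => real"
 shows "\<forall>x. f differentiable (at x) ==> pd v (%x. cx (f x)) = (%x. cx (pd v f x))"
 by (rule ext) (rule pd_eqI[OF has_derivative_of_real[OF differentiable_imp_has_pd]])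

lemma pd_inner: "pd v (%x. cx (x \<bullet> b)) = (%x. cx (v \<bullet> b))"
 by (rule ext, rule pd_eqI[where f'="%v. cx (v \<bullet> b)"]) (auto intro!: derivative_eq_intros)

lemma has_derivative_scale:
 assumes "\<forall>x. f differentiable (at x)"
 shows "((%x. f (c *\<^sub>R x)) has_derivative (%v. pd (c *\<^sub>R v) f (c *\<^sub>R x))) (at x)"
proof -
 have "((%x. c *\<^sub>R x) has_derivative (%v. c *\<^sub>R v)) (at x)" by (auto intro!: derivative_eq_intros)
 from has_derivative_compose[OF this differentiable_imp_has_pd[OF assms]] show ?thesis .
qed

lemma pd_scale:
 fixes f :: "'a::euclidean_space => 'b::real_normed_vector"
 assumes "\<forall>x. f differentiable (at x)"
 shows "pd v (%x. f (c *\<^sub>R x)) = (%x. c *\<^sub>R pd v f (c *\<^sub>R x))"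
proof
 fix x
 have "pd v (%x. f (c *\<^sub>R x)) x = pd (c *\<^sub>R v) f (c *\<^sub>R x)" using has_derivative_scale[OF assms] by (rule pd_eqI)
 also have "... = c *\<^sub>R pd v f (c *\<^sub>R x)"
  using has_derivative_bounded_linear[OF differentiable_imp_has_pd[OF assms, of "c *\<^sub>R x"]] by (rule linear_simps(5))
 finally show "pd v (%x. f (c *\<^sub>R x)) x = c *\<^sub>R pd v f (c *\<^sub>R x)" .
qed

lemma Cn_add: "Cn n f ==> Cn n g ==> Cn n (%x. f x + g x)" by (induction n arbitrary: f g) (auto simp: pd_add)

lemma Cn_mult:
 fixes f g :: "'a::euclidean_space => complex"
 shows "Cn n f ==> Cn n g ==> Cn n (%x. f x * g x)"
proof (induction n arbitrary: f g)
 case (Suc n)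
 have "Cn n (%x. f x * pd b g x + pd b f x * g x)" if "b \<in> Basis" for b
  using Suc.prems that by (intro Cn_add Suc.IH Cn_mono[of n f] Cn_mono[of n g]) auto
 then show ?case using Suc.prems by (auto simp: pd_mult)
qed auto

lemma Cn_cmult:
 fixes f :: "'a::euclidean_space => complex"
 shows "Cn n f ==> Cn n (%x. c * f x)" by (induction n arbitrary: f) (auto simp: pd_cmult)

lemma differentiable_of_real: "f differentiable (at x) ==> (%x. cx (f x)) differentiable (at x)"
 unfolding differentiable_def using has_derivative_of_real by blast

lemma Cn_of_real:
 fixes f :: "'a::euclidean_space => real"
 shows "Cn n f ==> Cn n (%x. cx (f x))"
proof (induction n arbitrary: f)
 case 0
 then show ?case by (auto intro: differentiable_of_real)
next
 case (Suc n)
 then show ?case by (auto simp: pd_of_real intro: differentiable_of_real)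
qed

lemma Cn_const: "Cn n (%x. c)"
proof (induction n arbitrary: c)
 case (Suc n)
 have "pd b (%x. c) = (%x. 0)" for b :: 'a by (rule ext, rule pd_eqI) (rule has_derivative_const)
 then show ?case using Suc by auto
qed auto

lemma Cn_inner: "Cn n (%x. cx (x \<bullet> b))"
proof -
 have d: "(%x. cx (x \<bullet> b)) differentiable (at x)" for x
  by (auto simp: differentiable_def intro!: exI has_derivative_of_real derivative_eq_intros)
 show ?thesis by (cases n) (auto simp: d pd_inner intro!: Cn_const)
qed

lemma Cn_scale:
 fixes f :: "'a::euclidean_space => complex"
 shows "Cn n f ==> Cn n (%x. f (c *\<^sub>R x))"
proof (induction n arbitrary: f)
 case 0
 then show ?case using has_derivative_scale[of f c] by (auto simp: differentiable_def)
next
 case (Suc n)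
 have "(%x. f (c *\<^sub>R x)) differentiable (at x)" for x using Suc.prems has_derivative_scale[of f c] by (auto simp: differentiable_def)
 moreover have "Cn n (%x. cx c * pd b f (c *\<^sub>R x))" if "b \<in> Basis" for b using Suc that by (intro Cn_cmult Suc.IH) auto
 ultimately show ?case using Suc.prems by (auto simp: pd_scale scaleR_conv_of_real)
qed

lemma Cn_continuous: "Cn n f ==> continuous_on UNIV f"
 by (intro differentiable_imp_continuous_on) (auto simp: differentiable_on_def intro: Cn_differentiable)

definition rapid :: "('a::euclidean_space => complex) => bool" where
 "rapid f \<longleftrightarrow> (\<forall>N::nat. \<exists>B. \<forall>x. (1 + norm x) ^ N * norm (f x) <= B)"

fun Sn :: "nat => ('a::euclidean_space => complex) => bool" where
 "Sn 0 f \<longleftrightarrow> (\<forall>x. f differentiable (at x)) & rapid f"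
| "Sn (Suc n) f \<longleftrightarrow> (\<forall>x. f differentiable (at x)) & rapid f & (\<forall>b\<in>Basis. Sn n (pd b f))"

lemma Sn_iff: "Sn n f \<longleftrightarrow> (\<forall>vs\<in>lists Basis. length vs <= n --> (\<forall>x. iter_deriv vs f differentiable (at x)) & rapid (iter_deriv vs f))"
proof (induction n arbitrary: f)
 case 0
 then show ?case by auto
next
 case (Suc n)
 show ?case
 proof
  assume L: "Sn (Suc n) f"
  show "\<forall>vs\<in>lists Basis. length vs <= Suc n --> (\<forall>x. iter_deriv vs f differentiable (at x)) & rapid (iter_deriv vs f)"
  proof (intro ballI impI)
   fix vs :: "'a list"
   assume vs: "vs \<in> lists Basis" "length vs <= Suc n"
   show "(\<forall>x. iter_deriv vs f differentiable (at x)) & rapid (iter_deriv vs f)"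
   proof (cases vs rule: rev_cases)
    case Nil
    then show ?thesis using L by simp
   next
    case (snoc ws b)
    then have "Sn n (pd b f)" using vs L by simp
    then show ?thesis using vs snoc unfolding Suc.IH by (simp add: iter_deriv_snoc)
   qed
  qed
 next
  assume R: "\<forall>vs\<in>lists Basis. length vs <= Suc n --> (\<forall>x. iter_deriv vs f differentiable (at x)) & rapid (iter_deriv vs f)"
  have "Sn n (pd b f)" if b: "b \<in> Basis" for b unfolding Suc.IH
  proof (intro ballI impI)
   fix vs :: "'a list" assume "vs \<in> lists Basis" "length vs <= n"
   then show "(\<forall>x. iter_deriv vs (pd b f) differentiable (at x)) & rapid (iter_deriv vs (pd b f))"
    using R[rule_format, of "vs @ [b]"] b by (simp add: iter_deriv_snoc)
  qed
  then show "Sn (Suc n) f" using R[rule_format, of "[]"] by simp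
 qed
qed

lemma schwartz_iff_Sn: "f \<in> schwartz \<longleftrightarrow> (\<forall>n. Sn n f)"
proof -
 have "f \<in> schwartz \<longleftrightarrow> (\<forall>vs\<in>lists Basis. (\<forall>x. iter_deriv vs f differentiable (at x)) & rapid (iter_deriv vs f))"
  unfolding schwartz_def smooth_def rapid_def by blast
 then show ?thesis unfolding Sn_iff by blast
qed

lemma schwartz_pd: "f \<in> schwartz ==> b \<in> Basis ==> pd b f \<in> schwartz" unfolding schwartz_iff_Sn using Sn.simps(2) by blast

lemma schwartz_rapid: "f \<in> schwartz ==> rapid f" unfolding schwartz_iff_Sn by (auto dest: spec[of _ 0])

lemma schwartz_differentiable: "f \<in> schwartz ==> f differentiable (at x)" unfolding schwartz_iff_Sn by (auto dest: spec[of _ 0])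

lemma schwartz_has_derivative: "f \<in> schwartz ==> (f has_derivative (%v. pd v f x)) (at x)" by (rule pd_has_derivative[OF schwartz_differentiable])

lemma schwartz_continuous: "f \<in> schwartz ==> continuous_on UNIV f"
 by (intro differentiable_imp_continuous_on) (auto simp: differentiable_on_def intro: schwartz_differentiable)

lemma schwartz_measurable: "f \<in> schwartz ==> meas f" by (intro borel_measurable_continuous_onI schwartz_continuous)

lemma rapid_add: "rapid f ==> rapid g ==> rapid (%x. f x + g x)" unfolding rapid_def
proof
 fix N
 assume f: "\<forall>N. \<exists>B. \<forall>x. (1 + norm x) ^ N * cmod (f x) <= B" and g: "\<forall>N. \<exists>B. \<forall>x. (1 + norm x) ^ N * cmod (g x) <= B"
 obtain B where B: "\<forall>x. (1 + norm x) ^ N * cmod (f x) <= B" using f by blast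
 obtain C where C: "\<forall>x. (1 + norm x) ^ N * cmod (g x) <= C" using g by blast
 have "(1 + norm x) ^ N * cmod (f x + g x) <= B + C" for x
 proof -
  have "(1 + norm x) ^ N * cmod (f x + g x) <= (1 + norm x) ^ N * (cmod (f x) + cmod (g x))" by (intro mult_left_mono norm_triangle_ineq) simp
  then show ?thesis using spec[OF B, of x] spec[OF C, of x] by (simp add: distrib_left)
 qed
 then show "\<exists>B. \<forall>x. (1 + norm x) ^ N * cmod (f x + g x) <= B" by blast
qed

text \<open>A factor of polynomial growth is absorbed by raising the order of decay.\<close>
lemma rapid_poly_mult:
 assumes "rapid f" and g: "!!x. norm (g x) <= c * (1 + norm x) ^ m * norm (f x)" and c: "c >= 0"
 shows "rapid g" unfolding rapid_def
proof
 fix N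
 obtain B where B: "\<forall>x. (1 + norm x) ^ (N + m) * cmod (f x) <= B" using assms(1) unfolding rapid_def by blast
 have "(1 + norm x) ^ N * cmod (g x) <= c * B" for x
 proof -
  have "(1 + norm x) ^ N * cmod (g x) <= (1 + norm x) ^ N * (c * (1 + norm x) ^ m * norm (f x))" by (intro mult_left_mono g) simp
  also have "... = c * ((1 + norm x) ^ (N + m) * cmod (f x))" by (simp add: power_add)
  also have "... <= c * B" by (intro mult_left_mono B[rule_format] c)
  finally show ?thesis .
 qed
 then show "\<exists>B. \<forall>x. (1 + norm x) ^ N * cmod (g x) <= B" by blast
qed

lemma schwartz_add: "f \<in> schwartz ==> g \<in> schwartz ==> (%x. f x + g x) \<in> schwartz"
proof -
 have "Sn n f ==> Sn n g ==> Sn n (%x. f x + g x)" for n by (induction n arbitrary: f g) (auto simp: pd_add rapid_add)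
 then show "f \<in> schwartz ==> g \<in> schwartz ==> (%x. f x + g x) \<in> schwartz" by (auto simp: schwartz_iff_Sn)
qed

lemma Sn_cmult: "Sn n f ==> Sn n (%x. c * f x)"
proof (induction n arbitrary: f)
 case 0
 then show ?case by (auto simp: norm_mult intro: rapid_poly_mult[of f _ "norm c" 0])
next
 case (Suc n)
 then show ?case by (auto simp: norm_mult pd_cmult intro: rapid_poly_mult[of f _ "norm c" 0])
qed

lemma Sn_mono: "Sn (Suc n) f ==> Sn n f" unfolding Sn_iff by auto

lemma Sn_add: "Sn n f ==> Sn n g ==> Sn n (%x. f x + g x)" by (induction n arbitrary: f g) (auto simp: pd_add rapid_add)

lemma Sn_inner: "b \<in> Basis ==> Sn n f ==> Sn n (%x. cx (x \<bullet> b) * f x)"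
proof (induction n arbitrary: f)
 case 0
 have "rapid (%x. cx (x \<bullet> b) * f x)"
 proof (rule rapid_poly_mult[of f _ 1 1])
  fix x show "cmod (cx (x \<bullet> b) * f x) <= 1 * (1 + norm x) ^ 1 * cmod (f x)"
   using Basis_le_norm[OF 0(1), of x] by (auto simp: norm_mult intro!: mult_right_mono)
 qed (use 0 in auto)
 then show ?case using 0 Cn_inner[of 0 b] by auto
next
 case (Suc n)
 have r: "rapid (%x. cx (x \<bullet> b) * f x)"
 proof (rule rapid_poly_mult[of f _ 1 1])
  fix x show "cmod (cx (x \<bullet> b) * f x) <= 1 * (1 + norm x) ^ 1 * cmod (f x)"
   using Basis_le_norm[OF Suc(2), of x] by (auto simp: norm_mult intro!: mult_right_mono)
 qed (use Suc in auto)
 have d: "\<forall>x. (%x. cx (x \<bullet> b)) differentiable (at x)" using Cn_inner[of 0 b] by simp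
 have "Sn n (%x. cx (x \<bullet> b) * pd b' f x + cx (b' \<bullet> b) * f x)" if "b' \<in> Basis" for b'
  using Suc.prems that by (intro Sn_add Suc.IH Sn_cmult Sn_mono[of n f]) auto
 then show ?case using Suc.prems r d by (auto simp: pd_mult pd_inner)
qed

lemma schwartz_inner: "b \<in> Basis ==> f \<in> schwartz ==> (%x. cx (x \<bullet> b) * f x) \<in> schwartz" by (auto simp: schwartz_iff_Sn Sn_inner)

lemma pd_outside:
 assumes "!!x. norm x > R ==> f x = 0" "norm x > R"
 shows "pd b f x = 0"
proof -
 have "((%x. 0) has_derivative (%v. 0)) (at x)" by (rule has_derivative_const)
 moreover have "open {x::'a. norm x > R}" by (intro open_Collect_less continuous_intros)
 ultimately have "(f has_derivative (%v. 0)) (at x)" by (rule has_derivative_transform_within_open) (use assms in auto)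
 then show ?thesis by (rule pd_eqI)
qed

lemma rapid_compact:
 assumes "continuous_on UNIV f" and R: "!!x. norm x > R ==> f x = 0"
 shows "rapid f" unfolding rapid_def
proof
 fix N
 have "compact ((%x. (1 + norm x) ^ N * cmod (f x)) ` cball 0 R)"
  by (intro compact_continuous_image continuous_intros continuous_on_subset[OF assms(1)]) auto
 then have "bounded ((%x. (1 + norm x) ^ N * cmod (f x)) ` cball 0 R)" by (rule compact_imp_bounded)
 then obtain B where "!!x. x \<in> cball 0 R ==> norm ((1 + norm x) ^ N * cmod (f x)) <= B" unfolding bounded_iff by blast
 then have B: "!!x. norm x <= R ==> (1 + norm x) ^ N * cmod (f x) <= B" by fastforce
 have "(1 + norm x) ^ N * cmod (f x) <= max B 0" for x using B[of x] R[of x] by (cases "norm x <= R") auto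
 then show "\<exists>B. \<forall>x. (1 + norm x) ^ N * cmod (f x) <= B" by blast
qed

lemma schwartz_of_compact_support:
 assumes "smooth f" and R: "!!x. norm x > R ==> f x = 0"
 shows "f \<in> schwartz"
proof -
 have "Cn n f ==> (!!x. norm x > R ==> f x = 0) ==> Sn n f" for n
 proof (induction n arbitrary: f)
  case 0
  then show ?case using Cn_continuous[of 0 f] by (auto intro!: rapid_compact[of f R])
 next
  case (Suc n)
  then show ?case using Cn_continuous[of "Suc n" f] by (auto intro!: rapid_compact[of f R] Suc.IH intro: pd_outside[of R])
 qed
 then show ?thesis using assms by (auto simp: schwartz_iff_Sn smooth_iff_Cn)
qed

lemma schwartz_wgt_bound:
 assumes "f \<in> schwartz"
 shows "\<exists>B\<ge>0. \<forall>x::'a::euclidean_space. norm (f x) <= B * wgt x & (1 + norm x) ^ m * norm (f x) <= B * wgt x"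
proof -
 obtain B where "\<forall>x. (1 + norm x) ^ (m + (DIM('a) + 1)) * norm (f x) <= B" using schwartz_rapid[OF assms] unfolding rapid_def by blast
 then have B: "(1 + norm x) ^ (m + (DIM('a) + 1)) * norm (f x) <= B" for x by blast
 have p: "0 < (1 + norm (x::'a)) ^ k" for x k by (intro zero_less_power add_pos_nonneg) auto
 have "0 <= (1 + norm (0::'a)) ^ (m + (DIM('a) + 1)) * norm (f 0)" by simp
 from order_trans[OF this B] have B0: "B >= 0" .
 have 1: "(1 + norm x) ^ m * norm (f x) <= B * wgt x" for x
  using B[of x] p[of x "DIM('a)+1"] unfolding wgt_def power_add by (simp add: pos_le_divide_eq ac_simps)
 have 2: "norm (f x) <= B * wgt x" for x
 proof -
  have "1 * norm (f x) <= (1 + norm x) ^ m * norm (f x)" by (intro mult_right_mono one_le_power) auto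
  then show ?thesis using 1[of x] by simp
 qed
 show ?thesis using B0 1 2 by blast
qed

lemma schwartz_integrable: "f \<in> schwartz ==> integrable lborel f"
proof -
 assume f: "f \<in> schwartz"
 from schwartz_wgt_bound[OF f] obtain B where B: "!!x. norm (f x) <= B * wgt x" by blast
 show ?thesis by (rule Bochner_Integration.integrable_bound[OF integrable_mult_right[OF integrable_wgt, of B]])
    (use schwartz_measurable[OF f] in \<open>auto intro!: AE_I2 order_trans[OF B abs_ge_self]\<close>)
qed

section \<open>Kernels: gradient bounds\<close>

lemma schwartz_pd_bound:
 assumes "f \<in> schwartz"
 shows "\<exists>B\<ge>0. \<forall>x v. norm (pd v f x) <= B * norm v * wgt x"
proof -
 have "\<forall>b\<in>Basis. \<exists>B\<ge>0. \<forall>x. norm (pd b f x) <= B * wgt x" using schwartz_wgt_bound[OF schwartz_pd[OF assms]] by blast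
 then obtain B where B: "!!b. b \<in> Basis ==> B b >= 0" "!!b x. b \<in> Basis ==> norm (pd b f x) <= B b * wgt x" by metis
 have "norm (pd v f x) <= (\<Sum>b\<in>Basis. B b) * norm v * wgt x" for x v
 proof -
  have bl: "bounded_linear (%v. pd v f x)" using schwartz_has_derivative[OF assms] by (rule has_derivative_bounded_linear)
  have "pd v f x = pd (\<Sum>b\<in>Basis. (v \<bullet> b) *\<^sub>R b) f x" by (simp add: euclidean_representation)
  also have "... = (\<Sum>b\<in>Basis. pd ((v \<bullet> b) *\<^sub>R b) f x)" by (rule linear_sum[OF bounded_linear.linear[OF bl]])
  also have "... = (\<Sum>b\<in>Basis. (v \<bullet> b) *\<^sub>R pd b f x)" using linear_simps(5)[OF bl] by simp
  also have "norm ... <= (\<Sum>b\<in>Basis. norm v * (B b * wgt x))" by (rule sum_norm_le) (auto intro!: mult_mono B simp: Basis_le_norm)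
  finally show ?thesis by (simp add: sum_distrib_right sum_distrib_left ac_simps)
 qed
 then show ?thesis using B by (intro exI[of _ "\<Sum>b\<in>Basis. B b"]) (auto intro: sum_nonneg)
qed

lemma mean_value_wgt:
 fixes f :: "'a::euclidean_space => complex"
 assumes d: "!!x. (f has_derivative f' x) (at x)"
  and B: "!!x. norm (f' x h) <= B * wgt x" and "B >= 0" and h: "norm h <= 1"
 shows "norm (f (x + h) - f x) <= B * 2 ^ (DIM('a) + 1) * wgt x"
proof -
 have "norm (f (x + 1 *\<^sub>R h) - f (x + 0 *\<^sub>R h)) <= (B * 2 ^ (DIM('a) + 1) * wgt x) * norm (1 - 0 :: real)"
 proof (rule differentiable_bound[of "{0..1}" "%t. f (x + t *\<^sub>R h)" "%t s. s *\<^sub>R f' (x + t *\<^sub>R h) h"])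
  fix t :: real assume t: "t \<in> {0..1}"
  have "((%t. x + t *\<^sub>R h) has_derivative (%s. s *\<^sub>R h)) (at t)" by (auto intro!: derivative_eq_intros)
  from has_derivative_compose[OF this d]
  have "((%t. f (x + t *\<^sub>R h)) has_derivative (%s. f' (x + t *\<^sub>R h) (s *\<^sub>R h))) (at t)" .
  also have "(%s. f' (x + t *\<^sub>R h) (s *\<^sub>R h)) = (%s. s *\<^sub>R f' (x + t *\<^sub>R h) h)"
   using linear_simps(5)[OF has_derivative_bounded_linear[OF d]] by simp
  finally show "((%t. f (x + t *\<^sub>R h)) has_derivative (%s. s *\<^sub>R f' (x + t *\<^sub>R h) h)) (at t within {0..1})"
   by (rule has_derivative_at_withinI)
  have "norm (f' (x + t *\<^sub>R h) h) <= B * wgt (x + t *\<^sub>R h)" by (rule B)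
  also have "... <= B * ((1 + norm (t *\<^sub>R h)) ^ (DIM('a) + 1) * wgt x)" by (intro mult_left_mono wgt_shift \<open>B >= 0\<close>)
  also have "... <= B * (2 ^ (DIM('a) + 1) * wgt x)"
  proof (intro mult_left_mono mult_right_mono power_mono)
   have "norm (t *\<^sub>R h) <= 1 * 1" using t h by (simp only: norm_scaleR) (intro mult_mono, auto)
   then show "1 + norm (t *\<^sub>R h) <= 2" by simp
  qed (auto simp: wgt_nonneg \<open>B >= 0\<close>)
  finally have le: "norm (f' (x + t *\<^sub>R h) h) <= B * 2 ^ (DIM('a) + 1) * wgt x" by (simp only: mult.assoc)
  show "onorm (%s. s *\<^sub>R f' (x + t *\<^sub>R h) h) <= B * 2 ^ (DIM('a) + 1) * wgt x"
  proof (rule onorm_le)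
   fix s :: real
   show "norm (s *\<^sub>R f' (x + t *\<^sub>R h) h) <= B * 2 ^ (DIM('a) + 1) * wgt x * norm s"
    using mult_right_mono[OF le, of "norm s"] by (simp only: norm_scaleR mult.commute real_norm_def abs_ge_zero)
  qed
 qed auto
 then show ?thesis by simp
qed

text \<open>For a small shift the mean value theorem gives a difference of size \<open>|h|\<close> times the weight; for a large
 one the norm of the function suffices.\<close>
lemma schwartz_L1_lipschitz:
 fixes f :: "'a::euclidean_space => complex"
 assumes f: "f \<in> schwartz"
 shows "\<exists>B\<ge>0. \<forall>h. (NN x. enorm (f (x + h) - f x)) <= ennreal (B * norm h)"
proof -
 obtain B where B: "B >= 0" "!!x v. norm (pd v f x) <= B * norm v * wgt x" using schwartz_pd_bound[OF f] by blast
 have [measurable]: "meas f" by (rule schwartz_measurable[OF f])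
 define I where "I = integral\<^sup>L lborel (%x::'a. wgt x)"
 define J where "J = (\<integral>x. norm (f x) \<partial>lborel)"
 have I: "I >= 0" "J >= 0" unfolding I_def J_def by (auto intro!: integral_nonneg_AE simp: wgt_nonneg)
 have II: "(NN x. ennreal (c * wgt (x::'a))) = ennreal (c * I)" if "c >= 0" for c
  using that by (subst nn_integral_eq_integral) (auto simp: I_def wgt_nonneg integrable_wgt)
 have JJ: "(NN x. enorm (f x)) = ennreal J" by (subst nn_integral_eq_integral) (auto simp: J_def schwartz_integrable[OF f])
 define C where "C = B * 2 ^ (DIM('a) + 1) * I + 2 * J"
 have "(NN x. enorm (f (x + h) - f x)) <= ennreal (C * norm h)" for h
 proof (cases "norm h <= 1")
  case True
  have "(NN x. enorm (f (x + h) - f x)) <= (NN x. ennreal ((B * norm h) * 2 ^ (DIM('a) + 1) * wgt (x::'a)))"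
  proof (intro nn_integral_mono ennreal_leI)
   fix x
   show "norm (f (x + h) - f x) <= (B * norm h) * 2 ^ (DIM('a) + 1) * wgt x"
    by (rule mean_value_wgt[where f'="%x v. pd v f x"]) (use B True in \<open>auto intro: schwartz_has_derivative[OF f]\<close>)
  qed
  also have "... = ennreal ((B * norm h) * 2 ^ (DIM('a) + 1) * I)" by (rule II) (use B in auto)
  also have "... <= ennreal (C * norm h)" using I B by (intro ennreal_leI) (auto simp: C_def algebra_simps)
  finally show ?thesis .
 next
  case False
  have "(NN x. enorm (f (x + h) - f x)) <= (NN x. enorm (f (x + h)) + enorm (f x))"
   by (intro nn_integral_mono) (auto simp: norm_triangle_ineq4 simp flip: ennreal_plus)
  also have "... = ennreal J + ennreal J" using nn_integral_translate[of "%x. enorm (f x)" "-h"] by (simp add: nn_integral_add JJ)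
  also have "... = ennreal (2 * J)" using I by (simp flip: ennreal_plus)
  also have "... <= ennreal (C * norm h)"
  proof (intro ennreal_leI)
   have "2 * J * 1 <= C * norm h" using I B False by (intro mult_mono) (auto simp: C_def)
   then show "2 * J <= C * norm h" by simp
  qed
  finally show ?thesis .
 qed
 moreover have "C >= 0" using I B by (simp add: C_def)
 ultimately show ?thesis by blast
qed

section \<open>The Fourier transform on Schwartz functions\<close>

text \<open>The integral common to both transforms: the inverse transform is a multiple of it, and the
 transform is its reflection.\<close>

definition ft :: "('a::euclidean_space => complex) => 'a => complex" where
 "ft f x = (LI \<xi>. iexp (x \<bullet> \<xi>) * f \<xi>)"

lemma inv_fourier_eq_ft: "inv_fourier f x = ft f x / cx ((2 * pi) ^ DIM('a))" for x :: "'a::euclidean_space" by (simp add: inv_fourier_def ft_def)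

lemma fourier_eq_ft: "fourier f x = ft f (- x)" by (simp add: fourier_def ft_def inner_commute)

lemma iexp_measurable [measurable]: "meas (%\<xi>. iexp (x \<bullet> \<xi>))" by (intro borel_measurable_continuous_onI continuous_intros)

lemma integrable_iexp_mult:
 assumes "integrable lborel f"
 shows "integrable lborel (%\<xi>. iexp (x \<bullet> \<xi>) * f \<xi>)"
proof (rule Bochner_Integration.integrable_bound[OF assms])
 show "(%\<xi>. iexp (x \<bullet> \<xi>) * f \<xi>) \<in> borel_measurable lborel" using borel_measurable_integrable[OF assms] by measurable
qed (simp add: norm_mult)

lemma norm_ft_le: "norm (ft f x) <= (\<integral>\<xi>. norm (f \<xi>) \<partial>lborel)"
 unfolding ft_def by (rule order_trans[OF integral_norm_bound]) (simp add: norm_mult)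

text \<open>The integral of a difference quotient vanishes by translation invariance; the limit is integration by
 parts without boundary terms.\<close>
lemma integral_pd_zero:
 fixes F :: "'a::euclidean_space => complex"
 assumes d: "!!x. (F has_derivative F' x) (at x)" and F: "integrable lborel F"
  and m: "meas (%x. F' x b)"
  and B: "!!x. norm (F' x b) <= B * wgt x" "B >= 0" and b: "norm b <= 1"
 shows "(LI x. F' x b) = 0"
proof -
 have [measurable]: "meas F" using borel_measurable_integrable[OF F] by simp
 define g where "g n x = (real (Suc n)) *\<^sub>R (F (x + (1 / real (Suc n)) *\<^sub>R b) - F x)" for n x
 have "(%n. LINT x|lborel. g n x) \<longlonglongrightarrow> (LI x. F' x b)"
 proof (rule integral_dominated_convergence[where w="%x. B * 2 ^ (DIM('a) + 1) * wgt x"])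
  show "integrable lborel (%x::'a. B * 2 ^ (DIM('a) + 1) * wgt x)" by (intro integrable_mult_right integrable_wgt)
  show "AE x in lborel. (%n. g n x) \<longlonglongrightarrow> F' x b"
  proof (intro AE_I2)
   fix x
   have "((%t. F (x + t *\<^sub>R b)) has_derivative (%s. F' x (s *\<^sub>R b))) (at 0)"
   proof -
    have "((%t. x + t *\<^sub>R b) has_derivative (%s. s *\<^sub>R b)) (at 0)" by (auto intro!: derivative_eq_intros)
    from has_derivative_compose[OF this, of F "F' x"] d show ?thesis by simp
   qed
   moreover have "F' x (s *\<^sub>R b) = s *\<^sub>R F' x b" for s by (rule linear_simps(5)[OF has_derivative_bounded_linear[OF d]])
   ultimately have "(%h. norm (F (x + h *\<^sub>R b) - F x - h *\<^sub>R F' x b) / norm h) \<midarrow>0\<rightarrow> 0"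
    by (simp add: has_derivative_at)
   then have "(%h. norm ((F (x + h *\<^sub>R b) - F x) /\<^sub>R h - F' x b)) \<midarrow>0\<rightarrow> 0"
   proof (rule Lim_transform_eventually)
    show "\<forall>\<^sub>F h in at 0. norm (F (x + h *\<^sub>R b) - F x - h *\<^sub>R F' x b) / norm h = norm ((F (x + h *\<^sub>R b) - F x) /\<^sub>R h - F' x b)"
    proof (rule eventually_mono[OF eventually_neq_at_within])
     fix h :: real assume h: "h ~= 0"
     then have "(F (x + h *\<^sub>R b) - F x) /\<^sub>R h - F' x b = (F (x + h *\<^sub>R b) - F x - h *\<^sub>R F' x b) /\<^sub>R h"
      by (simp add: scaleR_diff_right)
     then show "norm (F (x + h *\<^sub>R b) - F x - h *\<^sub>R F' x b) / norm h = norm ((F (x + h *\<^sub>R b) - F x) /\<^sub>R h - F' x b)"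
      by (simp add: divide_inverse mult.commute)
    qed
   qed
   then have "((%h. (F (x + h *\<^sub>R b) - F x) /\<^sub>R h) \<longlongrightarrow> F' x b) (at 0)"
    by (rule LIM_zero_cancel[OF tendsto_norm_zero_cancel])
   moreover have "filterlim (%n. 1 / real (Suc n)) (at 0) sequentially"
    by (intro filterlim_atI) (auto intro: LIMSEQ_Suc lim_1_over_n simp del: of_nat_Suc)
   ultimately have "((%n. (F (x + (1 / real (Suc n)) *\<^sub>R b) - F x) /\<^sub>R (1 / real (Suc n))) \<longlongrightarrow> F' x b) sequentially"
    by (rule filterlim_compose)
   then show "(%n. g n x) \<longlonglongrightarrow> F' x b" by (simp add: g_def del: of_nat_Suc)
  qed
  fix n
  show "AE x in lborel. norm (g n x) <= B * 2 ^ (DIM('a) + 1) * wgt x"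
  proof (intro AE_I2)
   fix x
   let ?h = "(1 / real (Suc n)) *\<^sub>R b"
   have "norm (F (x + ?h) - F x) <= (1 / real (Suc n) * B) * 2 ^ (DIM('a) + 1) * wgt x"
   proof (rule mean_value_wgt[OF d])
    show "norm ?h <= 1" using mult_mono[of "1 / real (Suc n)" 1 "norm b" 1] b by (simp del: of_nat_Suc)
    fix x
    have "F' x ?h = (1 / real (Suc n)) *\<^sub>R F' x b" by (rule linear_simps(5)[OF has_derivative_bounded_linear[OF d]])
    then show "norm (F' x ?h) <= 1 / real (Suc n) * B * wgt x" using B(1)[of x] by (simp add: divide_right_mono del: of_nat_Suc)
   qed (use B in simp)
   then have "real (Suc n) * norm (F (x + ?h) - F x) <= real (Suc n) * ((1 / real (Suc n) * B) * 2 ^ (DIM('a) + 1) * wgt x)"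
    by (intro mult_left_mono) auto
   then show "norm (g n x) <= B * 2 ^ (DIM('a) + 1) * wgt x" by (simp add: g_def del: of_nat_Suc)
  qed
 qed (use m in \<open>auto simp: g_def\<close>)
 moreover have "(LI x. g n x) = 0" for n
 proof -
  have "integrable lborel (%x. F (x + (1 / real (Suc n)) *\<^sub>R b))" using F integrable_translate[of F "- (1 / real (Suc n)) *\<^sub>R b"] by simp
  moreover have "(LI x. F (x + (1 / real (Suc n)) *\<^sub>R b)) = (LI x. F x)"
   using integral_translate[of F "- (1 / real (Suc n)) *\<^sub>R b"] by simp
  ultimately show ?thesis using F by (simp add: g_def)
 qed
 ultimately show ?thesis by (simp add: LIMSEQ_const_iff)
qed

lemma has_derivative_iexp:
 "((%y. iexp (x \<bullet> y)) has_derivative (%v. \<i> * cx (x \<bullet> v) * iexp (x \<bullet> y))) (at y)"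
proof -
 have "((%y. \<i> * cx (x \<bullet> y)) has_derivative (%v. \<i> * cx (x \<bullet> v))) (at y)"
  by (intro has_derivative_mult_right has_derivative_of_real has_derivative_inner_right has_derivative_ident)
 from has_derivative_compose[OF this DERIV_exp[unfolded has_field_derivative_def]]
 show ?thesis by (simp add: ac_simps)
qed

lemma ft_pd:
 assumes f: "f \<in> schwartz" and b: "b \<in> Basis"
 shows "ft (pd b f) x = - \<i> * cx (x \<bullet> b) * ft f x"
proof -
 let ?e = "%y. iexp (x \<bullet> y)"
 let ?F' = "%y v. ?e y * pd v f y + \<i> * cx (x \<bullet> v) * ?e y * f y"
 have [measurable]: "meas f" "meas (pd b f)" using f b by (auto intro: schwartz_measurable schwartz_pd)
 obtain B where B: "B >= 0" "!!y. norm (pd b f y) <= B * wgt y" using schwartz_wgt_bound[OF schwartz_pd[OF f b]] by blast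
 obtain C where C: "C >= 0" "!!y. norm (f y) <= C * wgt y" using schwartz_wgt_bound[OF f] by blast
 have i: "integrable lborel (%y. ?e y * pd b f y)" "integrable lborel (%y. ?e y * f y)"
  by (intro integrable_iexp_mult schwartz_integrable f schwartz_pd b)+
 have "(LI y. ?F' y b) = 0"
 proof (rule integral_pd_zero[where F="%y. ?e y * f y" and F'="?F'" and B="B + \<bar>x \<bullet> b\<bar> * C"])
  show "((%y. ?e y * f y) has_derivative ?F' y) (at y)" for y using has_derivative_mult[OF has_derivative_iexp schwartz_has_derivative[OF f]] .
  show "norm (?F' y b) <= (B + \<bar>x \<bullet> b\<bar> * C) * wgt y" for y
  proof -
   have "norm (?F' y b) <= norm (pd b f y) + \<bar>x \<bullet> b\<bar> * norm (f y)"
    by (rule order_trans[OF norm_triangle_ineq]) (simp add: norm_mult)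
   also have "... <= B * wgt y + \<bar>x \<bullet> b\<bar> * (C * wgt y)" by (intro add_mono mult_left_mono B C) auto
   finally show ?thesis by (simp add: algebra_simps)
  qed
 qed (use i b B C in auto)
 then have "(LI y. ?e y * pd b f y) + \<i> * cx (x \<bullet> b) * (LI y. ?e y * f y) = 0" using i by (simp add: mult.assoc)
 then show ?thesis unfolding ft_def by (simp add: add_eq_0_iff mult.assoc)
qed

text \<open>By \<open>ft_pd\<close>, multiplying the transform by a coordinate amounts to differentiating the function, so boundedness
 of the transform of every derivative is decay of every order.\<close>
lemma rapid_ft: "f \<in> schwartz ==> rapid (ft f)" unfolding rapid_def
proof
 fix N assume "f \<in> schwartz"
 then show "\<exists>B. \<forall>x. (1 + norm x) ^ N * cmod (ft f x) <= B"
 proof (induction N arbitrary: f)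
  case 0
  then show ?case using norm_ft_le[of f] by auto
 next
  case (Suc N)
  have "\<forall>b\<in>Basis. \<exists>B. \<forall>x. (1 + norm x) ^ N * cmod (ft (pd b f) x) <= B" using Suc schwartz_pd by blast
  then obtain B where B: "!!b x. b \<in> Basis ==> (1 + norm x) ^ N * cmod (ft (pd b f) x) <= B b" by metis
  obtain C where C: "!!x. (1 + norm x) ^ N * cmod (ft f x) <= C" using Suc by blast
  have "(1 + norm x) ^ Suc N * cmod (ft f x) <= C + (\<Sum>b\<in>Basis. B b)" for x
  proof -
   have "(1 + norm x) ^ Suc N * cmod (ft f x) = (1 + norm x) ^ N * cmod (ft f x) + norm x * ((1 + norm x) ^ N * cmod (ft f x))"
    by (simp add: algebra_simps)
   also have "norm x * ((1 + norm x) ^ N * cmod (ft f x)) <= (\<Sum>b\<in>Basis. \<bar>x \<bullet> b\<bar>) * ((1 + norm x) ^ N * cmod (ft f x))"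
    by (intro mult_right_mono norm_le_l1) auto
   also have "... = (\<Sum>b\<in>Basis. (1 + norm x) ^ N * cmod (ft (pd b f) x))"
    unfolding sum_distrib_right using Suc.prems by (intro sum.cong) (auto simp: ft_pd norm_mult)
   also have "... <= (\<Sum>b\<in>Basis. B b)" by (intro sum_mono B)
   finally show ?thesis using C[of x] by simp
  qed
  then show ?case by blast
 qed
qed

lemma norm_iexp_taylor: "norm (iexp t - 1 - \<i> * cx t) <= t\<^sup>2"
proof -
 have "norm (iexp t - 1 - \<i> * cx t) <= t\<^sup>2 / 2" using iexp_approx1[of t 1] by (simp add: diff_diff_eq power2_eq_square)
 also have "... <= t\<^sup>2" by simp
 finally show ?thesis .
qed

text \<open>The error of the first order expansion of the exponential is quadratic in the increment, and the second
 moment of a Schwartz function is finite.\<close>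
lemma ft_has_derivative:
 fixes f :: "'a::euclidean_space => complex"
 assumes f: "f \<in> schwartz"
 shows "(ft f has_derivative (%v. \<Sum>b\<in>Basis. (v \<bullet> b) *\<^sub>R (\<i> * ft (%\<xi>. cx (\<xi> \<bullet> b) * f \<xi>) x))) (at x)"
  (is "(_ has_derivative ?D) _")
proof -
 have [measurable]: "meas f" by (rule schwartz_measurable[OF f])
 obtain B where B: "B >= 0" "!!y. (1 + norm y) ^ 2 * norm (f y) <= B * wgt y" using schwartz_wgt_bound[OF f, of 2] by blast
 define I where "I = integral\<^sup>L lborel (%y::'a. B * wgt y)"
 have D: "?D h = (LI \<xi>. iexp (x \<bullet> \<xi>) * (\<i> * cx (h \<bullet> \<xi>) * f \<xi>))" for h
 proof -
  have "(LI \<xi>. iexp (x \<bullet> \<xi>) * (\<i> * cx (h \<bullet> \<xi>) * f \<xi>))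
   = (LI \<xi>. (\<Sum>b\<in>Basis. (\<i> * cx (h \<bullet> b)) * (iexp (x \<bullet> \<xi>) * (cx (\<xi> \<bullet> b) * f \<xi>))))"
  proof (rule Bochner_Integration.integral_cong)
   fix \<xi> :: 'a
   have "h \<bullet> \<xi> = (\<Sum>b\<in>Basis. (h \<bullet> b) * (\<xi> \<bullet> b))" by (rule euclidean_inner)
   then show "iexp (x \<bullet> \<xi>) * (\<i> * cx (h \<bullet> \<xi>) * f \<xi>)
    = (\<Sum>b\<in>Basis. (\<i> * cx (h \<bullet> b)) * (iexp (x \<bullet> \<xi>) * (cx (\<xi> \<bullet> b) * f \<xi>)))"
    by (simp add: sum_distrib_left sum_distrib_right ac_simps)
  qed simp
  also have "... = (\<Sum>b\<in>Basis. (\<i> * cx (h \<bullet> b)) * ft (%\<xi>. cx (\<xi> \<bullet> b) * f \<xi>) x)"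
  proof -
   have int: "integrable lborel (%\<xi>. iexp (x \<bullet> \<xi>) * (cx (\<xi> \<bullet> b) * f \<xi>))" if "b \<in> Basis" for b
    by (rule integrable_iexp_mult[OF schwartz_integrable[OF schwartz_inner[OF that f]]])
   show ?thesis unfolding ft_def by (subst Bochner_Integration.integral_sum)
     (auto intro: int)
  qed
  finally show ?thesis by (simp add: scaleR_conv_of_real ac_simps)
 qed
 have "bounded_linear ?D" by (intro bounded_linear_sum bounded_linear_scaleR_left[THEN bounded_linear_compose] bounded_linear_inner_left)
 moreover have "((%h. norm (ft f (x + h) - ft f x - ?D h) / norm h) \<longlongrightarrow> 0) (at 0)"
 proof (rule tendsto_sandwich[of "%h. 0" _ _ "%h. I * norm h"])
  show "eventually (%h. norm (ft f (x + h) - ft f x - ?D h) / norm h <= I * norm h) (at 0)"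
  proof (rule always_eventually, rule allI)
   fix h :: 'a
   let ?g = "%\<xi>. iexp (x \<bullet> \<xi>) * (iexp (h \<bullet> \<xi>) - 1 - \<i> * cx (h \<bullet> \<xi>)) * f \<xi>"
   have i3: "integrable lborel (%\<xi>. iexp (x \<bullet> \<xi>) * (\<i> * cx (h \<bullet> \<xi>) * f \<xi>))"
   proof (rule integrable_iexp_mult, rule Bochner_Integration.integrable_bound[OF integrable_mult_right[OF integrable_wgt, of "norm h * B"]])
    show "AE \<xi> in lborel. norm (\<i> * cx (h \<bullet> \<xi>) * f \<xi>) <= norm (norm h * B * wgt \<xi>)"
    proof (intro AE_I2)
     fix \<xi> :: 'a
     have "norm (\<i> * cx (h \<bullet> \<xi>) * f \<xi>) <= (norm h * norm \<xi>) * norm (f \<xi>)"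
      by (simp add: norm_mult mult_right_mono Cauchy_Schwarz_ineq2)
     also have "... <= norm h * ((1 + norm \<xi>)^2 * norm (f \<xi>))"
      by (auto simp: mult.assoc power2_eq_square algebra_simps intro!: mult_left_mono)
     also have "... <= norm h * (B * wgt \<xi>)" by (intro mult_left_mono B) auto
     finally show "norm (\<i> * cx (h \<bullet> \<xi>) * f \<xi>) <= norm (norm h * B * wgt \<xi>)" using B by (simp add: wgt_nonneg mult.assoc)
    qed
   qed simp
   have "ft f (x + h) - ft f x - ?D h = (LI \<xi>. ?g \<xi>)" unfolding D unfolding ft_def using integrable_iexp_mult[OF schwartz_integrable[OF f]] i3
    by (subst Bochner_Integration.integral_diff[symmetric], simp, simp,
      subst Bochner_Integration.integral_diff[symmetric], simp, simp)
      (auto intro!: Bochner_Integration.integral_cong simp: inner_add_left ring_distribs exp_add algebra_simps)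
   also have "norm ... <= (LI \<xi>. (norm h)\<^sup>2 * (B * wgt (\<xi>::'a)))"
   proof (rule Bochner_Integration.integral_norm_bound_integral)
    fix \<xi> :: 'a
    have "norm (?g \<xi>) <= (h \<bullet> \<xi>)^2 * norm (f \<xi>)" by (simp add: norm_mult mult_right_mono norm_iexp_taylor)
    also have "... <= (norm h * (1 + norm \<xi>))^2 * norm (f \<xi>)"
    proof (intro mult_right_mono)
     have "\<bar>h \<bullet> \<xi>\<bar> <= norm h * norm \<xi>" by (rule Cauchy_Schwarz_ineq2)
     also have "... <= norm h * (1 + norm \<xi>)" by (intro mult_left_mono) auto
     finally show "(h \<bullet> \<xi>)^2 <= (norm h * (1 + norm \<xi>))^2" by (subst abs_le_square_iff[symmetric]) (simp add: abs_mult)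
    qed simp
    also have "... = (norm h)^2 * ((1 + norm \<xi>)^2 * norm (f \<xi>))" by (simp add: power_mult_distrib)
    also have "... <= (norm h)^2 * (B * wgt \<xi>)" by (intro mult_left_mono B) auto
    finally show "norm (?g \<xi>) <= (norm h)^2 * (B * wgt \<xi>)" .
    show "integrable lborel ?g"
    proof -
     have "?g = (%\<xi>. iexp ((x + h) \<bullet> \<xi>) * f \<xi> - iexp (x \<bullet> \<xi>) * f \<xi>
       - iexp (x \<bullet> \<xi>) * (\<i> * cx (h \<bullet> \<xi>) * f \<xi>))"
      by (rule ext) (simp add: inner_add_left ring_distribs exp_add algebra_simps)
     then show ?thesis using integrable_iexp_mult[OF schwartz_integrable[OF f]] i3 by simp
    qed
   qed (intro integrable_mult_right integrable_wgt)
   also have "... = (norm h)^2 * I" by (simp add: I_def)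
   finally have "norm (ft f (x + h) - ft f x - ?D h) <= norm h * (norm h * I)" by (simp add: power2_eq_square mult.assoc)
   then show "norm (ft f (x + h) - ft f x - ?D h) / norm h <= I * norm h" by (cases "h = 0") (auto simp: pos_divide_le_eq ac_simps)
  qed
  show "((%h. I * norm h) \<longlongrightarrow> 0) (at 0)" by (auto intro!: tendsto_eq_intros)
 qed auto
 ultimately show ?thesis by (simp add: has_derivative_at)
qed

lemma ft_schwartz:
 assumes "f \<in> schwartz"
 shows "ft f \<in> schwartz"
proof -
 have "Sn n (ft f)" for n using assms
 proof (induction n arbitrary: f)
  case 0
  then show ?case using ft_has_derivative rapid_ft by (auto simp: differentiable_def)
 next
  case (Suc n)
  have "pd b (ft f) = (%x. \<i> * ft (%\<xi>. cx (\<xi> \<bullet> b) * f \<xi>) x)" if b: "b \<in> Basis" for b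
  proof
   fix x
   have "pd b (ft f) x = (\<Sum>b'\<in>Basis. (b \<bullet> b') *\<^sub>R (\<i> * ft (%\<xi>. cx (\<xi> \<bullet> b') * f \<xi>) x))"
    by (rule pd_eqI[OF ft_has_derivative[OF Suc.prems]])
   also have "... = (\<Sum>b'\<in>Basis. (if b' = b then (\<i> * ft (%\<xi>. cx (\<xi> \<bullet> b') * f \<xi>) x) else 0))"
    using b by (intro sum.cong) (auto simp: inner_Basis)
   also have "... = \<i> * ft (%\<xi>. cx (\<xi> \<bullet> b) * f \<xi>) x" using b by simp
   finally show "pd b (ft f) x = \<i> * ft (%\<xi>. cx (\<xi> \<bullet> b) * f \<xi>) x" .
  qed
  moreover have "Sn n (%x. \<i> * ft (%\<xi>. cx (\<xi> \<bullet> b) * f \<xi>) x)" if b: "b \<in> Basis" for b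
   by (intro Sn_cmult Suc.IH schwartz_inner b Suc.prems)
  ultimately show ?case using ft_has_derivative[OF Suc.prems] rapid_ft[OF Suc.prems] by (auto simp: differentiable_def)
 qed
 then show ?thesis by (simp add: schwartz_iff_Sn)
qed

section \<open>Fourier inversion\<close>

definition gauss :: "'a::euclidean_space => real" where
 "gauss x = exp (- (norm x)\<^sup>2 / 2)"

lemma gauss_measurable [measurable]: "meas gauss" unfolding gauss_def by measurable

lemma gauss_pos: "gauss x > 0" by (simp add: gauss_def)
lemma gauss_le_1: "gauss x <= 1" by (simp add: gauss_def)

lemma norm_sq_sum: "(norm (x::'a::euclidean_space))^2 = (\<Sum>b\<in>Basis. (x \<bullet> b)\<^sup>2)"
 unfolding power2_norm_eq_inner euclidean_inner[of x x] by (simp add: power2_eq_square)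

lemma integral_prod_Basis:
 fixes f :: "'a::euclidean_space => real => complex"
 assumes i: "!!b. b \<in> Basis ==> integrable lborel (f b)"
 shows "integrable lborel (%x::'a. \<Prod>b\<in>Basis. f b (x \<bullet> b))"
  and "(LI x. (\<Prod>b\<in>Basis. f b (x \<bullet> b))) = (\<Prod>b\<in>Basis. LINT t|lborel. f b t)"
proof -
 interpret product_sigma_finite "%b::'a. lborel :: real measure" ..
 have [measurable]: "meas (f b)" if "b \<in> Basis" for b using borel_measurable_integrable[OF i[OF that]] by simp
 have m: "meas (%x::'a. \<Prod>b\<in>Basis. f b (x \<bullet> b))" by measurable
 have T: "(%w. \<Sum>b\<in>(Basis::'a set). w b *\<^sub>R b) \<in> measurable (\<Pi>\<^sub>M b\<in>Basis. lborel) borel" by measurable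
 have eq: "(\<Prod>b\<in>Basis. f b ((\<Sum>c\<in>(Basis::'a set). w c *\<^sub>R c) \<bullet> b)) = (\<Prod>b\<in>Basis. f b (w b))" for w
  by (intro prod.cong) (auto simp: inner_sum_left_Basis)
 have int: "integrable (\<Pi>\<^sub>M b\<in>(Basis::'a set). lborel) (%w. \<Prod>b\<in>Basis. f b (w b))"
  by (rule product_integrable_prod) (use i in auto)
 show "integrable lborel (%x::'a. \<Prod>b\<in>Basis. f b (x \<bullet> b))" by (subst lborel_eq, subst integrable_distr_eq[OF T m]) (simp add: eq int)
 have "(LI x. (\<Prod>b\<in>Basis. f b (x \<bullet> b))) = (LINT w|(\<Pi>\<^sub>M b\<in>(Basis::'a set). lborel). (\<Prod>b\<in>Basis. f b (w b)))"
  by (subst lborel_eq, subst integral_distr[OF T m]) (simp add: eq)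
 also have "... = (\<Prod>b\<in>Basis. LINT t|lborel. f b t)" by (rule product_integral_prod) (use i in auto)
 finally show "(LI x. (\<Prod>b\<in>Basis. f b (x \<bullet> b))) = (\<Prod>b\<in>Basis. LINT t|lborel. f b t)" .
qed

lemma gaussian_char_1D:
 "integrable lborel (%x::real. iexp (t * x) * cx (exp (- x\<^sup>2 / 2)))"
 "(LI x. iexp (t * x) * cx (exp (- x\<^sup>2 / 2))) = cx (sqrt (2 * pi) * exp (- t\<^sup>2 / 2))"
proof -
 have i: "integrable lborel (%x::real. cx (std_normal_density x))" by (intro integrable_of_real integrable_normal_density) auto
 then have "integrable lborel (%x::real. cx (sqrt (2 * pi)) * cx (std_normal_density x))" by (rule integrable_mult_right)
 moreover have e: "cx (sqrt (2 * pi)) * cx (std_normal_density x) = cx (exp (- x\<^sup>2 / 2))" for x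
  unfolding of_real_mult[symmetric] by (simp add: std_normal_density_def)
 ultimately have g: "integrable lborel (%x::real. cx (exp (- x\<^sup>2 / 2)))" by simp
 show "integrable lborel (%x::real. iexp (t * x) * cx (exp (- x\<^sup>2 / 2)))" using integrable_iexp_mult[OF g, of t] by simp
 have "cx (exp (- (t^2) / 2)) = char std_normal_distribution t" by (simp add: char_std_normal_distribution)
 also have "... = (LI x. std_normal_density x *\<^sub>R iexp (t * x))"
  unfolding char_def by (subst integral_density) (auto simp: normal_density_nonneg)
 finally have "cx (sqrt (2 * pi)) * cx (exp (- (t^2) / 2))
   = (LI x. cx (sqrt (2 * pi)) * (std_normal_density x *\<^sub>R iexp (t * x)))" by (simp only: integral_mult_right_zero)
 also have "... = (LI x. iexp (t * x) * cx (exp (- x\<^sup>2 / 2)))"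
  by (rule Bochner_Integration.integral_cong[OF refl]) (simp only: scaleR_conv_of_real e[symmetric] ac_simps)
 finally show "(LI x. iexp (t * x) * cx (exp (- x\<^sup>2 / 2))) = cx (sqrt (2 * pi) * exp (- t\<^sup>2 / 2))" by simp
qed

lemma ft_gauss:
 fixes \<xi> :: "'a::euclidean_space"
 shows "ft (%x. cx (gauss x)) \<xi> = cx (sqrt (2 * pi) ^ DIM('a) * gauss \<xi>)"
proof -
 have "iexp (\<xi> \<bullet> x) * cx (gauss x)
  = (\<Prod>b\<in>Basis. iexp ((\<xi> \<bullet> b) * (x \<bullet> b)) * cx (exp (- (x \<bullet> b)\<^sup>2 / 2)))" for x
 proof -
  have "cx (gauss x) = (\<Prod>b\<in>Basis. cx (exp (- (x \<bullet> b)\<^sup>2 / 2)))"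
   unfolding gauss_def norm_sq_sum by (simp add: exp_sum[symmetric] of_real_prod[symmetric] sum_negf sum_divide_distrib del: of_real_prod)
  moreover have "iexp (\<xi> \<bullet> x) = (\<Prod>b\<in>Basis. iexp ((\<xi> \<bullet> b) * (x \<bullet> b)))"
   by (subst euclidean_inner) (simp add: exp_sum[symmetric] sum_distrib_left)
  ultimately show ?thesis by (simp add: prod.distrib)
 qed
 then have "ft (%x. cx (gauss x)) \<xi> = (\<Prod>b\<in>Basis. cx (sqrt (2 * pi) * exp (- (\<xi> \<bullet> b)\<^sup>2 / 2)))"
  unfolding ft_def by (simp only: integral_prod_Basis(2)[OF gaussian_char_1D(1)] gaussian_char_1D(2))
 also have "... = cx (sqrt (2 * pi) ^ DIM('a) * gauss \<xi>)" unfolding gauss_def norm_sq_sum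
  by (simp add: prod.distrib exp_sum[symmetric] of_real_prod[symmetric] sum_negf sum_divide_distrib del: of_real_prod)
 finally show ?thesis .
qed

lemma integrable_gauss: "integrable lborel (gauss :: 'a::euclidean_space => real)"
proof -
 have "integrable lborel (%x::'a. \<Prod>b\<in>Basis. cx (exp (- (x \<bullet> b)\<^sup>2 / 2)))"
  by (rule integral_prod_Basis(1)) (use gaussian_char_1D(1)[of 0] in simp)
 moreover have "(\<Prod>b\<in>Basis. cx (exp (- (x \<bullet> b)\<^sup>2 / 2))) = cx (gauss x)" for x :: 'a
  unfolding gauss_def norm_sq_sum by (simp add: exp_sum[symmetric] of_real_prod[symmetric] sum_negf sum_divide_distrib del: of_real_prod)
 ultimately have "integrable lborel (%x::'a. cx (gauss x))" by simp
 then show ?thesis using integrable_Re by fastforce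
qed

lemma Fubini_product:
 fixes f g :: "'a::euclidean_space => complex"
 assumes f: "integrable lborel f" and g: "integrable lborel g"
  and h[measurable]: "(%(x, y). h x y) \<in> borel_measurable (borel \<Otimes>\<^sub>M borel)" and h1: "!!x y. norm (h x y) <= B"
 shows "(LI y. LINT x|lborel. f x * g y * h x y) = (LI x. LINT y|lborel. f x * g y * h x y)"
proof (rule lborel_pair.Fubini_integral)
 have [measurable]: "meas f" "meas g" using borel_measurable_integrable[OF f] borel_measurable_integrable[OF g] by auto
 have "B >= 0" using order_trans[OF norm_ge_zero h1] .
 have "integrable (lborel \<Otimes>\<^sub>M lborel) (%(x, y). f x * g y)"
 proof (rule lborel_pair.Fubini_integrable)
  have "(%x. LINT y|lborel. norm (case (x, y) of (x, y) => f x * g y)) = (%x. norm (f x) * (LI y. norm (g y)))" by (simp add: norm_mult)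
  then show "integrable lborel (%x. LINT y|lborel. norm (case (x, y) of (x, y) => f x * g y))" using f by simp
 qed (use g in auto)
 then have i: "integrable (lborel \<Otimes>\<^sub>M lborel) (%z. cx B * (f (fst z) * g (snd z)))"
  by (intro integrable_mult_right) (simp add: case_prod_unfold)
 show "integrable (lborel \<Otimes>\<^sub>M lborel) (%(x, y). f x * g y * h x y)"
 proof (rule Bochner_Integration.integrable_bound[OF i])
  show "AE z in lborel \<Otimes>\<^sub>M lborel. norm (case z of (x, y) => f x * g y * h x y) <= norm (cx B * (f (fst z) * g (snd z)))"
  proof (intro AE_I2)
   fix z :: "'a \<times> 'a"
   have "norm (f (fst z) * g (snd z)) * norm (h (fst z) (snd z)) <= norm (f (fst z) * g (snd z)) * B" by (intro mult_left_mono h1) auto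
   then show "norm (case z of (x, y) => f x * g y * h x y) <= norm (cx B * (f (fst z) * g (snd z)))"
    using \<open>B >= 0\<close> by (simp add: case_prod_unfold norm_mult ac_simps)
  qed
 qed (simp add: case_prod_unfold)
qed

text \<open>Fubini's theorem does not apply to the double integral itself. With a Gaussian factor in the frequency it
 does, and the inner integral becomes a Gaussian approximate identity; then the factor is removed by dominated
 convergence on both sides.\<close>
lemma ft_ft:
 fixes f :: "'a::euclidean_space => complex"
 assumes f: "f \<in> schwartz"
 shows "ft (ft f) (- \<xi>) = cx ((2 * pi) ^ DIM('a)) * f \<xi>"
proof -
 let ?S = "cx (sqrt (2 * pi) ^ DIM('a))"
 define e where "e n = 1 / real (Suc n)" for n
 have e0: "e n > 0" for n by (simp add: e_def)
 have e1: "e \<longlonglongrightarrow> 0" unfolding e_def by (intro LIMSEQ_Suc lim_1_over_n)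
 have [measurable]: "meas f" "meas (ft f)" using f by (auto intro: schwartz_measurable ft_schwartz)
 have int: "integrable lborel f" "integrable lborel (ft f)" using f by (auto intro: schwartz_integrable ft_schwartz)
 obtain B where B: "B >= 0" "!!x. norm (f x) <= B * wgt x" using schwartz_wgt_bound[OF f] by blast
 have B1: "norm (f x) <= B" for x using B(2)[of x] mult_left_mono[OF wgt_le_1[of x] B(1)] by simp
 define L where "L n = (LI y. iexp ((- \<xi>) \<bullet> y) * ft f y * cx (gauss (e n *\<^sub>R y)))" for n
 have gl: "(%n. gauss (e n *\<^sub>R y)) \<longlonglongrightarrow> 1" for y :: 'a
 proof -
  have "(%n. gauss (e n *\<^sub>R y)) \<longlonglongrightarrow> exp (- (norm (0 *\<^sub>R y))\<^sup>2 / 2)"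
   unfolding gauss_def by (intro tendsto_intros e1) auto
  then show ?thesis by simp
 qed
 have "L \<longlonglongrightarrow> ft (ft f) (- \<xi>)" unfolding L_def ft_def[of "ft f"]
 proof (rule integral_dominated_convergence[where w="%y. norm (ft f y)"])
  show "AE y in lborel. (%n. iexp ((- \<xi>) \<bullet> y) * ft f y * cx (gauss (e n *\<^sub>R y))) \<longlonglongrightarrow> iexp ((- \<xi>) \<bullet> y) * ft f y"
  proof (intro AE_I2)
   fix y :: 'a
   have "(%n. iexp ((- \<xi>) \<bullet> y) * ft f y * cx (gauss (e n *\<^sub>R y))) \<longlonglongrightarrow> iexp ((- \<xi>) \<bullet> y) * ft f y * cx 1"
    by (intro tendsto_intros gl)
   then show "(%n. iexp ((- \<xi>) \<bullet> y) * ft f y * cx (gauss (e n *\<^sub>R y))) \<longlonglongrightarrow> iexp ((- \<xi>) \<bullet> y) * ft f y" by simp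
  qed
  show "AE y in lborel. norm (iexp ((- \<xi>) \<bullet> y) * ft f y * cx (gauss (e n *\<^sub>R y))) <= norm (ft f y)" for n
  proof (intro AE_I2)
   fix y :: 'a
   have "\<bar>gauss (e n *\<^sub>R y)\<bar> <= 1" using gauss_le_1[of "e n *\<^sub>R y"] gauss_pos[of "e n *\<^sub>R y"] by simp
   then show "norm (iexp ((- \<xi>) \<bullet> y) * ft f y * cx (gauss (e n *\<^sub>R y))) <= norm (ft f y)" by (simp add: norm_mult mult_left_le)
  qed
 qed (use int in auto)
 moreover have "L n = (LI w. f (\<xi> + e n *\<^sub>R w) * (?S * cx (gauss w)))" for n
 proof -
  let ?e = "e n"
  have gi: "integrable lborel (%y::'a. cx (gauss (?e *\<^sub>R y)))"
   using integrable_lborel_affine[OF integrable_gauss, of ?e 0] e0[of n] by (intro integrable_of_real) auto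
  have "L n = (LI y. LINT x|lborel. f x * cx (gauss (?e *\<^sub>R y)) * iexp ((x - \<xi>) \<bullet> y))" unfolding L_def
  proof (intro Bochner_Integration.integral_cong refl)
   fix y :: 'a
   have "iexp ((- \<xi>) \<bullet> y) * ft f y * cx (gauss (?e *\<^sub>R y))
    = (LI x. (iexp ((- \<xi>) \<bullet> y) * cx (gauss (?e *\<^sub>R y))) * (iexp (y \<bullet> x) * f x))" by (simp add: ft_def)
   also have "... = (LI x. f x * cx (gauss (?e *\<^sub>R y)) * iexp ((x - \<xi>) \<bullet> y))"
   proof (intro Bochner_Integration.integral_cong refl)
    fix x
    have h: "iexp ((x - \<xi>) \<bullet> y) = iexp ((- \<xi>) \<bullet> y) * iexp (y \<bullet> x)"
     unfolding exp_add[symmetric] by (rule arg_cong[where f=exp]) (simp add: inner_diff_left inner_commute algebra_simps)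
    show "(iexp ((- \<xi>) \<bullet> y) * cx (gauss (?e *\<^sub>R y))) * (iexp (y \<bullet> x) * f x)
     = f x * cx (gauss (?e *\<^sub>R y)) * iexp ((x - \<xi>) \<bullet> y)" by (simp only: h mult_ac)
   qed
   finally show "iexp ((- \<xi>) \<bullet> y) * ft f y * cx (gauss (?e *\<^sub>R y)) = ..." .
  qed
  also have "... = (LI x. LINT y|lborel. f x * cx (gauss (?e *\<^sub>R y)) * iexp ((x - \<xi>) \<bullet> y))"
  proof (rule Fubini_product[where B=1, OF int(1) gi])
   have "continuous_on UNIV (%z::'a\<times>'a. iexp ((fst z - \<xi>) \<bullet> snd z))" by (intro continuous_intros)
   then show "(%(x, y). iexp ((x - \<xi>) \<bullet> y)) \<in> borel_measurable (borel \<Otimes>\<^sub>M borel)"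
    unfolding borel_prod case_prod_unfold by (rule borel_measurable_continuous_onI)
  qed simp
  also have "... = (LI x. f x * (cx (1 / ?e ^ DIM('a)) * ?S * cx (gauss ((1 / ?e) *\<^sub>R (x - \<xi>)))))"
  proof (intro Bochner_Integration.integral_cong refl)
   fix x
   have "(LI y. f x * cx (gauss (?e *\<^sub>R y)) * iexp ((x - \<xi>) \<bullet> y))
    = f x * (LI y. iexp (((1 / ?e) *\<^sub>R (x - \<xi>)) \<bullet> (0 + ?e *\<^sub>R y)) * cx (gauss (0 + ?e *\<^sub>R y)))"
   proof -
    have "f x * cx (gauss (?e *\<^sub>R y)) * iexp ((x - \<xi>) \<bullet> y)
     = f x * (iexp (((1 / ?e) *\<^sub>R (x - \<xi>)) \<bullet> (0 + ?e *\<^sub>R y)) * cx (gauss (0 + ?e *\<^sub>R y)))" for y using e0[of n] by simp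
    then show ?thesis by (simp only: integral_mult_right_zero)
   qed
   also have "... = f x * (cx (1 / ?e ^ DIM('a)) * ft (%x. cx (gauss x)) ((1 / ?e) *\<^sub>R (x - \<xi>)))" unfolding ft_def using e0[of n]
    by (subst integral_lborel_affine[of ?e "%y. iexp (((1 / ?e) *\<^sub>R (x - \<xi>)) \<bullet> y) * cx (gauss y)"])
      (simp_all add: scaleR_conv_of_real)
   finally show "(LI y. f x * cx (gauss (?e *\<^sub>R y)) * iexp ((x - \<xi>) \<bullet> y))
    = f x * (cx (1 / ?e ^ DIM('a)) * ?S * cx (gauss ((1 / ?e) *\<^sub>R (x - \<xi>))))" unfolding ft_gauss by simp
  qed
  also have "... = cx (1 / ?e ^ DIM('a)) * (LI x. f x * (?S * cx (gauss ((1 / ?e) *\<^sub>R (x - \<xi>)))))"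
  proof -
   have "f x * (cx (1 / ?e ^ DIM('a)) * ?S * cx (gauss ((1 / ?e) *\<^sub>R (x - \<xi>))))
    = cx (1 / ?e ^ DIM('a)) * (f x * (?S * cx (gauss ((1 / ?e) *\<^sub>R (x - \<xi>)))))" for x by (simp only: mult_ac)
   then show ?thesis by (simp only: integral_mult_right_zero)
  qed
  also have "... = (LI w. f (\<xi> + ?e *\<^sub>R w) * (?S * cx (gauss ((1 / ?e) *\<^sub>R ((\<xi> + ?e *\<^sub>R w) - \<xi>)))))"
   using e0[of n] by (subst integral_lborel_affine[of ?e "%x. f x * (?S * cx (gauss ((1 / ?e) *\<^sub>R (x - \<xi>))))"])
    (simp_all add: scaleR_conv_of_real)
  also have "... = (LI w. f (\<xi> + ?e *\<^sub>R w) * (?S * cx (gauss w)))" using e0[of n] by simp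
  finally show ?thesis .
 qed
 moreover have "(%n. LINT w|lborel. f (\<xi> + e n *\<^sub>R w) * (?S * cx (gauss w))) \<longlonglongrightarrow> (LI w. f \<xi> * (?S * cx (gauss (w::'a))))"
 proof (rule integral_dominated_convergence[where w="%w. (B * norm ?S) * gauss w"])
  show "integrable lborel (%w::'a. (B * norm ?S) * gauss w)" by (intro integrable_mult_right integrable_gauss)
  show "AE w in lborel. (%n. f (\<xi> + e n *\<^sub>R w) * (?S * cx (gauss w))) \<longlonglongrightarrow> f \<xi> * (?S * cx (gauss w))"
  proof (intro AE_I2 tendsto_mult tendsto_const)
   fix w :: 'a
   have "(%n. \<xi> + e n *\<^sub>R w) \<longlonglongrightarrow> \<xi> + 0 *\<^sub>R w" by (intro tendsto_intros e1)
   then have "(%n. \<xi> + e n *\<^sub>R w) \<longlonglongrightarrow> \<xi>" by simp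
   then show "(%n. f (\<xi> + e n *\<^sub>R w)) \<longlonglongrightarrow> f \<xi>"
    using continuous_on_tendsto_compose[OF schwartz_continuous[OF f], of "%n. \<xi> + e n *\<^sub>R w" \<xi> sequentially] by simp
  qed
  show "AE w in lborel. norm (f (\<xi> + e n *\<^sub>R w) * (?S * cx (gauss w))) <= B * norm ?S * gauss w" for n
  proof (intro AE_I2)
   fix w :: 'a
   have "norm (f (\<xi> + e n *\<^sub>R w)) * (norm ?S * gauss w) <= B * (norm ?S * gauss w)" using gauss_pos[of w] by (intro mult_right_mono B1) auto
   then show "norm (f (\<xi> + e n *\<^sub>R w) * (?S * cx (gauss w))) <= B * norm ?S * gauss w"
    using gauss_pos[of w] by (simp add: norm_mult ac_simps)
  qed
 qed auto
 ultimately have "ft (ft f) (- \<xi>) = (LI w. f \<xi> * (?S * cx (gauss (w::'a))))"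
 proof -
  assume 1: "L \<longlonglongrightarrow> ft (ft f) (- \<xi>)"
   and 2: "!!n. L n = (LI w. f (\<xi> + e n *\<^sub>R w) * (?S * cx (gauss w)))"
   and 3: "(%n. LINT w|lborel. f (\<xi> + e n *\<^sub>R w) * (?S * cx (gauss w))) \<longlonglongrightarrow> (LI w. f \<xi> * (?S * cx (gauss (w::'a))))"
  have "L \<longlonglongrightarrow> (LI w. f \<xi> * (?S * cx (gauss (w::'a))))" using 3 by (simp only: 2[symmetric])
  with 1 show ?thesis by (rule LIMSEQ_unique)
 qed
 also have "... = f \<xi> * (?S * (LI w. cx (gauss (w::'a))))" by simp
 also have "(LI w. cx (gauss (w::'a))) = ?S" using ft_gauss[of "0::'a"] by (simp add: ft_def gauss_def)
 also have "?S * ?S = cx ((2 * pi) ^ DIM('a))" unfolding of_real_mult[symmetric] power_mult_distrib[symmetric] by simp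
 finally show ?thesis by (simp add: mult.commute)
qed

section \<open>Frequency supports of products\<close>

lemma integral_ft_mult:
 fixes A g :: "'a::euclidean_space => complex"
 assumes A: "integrable lborel A" and g: "integrable lborel g"
 shows "(LI y. ft A (y - u) * g y) = (LI \<xi>. A \<xi> * (LI y. iexp ((y - u) \<bullet> \<xi>) * g y))"
proof -
 have "(LI y. ft A (y - u) * g y) = (LI y. LINT \<xi>|lborel. A \<xi> * g y * iexp ((y - u) \<bullet> \<xi>))"
 proof (intro Bochner_Integration.integral_cong refl)
  fix y :: 'a
  have "ft A (y - u) * g y = (LI \<xi>. iexp ((y - u) \<bullet> \<xi>) * A \<xi> * g y)" by (simp add: ft_def)
  then show "ft A (y - u) * g y = (LI \<xi>. A \<xi> * g y * iexp ((y - u) \<bullet> \<xi>))" by (simp add: ac_simps)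
 qed
 also have "... = (LI \<xi>. LINT y|lborel. A \<xi> * g y * iexp ((y - u) \<bullet> \<xi>))"
 proof (rule Fubini_product[where B=1, OF A g])
  have "continuous_on UNIV (%z::'a\<times>'a. iexp ((snd z - u) \<bullet> fst z))" by (intro continuous_intros)
  then show "(%(x, y). iexp ((y - u) \<bullet> x)) \<in> borel_measurable (borel \<Otimes>\<^sub>M borel)"
   unfolding borel_prod case_prod_unfold by (rule borel_measurable_continuous_onI)
 qed simp
 also have "... = (LI \<xi>. A \<xi> * (LI y. iexp ((y - u) \<bullet> \<xi>) * g y))"
 proof (intro Bochner_Integration.integral_cong refl)
  fix \<xi> :: 'a
  have "(LI y. A \<xi> * g y * iexp ((y - u) \<bullet> \<xi>)) = (LI y. A \<xi> * (iexp ((y - u) \<bullet> \<xi>) * g y))" by (simp add: ac_simps)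
  then show "(LI y. A \<xi> * g y * iexp ((y - u) \<bullet> \<xi>)) = A \<xi> * (LI y. iexp ((y - u) \<bullet> \<xi>) * g y)" by simp
 qed
 finally show ?thesis .
qed

lemma ft_bounded: "f \<in> schwartz ==> \<exists>B\<ge>0. \<forall>x. norm (f x) <= B"
proof -
 assume "f \<in> schwartz"
 then obtain B where "\<forall>x. (1 + norm x) ^ 0 * norm (f x) <= B" using schwartz_rapid unfolding rapid_def by blast
 then have "\<forall>x. norm (f x) <= B" by simp
 moreover from this have "B >= 0" using order_trans[OF norm_ge_zero] by blast
 ultimately show ?thesis by blast
qed

lemma schwartz_integrable_translate:
 assumes "f \<in> schwartz"
 shows "integrable lborel (%y. f (y - v))" "integrable lborel (%y. f (v - y))"
 using schwartz_integrable[OF assms] integrable_translate integrable_reflect by auto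

text \<open>Integrating over the position of a product of three exponentials forces the frequencies to balance, so only
 the values \<open>A \<xi> * B \<zeta> * C (\<xi> + \<zeta>)\<close> enter.\<close>
lemma trilinear_orthogonality:
 fixes A B C :: "'a::euclidean_space => complex"
 assumes A: "A \<in> schwartz" and B: "B \<in> schwartz" and C: "C \<in> schwartz"
  and z: "!!\<xi> \<zeta>. A \<xi> * B \<zeta> * C (\<xi> + \<zeta>) = 0"
 shows "(LI y. ft C (x - y) * ft A (y - u) * ft B (y - v)) = 0"
proof -
 have [measurable]: "meas (ft A)" "meas (ft B)" "meas (ft C)" using A B C by (auto intro: schwartz_measurable ft_schwartz)
 obtain K where K: "!!x. norm (ft C x) <= K" "K >= 0" using ft_bounded[OF ft_schwartz[OF C]] by blast
 have iB: "integrable lborel (%y. ft B (y - v))" by (intro schwartz_integrable_translate ft_schwartz B)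
 have iC: "integrable lborel (%y. ft C (x - y))" by (intro schwartz_integrable_translate ft_schwartz C)
 have g: "integrable lborel (%y. ft C (x - y) * ft B (y - v))"
  by (rule Bochner_Integration.integrable_bound[OF integrable_mult_right[OF iB, of "cx K"]])
    (use K in \<open>auto intro!: AE_I2 simp: norm_mult mult_right_mono\<close>)
 have inner: "A \<xi> * (LI y. iexp ((y - u) \<bullet> \<xi>) * (ft C (x - y) * ft B (y - v))) = 0" for \<xi>
 proof -
  define g' where "g' y = iexp ((y - u) \<bullet> \<xi>) * ft C (x - y)" for y
  have g': "integrable lborel g'" unfolding g'_def
  proof (rule Bochner_Integration.integrable_bound[OF iC])
   have "continuous_on UNIV (%y. iexp ((y - u) \<bullet> \<xi>))" by (intro continuous_intros)
   then have [measurable]: "meas (%y. iexp ((y - u) \<bullet> \<xi>))" by (rule borel_measurable_continuous_onI)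
   show "(%y. iexp ((y - u) \<bullet> \<xi>) * ft C (x - y)) \<in> borel_measurable lborel" by measurable
  qed (simp add: norm_mult)
  have "(LI y. iexp ((y - u) \<bullet> \<xi>) * (ft C (x - y) * ft B (y - v))) = (LI y. ft B (y - v) * g' y)" by (simp add: g'_def ac_simps)
  also have "... = (LI \<zeta>. B \<zeta> * (LI y. iexp ((y - v) \<bullet> \<zeta>) * g' y))"
   by (rule integral_ft_mult[OF schwartz_integrable[OF B] g'])
  finally have eq: "A \<xi> * (LI y. iexp ((y - u) \<bullet> \<xi>) * (ft C (x - y) * ft B (y - v)))
   = (LI \<zeta>. A \<xi> * (B \<zeta> * (LI y. iexp ((y - v) \<bullet> \<zeta>) * g' y)))" by simp
  have "A \<xi> * (B \<zeta> * (LI y. iexp ((y - v) \<bullet> \<zeta>) * g' y)) = 0" for \<zeta>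
  proof -
   let ?c = "iexp (x \<bullet> (\<xi> + \<zeta>) - u \<bullet> \<xi> - v \<bullet> \<zeta>)"
   have "(LI y. iexp ((y - v) \<bullet> \<zeta>) * g' y)
    = (LI y. iexp (((x - (x - y)) - v) \<bullet> \<zeta>) * (iexp (((x - (x - y)) - u) \<bullet> \<xi>) * ft C (x - y)))" by (simp add: g'_def)
   also have "... = (LI y. iexp (((x - y) - v) \<bullet> \<zeta>) * (iexp (((x - y) - u) \<bullet> \<xi>) * ft C y))" by (rule integral_reflect)
   also have "... = (LI y. ?c * (iexp ((- (\<xi> + \<zeta>)) \<bullet> y) * ft C y))"
   proof (intro Bochner_Integration.integral_cong refl)
    fix y
    have "iexp (((x - y) - v) \<bullet> \<zeta>) * iexp (((x - y) - u) \<bullet> \<xi>) = ?c * iexp ((- (\<xi> + \<zeta>)) \<bullet> y)"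
     unfolding exp_add[symmetric] by (rule arg_cong[where f=exp]) (simp add: inner_diff_left inner_add_left inner_add_right inner_commute algebra_simps)
    then show "iexp (((x - y) - v) \<bullet> \<zeta>) * (iexp (((x - y) - u) \<bullet> \<xi>) * ft C y) = ?c * (iexp ((- (\<xi> + \<zeta>)) \<bullet> y) * ft C y)"
     by (simp only: mult.assoc[symmetric])
   qed
   also have "... = ?c * ft (ft C) (- (\<xi> + \<zeta>))" by (simp add: ft_def[of "ft C"])
   also have "... = ?c * (cx ((2 * pi) ^ DIM('a)) * C (\<xi> + \<zeta>))" by (simp only: ft_ft[OF C])
   finally show ?thesis using z[of \<xi> \<zeta>] by auto
  qed
  then show ?thesis unfolding eq by (simp only: integral_zero)
 qed
 have "(LI y. ft C (x - y) * ft A (y - u) * ft B (y - v)) = (LI y. ft A (y - u) * (ft C (x - y) * ft B (y - v)))" by (simp add: ac_simps)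
 also have "... = (LI \<xi>. A \<xi> * (LI y. iexp ((y - u) \<bullet> \<xi>) * (ft C (x - y) * ft B (y - v))))"
  by (rule integral_ft_mult[OF schwartz_integrable[OF A] g])
 also have "... = 0" by (simp only: inner integral_zero)
 finally show ?thesis .
qed

lemma bilinear_orthogonality:
 fixes A B :: "'a::euclidean_space => complex"
 assumes A: "A \<in> schwartz" and B: "B \<in> schwartz" and z: "!!\<xi>. A \<xi> * cnj (B \<xi>) = 0"
 shows "(LI y. ft A (y - u) * cnj (ft B (y - v))) = 0"
proof -
 have iB: "integrable lborel (%y. ft B (y - v))" by (intro schwartz_integrable_translate ft_schwartz B)
 have "A \<xi> * (LI y. iexp ((y - u) \<bullet> \<xi>) * cnj (ft B (y - v))) = 0" for \<xi>
 proof -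
  let ?c = "exp (- \<i> * cx ((v - u) \<bullet> \<xi>))"
  have "(LI y. iexp ((y - u) \<bullet> \<xi>) * cnj (ft B (y - v)))
   = (LI y. cnj (exp (- \<i> * cx (((y - v) + v - u) \<bullet> \<xi>)) * ft B (y - v)))"
   by (intro Bochner_Integration.integral_cong refl) (simp add: exp_cnj)
  also have "... = cnj (LI y. exp (- \<i> * cx (((y - v) + v - u) \<bullet> \<xi>)) * ft B (y - v))" by (rule Bochner_Integration.integral_cnj)
  also have "(LI y. exp (- \<i> * cx (((y - v) + v - u) \<bullet> \<xi>)) * ft B (y - v))
   = (LI y. exp (- \<i> * cx ((y + v - u) \<bullet> \<xi>)) * ft B y)" by (rule integral_translate)
  also have "... = (LI y. ?c * (iexp ((- \<xi>) \<bullet> y) * ft B y))"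
  proof (intro Bochner_Integration.integral_cong refl)
   fix y
   have h: "exp (- \<i> * cx ((y + v - u) \<bullet> \<xi>)) = ?c * iexp ((- \<xi>) \<bullet> y)"
    unfolding exp_add[symmetric] by (rule arg_cong[where f=exp]) (simp add: inner_diff_left inner_add_left inner_commute algebra_simps)
   show "exp (- \<i> * cx ((y + v - u) \<bullet> \<xi>)) * ft B y = ?c * (iexp ((- \<xi>) \<bullet> y) * ft B y)" by (simp only: h mult_ac)
  qed
  also have "... = ?c * ft (ft B) (- \<xi>)" by (simp add: ft_def[of "ft B"])
  also have "... = ?c * (cx ((2 * pi) ^ DIM('a)) * B \<xi>)" by (simp only: ft_ft[OF B])
  finally show ?thesis using z[of \<xi>] by auto
 qed
 moreover have "(LI y. ft A (y - u) * cnj (ft B (y - v))) = (LI \<xi>. A \<xi> * (LI y. iexp ((y - u) \<bullet> \<xi>) * cnj (ft B (y - v))))"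
  by (rule integral_ft_mult[OF schwartz_integrable[OF A]]) (use iB in simp)
 ultimately show ?thesis by (simp only: integral_zero)
qed

text \<open>Since \<open>|\<xi>|\<^sup>s\<close> is even, the reflection of the kernel is harmless and \<open>D\<^sup>s\<close> acts on the multiplier.\<close>
lemma frac_D_ft:
 fixes A :: "'a::euclidean_space => complex"
 assumes A: "A \<in> schwartz"
 shows "frac_D s (%y. ft A (x - y)) y = ft (%\<xi>. cx (norm \<xi> powr s) * A \<xi>) (x - y)"
proof -
 have "fourier (%y. ft A (x - y)) \<xi> = exp (- \<i> * cx (x \<bullet> \<xi>)) * (cx ((2 * pi) ^ DIM('a)) * A (- \<xi>))" for \<xi>
 proof -
  have "fourier (%y. ft A (x - y)) \<xi> = (LI y. exp (- \<i> * cx ((x - (x - y)) \<bullet> \<xi>)) * ft A (x - y))" by (simp add: fourier_def)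
  also have "... = (LI y. exp (- \<i> * cx ((x - y) \<bullet> \<xi>)) * ft A y)" by (rule integral_reflect)
  also have "... = (LI y. exp (- \<i> * cx (x \<bullet> \<xi>)) * (iexp (\<xi> \<bullet> y) * ft A y))"
  proof (intro Bochner_Integration.integral_cong refl)
   fix y
   have h: "exp (- \<i> * cx ((x - y) \<bullet> \<xi>)) = exp (- \<i> * cx (x \<bullet> \<xi>)) * iexp (\<xi> \<bullet> y)"
    unfolding exp_add[symmetric] by (rule arg_cong[where f=exp]) (simp add: inner_diff_left inner_commute algebra_simps)
   show "exp (- \<i> * cx ((x - y) \<bullet> \<xi>)) * ft A y = exp (- \<i> * cx (x \<bullet> \<xi>)) * (iexp (\<xi> \<bullet> y) * ft A y)"
    by (simp only: h mult_ac)
  qed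
  also have "... = exp (- \<i> * cx (x \<bullet> \<xi>)) * ft (ft A) (- (- \<xi>))" by (simp add: ft_def[of "ft A"])
  also have "... = exp (- \<i> * cx (x \<bullet> \<xi>)) * (cx ((2 * pi) ^ DIM('a)) * A (- \<xi>))" by (simp only: ft_ft[OF A])
  finally show ?thesis .
 qed
 then have "frac_D s (%y. ft A (x - y)) y = (1 / cx ((2 * pi) ^ DIM('a))) * (LI \<xi>. iexp (y \<bullet> \<xi>) *
   (cx (norm \<xi> powr s) * (exp (- \<i> * cx (x \<bullet> \<xi>)) * (cx ((2 * pi) ^ DIM('a)) * A (- \<xi>)))))"
  by (simp add: frac_D_def inv_fourier_def)
 also have "... = (LI \<xi>. (1 / cx ((2 * pi) ^ DIM('a))) * (iexp (y \<bullet> \<xi>) *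
   (cx (norm \<xi> powr s) * (exp (- \<i> * cx (x \<bullet> \<xi>)) * (cx ((2 * pi) ^ DIM('a)) * A (- \<xi>))))))"
  by (simp only: integral_mult_right_zero)
 also have "... = (LI \<xi>. iexp ((x - y) \<bullet> (0 - \<xi>)) * (cx (norm (0 - \<xi>) powr s) * A (0 - \<xi>)))"
 proof (intro Bochner_Integration.integral_cong refl)
  fix \<xi> :: 'a
  have h: "iexp ((x - y) \<bullet> (0 - \<xi>)) = iexp (y \<bullet> \<xi>) * exp (- \<i> * cx (x \<bullet> \<xi>))"
   unfolding exp_add[symmetric] by (rule arg_cong[where f=exp]) (simp add: inner_diff_left inner_diff_right algebra_simps)
  show "(1 / cx ((2 * pi) ^ DIM('a))) * (iexp (y \<bullet> \<xi>) *
   (cx (norm \<xi> powr s) * (exp (- \<i> * cx (x \<bullet> \<xi>)) * (cx ((2 * pi) ^ DIM('a)) * A (- \<xi>)))))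
   = iexp ((x - y) \<bullet> (0 - \<xi>)) * (cx (norm (0 - \<xi>) powr s) * A (0 - \<xi>))" unfolding h by (simp add: field_simps)
 qed
 also have "... = (LI \<xi>. iexp ((x - y) \<bullet> \<xi>) * (cx (norm \<xi> powr s) * A \<xi>))" by (rule integral_reflect)
 finally show ?thesis by (simp add: ft_def)
qed

section \<open>Multipliers\<close>

text \<open>The multipliers: smooth and of bounded support, so that their transforms are Schwartz functions.\<close>
definition bumps :: "('a::euclidean_space => complex) set" where
 "bumps = {A. smooth A & (\<exists>R. \<forall>x. norm x > R --> A x = 0)}"

lemma bumps_schwartz: "A \<in> bumps ==> A \<in> schwartz" unfolding bumps_def by (auto intro: schwartz_of_compact_support)

lemma bumps_smooth_mult: "A \<in> bumps ==> smooth B ==> (%x. A x * B x) \<in> bumps"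
 unfolding bumps_def by (auto simp: smooth_iff_Cn intro!: Cn_mult)

lemma bumps_cmult: "A \<in> bumps ==> (%x. c * A x) \<in> bumps" unfolding bumps_def by (auto simp: smooth_iff_Cn intro!: Cn_cmult)

lemma bumps_scale:
 assumes "A \<in> bumps" "t > 0"
 shows "(%x. A (x /\<^sub>R t)) \<in> bumps"
proof -
 obtain R where R: "!!x. norm x > R ==> A x = 0" using assms by (auto simp: bumps_def)
 have "A (x /\<^sub>R t) = 0" if "norm x > t * R" for x using that assms(2) by (intro R) (simp add: field_simps)
 then show ?thesis using assms unfolding bumps_def by (auto simp: smooth_iff_Cn intro!: Cn_scale exI[of _ "t * R"])
qed

lemma has_derivative_norm_powr:
 fixes x :: "'a::euclidean_space"
 assumes "x ~= 0"
 shows "((%x. cx (norm x powr a)) has_derivative (%v. cx (norm x powr (a - 2) * a * (v \<bullet> x)))) (at x)"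
proof -
 have "((%x. norm x powr a) has_derivative (%v. norm x powr (a - 2) * a * (v \<bullet> x))) (at x)"
 proof -
  have "((%t. t powr a) has_derivative (%t. t * (a * norm x powr (a - 1)))) (at (norm x))"
   using has_real_derivative_powr[of "norm x" a] assms by (simp add: has_field_derivative_def mult_commute_abs)
  from has_derivative_compose[OF has_derivative_norm[OF assms] this]
  have "((%x. norm x powr a) has_derivative (%v. (v \<bullet> sgn x) * (a * norm x powr (a - 1)))) (at x)" .
  also have "(%v. (v \<bullet> sgn x) * (a * norm x powr (a - 1))) = (%v. norm x powr (a - 2) * a * (v \<bullet> x))"
  proof
   fix v
   have "norm x powr (a - 1) = norm x powr (a - 2) * norm x" using assms powr_add[of "norm x" "a-2" 1] by simp
   then show "(v \<bullet> sgn x) * (a * norm x powr (a - 1)) = norm x powr (a - 2) * a * (v \<bullet> x)" using assms by (simp add: sgn_div_norm)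
  qed
  finally show ?thesis .
 qed
 then show ?thesis by (rule has_derivative_of_real)
qed

text \<open>Differentiation replaces the exponent \<open>a\<close> by \<open>a - 2\<close> and \<open>A\<close> by functions that still vanish near the origin, so
 the induction on the order runs over all exponents and all such functions at once.\<close>
lemma Cn_norm_powr_mult:
 fixes A :: "'a::euclidean_space => complex"
 assumes "\<delta> > 0"
 shows "\<forall>n. Cn n A ==> (!!x. norm x < \<delta> ==> A x = 0) ==> Cn n (%x. cx (norm x powr a) * A x)"
proof (induction n arbitrary: a A)
 have zero: "((%x. cx (norm x powr a) * A x) has_derivative (%v. 0)) (at x)" "(A has_derivative (%v. 0)) (at x)"
  if "norm x < \<delta>" and A: "!!x. norm x < \<delta> ==> A x = 0" for x a and A :: "'a => complex"
 proof -
  have "((%x. 0) has_derivative (%v. 0)) (at x)" "open {x::'a. norm x < \<delta>}"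
   by (auto intro!: has_derivative_const open_Collect_less continuous_intros)
  then show "((%x. cx (norm x powr a) * A x) has_derivative (%v. 0)) (at x)" "(A has_derivative (%v. 0)) (at x)"
   by (rule has_derivative_transform_within_open; use that in auto)+
 qed
 have D: "((%x. cx (norm x powr a) * A x) has_derivative
   (%v. cx (norm x powr (a - 2)) * (cx a * (cx (x \<bullet> v) * A x)) + cx (norm x powr a) * pd v A x)) (at x)"
  if A: "\<forall>x. A differentiable (at x)" "!!x. norm x < \<delta> ==> A x = 0" for x a and A :: "'a => complex"
 proof (cases "norm x < \<delta>")
  case True
  have "pd v A x = 0" for v using zero(2)[OF True A(2)] by (rule pd_eqI)
  then show ?thesis using zero(1)[OF True A(2)] A(2)[OF True] by simp
 next
  case False
  then have "x ~= 0" using assms by auto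
  from has_derivative_mult[OF has_derivative_norm_powr[OF this, of a] differentiable_imp_has_pd[OF A(1)]]
  show ?thesis by (simp add: ac_simps inner_commute add.commute)
 qed
 {
  case 0
  then have "\<forall>x. A differentiable (at x)" using Cn_differentiable by blast
  from D[OF this 0(2)] show ?case by (auto simp: differentiable_def)
 next
  case (Suc n)
  have dA: "\<forall>x. A differentiable (at x)" using Suc.prems(1) Cn_differentiable by blast
  have eq: "pd b (%x. cx (norm x powr a) * A x) =
   (%x. cx (norm x powr (a - 2)) * (cx a * (cx (x \<bullet> b) * A x)) + cx (norm x powr a) * pd b A x)" for b
   by (rule ext, rule pd_eqI[OF D[OF dA Suc.prems(2)]])
  have "Cn n (%x. cx (norm x powr (a - 2)) * (cx a * (cx (x \<bullet> b) * A x)) + cx (norm x powr a) * pd b A x)" if b: "b \<in> Basis" for b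
  proof (intro Cn_add Suc.IH allI)
   show "Cn m (%x. cx a * (cx (x \<bullet> b) * A x))" for m using Suc.prems(1) by (intro Cn_cmult Cn_mult Cn_inner) auto
   show "Cn m (pd b A)" for m using Suc.prems(1) b Cn.simps(2)[of m A] by blast
   show "pd b A x = 0" if "norm x < \<delta>" for x using zero(2)[OF that Suc.prems(2)] by (rule pd_eqI)
  qed (use Suc.prems in auto)
  then show ?case using D[OF dA Suc.prems(2)] by (auto simp: eq differentiable_def)
 }
qed

lemma bumps_norm_powr_mult:
 assumes "A \<in> bumps" "\<delta> > 0" "!!x. norm x < \<delta> ==> A x = 0"
 shows "(%x. cx (norm x powr a) * A x) \<in> bumps" using assms Cn_norm_powr_mult[of \<delta> A _ a] unfolding bumps_def by (auto simp: smooth_iff_Cn)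

lemma cutoff_bumps:
 assumes "lp_cutoff \<eta>"
 shows "(%x. cx (\<eta> x)) \<in> bumps" "(%x. cx (lp_chi \<eta> x)) \<in> bumps"
  "norm x > 1.1 ==> \<eta> x = 0" "norm x <= 1 ==> \<eta> x = 1"
  "norm x < 1/2 ==> lp_chi \<eta> x = 0" "norm x > 1.1 ==> lp_chi \<eta> x = 0"
proof -
 have z: "\<eta> x = 0" if "norm x > 1.1" for x
 proof (rule ccontr)
  assume "\<eta> x ~= 0"
  then have "x \<in> closure {\<xi>. \<eta> \<xi> ~= 0}" using closure_subset[of "{\<xi>. \<eta> \<xi> ~= 0}"] by auto
  moreover have "closure {\<xi>. \<eta> \<xi> ~= 0} \<subseteq> {\<xi>. norm \<xi> <= 1.1}" using assms unfolding lp_cutoff_def by blast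
  ultimately show False using that by auto
 qed
 then show "norm x > 1.1 ==> \<eta> x = 0" .
 show o: "norm x <= 1 ==> \<eta> x = 1" for x using assms unfolding lp_cutoff_def by blast
 show "norm x < 1/2 ==> lp_chi \<eta> x = 0" using o[of x] o[of "2 *\<^sub>R x"] by (simp add: lp_chi_def)
 show "norm x > 1.1 ==> lp_chi \<eta> x = 0" using z[of x] z[of "2 *\<^sub>R x"] by (simp add: lp_chi_def)
 have C: "\<forall>n. Cn n (%x. cx (\<eta> x))" 
 proof -
  have "smooth \<eta>" using assms unfolding lp_cutoff_def by blast
  then show ?thesis by (auto simp: smooth_iff_Cn intro!: Cn_of_real)
 qed
 then show b: "(%x. cx (\<eta> x)) \<in> bumps" using z unfolding bumps_def by (auto simp: smooth_iff_Cn intro!: exI[of _ "1.1"])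
 have "Cn n (%x. cx (\<eta> x) + (- 1) * cx (\<eta> (2 *\<^sub>R x)))" for n using C by (intro Cn_add Cn_cmult Cn_scale) auto
 moreover have "(%x. cx (\<eta> x) + (- 1) * cx (\<eta> (2 *\<^sub>R x))) = (%x. cx (lp_chi \<eta> x))" by (simp add: lp_chi_def)
 ultimately have "Cn n (%x. cx (lp_chi \<eta> x))" for n by simp
 moreover have "lp_chi \<eta> x = 0" if "norm x > 1.1" for x using z[of x] z[of "2 *\<^sub>R x"] that by (simp add: lp_chi_def)
 ultimately show "(%x. cx (lp_chi \<eta> x)) \<in> bumps"
  unfolding bumps_def smooth_iff_Cn mem_Collect_eq by (intro conjI allI exI[of _ "1.1"] impI) simp_all
qed

section \<open>The maximal function\<close>

definition ballint :: "('a::euclidean_space => complex) => 'a => real => ennreal" where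
 "ballint f x r = (NN y. enorm (f y) * indicator (ball x r) y)"

text \<open>Normalised by \<open>r\<^sup>d\<close> and not by the volume of the ball, which changes only constants.\<close>
definition maxf :: "('a::euclidean_space => complex) => 'a => ennreal" where
 "maxf f x = (SUP r\<in>{0<..}. ennreal (1 / r ^ DIM('a)) * ballint f x r)"

lemma ennreal_inverse_cancel: "r > 0 ==> ennreal r * (ennreal (1 / r) * x) = x" by (simp add: mult.assoc[symmetric] ennreal_mult'[symmetric])

lemma ballint_le_maxf:
 fixes x :: "'a::euclidean_space"
 assumes "r > 0"
 shows "ballint f x r <= maxf f x * ennreal (r ^ DIM('a))"
proof -
 have "ennreal (1 / r ^ DIM('a)) * ballint f x r <= maxf f x" unfolding maxf_def using assms by (intro SUP_upper) auto
 then have "ennreal (r ^ DIM('a)) * (ennreal (1 / r ^ DIM('a)) * ballint f x r) <= ennreal (r ^ DIM('a)) * maxf f x" by (intro mult_left_mono) auto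
 then show ?thesis unfolding ennreal_inverse_cancel[OF zero_less_power[OF assms]] by (simp only: mult.commute)
qed

lemma less_maxf_iff:
 fixes x :: "'a::euclidean_space"
 assumes "l >= 0"
 shows "ennreal l < maxf f x \<longleftrightarrow> (\<exists>r>0. ennreal (l * r ^ DIM('a)) < ballint f x r)"
proof -
 have "ennreal l < ennreal (1 / r ^ DIM('a)) * ballint f x r \<longleftrightarrow> ennreal (l * r ^ DIM('a)) < ballint f x r" if "r > 0" for r
 proof
  assume "ennreal l < ennreal (1 / r ^ DIM('a)) * ballint f x r"
  then have "ennreal (r ^ DIM('a)) * ennreal l < ennreal (r ^ DIM('a)) * (ennreal (1 / r ^ DIM('a)) * ballint f x r)"
   using that by (intro ennreal_mult_strict_left_mono) auto
  then have "ennreal (r ^ DIM('a)) * ennreal l < ballint f x r" unfolding ennreal_inverse_cancel[OF zero_less_power[OF that]] .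
  then show "ennreal (l * r ^ DIM('a)) < ballint f x r" using that assms by (simp add: mult.commute ennreal_mult)
 next
  assume "ennreal (l * r ^ DIM('a)) < ballint f x r"
  then have "ennreal (1 / r ^ DIM('a)) * ennreal (l * r ^ DIM('a)) < ennreal (1 / r ^ DIM('a)) * ballint f x r"
   using that by (intro ennreal_mult_strict_left_mono) auto
  then show "ennreal l < ennreal (1 / r ^ DIM('a)) * ballint f x r" using that assms by (simp add: ennreal_mult'[symmetric])
 qed
 then show ?thesis unfolding maxf_def less_SUP_iff by auto
qed

lemma ballint_mono: "ball x r \<subseteq> ball y r' ==> ballint f x r <= ballint f y r'"
 unfolding ballint_def by (intro nn_integral_mono mult_left_mono) (auto simp: indicator_def)

text \<open>For a fixed radius the condition persists under small shifts of the centre, after enlarging the ball slightly.\<close>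
lemma open_maxf:
 assumes "l >= 0"
 shows "open {x::'a::euclidean_space. ennreal l < maxf f x}" unfolding open_contains_ball
proof
 fix x :: 'a assume "x \<in> {x. ennreal l < maxf f x}"
 then obtain r where r: "r > 0" "ennreal (l * r ^ DIM('a)) < ballint f x r" using less_maxf_iff[OF assms] by blast
 have "((%t. ennreal (l * t ^ DIM('a))) \<longlongrightarrow> ennreal (l * r ^ DIM('a))) (at_right r)" by (intro tendsto_ennrealI tendsto_intros)
 then have "\<forall>\<^sub>F t in at_right r. ennreal (l * t ^ DIM('a)) < ballint f x r" using r(2) by (rule order_tendstoD)
 moreover have "\<forall>\<^sub>F t in at_right r. t > r" by (rule eventually_at_right_less)
 ultimately have "\<forall>\<^sub>F t in at_right r. t > r & ennreal (l * t ^ DIM('a)) < ballint f x r" by eventually_elim simp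
 then obtain t where t: "t > r" "ennreal (l * t ^ DIM('a)) < ballint f x r" using eventually_happens'[of "at_right r"] by auto
 have "ball x (t - r) \<subseteq> {x. ennreal l < maxf f x}"
 proof
  fix y assume "y \<in> ball x (t - r)"
  then have "dist x y < t - r" by simp
  then have "ball x r \<subseteq> ball y t"
  proof (intro subsetI)
   fix z assume "z \<in> ball x r"
   then show "z \<in> ball y t" using \<open>dist x y < t - r\<close> dist_triangle[of y z x] by (simp add: dist_commute)
  qed
  then have "ballint f x r <= ballint f y t" by (rule ballint_mono)
  with t have "ennreal (l * t ^ DIM('a)) < ballint f y t" by simp
  then show "y \<in> {x. ennreal l < maxf f x}" using less_maxf_iff[OF assms] r t by force
 qed
 then show "\<exists>e>0. ball x e \<subseteq> {x. ennreal l < maxf f x}" using t by (intro exI[of _ "t - r"]) auto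
qed

lemma maxf_measurable [measurable]: "meas (maxf f)"
proof (rule borel_measurableI_greater)
 fix y :: ennreal
 show "{x \<in> space borel. y < maxf f x} \<in> sets borel"
 proof (cases y)
  case (real l)
  then show ?thesis using open_maxf[of l f] by (auto intro: borel_open)
 qed simp
qed

text \<open>Vitali's covering lemma: disjoint balls carry enough of the integral, and their fivefold enlargements cover.\<close>
lemma maxf_weak_type:
 fixes f :: "'a::euclidean_space => complex"
 assumes [measurable]: "meas f" and l: "l > 0"
 shows "emeasure lborel {x. ennreal l < maxf f x} <= ennreal (10 ^ DIM('a) / l) * (NN y. enorm (f y))"
proof (cases "(NN y. enorm (f y)) = \<infinity>")
 case True
 then show ?thesis using l by (simp add: ennreal_mult_top)
next
 case False
 then obtain K where K: "(NN y. enorm (f y)) = ennreal K" "K >= 0" by (cases "(NN y. enorm (f y))") auto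
 define S where "S = {x. ennreal l < maxf f x}"
 have "\<forall>x\<in>S. \<exists>r>0. ennreal (l * r ^ DIM('a)) < ballint f x r" unfolding S_def using less_maxf_iff[of l f] l by auto
 then obtain r where r: "!!x. x \<in> S ==> r x > 0" "!!x. x \<in> S ==> ennreal (l * r x ^ DIM('a)) < ballint f x (r x)" by metis
 have bl: "ballint f x t <= ennreal K" for x t unfolding K(1)[symmetric] ballint_def by (intro nn_integral_mono) (auto simp: indicator_def)
 have rb: "r x <= max 1 (K / l)" if x: "x \<in> S" for x
 proof (cases "r x <= 1")
  case False
  have "ennreal (l * r x ^ DIM('a)) <= ennreal K" by (rule order_trans[OF less_imp_le[OF r(2)[OF x]] bl])
  then have "l * r x ^ DIM('a) <= K" using K by simp
  moreover have "r x ^ 1 <= r x ^ DIM('a)" using False by (intro power_increasing) auto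
  then have "l * r x <= l * r x ^ DIM('a)" using l by (intro mult_left_mono) auto
  ultimately have "l * r x <= K" by simp
  then show ?thesis using l by (simp add: pos_le_divide_eq mult.commute le_max_iff_disj)
 qed simp
 have "S \<subseteq> (\<Union>i\<in>S. ball i (r i))" using r(1) by force
 moreover have "!!i. i \<in> S ==> 0 < r i & r i <= max 1 (K / l)" using r(1) rb by blast
 ultimately obtain C where C: "countable C" "C \<subseteq> S"
   "pairwise (%i j. disjnt (ball i (r i)) (ball j (r j))) C"
   "S \<subseteq> (\<Union>i\<in>C. ball i (5 * r i))" by (rule Vitali_covering_lemma_balls)
 have "emeasure lborel S <= emeasure lborel (\<Union>i\<in>C. ball i (5 * r i))" using C by (intro emeasure_mono) auto
 also have "... <= (\<integral>\<^sup>+i. emeasure lborel (ball i (5 * r i)) \<partial>count_space C)"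
 proof -
  have "emeasure lborel (\<Union>i\<in>C. ball i (5 * r i)) = (NN x. indicator (\<Union>i\<in>C. ball i (5 * r i)) x)"
   using C by (intro nn_integral_indicator[symmetric]) auto
  also have "... <= (NN x. (\<integral>\<^sup>+i. indicator (ball i (5 * r i)) x \<partial>count_space C))"
  proof (intro nn_integral_mono)
   fix x
   show "indicator (\<Union>i\<in>C. ball i (5 * r i)) x <= (\<integral>\<^sup>+i. indicator (ball i (5 * r i)) x \<partial>count_space C)"
   proof (cases "x \<in> (\<Union>i\<in>C. ball i (5 * r i))")
    case True
    then obtain i where "i \<in> C" "x \<in> ball i (5 * r i)" by blast
    then show ?thesis using nn_integral_ge_point[of i C "%i. indicator (ball i (5 * r i)) x"] True by simp
   qed simp
  qed
  also have "... = (\<integral>\<^sup>+i. emeasure lborel (ball i (5 * r i)) \<partial>count_space C)"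
   using C by (subst nn_integral_count_space_nn_integral) auto
  finally show ?thesis .
 qed
 also have "... <= (\<integral>\<^sup>+i. ennreal (10 ^ DIM('a) / l) * emeasure (density lborel (%y. enorm (f y))) (ball i (r i)) \<partial>count_space C)"
 proof (intro nn_integral_mono)
  fix i assume "i \<in> space (count_space C)"
  then have i: "i \<in> S" using C by auto
  have "emeasure lborel (ball i (5 * r i)) <= ennreal (2 ^ DIM('a)) * ennreal ((5 * r i) ^ DIM('a))"
   by (rule emeasure_ball_le) (use r(1)[OF i] in simp)
  also have "... = ennreal (10 ^ DIM('a) / l) * ennreal (l * r i ^ DIM('a))"
  proof -
   have "(2::real) ^ DIM('a) * (5 * r i) ^ DIM('a) = 10 ^ DIM('a) * r i ^ DIM('a)" unfolding power_mult_distrib[symmetric] by simp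
   then show ?thesis using l r(1)[OF i] by (simp add: ennreal_mult'[symmetric])
  qed
  also have "... <= ennreal (10 ^ DIM('a) / l) * ballint f i (r i)" using r(2)[OF i] by (intro mult_left_mono) auto
  also have "ballint f i (r i) = emeasure (density lborel (%y. enorm (f y))) (ball i (r i))" unfolding ballint_def by (subst emeasure_density) auto
  finally show "emeasure lborel (ball i (5 * r i)) <= ennreal (10 ^ DIM('a) / l) * emeasure (density lborel (%y. enorm (f y))) (ball i (r i))" .
 qed
 also have "... = ennreal (10 ^ DIM('a) / l) * (\<integral>\<^sup>+i. emeasure (density lborel (%y. enorm (f y))) (ball i (r i)) \<partial>count_space C)"
  by (simp add: nn_integral_cmult)
 also have "(\<integral>\<^sup>+i. emeasure (density lborel (%y. enorm (f y))) (ball i (r i)) \<partial>count_space C)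
   = emeasure (density lborel (%y. enorm (f y))) (\<Union>i\<in>C. ball i (r i))"
  using C by (subst emeasure_UN_countable) (auto simp: disjoint_family_on_def pairwise_def disjnt_def)
 also have "... <= (NN y. enorm (f y))" using C by (subst emeasure_density) (auto intro!: nn_integral_mono simp: indicator_def)
 finally show ?thesis by (simp add: S_def mult_left_mono)
qed

text \<open>Values of \<open>f\<close> below \<open>l / 2\<^sup>d\<^sup>+\<^sup>1\<close> raise the maximal function by at most \<open>l / 2\<close>, so the weak type bound need only be
 applied to the values above.\<close>
lemma maxf_distribution:
 fixes f :: "'a::euclidean_space => complex"
 assumes [measurable]: "meas f" and l: "l > 0"
 shows "emeasure lborel {x. ennreal l < maxf f x}
  <= ennreal (10 ^ DIM('a)) * (NN x. ennreal (2 ^ (DIM('a) + 1) * norm (f x) / l) * indicator {x. 2 ^ (DIM('a) + 1) * norm (f x) / l > 1} x)"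
proof -
 define c where "c = (2::real) ^ (DIM('a) + 1)"
 have c: "c >= 2" unfolding c_def by simp
 define g where "g x = (if c * norm (f x) / l > 1 then f x else 0)" for x
 have [measurable]: "meas g" unfolding g_def by measurable
 have sub: "{x. ennreal l < maxf f x} \<subseteq> {x. ennreal (l / 2) < maxf g x}"
 proof
  fix x assume "x \<in> {x. ennreal l < maxf f x}"
  then obtain r where r: "r > 0" "ennreal (l * r ^ DIM('a)) < ballint f x r" using less_maxf_iff[of l f x] l by auto
  have "ballint f x r <= ballint g x r + ennreal (l / c) * emeasure lborel (ball x r)"
  proof -
   have "ballint f x r <= (NN y. enorm (g y) * indicator (ball x r) y + ennreal (l / c) * indicator (ball x r) y)" unfolding ballint_def
   proof (intro nn_integral_mono)
    fix y
    have "norm (f y) <= norm (g y) + l / c" using l c by (auto simp: g_def not_less pos_divide_le_eq pos_le_divide_eq mult.commute)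
    then have "enorm (f y) <= enorm (g y) + ennreal (l / c)" using l c by (simp add: ennreal_plus[symmetric] del: ennreal_plus)
    then show "enorm (f y) * indicator (ball x r) y <= enorm (g y) * indicator (ball x r) y + ennreal (l / c) * indicator (ball x r) y"
     by (auto simp: indicator_def)
   qed
   also have "... = ballint g x r + ennreal (l / c) * emeasure lborel (ball x r)" by (simp add: nn_integral_add nn_integral_cmult ballint_def)
   finally show ?thesis .
  qed
  also have "... <= ballint g x r + ennreal (l / c) * (ennreal (2 ^ DIM('a)) * ennreal (r ^ DIM('a)))"
   by (intro add_left_mono mult_left_mono emeasure_ball_le r) auto
  also have "ennreal (l / c) * (ennreal (2 ^ DIM('a)) * ennreal (r ^ DIM('a))) = ennreal (l / 2 * r ^ DIM('a))"
   using l r by (simp add: ennreal_mult'[symmetric] c_def)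
  finally have le: "ennreal (l * r ^ DIM('a)) < ballint g x r + ennreal (l / 2 * r ^ DIM('a))" by (rule order_less_le_trans[OF r(2)])
  have "ennreal (l / 2 * r ^ DIM('a)) < ballint g x r"
  proof (rule ccontr)
   assume "\<not> ennreal (l / 2 * r ^ DIM('a)) < ballint g x r"
   then have "ballint g x r + ennreal (l / 2 * r ^ DIM('a)) <= ennreal (l / 2 * r ^ DIM('a)) + ennreal (l / 2 * r ^ DIM('a))"
    by (intro add_right_mono) simp
   also have "... = ennreal (l * r ^ DIM('a))" using l r by (simp add: ennreal_plus[symmetric] del: ennreal_plus)
   finally show False using le by simp
  qed
  then show "x \<in> {x. ennreal (l / 2) < maxf g x}" using less_maxf_iff[of "l/2" g x] l r by auto
 qed
 have "emeasure lborel {x. ennreal l < maxf f x} <= emeasure lborel {x. ennreal (l / 2) < maxf g x}" using sub by (intro emeasure_mono) auto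
 also have "... <= ennreal (10 ^ DIM('a) / (l / 2)) * (NN y. enorm (g y))" by (rule maxf_weak_type) (use l in auto)
 also have "... = (NN y. ennreal (10 ^ DIM('a) / (l / 2)) * enorm (g y))" by (simp add: nn_integral_cmult)
 also have "... <= (NN y. ennreal (10 ^ DIM('a)) * (ennreal (c * norm (f y) / l) * indicator {x. c * norm (f x) / l > 1} y))"
 proof (intro nn_integral_mono)
  fix y
  have "10 ^ DIM('a) / (l / 2) * norm (f y) <= 10 ^ DIM('a) * (c * norm (f y) / l)"
   using l mult_right_mono[OF c, of "10 ^ DIM('a) * norm (f y)"] by (simp add: field_simps)
  then have "ennreal (10 ^ DIM('a) / (l / 2) * norm (f y)) <= ennreal (10 ^ DIM('a) * (c * norm (f y) / l))" by (rule ennreal_leI)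
  then show "ennreal (10 ^ DIM('a) / (l / 2)) * enorm (g y) <= ennreal (10 ^ DIM('a)) * (ennreal (c * norm (f y) / l) * indicator {x. c * norm (f x) / l > 1} y)"
   using l c by (auto simp: g_def indicator_def ennreal_mult'[symmetric])
 qed
 also have "... = ennreal (10 ^ DIM('a)) * (NN x. ennreal (c * norm (f x) / l) * indicator {x. c * norm (f x) / l > 1} x)"
  by (subst nn_integral_cmult) auto
 finally show ?thesis by (simp add: c_def)
qed

text \<open>Real valued for use in Hoelder's inequality. The value 0 where the maximal function is infinite concerns
 only a null set when \<open>f\<close> is in \<open>L\<^sup>p\<close> (\<open>maxf_finite_AE\<close>).\<close>
definition mf :: "('a::euclidean_space => complex) => 'a => real" where
 "mf f x = enn2real (maxf f x)"

lemma mf_nonneg: "mf f x >= 0" by (simp add: mf_def)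

lemma mf_measurable [measurable]: "meas (mf f)" unfolding mf_def by measurable

lemma maximal_theorem:
 fixes f :: "'a::euclidean_space => complex"
 assumes [measurable]: "meas f" and p: "p > 1"
 shows "pint p (mf f) <= ennreal (10 ^ DIM('a) * (p / (p - 1) + p) * (2 ^ (DIM('a) + 1)) powr p) * pint p f"
proof -
 define c where "c = (2::real) ^ (DIM('a) + 1)"
 have c: "c > 0" by (simp add: c_def)
 have "pint p (mf f) <= ennreal (10 ^ DIM('a) * (p / (p - 1) + p / ((p + 1) - p))) * pint p (%x. c * norm (f x))"
 proof (rule strong_type_of_distribution_bound)
  fix l :: real assume l: "l > 0"
  have "emeasure lborel {x. l < mf f x} <= emeasure lborel {x. ennreal l < maxf f x}"
  proof (intro emeasure_mono subsetI, clarify)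
   fix x assume "l < mf f x"
   then show "ennreal l < maxf f x" using l unfolding mf_def by (cases "maxf f x") (auto simp: ennreal_less_iff)
  qed auto
  also have "... <= ennreal (10 ^ DIM('a)) * (NN x. ennreal (c * norm (f x) / l) * indicator {x. c * norm (f x) / l > 1} x)"
   unfolding c_def by (rule maxf_distribution) (use l in auto)
  also have "... <= ennreal (10 ^ DIM('a)) * (NN x. ennreal (kap (p + 1) (c * norm (f x) / l)))"
   by (intro mult_left_mono nn_integral_mono) (auto simp: kap_def indicator_def)
  finally show "emeasure lborel {x. l < mf f x} <= ennreal (10 ^ DIM('a)) * (NN x. ennreal (kap (p + 1) (c * norm (f x) / l)))" .
 qed (use p c in \<open>auto simp: mf_nonneg\<close>)
 also have "pint p (%x. c * norm (f x)) = ennreal (c powr p) * pint p (%x. norm (f x))" by (rule pint_cmult) (use c in auto)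
 also have "pint p (%x. norm (f x)) = pint p f" by (simp add: pint_def)
 finally show ?thesis using p c by (simp add: c_def mult.assoc[symmetric] ennreal_mult'[symmetric])
qed

lemma maxf_finite_AE:
 fixes f :: "'a::euclidean_space => complex"
 assumes f: "f \<in> Lp_space p" and p: "p > 1"
 shows "AE x in lborel. maxf f x < \<infinity>"
proof -
 have [measurable]: "meas f" and fin: "pint p f < \<infinity>" using f by (auto simp: Lp_space_iff)
 define c where "c = (2::real) ^ (DIM('a) + 1)"
 have c: "c > 0" by (simp add: c_def)
 have "pint p (%x. c * norm (f x)) = ennreal (c powr p) * pint p (%x. norm (f x))" by (rule pint_cmult) (use c in auto)
 also have "... < \<infinity>" using fin by (auto simp: pint_def ennreal_mult_less_top)
 finally obtain K where K: "pint p (%x. c * norm (f x)) = ennreal K" "K >= 0" by (cases "pint p (%x. c * norm (f x))") auto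
 have le: "emeasure lborel {x. maxf f x = \<infinity>} <= ennreal (10 ^ DIM('a) * (K * l powr (-p)))" if l: "l > 0" for l
 proof -
  have "emeasure lborel {x. maxf f x = \<infinity>} <= emeasure lborel {x. ennreal l < maxf f x}"
   by (intro emeasure_mono) (auto simp: ennreal_less_top)
  also have "... <= ennreal (10 ^ DIM('a)) * (NN x. ennreal (c * norm (f x) / l) * indicator {x. c * norm (f x) / l > 1} x)"
   unfolding c_def by (rule maxf_distribution) (use l in auto)
  also have "... <= ennreal (10 ^ DIM('a)) * (NN x. ennreal (l powr (-p)) * ennreal (norm (c * norm (f x)) powr p))"
  proof (intro mult_left_mono nn_integral_mono)
   fix x
   have "c * norm (f x) / l <= l powr (-p) * (c * norm (f x)) powr p" if "c * norm (f x) / l > 1"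
   proof -
    have "(c * norm (f x) / l) powr 1 <= (c * norm (f x) / l) powr p" using that p by (intro powr_mono) auto
    then show ?thesis using that l c by (simp add: powr_divide powr_minus_divide)
   qed
   then show "ennreal (c * norm (f x) / l) * indicator {x. c * norm (f x) / l > 1} x <= ennreal (l powr (-p)) * ennreal (norm (c * norm (f x)) powr p)"
    using c by (auto simp: indicator_def ennreal_mult'[symmetric] intro!: ennreal_leI)
  qed simp
  also have "... = ennreal (10 ^ DIM('a)) * (ennreal (l powr (-p)) * pint p (%x. c * norm (f x)))" by (simp add: nn_integral_cmult pint_def)
  also have "... = ennreal (10 ^ DIM('a) * (K * l powr (-p)))" using K by (simp add: ennreal_mult'[symmetric] ac_simps)
  finally show ?thesis .
 qed
 have "((%l. l powr (-p)) \<longlongrightarrow> 0) at_top" using p by (intro tendsto_neg_powr filterlim_ident) auto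
 then have "((%l. 10 ^ DIM('a) * (K * l powr (-p))) \<longlongrightarrow> 10 ^ DIM('a) * (K * 0)) at_top" by (intro tendsto_intros)
 then have "((%l. ennreal (10 ^ DIM('a) * (K * l powr (-p)))) \<longlongrightarrow> ennreal (10 ^ DIM('a) * (K * 0))) at_top"
  by (rule tendsto_ennrealI)
 then have "emeasure lborel {x. maxf f x = \<infinity>} <= ennreal (10 ^ DIM('a) * (K * 0))"
  by (rule tendsto_lowerbound) (use le in \<open>auto intro: eventually_mono[OF eventually_gt_at_top[of 0]]\<close>)
 then have "emeasure lborel {x. maxf f x = \<infinity>} = 0" by simp
 then have "AE x in lborel. \<not> maxf f x = \<infinity>" by (intro AE_I[where N="{x. maxf f x = \<infinity>}"]) auto
 then show ?thesis by eventually_elim (simp add: top.not_eq_extremum)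
qed

text \<open>Convolution against any dilate of the weight is an average over dyadic balls.\<close>

lemma conv_wgt_le_maxf:
 fixes f :: "'a::euclidean_space => complex"
 assumes [measurable]: "meas f" and t: "t > 0"
 shows "(NN y. ennreal (t ^ DIM('a) * wgt (t *\<^sub>R (x - y)) * norm (f y))) <= ennreal (2 ^ (DIM('a) + 2)) * maxf f x"
proof -
 have "(NN y. ennreal (t ^ DIM('a) * wgt (t *\<^sub>R (x - y)) * norm (f y)))
  = ennreal (t ^ DIM('a)) * (NN y. ennreal (wgt (t *\<^sub>R (x - y)) * norm (f y)))"
  using t by (subst nn_integral_cmult[symmetric]) (auto simp: ennreal_mult' mult.assoc intro!: nn_integral_cong)
 also have "... = (NN u. ennreal (wgt (t *\<^sub>R (x - (x + (- (1 / t)) *\<^sub>R u))) * norm (f (x + (- (1 / t)) *\<^sub>R u))))"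
  using t by (subst nn_integral_lborel_affine[of "%y. ennreal (wgt (t *\<^sub>R (x - y)) * norm (f y))" "- (1 / t)" x])
   (auto simp: power_divide)
 also have "... = (NN u. ennreal (wgt u) * enorm (f (x + (- (1 / t)) *\<^sub>R u)))" using t by (simp add: ennreal_mult' wgt_nonneg)
 also have "... <= ennreal (2 ^ (DIM('a) + 2)) * maxf f x"
 proof (rule nn_integral_wgt)
  fix r :: real assume r: "r > 0"
  have "(NN u. enorm (f (x + (- (1 / t)) *\<^sub>R u)) * indicator (ball 0 r) u)
   = (NN u. enorm (f (x + (- (1 / t)) *\<^sub>R u)) * indicator (ball x (r / t)) (x + (- (1 / t)) *\<^sub>R u))"
   using t by (intro nn_integral_cong) (auto simp: indicator_def dist_norm field_simps)
  also have "... = ennreal (t ^ DIM('a)) * ballint f x (r / t)" unfolding ballint_def using t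
   by (subst nn_integral_lborel_affine[of "%y. enorm (f y) * indicator (ball x (r / t)) y" "- (1 / t)" x])
    (auto simp: power_divide)
  also have "... <= ennreal (t ^ DIM('a)) * (maxf f x * ennreal ((r / t) ^ DIM('a)))" using t r by (intro mult_left_mono ballint_le_maxf) auto
  also have "... = maxf f x * ennreal (t ^ DIM('a) * (r / t) ^ DIM('a))" using t r by (simp add: ennreal_mult ac_simps)
  also have "t ^ DIM('a) * (r / t) ^ DIM('a) = r ^ DIM('a)" using t by (simp add: power_divide)
  finally show "(NN u. enorm (f (x + (- (1 / t)) *\<^sub>R u)) * indicator (ball 0 r) u) <= maxf f x * ennreal (r ^ DIM('a))" .
 qed measurable
 finally show ?thesis .
qed

section \<open>Density of continuous functions\<close>

definition tame :: "('a::euclidean_space => complex) => bool" where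
 "tame h \<longleftrightarrow> continuous_on UNIV h & (\<exists>R. \<forall>x. norm x > R --> h x = 0)"

lemma tame_bounded: "tame h ==> \<exists>B\<ge>0. \<forall>x. norm (h x) <= B" unfolding tame_def using rapid_compact[of h]
 by (metis mult_1 norm_ge_zero order_trans power_0 rapid_def)

lemma pint_diff_triangle:
 fixes f g h :: "'a::euclidean_space => complex"
 assumes [measurable]: "meas f" "meas g" "meas h" and "p >= 0"
 shows "pint p (%x. f x - h x) <= ennreal (2 powr p) * (pint p (%x. f x - g x) + pint p (%x. g x - h x))"
proof -
 have "pint p (%x. f x - h x) <= (NN x. ennreal (2 powr p) * (ennreal (norm (f x - g x) powr p) + ennreal (norm (g x - h x) powr p)))"
  unfolding pint_def
 proof (intro nn_integral_mono)
  fix x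
  have "norm ((f x - g x) + (g x - h x)) powr p <= 2 powr p * (norm (f x - g x) powr p + norm (g x - h x) powr p)" by (rule minus_triangle) fact
  then show "ennreal (norm (f x - h x) powr p) <= ennreal (2 powr p) * (ennreal (norm (f x - g x) powr p) + ennreal (norm (g x - h x) powr p))"
   by (simp add: ennreal_plus[symmetric] ennreal_mult'[symmetric] del: ennreal_plus)
 qed
 also have "... = ennreal (2 powr p) * (pint p (%x. f x - g x) + pint p (%x. g x - h x))" by (simp add: nn_integral_cmult nn_integral_add pint_def)
 finally show ?thesis .
qed

lemma pint_converges_zero:
 fixes f :: "'a::euclidean_space => complex" and F :: "nat => 'a => complex"
 assumes [measurable]: "meas f" "!!n. meas (F n)"
  and p: "p > 0" and c: "AE x in lborel. (%n. F n x) \<longlonglongrightarrow> f x"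
  and w: "!!n x. norm (f x - F n x) <= w x" "meas (%x. w x)" "pint p w < \<infinity>"
 shows "(%n. pint p (%x. f x - F n x)) \<longlonglongrightarrow> 0"
proof -
 have "(%n. (NN x. ennreal (norm (f x - F n x) powr p))) \<longlonglongrightarrow> (\<integral>\<^sup>+x. 0 \<partial>(lborel :: 'a measure))"
 proof (rule nn_integral_dominated_convergence[where w="%x. ennreal (norm (w x) powr p)"])
  show "AE x in lborel. (%n. ennreal (norm (f x - F n x) powr p)) \<longlonglongrightarrow> 0" using c
  proof eventually_elim
   case (elim x)
   have "(%n. norm (f x - F n x)) \<longlonglongrightarrow> norm (f x - f x)" using elim by (intro tendsto_intros)
   then have "(%n. norm (f x - F n x)) \<longlonglongrightarrow> 0" by simp
   then have "(%n. norm (f x - F n x) powr p) \<longlonglongrightarrow> 0 powr p" by (intro tendsto_powr') (use p in auto)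
   then have "(%n. ennreal (norm (f x - F n x) powr p)) \<longlonglongrightarrow> ennreal 0" by (intro tendsto_ennrealI) simp
   then show ?case by simp
  qed
  show "AE x in lborel. ennreal (norm (f x - F n x) powr p) <= ennreal (norm (w x) powr p)" for n
   using w(1) p by (intro AE_I2 ennreal_leI powr_mono2) (auto intro: order_trans[OF w(1)])
 qed (use w in \<open>auto simp: pint_def\<close>)
 then show ?thesis by (simp add: pint_def)
qed

text \<open>A function cut off in size and in space is almost everywhere a limit of continuous functions; clipping these
 at the same size and multiplying them by a cutoff provides a common majorant for dominated convergence.\<close>
lemma tame_dense:
 fixes f :: "'a::euclidean_space => complex"
 assumes f: "f \<in> Lp_space p" and p: "p > 0" and e: "e > 0"
 shows "\<exists>h. tame h & pint p (%x. f x - h x) < e"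
proof -
 have [measurable]: "meas f" and fin: "pint p f < \<infinity>" using f by (auto simp: Lp_space_iff)
 define d where "d = min 1 e / ennreal (2 powr p * 4)"
 have d: "d > 0" using e by (simp add: d_def ennreal_zero_less_divide)
 have d2: "ennreal (2 powr p) * (d + d) < e"
 proof -
  obtain m where m: "min 1 e = ennreal m" "m > 0" using e by (cases "min 1 e") (auto simp: min_def zero_less_iff_neq_zero split: if_splits)
  have "d = ennreal (m / (2 powr p * 4))" using m by (simp add: d_def divide_ennreal)
  then have "ennreal (2 powr p) * (d + d) = ennreal (m / 2)" using m by (simp add: ennreal_plus[symmetric] ennreal_mult'[symmetric] del: ennreal_plus)
  also have "... < ennreal m" using m by (simp add: ennreal_less_iff)
  also have "... <= e" using m(1) by (metis min.cobounded2)
  finally show ?thesis .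
 qed
 define F where "F m x = (if norm (f x) <= real m & norm x <= real m then f x else 0)" for m :: nat and x
 have [measurable]: "meas (F m)" for m unfolding F_def by measurable
 have "(%m. pint p (%x. f x - F m x)) \<longlonglongrightarrow> 0"
 proof (rule pint_converges_zero[where w="%x. norm (f x)"])
  show "AE x in lborel. (%m. F m x) \<longlonglongrightarrow> f x"
  proof (intro AE_I2 tendsto_eventually)
   fix x
   obtain m0 :: nat where "max (norm (f x)) (norm x) <= real m0" using real_arch_simple by blast
   then show "\<forall>\<^sub>F m in sequentially. F m x = f x" by (intro eventually_sequentiallyI[of m0]) (auto simp: F_def)
  qed
  show "norm (f x - F m x) <= norm (f x)" for m x by (simp add: F_def)
  show "pint p (%x. norm (f x)) < \<infinity>" using fin by (simp add: pint_def)
 qed (use p in auto)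
 from order_tendstoD(2)[OF this d] obtain m where m: "pint p (%x. f x - F m x) < d" by (auto dest: eventually_happens)
 have "F m \<in> borel_measurable (lebesgue_on UNIV)" by (simp add: lebesgue_on_UNIV_eq measurable_completion)
 then have "F m measurable_on UNIV" by (subst measurable_on_iff_borel_measurable) auto
 then obtain N g where N: "negligible N" and g: "!!n. continuous_on UNIV (g n)" "!!x. x \<notin> N ==> (%n. g n x) \<longlonglongrightarrow> F m x"
  unfolding measurable_on_def by auto
 define clip where "clip z = z / cx (max 1 (norm z / real (m + 1)))" for z :: complex
 have clip_cont: "continuous_on UNIV clip" unfolding clip_def by (intro continuous_intros) auto
 have clip_le: "norm (clip z) <= real (m + 1)" for z
 proof -
  have pos: "0 < max 1 (norm z / real (m + 1))" by (simp add: less_max_iff_disj)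
  have "norm z = real (m + 1) * (norm z / real (m + 1))" by simp
  also have "... <= real (m + 1) * max 1 (norm z / real (m + 1))" by (intro mult_left_mono) auto
  finally have "norm z / max 1 (norm z / real (m + 1)) <= real (m + 1)" unfolding pos_divide_le_eq[OF pos] .
  moreover have "norm (clip z) = norm z / max 1 (norm z / real (m + 1))" unfolding clip_def norm_divide norm_of_real using pos by simp
  ultimately show ?thesis by simp
 qed
 have clip_F: "clip (F m x) = F m x" for x by (simp add: clip_def F_def max_def pos_le_divide_eq)
 define cut where "cut x = max 0 (min 1 (real (m + 1) - norm x))" for x :: 'a
 have cut_cont: "continuous_on UNIV cut" unfolding cut_def by (intro continuous_intros)
 have cut_le: "0 <= cut x" "cut x <= 1" for x by (auto simp: cut_def)
 define h where "h n x = cx (cut x) * clip (g n x)" for n x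
 have h_cont: "continuous_on UNIV (h n)" for n unfolding h_def by (intro continuous_intros cut_cont continuous_on_compose2[OF clip_cont g(1)]) auto
 have h_tame: "tame (h n)" for n unfolding tame_def using h_cont by (auto simp: h_def cut_def intro!: exI[of _ "real (m + 1)"])
 have [measurable]: "meas (h n)" for n by (rule borel_measurable_continuous_onI[OF h_cont])
 have "(%n. pint p (%x. F m x - h n x)) \<longlonglongrightarrow> 0"
 proof (rule pint_converges_zero[where w="%x. 2 * real (m + 1) * indicator (cball 0 (real (m + 1))) x"])
  obtain N' where N': "N' \<in> null_sets lborel" "N \<subseteq> N'" using N unfolding negligible_iff_null_sets null_sets_completion_iff2 by blast
  have "AE x in lborel. x \<notin> N" using AE_not_in[OF N'(1)] by eventually_elim (use N' in auto)
  then show "AE x in lborel. (%n. h n x) \<longlonglongrightarrow> F m x"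
  proof eventually_elim
   case (elim x)
   have "(%n. h n x) \<longlonglongrightarrow> cx (cut x) * clip (F m x)" unfolding h_def
    by (intro tendsto_intros continuous_on_tendsto_compose[OF clip_cont g(2)[OF elim]]) auto
   also have "cx (cut x) * clip (F m x) = F m x" unfolding clip_F by (auto simp: F_def cut_def)
   finally show ?case .
  qed
  fix n x
  show "norm (F m x - h n x) <= 2 * real (m + 1) * indicator (cball 0 (real (m + 1))) x"
  proof (cases "norm x <= real (m + 1)")
   case True
   have "norm (F m x - h n x) <= norm (F m x) + norm (h n x)" by (rule norm_triangle_ineq4)
   also have "norm (F m x) <= real (m + 1)" by (simp add: F_def)
   also have "norm (h n x) <= 1 * real (m + 1)" unfolding h_def norm_mult using cut_le[of x] by (intro mult_mono clip_le) auto
   finally show ?thesis using True by (simp add: algebra_simps)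
  next
   case False
   then show ?thesis by (simp add: F_def h_def cut_def)
  qed
 next
  have "pint p (%x. 2 * real (m + 1) * indicator (cball (0::'a) (real (m + 1))) x)
    = (NN x. ennreal ((2 * real (m + 1)) powr p) * indicator (cball (0::'a) (real (m + 1))) x)"
   unfolding pint_def by (intro nn_integral_cong) (auto simp: indicator_def)
  also have "... < \<infinity>" using emeasure_lborel_cball_finite[of "0::'a" "real (m+1)"]
   by (simp add: nn_integral_cmult_indicator ennreal_mult_less_top)
  finally show "pint p (%x. 2 * real (m + 1) * indicator (cball (0::'a) (real (m + 1))) x) < \<infinity>" .
 qed (use p in auto)
 from order_tendstoD(2)[OF this d] obtain n where n: "pint p (%x. F m x - h n x) < d" by (auto dest: eventually_happens)
 have "pint p (%x. f x - h n x) <= ennreal (2 powr p) * (pint p (%x. f x - F m x) + pint p (%x. F m x - h n x))"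
  by (rule pint_diff_triangle) (use p in auto)
 also have "... <= ennreal (2 powr p) * (d + d)" using m n by (intro mult_left_mono add_mono) auto
 also have "... < e" by (rule d2)
 finally show ?thesis using h_tame by blast
qed

section \<open>Convolution\<close>

definition conv :: "('a::euclidean_space => complex) => ('a => complex) => 'a => complex" where
 "conv K f x = (LI y. K (x - y) * f y)"

text \<open>Exactly what makes all convolutions and pairings below absolutely convergent.\<close>
definition nice :: "('a::euclidean_space => complex) => bool" where
 "nice f \<longleftrightarrow> integrable lborel f & (\<exists>B. \<forall>x. norm (f x) <= B)"

lemma nice_measurable: "nice f ==> meas f" unfolding nice_def using borel_measurable_integrable by fastforce

lemma nice_integrable: "nice f ==> integrable lborel f" by (simp add: nice_def)

lemma nice_bound: "nice f ==> \<exists>B\<ge>0. \<forall>x. norm (f x) <= B" unfolding nice_def using order_trans[OF norm_ge_zero] by blast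

lemma schwartz_nice: "f \<in> schwartz ==> nice f" unfolding nice_def using schwartz_integrable ft_bounded by blast

lemma conv_measurable [measurable]:
 assumes [measurable]: "meas K" "meas f"
 shows "meas (conv K f)" unfolding conv_def by measurable

lemma integrable_bounded_mult:
 fixes f g :: "'a::euclidean_space => complex"
 assumes f: "integrable lborel f" and [measurable]: "meas g" and B: "!!x. norm (g x) <= B"
 shows "integrable lborel (%x. f x * g x)" "integrable lborel (%x. g x * f x)"
proof -
 have [measurable]: "meas f" using borel_measurable_integrable[OF f] by simp
 have "B >= 0" using order_trans[OF norm_ge_zero B] .
 show "integrable lborel (%x. f x * g x)"
 proof (rule Bochner_Integration.integrable_bound[OF integrable_mult_right[OF f, of "cx B"]])
  show "AE x in lborel. norm (f x * g x) <= norm (cx B * f x)"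
  proof (intro AE_I2)
   fix x
   show "norm (f x * g x) <= norm (cx B * f x)"
    using mult_left_mono[OF B[of x], of "norm (f x)"] \<open>B >= 0\<close> by (simp add: norm_mult mult.commute[of B])
  qed
 qed simp
 then show "integrable lborel (%x. g x * f x)" by (simp add: mult.commute)
qed

lemma nice_translate_mult:
 assumes K: "nice K" and f: "nice f"
 shows "integrable lborel (%y. K (x - y) * f y)" "integrable lborel (%y. K (y - x) * f y)"
proof -
 obtain B where "!!x. norm (K x) <= B" using nice_bound[OF K] by blast
 moreover have [measurable]: "meas K" by (rule nice_measurable[OF K])
 ultimately show "integrable lborel (%y. K (x - y) * f y)" "integrable lborel (%y. K (y - x) * f y)"
  using nice_integrable[OF f] by (auto intro!: integrable_bounded_mult)
qed

lemma conv_norm_le: "norm (conv K f x) <= (NN y. ennreal (norm (K (x - y)) * norm (f y)))"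
proof (cases "integrable lborel (%y. K (x - y) * f y)")
 case True
 have "enorm (conv K f x) <= ennreal (LI y. norm (K (x - y) * f y))" unfolding conv_def by (intro ennreal_leI integral_norm_bound)
 also have "... = (NN y. enorm (K (x - y) * f y))" using True by (subst nn_integral_eq_integral) auto
 finally show ?thesis by (simp add: norm_mult)
next
 case False
 then show ?thesis by (simp add: conv_def not_integrable_integral_eq)
qed

lemma nn_integral_conv_le:
 fixes K f :: "'a::euclidean_space => complex"
 assumes [measurable]: "meas K" "meas f"
 shows "(NN x. (NN y. ennreal (norm (K (x - y)) * norm (f y))))
  = (NN x. enorm (K x)) * (NN x. enorm (f x))"
proof -
 have "(NN x. (NN y. ennreal (norm (K (x - y)) * norm (f y))))
  = (NN y. (NN x. ennreal (norm (K (x - y)) * norm (f y))))" by (rule lborel_pair.Fubini') measurable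
 also have "... = (NN y. (NN x. enorm (K (x - y))) * enorm (f y))" by (intro nn_integral_cong) (simp add: ennreal_mult' nn_integral_multc)
 also have "... = (NN y. (NN x. enorm (K x)) * enorm (f y))" using nn_integral_translate[of "%x. enorm (K x)"] by simp
 finally show ?thesis by (simp add: nn_integral_cmult)
qed

lemma nice_conv:
 assumes K: "nice K" and f: "nice f"
 shows "nice (conv K f)"
proof -
 have [measurable]: "meas K" "meas f" using assms by (auto intro: nice_measurable)
 have "(NN x. enorm (conv K f x)) <= (NN x. enorm (K x)) * (NN x. enorm (f x))"
  unfolding nn_integral_conv_le[symmetric, OF \<open>meas K\<close> \<open>meas f\<close>] by (intro nn_integral_mono conv_norm_le)
 also have "... < \<infinity>" using nice_integrable[OF K] nice_integrable[OF f] by (auto simp: integrable_iff_bounded ennreal_mult_less_top)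
 finally have i: "integrable lborel (conv K f)" by (simp add: integrable_iff_bounded)
 obtain B where B: "B >= 0" "!!x. norm (K x) <= B" using nice_bound[OF K] by blast
 have "norm (conv K f x) <= B * (LI y. norm (f y))" for x
 proof -
  have "norm (conv K f x) <= (LI y. norm (K (x - y) * f y))" unfolding conv_def by (rule integral_norm_bound)
  also have "... <= (LI y. B * norm (f y))" using nice_translate_mult(1)[OF K f] nice_integrable[OF f] B
   by (intro integral_mono integrable_norm integrable_mult_right) (auto simp: norm_mult mult_right_mono)
  finally show ?thesis by simp
 qed
 then show ?thesis using i unfolding nice_def by blast
qed

lemma nice_sum: "finite J ==> (!!j. j \<in> J ==> nice (F j)) ==> nice (%x. \<Sum>j\<in>J. F j x)"
proof (induction J rule: finite_induct)
 case empty
 then show ?case by (auto simp: nice_def)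
next
 case (insert j J)
 then have 1: "nice (F j)" "nice (%x. \<Sum>j\<in>J. F j x)" by auto
 then obtain B C where "!!x. norm (F j x) <= B" "!!x. norm (\<Sum>j\<in>J. F j x) <= C" unfolding nice_def by blast
 then have "norm (F j x + (\<Sum>j\<in>J. F j x)) <= B + C" for x using norm_triangle_le by (meson add_mono)
 then show ?case using insert 1 unfolding nice_def by (auto intro!: Bochner_Integration.integrable_add)
qed

lemma nice_cmult: "nice f ==> nice (%x. c * f x)"
proof -
 assume f: "nice f"
 then obtain B where "!!x. norm (f x) <= B" unfolding nice_def by blast
 then have "norm (c * f x) <= norm c * B" for x by (simp add: norm_mult mult_left_mono)
 then show ?thesis using f unfolding nice_def by auto
qed

lemma nice_cnj: "nice f ==> nice (%x. cnj (f x))" unfolding nice_def by auto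

lemma nice_mult: "nice f ==> nice g ==> integrable lborel (%x. f x * g x)"
proof -
 assume f: "nice f" and g: "nice g"
 obtain B where "!!x. norm (g x) <= B" using nice_bound[OF g] by blast
 then show ?thesis by (rule integrable_bounded_mult(1)[OF nice_integrable[OF f] nice_measurable[OF g]])
qed

lemma nice_Lp:
 assumes f: "nice f" and p: "p >= 1"
 shows "f \<in> Lp_space p"
proof -
 have [measurable]: "meas f" by (rule nice_measurable[OF f])
 obtain B where B: "B >= 0" "!!x. norm (f x) <= B" using nice_bound[OF f] by blast
 have "integrable lborel (%x. norm (f x) powr p)"
 proof (rule Bochner_Integration.integrable_bound[OF integrable_mult_right[OF integrable_norm[OF nice_integrable[OF f]], of "B powr (p - 1)"]])
  show "AE x in lborel. norm (norm (f x) powr p) <= norm (B powr (p - 1) * norm (f x))"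
  proof (intro AE_I2)
   fix x
   have "norm (f x) powr p = norm (f x) powr (p - 1) * norm (f x)" by (cases "f x = 0") (auto simp: powr_mult_base[symmetric] mult.commute powr_diff)
   also have "... <= B powr (p - 1) * norm (f x)" using B p by (intro mult_right_mono powr_mono2) auto
   finally show "norm (norm (f x) powr p) <= norm (B powr (p - 1) * norm (f x))" by simp
  qed
 qed measurable
 then show ?thesis by (simp add: Lp_space_def)
qed

text \<open>From \<open>|f| <= e + e\<^sup>1\<^sup>-\<^sup>p |f|\<^sup>p\<close>. The value \<open>e = 1\<close> gives boundedness; small \<open>e\<close> gives decay when the kernel is
 spread out so that \<open>B\<close> is small.\<close>
lemma conv_Lp_bound:
 assumes K: "nice K" and B: "!!x. norm (K x) <= B" and f: "f \<in> Lp_space p" and p: "p >= 1" and e: "e > 0"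
 shows "(NN y. ennreal (norm (K (x - y)) * norm (f y)))
  <= ennreal (e * (LI y. norm (K y)) + B * e powr (1 - p) * Lp_norm p f powr p)"
proof -
 have [measurable]: "meas K" "meas f" using K f by (auto simp: Lp_space_iff intro: nice_measurable)
 have B0: "B >= 0" using order_trans[OF norm_ge_zero B] .
 have le: "norm (K (x - y)) * norm (f y) <= e * norm (K (x - y)) + B * e powr (1 - p) * norm (f y) powr p" for y
 proof -
  have "norm (f y) / e <= 1 + (norm (f y) / e) powr p" using e p by (intro le_one_plus_powr) auto
  also have "(norm (f y) / e) powr p = norm (f y) powr p / e powr p" using e by (simp add: powr_divide)
  finally have "norm (f y) <= e + e powr (1 - p) * norm (f y) powr p" using e by (simp add: field_simps powr_diff)
  then have "norm (K (x - y)) * norm (f y) <= norm (K (x - y)) * (e + e powr (1 - p) * norm (f y) powr p)" by (intro mult_left_mono) auto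
  also have "... = e * norm (K (x - y)) + norm (K (x - y)) * (e powr (1 - p) * norm (f y) powr p)" by (simp add: algebra_simps)
  also have "norm (K (x - y)) * (e powr (1 - p) * norm (f y) powr p) <= B * (e powr (1 - p) * norm (f y) powr p)"
   using B by (intro mult_right_mono) auto
  finally show ?thesis by (simp add: mult.assoc)
 qed
 have "(NN y. ennreal (norm (K (x - y)) * norm (f y)))
  <= (NN y. ennreal e * enorm (K (x - y)) + ennreal (B * e powr (1 - p)) * ennreal (norm (f y) powr p))"
 proof (intro nn_integral_mono)
  fix y
  have "ennreal (norm (K (x - y)) * norm (f y)) <= ennreal (e * norm (K (x - y)) + B * e powr (1 - p) * norm (f y) powr p)" by (intro ennreal_leI le)
  then show "ennreal (norm (K (x - y)) * norm (f y)) <= ennreal e * enorm (K (x - y)) + ennreal (B * e powr (1 - p)) * ennreal (norm (f y) powr p)"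
   using e B0 by (simp add: ennreal_mult' mult.assoc)
 qed
 also have "... = ennreal e * (NN y. enorm (K (x - y))) + ennreal (B * e powr (1 - p)) * pint p f"
  unfolding pint_def by (subst nn_integral_add) (auto simp: nn_integral_cmult)
 also have "(NN y. enorm (K (x - y))) = (NN y. enorm (K y))" by (rule nn_integral_reflect[of "%y. enorm (K y)"]) measurable
 also have "... = ennreal (LI y. norm (K y))" using nice_integrable[OF K] by (subst nn_integral_eq_integral) auto
 also have "pint p f = ennreal (Lp_norm p f powr p)" using f p by (intro pint_eq_Lp_norm) auto
 finally show ?thesis using e B0 by (simp add: ennreal_mult' integral_nonneg_AE)
qed

lemma conv_Lp_bounded:
 assumes K: "nice K" and f: "f \<in> Lp_space p" and p: "p >= 1"
 shows "\<exists>M\<ge>0. \<forall>x. (NN y. ennreal (norm (K (x - y)) * norm (f y))) <= ennreal M & norm (conv K f x) <= M"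
proof -
 obtain B where B: "!!x. norm (K x) <= B" "B >= 0" using nice_bound[OF K] by blast
 define M where "M = 1 * (LI y. norm (K y)) + B * 1 powr (1 - p) * Lp_norm p f powr p"
 have M0: "M >= 0" unfolding M_def using B(2) by (intro add_nonneg_nonneg mult_nonneg_nonneg integral_nonneg_AE) auto
 have b: "(NN y. ennreal (norm (K (x - y)) * norm (f y))) <= ennreal M" for x unfolding M_def by (rule conv_Lp_bound[OF K B(1) f p]) simp
 have "enorm (conv K f x) <= ennreal M" for x using conv_norm_le b by (rule order_trans)
 then show ?thesis using b M0 by (auto simp: ennreal_le_iff)
qed

lemma Lp_conv_integrable:
 assumes K: "nice K" and f: "f \<in> Lp_space p" and p: "p >= 1"
 shows "integrable lborel (%y. K (x - y) * f y)"
proof (rule integrableI_bounded)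
 have [measurable]: "meas f" "meas K" using K f by (auto simp: Lp_space_iff intro: nice_measurable)
 show "(%y. K (x - y) * f y) \<in> borel_measurable lborel" by measurable
 show "(NN y. enorm (K (x - y) * f y)) < \<infinity>"
  using conv_Lp_bounded[OF K f p] by (auto simp: norm_mult intro: le_less_trans)
qed

text \<open>Fubini's theorem, where \<open>conv_Lp_bounded\<close> makes the double integral absolutely convergent.\<close>
lemma conv_adjoint_Lp:
 assumes K: "nice K" and f: "f \<in> Lp_space p" "p >= 1" and g: "integrable lborel g"
 shows "(LI x. conv K f x * g x) = (LI y. f y * (LI x. K (x - y) * g x))"
proof -
 have [measurable]: "meas K" "meas f" "meas g" using assms by (auto intro: nice_measurable simp: Lp_space_iff)
 obtain M where M: "M >= 0" "!!x. (NN y. ennreal (norm (K (x - y)) * norm (f y))) <= ennreal M" using conv_Lp_bounded[OF K f] by blast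
 define H where "H x y = K (x - y) * f y * g x" for x y
 have Hm[measurable]: "(%(x, y). H x y) \<in> borel_measurable (lborel \<Otimes>\<^sub>M lborel)" unfolding H_def by measurable
 have "(\<integral>\<^sup>+z. enorm ((%(x, y). H x y) z) \<partial>(lborel \<Otimes>\<^sub>M lborel)) = (NN x. (NN y. enorm (H x y)))"
  by (subst lborel.nn_integral_fst[symmetric]) (auto simp: case_prod_beta)
 also have "... <= (NN x. ennreal M * enorm (g x))"
 proof (intro nn_integral_mono)
  fix x
  have "(NN y. enorm (H x y)) = (NN y. ennreal (norm (K (x - y)) * norm (f y)) * enorm (g x))" by (simp add: H_def norm_mult ennreal_mult')
  also have "... = (NN y. ennreal (norm (K (x - y)) * norm (f y))) * enorm (g x)" by (rule nn_integral_multc) measurable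
  also have "... <= ennreal M * enorm (g x)" by (intro mult_right_mono M) auto
  finally show "(NN y. enorm (H x y)) <= ennreal M * enorm (g x)" .
 qed
 also have "... = ennreal M * (NN x. enorm (g x))" by (rule nn_integral_cmult) measurable
 also have "... < \<infinity>" using g by (auto simp: integrable_iff_bounded ennreal_mult_less_top)
 finally have "integrable (lborel \<Otimes>\<^sub>M lborel) (%(x, y). H x y)" by (intro integrableI_bounded Hm)
 from lborel_pair.Fubini_integral[OF this]
 have "(LI x. LINT y|lborel. H x y) = (LI y. LINT x|lborel. H x y)" by (simp add: case_prod_beta)
 moreover have "(LI y. H x y) = conv K f x * g x" for x by (simp add: H_def conv_def)
 moreover have "(LI x. H x y) = f y * (LI x. K (x - y) * g x)" for y
 proof -
  have "H x y = f y * (K (x - y) * g x)" for x by (simp add: H_def ac_simps)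
  then show ?thesis by simp
 qed
 ultimately show ?thesis by simp
qed

lemma conv_adjoint:
 assumes K: "nice K" and f: "nice f" and g: "nice g"
 shows "(LI x. conv K f x * g x) = (LI y. f y * (LI x. K (x - y) * g x))"
 by (rule conv_adjoint_Lp[OF K nice_Lp[OF f order_refl] order_refl nice_integrable[OF g]])

section \<open>Mean square bounds by orthogonality\<close>

definition ip :: "('a::euclidean_space => complex) => ('a => complex) => complex" where
 "ip f g = (LI x. f x * cnj (g x))"

definition nsq :: "('a::euclidean_space => complex) => real" where
 "nsq f = (LI x. (norm (f x))\<^sup>2)"

lemma nice_ip: "nice f ==> nice g ==> integrable lborel (%x. f x * cnj (g x))" by (intro nice_mult nice_cnj)

lemma nice_sq: "nice f ==> integrable lborel (%x. (norm (f x))\<^sup>2)"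
proof -
 assume "nice f"
 from integrable_norm[OF nice_ip[OF this this]] show ?thesis by (simp add: norm_mult power2_eq_square)
qed

lemma ip_self: "nice f ==> ip f f = cx (nsq f)" unfolding ip_def nsq_def integral_complex_of_real[symmetric] complex_norm_square ..

lemma nsq_nonneg: "nsq f >= 0" unfolding nsq_def by (intro integral_nonneg_AE) auto

lemma nsq_eq_nn_integral: "nice f ==> (NN x. ennreal ((norm (f x))^2)) = ennreal (nsq f)"
 unfolding nsq_def by (intro nn_integral_eq_integral nice_sq) auto

lemma nsq_add_le: "nice f ==> nice g ==> nsq (%x. f x + g x) <= 2 * (nsq f + nsq g)"
proof -
 assume f: "nice f" and g: "nice g"
 have "nsq (%x. f x + g x) <= (LI x. 2 * ((norm (f x))^2 + (norm (g x))^2))" unfolding nsq_def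
 proof (intro integral_mono)
  show "integrable lborel (%x. (norm (f x + g x))\<^sup>2)" using nice_sq[OF nice_sum[of "{True, False}" "%b. if b then f else g"]] f g by simp
  show "integrable lborel (%x. 2 * ((norm (f x))^2 + (norm (g x))^2))" using nice_sq[OF f] nice_sq[OF g] by auto
  fix x
  have "(norm (f x + g x))^2 <= (norm (f x) + norm (g x))^2" by (intro power_mono norm_triangle_ineq) auto
  also have "... <= 2 * ((norm (f x))^2 + (norm (g x))^2)" using sum_squares_bound[of "norm (f x)" "norm (g x)"] by (simp add: power2_sum)
  finally show "(norm (f x + g x))^2 <= 2 * ((norm (f x))^2 + (norm (g x))^2)" .
 qed
 also have "... = 2 * (nsq f + nsq g)" using nice_sq[OF f] nice_sq[OF g] by (simp add: nsq_def)
 finally show ?thesis .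
qed

lemma ip_le: "nice f ==> nice g ==> c > 0 ==> 2 * Re (ip f g) <= c * nsq f + nsq g / c"
proof -
 assume f: "nice f" and g: "nice g" and c: "c > 0"
 have "2 * Re (ip f g) = (LI x. 2 * Re (f x * cnj (g x)))" unfolding ip_def by (simp only: integral_mult_right_zero integral_Re[OF nice_ip[OF f g]])
 also have "... <= (LI x. c * (norm (f x))^2 + (norm (g x))^2 / c)"
 proof (intro integral_mono)
  show "integrable lborel (%x. 2 * Re (f x * cnj (g x)))" by (rule integrable_mult_right[OF integrable_Re[OF nice_ip[OF f g]]])
  show "integrable lborel (%x. c * (norm (f x))^2 + (norm (g x))^2 / c)" using nice_sq[OF f] nice_sq[OF g] by auto
  fix x
  have "2 * Re (f x * cnj (g x)) <= 2 * (norm (f x) * norm (g x))" using complex_Re_le_cmod[of "f x * cnj (g x)"] by (simp add: norm_mult)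
  also have "... = 2 * (sqrt c * norm (f x)) * (norm (g x) / sqrt c)" using c by simp
  also have "... <= (sqrt c * norm (f x))^2 + (norm (g x) / sqrt c)^2" by (rule sum_squares_bound)
  also have "... = c * (norm (f x))^2 + (norm (g x))^2 / c" using c by (simp add: power_mult_distrib power_divide)
  finally show "2 * Re (f x * cnj (g x)) <= c * (norm (f x))^2 + (norm (g x))^2 / c" .
 qed
 also have "... = c * nsq f + nsq g / c" using nice_sq[OF f] nice_sq[OF g] by (simp add: nsq_def)
 finally show ?thesis .
qed

lemma ip_sum_right:
 assumes "finite J" "nice f" "!!j. j \<in> J ==> nice (F j)"
 shows "ip f (%x. \<Sum>j\<in>J. F j x) = (\<Sum>j\<in>J. ip f (F j))" unfolding ip_def using assms by (simp add: sum_distrib_left nice_ip)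

lemma pythagoras:
 assumes "finite J" "!!j. j \<in> J ==> nice (F j)" "!!i j. i \<in> J ==> j \<in> J ==> i ~= j ==> ip (F i) (F j) = 0"
 shows "nsq (%x. \<Sum>j\<in>J. F j x) = (\<Sum>j\<in>J. nsq (F j))"
proof -
 let ?S = "%x. \<Sum>j\<in>J. F j x"
 have S: "nice ?S" using assms by (intro nice_sum) auto
 have "ip ?S ?S = (\<Sum>i\<in>J. ip (F i) ?S)" unfolding ip_def using nice_ip[OF assms(2) S] assms(1) by (simp add: sum_distrib_right)
 also have "... = (\<Sum>i\<in>J. \<Sum>j\<in>J. ip (F i) (F j))" using assms by (intro sum.cong refl ip_sum_right) auto
 also have "... = (\<Sum>i\<in>J. \<Sum>j\<in>J. if j = i then ip (F i) (F i) else 0)" using assms by (intro sum.cong refl) auto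
 also have "... = (\<Sum>i\<in>J. ip (F i) (F i))" using assms(1) by simp
 also have "... = cx (\<Sum>i\<in>J. nsq (F i))" using assms by (simp add: ip_self)
 finally show ?thesis using ip_self[OF S] by (simp only: of_real_eq_iff)
qed

text \<open>Pieces with even index are mutually orthogonal, and so are those with odd index.\<close>
lemma almost_orthogonal:
 assumes "finite J" "!!j. j \<in> J ==> nice (F j)" "!!i j. i \<in> J ==> j \<in> J ==> \<bar>i - j\<bar> >= (2::int) ==> ip (F i) (F j) = 0"
 shows "nsq (%x. \<Sum>j\<in>J. F j x) <= 2 * (\<Sum>j\<in>J. nsq (F j))"
proof -
 let ?E = "{j\<in>J. even j}" and ?O = "{j\<in>J. odd j}"
 have J: "?E \<union> ?O = J" "?E \<inter> ?O = {}" by auto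
 have p: "nsq (%x. \<Sum>j\<in>?E. F j x) = (\<Sum>j\<in>?E. nsq (F j))" "nsq (%x. \<Sum>j\<in>?O. F j x) = (\<Sum>j\<in>?O. nsq (F j))"
 proof -
  have "\<bar>i - j\<bar> >= 2" if "i ~= j" "even i = even j" for i j :: int using that by presburger
  then show "nsq (%x. \<Sum>j\<in>?E. F j x) = (\<Sum>j\<in>?E. nsq (F j))" "nsq (%x. \<Sum>j\<in>?O. F j x) = (\<Sum>j\<in>?O. nsq (F j))"
   using assms by (auto intro!: pythagoras)
 qed
 have "(\<Sum>j\<in>J. F j x) = (\<Sum>j\<in>?E. F j x) + (\<Sum>j\<in>?O. F j x)" for x
  using assms(1) J by (subst J(1)[symmetric], intro sum.union_disjoint) auto
 then have "nsq (%x. \<Sum>j\<in>J. F j x) <= 2 * (nsq (%x. \<Sum>j\<in>?E. F j x) + nsq (%x. \<Sum>j\<in>?O. F j x))"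
  using nsq_add_le[OF nice_sum nice_sum, of ?E F ?O F] assms by simp
 also have "... = 2 * (\<Sum>j\<in>J. nsq (F j))" unfolding p using assms(1) J by (subst sum.union_disjoint[symmetric]) auto
 finally show ?thesis .
qed

text \<open>Schur's test: the Cauchy--Schwarz inequality with \<open>|K|\<close> as weight.\<close>
lemma nsq_conv_le:
 assumes K: "nice K" and f: "nice f"
 shows "nsq (conv K f) <= (LI x. norm (K x))^2 * nsq f"
proof -
 have [measurable]: "meas K" "meas f" using assms by (auto intro: nice_measurable)
 define M where "M = (LI x. norm (K x))"
 have M0: "M >= 0" unfolding M_def by (intro integral_nonneg_AE) auto
 have fsq: "nice (%x. cx ((norm (f x))^2))" unfolding nice_def
 proof
  show "integrable lborel (%x. cx ((norm (f x))^2))" by (intro integrable_of_real nice_sq f)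
  obtain B where "!!x. norm (f x) <= B" using nice_bound[OF f] by blast
  then have "(norm (f x))^2 <= B\<^sup>2" for x by (intro power_mono) auto
  then show "\<exists>B. \<forall>x. norm (cx ((norm (f x))^2)) <= B" by (auto simp: norm_power)
 qed
 have pw: "(norm (conv K f x))^2 <= M * (LI y. norm (K (x - y)) * (norm (f y))^2)" for x
 proof -
  have i1: "integrable lborel (%y. norm (K (x - y)))" using nice_integrable[OF K] integrable_reflect[of K x] by auto
  have I1: "(LI y. norm (K (x - y))) = M" unfolding M_def by (rule integral_reflect)
  have i2: "integrable lborel (%y. norm (K (x - y)) * (norm (f y))^2)"
   using integrable_norm[OF nice_translate_mult(1)[OF K fsq, of x]] by (simp add: norm_mult norm_power)
  have i3: "integrable lborel (%y. norm (K (x - y)) * norm (f y))"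
   using integrable_norm[OF nice_translate_mult(1)[OF K f, of x]] by (simp add: norm_mult)
  define a where "a = (LI y. norm (K (x - y)) * norm (f y))"
  define q where "q = (LI y. norm (K (x - y)) * (norm (f y))^2)"
  have "norm (conv K f x) <= a" unfolding conv_def a_def by (rule order_trans[OF integral_norm_bound]) (simp add: norm_mult)
  moreover have "a\<^sup>2 <= M * q"
  proof -
   have "0 <= (LI y. norm (K (x - y)) * (M * norm (f y) - a)^2)" by (intro integral_nonneg_AE) auto
   also have "... = (LI y. M\<^sup>2 * (norm (K (x - y)) * (norm (f y))^2) - (2 * M * a) * (norm (K (x - y)) * norm (f y)) + a\<^sup>2 * norm (K (x - y)))"
    by (intro Bochner_Integration.integral_cong refl) (simp add: power2_eq_square algebra_simps)
   also have "... = M\<^sup>2 * q - (2 * M * a) * a + a\<^sup>2 * M" using i1 i2 i3 by (simp add: I1 a_def q_def)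
   finally have "M * a\<^sup>2 <= M * (M * q)" by (simp add: power2_eq_square algebra_simps)
   then show ?thesis
   proof (cases "M = 0")
    case True
    have "AE y in lborel. norm (K (x - y)) = 0" using i1 I1 True by (subst integral_nonneg_eq_0_iff_AE[symmetric]) auto
    then have "a = 0" unfolding a_def by (intro integral_eq_zero_AE) (auto elim: eventually_mono)
    then show ?thesis using True by simp
   qed (use M0 in simp)
  qed
  ultimately show ?thesis unfolding q_def[symmetric] by (meson norm_ge_zero order_trans power_mono)
 qed
 let ?q = "conv (%x. cx (norm (K x))) (%x. cx ((norm (f x))^2))"
 have Kn: "nice (%x. cx (norm (K x)))" using K unfolding nice_def by auto
 have q: "?q x = cx (LI y. norm (K (x - y)) * (norm (f y))^2)" for x unfolding conv_def by (simp flip: of_real_mult of_real_power)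
 have "integrable lborel ?q" using nice_conv[OF Kn fsq] by (rule nice_integrable)
 then have iq: "integrable lborel (%x. LINT y|lborel. norm (K (x - y)) * (norm (f y))^2)" unfolding q complex_of_real_integrable_eq .
 have "nsq (conv K f) <= (LI x. M * (LI y. norm (K (x - y)) * (norm (f y))^2))"
  unfolding nsq_def using pw iq nice_sq[OF nice_conv[OF K f]] by (intro integral_mono) auto
 also have "... = M * (LI x. LINT y|lborel. norm (K (x - y)) * (norm (f y))^2)" by simp
 also have "(LI x. LINT y|lborel. norm (K (x - y)) * (norm (f y))^2) = M * nsq f"
 proof -
  have "ennreal (LI x. LINT y|lborel. norm (K (x - y)) * (norm (f y))^2)
    = (NN x. ennreal (LI y. norm (K (x - y)) * (norm (f y))^2))" by (rule nn_integral_eq_integral[symmetric, OF iq]) (auto intro!: integral_nonneg_AE)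
  also have "... = (NN x. (NN y. ennreal (norm (K (x - y)) * norm (cx ((norm (f y))^2)))))"
  proof (intro nn_integral_cong)
   fix x
   have "integrable lborel (%y. norm (K (x - y)) * (norm (f y))^2)"
    using integrable_norm[OF nice_translate_mult(1)[OF K fsq, of x]] by (simp add: norm_mult norm_power)
   then show "ennreal (LI y. norm (K (x - y)) * (norm (f y))^2) = (NN y. ennreal (norm (K (x - y)) * norm (cx ((norm (f y))^2))))"
    by (subst nn_integral_eq_integral) (auto simp: norm_power)
  qed
  also have "... = (NN x. enorm (K x)) * (NN x. enorm (cx ((norm (f x))^2)))" by (rule nn_integral_conv_le) measurable
  also have "(NN x. enorm (K x)) = ennreal M" unfolding M_def by (rule nn_integral_eq_integral[OF integrable_norm[OF nice_integrable[OF K]]]) auto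
  also have "(NN x. enorm (cx ((norm (f x))^2))) = ennreal (nsq f)" using nsq_eq_nn_integral[OF f] by (simp add: norm_power)
  finally show ?thesis using M0 nsq_nonneg[of f] by (simp add: ennreal_mult'[symmetric] integral_nonneg_AE)
 qed
 finally show ?thesis by (simp add: M_def power2_eq_square mult.assoc)
qed

text \<open>Functions with disjoint frequency supports are orthogonal; for pieces living on dyadic annuli
 this gives both the bound for the sum of the pieces and, by duality, the bound for the sum of their
 squared norms.\<close>

lemma ip_conv_zero:
 fixes f g :: "'a::euclidean_space => complex"
 assumes A: "A \<in> schwartz" and B: "B \<in> schwartz" and z: "!!\<xi>. A \<xi> * cnj (B \<xi>) = 0" and f: "nice f" and g: "nice g"
 shows "ip (conv (%x. ft A (x - u)) f) (conv (%x. ft B (x - v)) g) = 0"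
proof -
 have n: "nice (%x. ft C (x - w))" if "C \<in> schwartz" for C and w :: 'a
  using schwartz_nice[OF ft_schwartz[OF that]] integrable_translate[of "ft C" w] unfolding nice_def by blast
 have "ip (conv (%x. ft A (x - u)) f) (conv (%x. ft B (x - v)) g)
   = (LI y. f y * (LI x. ft A (x - y - u) * cnj (conv (%x. ft B (x - v)) g x)))"
  unfolding ip_def by (rule conv_adjoint[OF n[OF A] f nice_cnj[OF nice_conv[OF n[OF B] g]]])
 also have "... = 0"
 proof -
  have "(LI x. ft A (x - y - u) * cnj (conv (%x. ft B (x - v)) g x)) = 0" for y
  proof -
  have nA: "nice (%x. cnj (ft A (x - y - u)))" using nice_cnj[OF n[OF A, of "y + u"]] by (simp add: diff_diff_eq)
  have "(LI x. ft A (x - y - u) * cnj (conv (%x. ft B (x - v)) g x))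
   = cnj (LI x. conv (%x. ft B (x - v)) g x * cnj (ft A (x - y - u)))" by (subst Bochner_Integration.integral_cnj[symmetric]) (simp add: mult.commute)
  also have "(LI x. conv (%x. ft B (x - v)) g x * cnj (ft A (x - y - u)))
   = (LI w. g w * (LI x. ft B (x - w - v) * cnj (ft A (x - y - u))))" by (rule conv_adjoint[OF n[OF B] g nA])
  also have "... = (LI w. g w * (LI x. ft B (x - (w + v)) * cnj (ft A (x - (y + u)))))" by (simp add: diff_diff_eq)
  also have "... = 0"
  proof -
   have "B \<xi> * cnj (A \<xi>) = 0" for \<xi> using z[of \<xi>] by auto
   from bilinear_orthogonality[OF B A this] show ?thesis by simp
  qed
  finally show ?thesis by simp
  qed
  then show ?thesis by simp
 qed
 finally show ?thesis .
qed

lemma ft_cnj: "cnj (ft A (- x)) = ft (%\<xi>. cnj (A \<xi>)) x"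
 unfolding ft_def by (subst Bochner_Integration.integral_cnj[symmetric]) (simp add: exp_cnj)

lemma schwartz_cnj: "A \<in> schwartz ==> (%x. cnj (A x)) \<in> schwartz"
proof -
 have d: "((%x. cnj (f x)) has_derivative (%v. cnj (pd v f x))) (at x)" if "\<forall>x. f differentiable (at x)" for f :: "'a => complex" and x
  using bounded_linear.has_derivative[OF bounded_linear_cnj differentiable_imp_has_pd[OF that]] .
 have "Sn n f ==> Sn n (%x. cnj (f x))" for n and f :: "'a => complex"
 proof (induction n arbitrary: f)
  case 0
  then show ?case using d[of f] by (auto simp: differentiable_def rapid_def)
 next
  case (Suc n)
  have "pd b (%x. cnj (f x)) = (%x. cnj (pd b f x))" for b by (rule ext, rule pd_eqI, rule d) (use Suc.prems in auto)
  then show ?case using Suc d[of f] by (auto simp: differentiable_def rapid_def)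
 qed
 then show "A \<in> schwartz ==> (%x. cnj (A x)) \<in> schwartz" by (simp add: schwartz_iff_Sn)
qed

text \<open>The left side \<open>V\<close> equals the pairing of \<open>f\<close> with the sum \<open>S\<close> of the functions \<open>T\<^sub>j\<^sup>*T\<^sub>jf\<close>. Almost orthogonality bounds
 the squared norm of \<open>S\<close> by \<open>2M\<^sup>2V\<close>, and the resulting inequality can be solved for \<open>V\<close>.\<close>
lemma sum_nsq_conv_le:
 fixes A :: "int => 'a::euclidean_space => complex"
 assumes J: "finite J" and A: "!!j. A j \<in> schwartz"
  and z: "!!i j \<xi>. \<bar>i - j\<bar> >= 2 ==> A i \<xi> * cnj (A j \<xi>) = 0"
  and M: "!!j. (LI x. norm (ft (A j) x)) <= M" "M > 0" and f: "nice f"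
 shows "(\<Sum>j\<in>J. nsq (conv (%x. ft (A j) (x - u j)) f)) <= 2 * M\<^sup>2 * nsq f"
proof -
 have n: "nice (%x. ft C (x - w))" if "C \<in> schwartz" for C and w :: 'a
  using schwartz_nice[OF ft_schwartz[OF that]] integrable_translate[of "ft C" w] unfolding nice_def by blast
 define T where "T j = conv (%x. ft (A j) (x - u j)) f" for j
 have T: "nice (T j)" for j unfolding T_def by (intro nice_conv n A f)
 define S where "S j = conv (%x. ft (%\<xi>. cnj (A j \<xi>)) (x - (- u j))) (T j)" for j
 have S: "nice (S j)" for j unfolding S_def by (intro nice_conv n schwartz_cnj A T)
 define V where "V = (\<Sum>j\<in>J. nsq (T j))"
 have V0: "V >= 0" unfolding V_def by (intro sum_nonneg nsq_nonneg)
 have TS: "cx (nsq (T j)) = ip f (S j)" for j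
 proof -
  have "cx (nsq (T j)) = (LI x. conv (%x. ft (A j) (x - u j)) f x * cnj (T j x))" using ip_self[OF T[of j]] by (simp add: ip_def T_def)
  also have "... = (LI y. f y * (LI x. ft (A j) (x - y - u j) * cnj (T j x)))" by (rule conv_adjoint[OF n[OF A] f nice_cnj[OF T]])
  also have "... = (LI y. f y * cnj (S j y))"
  proof -
   have "(LI x. ft (A j) (x - y - u j) * cnj (T j x)) = cnj (S j y)" for y unfolding S_def conv_def
    by (subst Bochner_Integration.integral_cnj[symmetric], intro Bochner_Integration.integral_cong refl)
      (simp add: ft_cnj[symmetric] algebra_simps)
   then show ?thesis by simp
  qed
  finally show ?thesis by (simp add: ip_def)
 qed
 have nS: "nice (%x. \<Sum>j\<in>J. S j x)" using J S by (intro nice_sum)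
 have "nsq (%x. \<Sum>j\<in>J. S j x) <= 2 * (\<Sum>j\<in>J. nsq (S j))"
 proof (rule almost_orthogonal[OF J S])
  fix i j :: int assume "\<bar>i - j\<bar> >= 2"
  from z[OF this] show "ip (S i) (S j) = 0"
   unfolding S_def by (intro ip_conv_zero schwartz_cnj A T) (metis complex_cnj_cnj complex_cnj_mult complex_cnj_zero)
 qed
 also have "... <= 2 * (\<Sum>j\<in>J. M\<^sup>2 * nsq (T j))"
 proof (intro mult_left_mono sum_mono)
  fix j
  have "(LI x. norm (ft (%\<xi>. cnj (A j \<xi>)) (x - (- u j)))) = (LI x. norm (ft (%\<xi>. cnj (A j \<xi>)) x))" by (rule integral_translate)
  also have "... = (LI x. norm (ft (A j) (0 - x)))" by (simp add: ft_cnj[symmetric])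
  also have "... = (LI x. norm (ft (A j) x))" by (rule integral_reflect)
  finally have "(LI x. norm (ft (%\<xi>. cnj (A j \<xi>)) (x - (- u j)))) <= M" using M(1)[of j] by simp
  moreover have "0 <= (LI x. norm (ft (%\<xi>. cnj (A j \<xi>)) (x - (- u j))))" by (intro integral_nonneg_AE) auto
  ultimately have "(LI x. norm (ft (%\<xi>. cnj (A j \<xi>)) (x - (- u j))))^2 * nsq (T j) <= M\<^sup>2 * nsq (T j)"
   by (intro mult_right_mono power_mono nsq_nonneg) auto
  with nsq_conv_le[OF n[OF schwartz_cnj[OF A]] T, of j "- u j" j] show "nsq (S j) <= M\<^sup>2 * nsq (T j)" unfolding S_def by linarith
 qed simp
 also have "... = 2 * M\<^sup>2 * V" by (simp add: V_def sum_distrib_left mult.assoc)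
 finally have SV: "nsq (%x. \<Sum>j\<in>J. S j x) <= 2 * M\<^sup>2 * V" .
 have "cx V = ip f (%x. \<Sum>j\<in>J. S j x)" unfolding V_def by (subst ip_sum_right[OF J f S]) (simp add: TS[symmetric])
 then have "V = Re (ip f (%x. \<Sum>j\<in>J. S j x))" by (metis Re_complex_of_real)
 then have "2 * V <= (2 * M\<^sup>2) * nsq f + nsq (%x. \<Sum>j\<in>J. S j x) / (2 * M\<^sup>2)" using ip_le[OF f nS, of "2 * M\<^sup>2"] M by simp
 also have "... <= (2 * M\<^sup>2) * nsq f + (2 * M\<^sup>2 * V) / (2 * M\<^sup>2)" using SV by (intro add_left_mono divide_right_mono) auto
 also have "... = (2 * M\<^sup>2) * nsq f + V" using M by simp
 finally show ?thesis by (simp add: V_def T_def)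
qed

section \<open>Dyadic cubes\<close>

text \<open>The half-open dyadic cube of side \<open>2^(-n)\<close> containing \<open>x\<close> is encoded by its corner: the cubes of
 generation \<open>n\<close> are the fibres of \<open>corner n\<close>.\<close>

definition corner :: "int => 'a::euclidean_space => 'a" where
 "corner n x = (\<Sum>b\<in>Basis. (real_of_int \<lfloor>2 powi n * (x \<bullet> b)\<rfloor> / 2 powi n) *\<^sub>R b)"

definition cube :: "int => 'a::euclidean_space => 'a set" where
 "cube n x = {y. corner n y = corner n x}"

lemma corner_inner: "b \<in> Basis ==> corner n x \<bullet> b = real_of_int \<lfloor>2 powi n * (x \<bullet> b)\<rfloor> / 2 powi n"
 unfolding corner_def by (rule inner_sum_left_Basis)

lemma corner_eq_iff: "corner n x = corner n y \<longleftrightarrow> (\<forall>b\<in>Basis. \<lfloor>2 powi n * (x \<bullet> b)\<rfloor> = \<lfloor>2 powi n * (y \<bullet> b)\<rfloor>)"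
proof
 assume eq: "corner n x = corner n y"
 show "\<forall>b\<in>Basis. \<lfloor>2 powi n * (x \<bullet> b)\<rfloor> = \<lfloor>2 powi n * (y \<bullet> b)\<rfloor>"
 proof
  fix b :: 'a assume b: "b \<in> Basis"
  have "corner n x \<bullet> b = corner n y \<bullet> b" by (simp only: eq)
  then show "\<lfloor>2 powi n * (x \<bullet> b)\<rfloor> = \<lfloor>2 powi n * (y \<bullet> b)\<rfloor>" using b by (simp add: corner_inner)
 qed
next
 assume "\<forall>b\<in>Basis. \<lfloor>2 powi n * (x \<bullet> b)\<rfloor> = \<lfloor>2 powi n * (y \<bullet> b)\<rfloor>"
 then show "corner n x = corner n y" unfolding corner_def by (intro sum.cong) auto
qed

lemma corner_measurable [measurable]: "meas (corner n)" unfolding corner_def by measurable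

lemma corner_nested:
 assumes "corner n x = corner n y" "m <= n"
 shows "corner m x = corner m y" unfolding corner_eq_iff
proof
 fix b :: 'a assume b: "b \<in> Basis"
 define k where "k = nat (n - m)"
 have e: "2 powi m * t = (2 powi n * t) / real_of_int (2 ^ k)" for t :: real
 proof -
  have "n = m + int k" using assms(2) by (simp add: k_def)
  then have "(2::real) powi n = 2 powi m * 2 ^ k" by (simp add: power_int_add power_int_of_nat)
  then show ?thesis by simp
 qed
 have "\<lfloor>2 powi m * t\<rfloor> = \<lfloor>2 powi n * t\<rfloor> div 2 ^ k" for t :: real unfolding e by (rule floor_divide_real_eq_div) simp
 then show "\<lfloor>2 powi m * (x \<bullet> b)\<rfloor> = \<lfloor>2 powi m * (y \<bullet> b)\<rfloor>"
  using assms(1) b unfolding corner_eq_iff by simp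
qed

lemma norm_corner_le: "norm (x - corner n x) <= real DIM('a) / 2 powi n" for x :: "'a::euclidean_space"
proof -
 have "norm (x - corner n x) <= (\<Sum>b\<in>Basis. \<bar>(x - corner n x) \<bullet> b\<bar>)" by (rule norm_le_l1)
 also have "... <= (\<Sum>b\<in>(Basis::'a set). 1 / 2 powi n)"
 proof (intro sum_mono)
  fix b :: 'a assume b: "b \<in> Basis"
  have "(x - corner n x) \<bullet> b = (2 powi n * (x \<bullet> b) - real_of_int \<lfloor>2 powi n * (x \<bullet> b)\<rfloor>) / 2 powi n"
   using b by (simp add: inner_diff_left corner_inner diff_divide_distrib)
  moreover have "0 <= 2 powi n * (x \<bullet> b) - real_of_int \<lfloor>2 powi n * (x \<bullet> b)\<rfloor>" "2 powi n * (x \<bullet> b) - real_of_int \<lfloor>2 powi n * (x \<bullet> b)\<rfloor> <= 1"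
   by linarith+
  ultimately show "\<bar>(x - corner n x) \<bullet> b\<bar> <= 1 / 2 powi n" by (simp add: divide_right_mono)
 qed
 finally show ?thesis by simp
qed

lemma cube_measurable [measurable]: "cube n x \<in> sets borel"
proof -
 have "corner n -` {corner n x} \<inter> space borel \<in> sets borel" by (rule measurable_sets[OF corner_measurable]) simp
 then show ?thesis by (simp add: cube_def vimage_def)
qed

lemma emeasure_cube: "emeasure lborel (cube n x) = ennreal (1 / (2 powi n) ^ DIM('a))" for x :: "'a::euclidean_space"
proof -
 define h where "h = 1 / (2::real) powi n"
 have h: "h > 0" "2 powi n * h = 1" by (auto simp: h_def)
 define c where "c = corner n x"
 have cb: "c \<bullet> b = real_of_int \<lfloor>2 powi n * (x \<bullet> b)\<rfloor> * h" if "b \<in> Basis" for b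
  using that by (simp add: c_def corner_inner h_def)
 have in_cube: "y \<in> cube n x \<longleftrightarrow> (\<forall>b\<in>Basis. c \<bullet> b <= y \<bullet> b & y \<bullet> b < c \<bullet> b + h)" for y
 proof -
  have "\<lfloor>2 powi n * (y \<bullet> b)\<rfloor> = \<lfloor>2 powi n * (x \<bullet> b)\<rfloor> \<longleftrightarrow> c \<bullet> b <= y \<bullet> b & y \<bullet> b < c \<bullet> b + h" if b: "b \<in> Basis" for b
  proof -
   have "\<lfloor>2 powi n * (y \<bullet> b)\<rfloor> = \<lfloor>2 powi n * (x \<bullet> b)\<rfloor> \<longleftrightarrow>
    real_of_int \<lfloor>2 powi n * (x \<bullet> b)\<rfloor> <= 2 powi n * (y \<bullet> b) & 2 powi n * (y \<bullet> b) < real_of_int \<lfloor>2 powi n * (x \<bullet> b)\<rfloor> + 1"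
    by (rule floor_eq_iff)
   also have "... \<longleftrightarrow> c \<bullet> b <= y \<bullet> b & y \<bullet> b < c \<bullet> b + h"
    unfolding cb[OF b] h_def by (simp add: field_simps)
   finally show ?thesis .
  qed
  then show ?thesis unfolding cube_def mem_Collect_eq corner_eq_iff by blast
 qed
 have vol: "(\<Prod>b\<in>Basis. ((c + h *\<^sub>R One) - c) \<bullet> b) = h ^ DIM('a)" by simp
 have "emeasure lborel (cube n x) <= emeasure lborel (cbox c (c + h *\<^sub>R One))"
  by (intro emeasure_mono subsetI) (simp_all add: in_cube mem_box inner_add_left less_imp_le)
 also have "... = ennreal (h ^ DIM('a))" using h by (subst emeasure_lborel_cbox) (auto simp: inner_add_left)
 finally have 1: "emeasure lborel (cube n x) <= ennreal (h ^ DIM('a))" .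
 have "ennreal (h ^ DIM('a)) = emeasure lborel (box c (c + h *\<^sub>R One))" using h by (subst emeasure_lborel_box) (auto simp: inner_add_left)
 also have "... <= emeasure lborel (cube n x)" by (intro emeasure_mono subsetI) (simp_all add: in_cube mem_box inner_add_left less_imp_le)
 finally show ?thesis using 1 by (simp add: h_def power_divide)
qed

lemma cube_subset_ball:
 fixes x :: "'a::euclidean_space"
 assumes "y \<in> cube n x" "norm (z - corner n x) < 2 * real DIM('a) / 2 powi n"
 shows "y \<in> ball z (3 * real DIM('a) / 2 powi n)"
proof -
 have "norm (y - corner n x) <= real DIM('a) / 2 powi n" using norm_corner_le[of y n] assms(1) by (simp add: cube_def)
 moreover have "dist z y <= norm (z - corner n x) + norm (y - corner n x)"
  using norm_triangle_ineq4[of "z - corner n x" "y - corner n x"] by (simp add: dist_norm)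
 ultimately have "dist z y < 2 * real DIM('a) / 2 powi n + real DIM('a) / 2 powi n" using assms(2) by linarith
 also have "... = 3 * real DIM('a) / 2 powi n" by (simp add: add_divide_distrib[symmetric])
 finally show ?thesis by simp
qed

definition cavg :: "('a::euclidean_space => complex) => int => 'a => ennreal" where
 "cavg f n x = ennreal ((2 powi n) ^ DIM('a)) * (NN y. enorm (f y) * indicator (cube n x) y)"

text \<open>The constant makes this dominate the averages over all cubes whose corner is near the point
 (\<open>cavg_le_of_near\<close>), not only over the cubes that contain it.\<close>
definition dmf :: "('a::euclidean_space => complex) => 'a => real" where
 "dmf f x = (3 * real DIM('a)) ^ DIM('a) * mf f x"

lemma dmf_nonneg: "dmf f x >= 0" by (simp add: dmf_def mf_nonneg)

lemma dmf_measurable [measurable]: "meas (dmf f)" unfolding dmf_def by measurable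

lemma maxf_finite_bounded:
 fixes f :: "'a::euclidean_space => complex"
 assumes "!!x. norm (f x) <= B"
 shows "maxf f x < \<infinity>"
proof -
 have "maxf f x <= ennreal (B * 2 ^ DIM('a))" unfolding maxf_def
 proof (intro SUP_least)
  fix r :: real assume "r \<in> {0<..}"
  then have r: "r > 0" by simp
  have B: "B >= 0" using order_trans[OF norm_ge_zero assms] .
  have "ballint f x r <= (NN y. ennreal B * indicator (ball x r) y)"
   unfolding ballint_def by (intro nn_integral_mono mult_right_mono ennreal_leI assms) auto
  also have "... = ennreal B * emeasure lborel (ball x r)" by (simp add: nn_integral_cmult)
  also have "... <= ennreal B * (ennreal (2 ^ DIM('a)) * ennreal (r ^ DIM('a)))" by (intro mult_left_mono emeasure_ball_le r) auto
  finally have "ennreal (1 / r ^ DIM('a)) * ballint f x r <= ennreal (1 / r ^ DIM('a)) * (ennreal B * (ennreal (2 ^ DIM('a)) * ennreal (r ^ DIM('a))))"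
   by (intro mult_left_mono) auto
  also have "... = ennreal (B * 2 ^ DIM('a))" using r B by (simp add: ennreal_mult'[symmetric])
  finally show "ennreal (1 / r ^ DIM('a)) * ballint f x r <= ennreal (B * 2 ^ DIM('a))" .
 qed
 then show ?thesis by (rule order_le_less_trans) simp
qed

lemma cavg_le_of_near:
 fixes f :: "'a::euclidean_space => complex"
 assumes B: "!!x. norm (f x) <= B" and z: "norm (z - corner n x) < 2 * real DIM('a) / 2 powi n"
 shows "cavg f n x <= ennreal (dmf f z)"
proof -
 define r where "r = 3 * real DIM('a) / 2 powi n"
 have r: "r > 0" by (simp add: r_def)
 have "cavg f n x <= ennreal ((2 powi n) ^ DIM('a)) * ballint f z r" unfolding cavg_def ballint_def using cube_subset_ball[OF _ z]
  by (intro mult_left_mono nn_integral_mono) (auto simp: indicator_def r_def)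
 also have "... <= ennreal ((2 powi n) ^ DIM('a)) * (maxf f z * ennreal (r ^ DIM('a)))" by (intro mult_left_mono ballint_le_maxf r) auto
 also have "maxf f z = ennreal (mf f z)" using maxf_finite_bounded[of f B z, OF B] by (simp add: mf_def)
 also have "ennreal ((2 powi n) ^ DIM('a)) * (ennreal (mf f z) * ennreal (r ^ DIM('a))) = ennreal ((2 powi n * r) ^ DIM('a) * mf f z)"
  using r by (simp add: ennreal_mult'[symmetric] mf_nonneg power_mult_distrib ac_simps)
 also have "2 powi n * r = 3 * real DIM('a)" by (simp add: r_def)
 finally show ?thesis by (simp add: dmf_def)
qed

lemma cavg_le_dmf:
 fixes f :: "'a::euclidean_space => complex"
 assumes B: "!!x. norm (f x) <= B"
 shows "cavg f n x <= ennreal (dmf f x)"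
proof (rule cavg_le_of_near[OF B])
 have "real DIM('a) / 2 powi n < 2 * real DIM('a) / 2 powi n" by (simp add: divide_strict_right_mono)
 then show "norm (x - corner n x) < 2 * real DIM('a) / 2 powi n" using norm_corner_le[of x n] by linarith
qed

text \<open>By continuity \<open>|f|\<close> exceeds \<open>l\<close> by a fixed amount on a whole cube. This takes the place of Lebesgue's
 differentiation theorem.\<close>
lemma cavg_gt:
 fixes f :: "'a::euclidean_space => complex"
 assumes c: "continuous_on UNIV f" and l: "l < norm (f x)" "l >= 0"
 shows "\<exists>n. ennreal l < cavg f n x"
proof -
 define e where "e = (norm (f x) - l) / 2"
 have e: "e > 0" using l by (simp add: e_def)
 have "isCont f x" using c by (simp add: continuous_on_eq_continuous_at)
 then obtain d where d: "d > 0" "!!y. dist y x < d ==> dist (f y) (f x) < e" unfolding continuous_at_eps_delta using e by (metis dist_commute)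
 obtain k :: nat where k: "2 * real DIM('a) / d < 2 ^ k" using real_arch_pow[of 2 "2 * real DIM('a) / d"] by auto
 define n where "n = int k"
 have n: "2 * real DIM('a) / 2 powi n < d" using k d by (simp add: n_def power_int_of_nat field_simps)
 have near: "l + e <= norm (f y)" if y: "y \<in> cube n x" for y
 proof -
  have "norm (y - x) <= norm (y - corner n x) + norm (x - corner n x)" using norm_triangle_ineq4[of "y - corner n x" "x - corner n x"] by simp
  also have "... <= real DIM('a) / 2 powi n + real DIM('a) / 2 powi n"
   using norm_corner_le[of y n] norm_corner_le[of x n] y by (intro add_mono) (auto simp: cube_def)
  also have "... < d" using n by simp
  finally have "dist (f y) (f x) < e" by (intro d(2)) (simp add: dist_norm)
  then have "norm (f x) - norm (f y) < e" using norm_triangle_ineq2[of "f x" "f y"] by (simp add: dist_norm norm_minus_commute)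
  then show ?thesis by (simp add: e_def field_simps)
 qed
 have "ennreal l < ennreal (l + e)" using e l by (simp add: ennreal_less_iff)
 also have "ennreal (l + e) = ennreal ((2 powi n) ^ DIM('a)) * (ennreal (l + e) * emeasure lborel (cube n x))"
  unfolding emeasure_cube using e l by (simp add: ennreal_mult'[symmetric] del: ennreal_plus)
 also have "... = ennreal ((2 powi n) ^ DIM('a)) * (NN y. ennreal (l + e) * indicator (cube n x) y)" by (simp add: nn_integral_cmult)
 also have "... <= cavg f n x" unfolding cavg_def using near by (intro mult_left_mono nn_integral_mono) (auto simp: indicator_def intro!: ennreal_leI)
 finally show ?thesis by blast
qed

lemma norm_le_dmf:
 fixes f :: "'a::euclidean_space => complex"
 assumes B: "!!x. norm (f x) <= B" and c: "continuous_on UNIV f"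
 shows "norm (f x) <= dmf f x"
proof (rule ccontr)
 assume "\<not> norm (f x) <= dmf f x"
 then obtain n where "ennreal (dmf f x) < cavg f n x" using cavg_gt[OF c, of "dmf f x" x] dmf_nonneg by auto
 then show False using cavg_le_dmf[where f=f and n=n and x=x, OF B] by simp
qed

lemma cavg_measurable [measurable]:
 assumes [measurable]: "meas f"
 shows "meas (cavg f n)"
proof -
 have "meas (%x. (NN y. enorm (f y) * indicator {z. corner n (fst z) = corner n (snd z)} (y, x)))" by measurable
 then show ?thesis by (simp add: cavg_def[abs_def] cube_def indicator_def)
qed

lemma cavg_cong: "y \<in> cube n x ==> m <= n ==> cavg f m y = cavg f m x" using corner_nested[of n y x m] by (simp add: cavg_def cube_def)

section \<open>The Calderon-Zygmund decomposition\<close>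

text \<open>Larger \<open>n\<close> means a smaller cube, so this is the largest cube around \<open>x\<close> on which the average exceeds \<open>l\<close>.\<close>
definition stops :: "('a::euclidean_space => complex) => real => int => 'a => bool" where
 "stops f l n x \<longleftrightarrow> ennreal l < cavg f n x & (\<forall>m<n. \<not> ennreal l < cavg f m x)"

definition badset :: "('a::euclidean_space => complex) => real => 'a set" where
 "badset f l = {x. \<exists>n. ennreal l < cavg f n x}"

definition st :: "('a::euclidean_space => complex) => real => 'a => int" where
 "st f l x = (if x \<in> badset f l then (SOME n. stops f l n x) else 0)"

abbreviation ctr :: "('a::euclidean_space => complex) => real => 'a => 'a" where
 "ctr f l x \<equiv> corner (st f l x) x"

definition good :: "('a::euclidean_space => complex) => real => 'a => complex" where
 "good f l x = (if x \<in> badset f l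
   then cx ((2 powi st f l x) ^ DIM('a)) * (LI y. indicator (cube (st f l x) x) y * f y) else f x)"

lemma stops_unique: "stops f l m x ==> stops f l n x ==> m = n" unfolding stops_def by (meson linorder_neqE)

text \<open>Large cubes have small averages because \<open>f\<close> is integrable; hence a largest cube with average above \<open>l\<close> exists.\<close>
lemma cavg_small:
 assumes f: "integrable lborel f" and l: "l > 0"
 shows "\<exists>n0. \<forall>n\<le>n0. \<forall>x. \<not> ennreal l < cavg f n x"
proof -
 define I where "I = (LI y. norm (f y))"
 have I0: "I >= 0" unfolding I_def by (intro integral_nonneg_AE) auto
 have [measurable]: "meas f" using borel_measurable_integrable[OF f] by simp
 have II: "(NN y. enorm (f y)) = ennreal I" unfolding I_def by (rule nn_integral_eq_integral) (use f in auto)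
 obtain k :: nat where k: "I / l < 2 ^ k" using real_arch_pow[of 2 "I / l"] by auto
 have "\<not> ennreal l < cavg f n x" if n: "n <= - int k" for n x
 proof -
  have p: "(2::real) powi n <= 2 powi (- int k)" using n by (intro power_int_increasing) auto
  also have "... = 1 / 2 ^ k" by (simp add: power_int_minus power_int_of_nat inverse_eq_divide)
  finally have p: "(2::real) powi n <= 1 / 2 ^ k" .
  also have "... <= 1" by simp
  finally have p1: "(2::real) powi n <= 1" .
  have "((2::real) powi n) ^ DIM('a) <= (2 powi n) ^ 1" using p1 by (intro power_decreasing) auto
  then have p2: "((2::real) powi n) ^ DIM('a) <= 1 / 2 ^ k" using p by simp
  have "cavg f n x <= ennreal ((2 powi n) ^ DIM('a)) * ennreal I"
   unfolding cavg_def II[symmetric] by (intro mult_left_mono nn_integral_mono) (auto simp: indicator_def)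
  also have "... = ennreal ((2 powi n) ^ DIM('a) * I)" using I0 by (simp add: ennreal_mult'[symmetric])
  also have "... <= ennreal (1 / 2 ^ k * I)" using p2 I0 by (intro ennreal_leI mult_right_mono) auto
  also have "... <= ennreal l" using k l by (intro ennreal_leI) (simp add: field_simps)
  finally show ?thesis by simp
 qed
 then show ?thesis by blast
qed

lemma stops_exists:
 assumes f: "integrable lborel f" and l: "l > 0" and x: "x \<in> badset f l"
 shows "\<exists>n. stops f l n x"
proof -
 obtain n0 where n0: "!!n x. n <= n0 ==> \<not> ennreal l < cavg f n x" using cavg_small[OF f l] by blast
 obtain n where n: "ennreal l < cavg f n x" using x by (auto simp: badset_def)
 then have "n0 < n" using n0 by (meson not_le)
 define P where "P k \<longleftrightarrow> ennreal l < cavg f (n0 + int k) x" for k :: nat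
 have "P (nat (n - n0))" using n \<open>n0 < n\<close> by (simp add: P_def)
 then have L: "P (LEAST k. P k)" by (rule LeastI)
 have "\<not> ennreal l < cavg f m x" if m: "m < n0 + int (LEAST k. P k)" for m
 proof (cases "m <= n0")
  case False
  then have "nat (m - n0) < (LEAST k. P k)" using m by linarith
  then have "\<not> P (nat (m - n0))" by (rule not_less_Least)
  then show ?thesis using False by (simp add: P_def)
 qed (use n0 in blast)
 then show ?thesis using L unfolding stops_def P_def by blast
qed

lemma st_stops:
 assumes "integrable lborel f" "l > 0" "x \<in> badset f l"
 shows "stops f l (st f l x) x" using someI_ex[OF stops_exists[OF assms]] assms(3) by (simp add: st_def)

lemma badset_measurable [measurable]:
 assumes [measurable]: "meas f"
 shows "badset f l \<in> sets borel" unfolding badset_def by measurable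

lemma st_measurable:
 assumes f: "integrable lborel f" and l: "l > 0"
 shows "st f l \<in> measurable borel (count_space UNIV)"
proof (subst measurable_count_space_eq_countable)
 have [measurable]: "meas f" using borel_measurable_integrable[OF f] by simp
 have "st f l -` {n} \<inter> space borel \<in> sets borel" for n
 proof -
  have "st f l -` {n} \<inter> space borel = {x\<in>space borel. stops f l n x} \<union> (if n = 0 then space borel - badset f l else {})"
  proof (intro set_eqI)
   fix x
   show "x \<in> st f l -` {n} \<inter> space borel \<longleftrightarrow> x \<in> {x\<in>space borel. stops f l n x} \<union> (if n = 0 then space borel - badset f l else {})"
   proof (cases "x \<in> badset f l")
    case True
    then show ?thesis using st_stops[OF f l True] stops_unique[of f l _ x] by auto
   next
    case False
    then have "\<not> stops f l n x" by (auto simp: badset_def stops_def)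
    then show ?thesis using False by (auto simp: st_def)
   qed
  qed
  also have "{x\<in>space borel. stops f l n x} \<in> sets borel" unfolding stops_def by measurable
  then have "{x\<in>space borel. stops f l n x} \<union> (if n = 0 then space borel - badset f l else {}) \<in> sets borel" by (intro sets.Un) auto
  finally show ?thesis .
 qed
 then show "st f l \<in> space borel \<rightarrow> UNIV & (\<forall>a\<in>UNIV. st f l -` {a} \<inter> space borel \<in> sets borel)" by auto
qed simp

lemma same_stopping_cube:
 assumes "integrable lborel f" "l > 0" "x \<in> badset f l" "corner (st f l x) y = ctr f l x"
 shows "y \<in> badset f l" "st f l y = st f l x"
proof -
 have "stops f l (st f l x) x" by (rule st_stops[OF assms(1-3)])
 moreover have "cavg f m y = cavg f m x" if "m <= st f l x" for m using assms(4) that by (intro cavg_cong[of y "st f l x"]) (auto simp: cube_def)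
 ultimately have s: "stops f l (st f l x) y" unfolding stops_def by auto
 then show y: "y \<in> badset f l" by (auto simp: badset_def stops_def)
 show "st f l y = st f l x" by (rule stops_unique[OF st_stops[OF assms(1,2) y] s])
qed

text \<open>The parent of a stopping cube has average at most \<open>l\<close>, and its volume is larger by the factor \<open>2\<^sup>d\<close>.\<close>
lemma cavg_st_le:
 fixes x :: "'a::euclidean_space"
 assumes "integrable lborel f" "l > 0" "x \<in> badset f l"
 shows "cavg f (st f l x) x <= ennreal (2 ^ DIM('a) * l)"
proof -
 let ?n = "st f l x"
 have "\<not> ennreal l < cavg f (?n - 1) x" using st_stops[OF assms] by (simp add: stops_def)
 then have le: "cavg f (?n - 1) x <= ennreal l" by simp
 have "cube ?n x \<subseteq> cube (?n - 1) x" unfolding cube_def by (intro Collect_mono impI, erule corner_nested) simp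
 then have "cavg f ?n x <= ennreal ((2 powi ?n) ^ DIM('a)) * (NN y. enorm (f y) * indicator (cube (?n - 1) x) y)"
  unfolding cavg_def by (intro mult_left_mono nn_integral_mono) (auto simp: indicator_def)
 also have "(2::real) powi ?n = 2 * 2 powi (?n - 1)" using power_int_add[of "2::real" 1 "?n - 1"] by simp
 also have "ennreal ((2 * 2 powi (?n - 1)) ^ DIM('a)) = ennreal (2 ^ DIM('a)) * ennreal ((2 powi (?n - 1)) ^ DIM('a))"
  by (simp add: power_mult_distrib ennreal_mult')
 also have "ennreal (2 ^ DIM('a)) * ennreal ((2 powi (?n - 1)) ^ DIM('a)) * (NN y. enorm (f y) * indicator (cube (?n - 1) x) y)
   = ennreal (2 ^ DIM('a)) * cavg f (?n - 1) x" by (simp add: cavg_def mult.assoc)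
 also have "... <= ennreal (2 ^ DIM('a)) * ennreal l" by (intro mult_left_mono le) auto
 finally show ?thesis by (simp add: ennreal_mult')
qed

lemma good_norm_le:
 fixes x :: "'a::euclidean_space"
 assumes "integrable lborel f" "l > 0" "x \<in> badset f l"
 shows "norm (good f l x) <= 2 ^ DIM('a) * l"
proof -
 have [measurable]: "meas f" using borel_measurable_integrable[OF assms(1)] by simp
 let ?Q = "cube (st f l x) x"
 have i: "integrable lborel (%y. indicator ?Q y * f y)" by (rule integrable_bounded_mult(2)[OF assms(1), where B=1]) (auto simp: indicator_def)
 have "enorm (good f l x) = ennreal ((2 powi st f l x) ^ DIM('a)) * enorm (LI y. indicator ?Q y * f y)"
  using assms(3) by (simp add: good_def norm_mult norm_power norm_power_int ennreal_mult')
 also have "... <= ennreal ((2 powi st f l x) ^ DIM('a)) * ennreal (LI y. norm (indicator ?Q y * f y))"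
  by (intro mult_left_mono ennreal_leI integral_norm_bound) auto
 also have "ennreal (LI y. norm (indicator ?Q y * f y)) = (NN y. enorm (indicator ?Q y * f y))"
  using i by (intro nn_integral_eq_integral[symmetric]) auto
 also have "... = (NN y. enorm (f y) * indicator ?Q y)" by (intro nn_integral_cong) (auto simp: indicator_def)
 also have "ennreal ((2 powi st f l x) ^ DIM('a)) * (NN y. enorm (f y) * indicator ?Q y) <= ennreal (2 ^ DIM('a) * l)"
  using cavg_st_le[OF assms] by (simp add: cavg_def)
 finally show ?thesis using assms(2) by simp
qed

lemma ctr_measurable:
 assumes f: "integrable lborel f" and l: "l > 0"
 shows "meas (ctr f l)" by (rule measurable_compose_countable[where f=corner]) (use st_measurable[OF f l] in auto)

lemma powi_st_measurable:
 assumes f: "integrable lborel f" and l: "l > 0"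
 shows "meas (%x. (2 powi st f l x) ^ k :: real)" by (rule measurable_compose[OF st_measurable[OF f l]]) simp

lemma same_cube_pred_measurable:
 fixes f :: "'a::euclidean_space => complex"
 assumes f: "integrable lborel f" and l: "l > 0"
 shows "{z. corner (st f l (snd z)) (fst z) = ctr f l (snd z)} \<in> sets (borel \<Otimes>\<^sub>M borel :: ('a \<times> 'a) measure)"
proof -
 have m1: "(%z::'a\<times>'a. st f l (snd z)) \<in> measurable (borel \<Otimes>\<^sub>M borel) (count_space UNIV)"
  by (rule measurable_compose[OF measurable_snd st_measurable[OF f l]])
 have m2: "(%z::'a\<times>'a. corner (st f l (snd z)) (fst z)) \<in> borel_measurable (borel \<Otimes>\<^sub>M borel)"
  by (rule measurable_compose_countable[where f="%i z. corner i (fst z)", OF _ m1]) measurable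
 have m3: "(%z::'a\<times>'a. ctr f l (snd z)) \<in> borel_measurable (borel \<Otimes>\<^sub>M borel)"
  by (rule measurable_compose[OF measurable_snd ctr_measurable[OF f l]])
 have "{z \<in> space (borel \<Otimes>\<^sub>M borel). corner (st f l (snd z)) (fst z) = ctr f l (snd z)} \<in> sets (borel \<Otimes>\<^sub>M borel :: ('a \<times> 'a) measure)"
  by (rule measurable_equality_set[OF m2 m3])
 then show ?thesis by (simp add: space_pair_measure)
qed

lemma good_measurable:
 fixes f :: "'a::euclidean_space => complex"
 assumes f: "integrable lborel f" and l: "l > 0"
 shows "meas (good f l)"
proof -
 have [measurable]: "meas f" using borel_measurable_integrable[OF f] by simp
 note [measurable] = same_cube_pred_measurable[OF f l] powi_st_measurable[OF f l]
 have "meas (%x. LINT y|lborel. indicator {z. corner (st f l (snd z)) (fst z) = ctr f l (snd z)} (y, x) * f y)" by measurable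
 then have [measurable]: "meas (%x. LINT y|lborel. indicator (cube (st f l x) x) y * f y)" by (simp add: cube_def indicator_def)
 show ?thesis unfolding good_def[abs_def] by measurable
qed

text \<open>Being in the same stopping cube is a symmetric relation, so Fubini's theorem moves the average
 from \<open>f\<close> to the weight, which is constant on the cube. This is the cancellation of the bad part,
 without enumerating the cubes.\<close>

lemma bad_part_cancels:
 fixes f H :: "'a::euclidean_space => complex"
 assumes f: "integrable lborel f" and l: "l > 0"
  and H[measurable]: "meas H" and B: "!!x. norm (H x) <= B"
 shows "(LI y. indicator (badset f l) y * H (ctr f l y) * good f l y)
    = (LI y. indicator (badset f l) y * H (ctr f l y) * f y)"
proof -
 have [measurable]: "meas f" using borel_measurable_integrable[OF f] by simp
 note [measurable] = same_cube_pred_measurable[OF f l] powi_st_measurable[OF f l] ctr_measurable[OF f l]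
 let ?W = "badset f l"
 define S where "S = {z::'a\<times>'a. corner (st f l (snd z)) (fst z) = ctr f l (snd z)}"
 have [measurable]: "S \<in> sets (borel \<Otimes>\<^sub>M borel)" unfolding S_def by measurable
 define P where "P x y = indicator ?W y * H (ctr f l y) * cx ((2 powi st f l y) ^ DIM('a)) * indicator S (x, y) * f x" for x y
 define G where "G y = indicator ?W y * H (ctr f l y) * cx ((2 powi st f l y) ^ DIM('a))" for y
 have [measurable]: "meas G" unfolding G_def by measurable
 have "(%z. G (snd z) * indicator S z * f (fst z)) \<in> borel_measurable (borel \<Otimes>\<^sub>M borel)" by measurable
 then have Pm: "(%z. P (fst z) (snd z)) \<in> borel_measurable (lborel \<Otimes>\<^sub>M lborel)"
  by (simp add: P_def G_def cong: measurable_cong_sets sets_pair_measure_cong)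
 have P_eq: "P x y = (indicator ?W x * H (ctr f l x) * f x * cx ((2 powi st f l x) ^ DIM('a))) * indicator (cube (st f l x) x) y" for x y
 proof -
  have 1: "x \<in> ?W & corner (st f l x) y = ctr f l x & st f l x = st f l y" if "y \<in> ?W" "corner (st f l y) x = ctr f l y" for x y
   using same_stopping_cube[OF f l that] that(2) by simp
  show ?thesis
  proof (cases "y \<in> ?W & corner (st f l y) x = ctr f l y")
   case True
   with 1[of y x] show ?thesis by (simp add: P_def S_def cube_def)
  next
   case False
   then have "\<not> (x \<in> ?W & corner (st f l x) y = ctr f l x)" using 1[of x y] by blast
   with False show ?thesis by (auto simp: P_def S_def cube_def indicator_def)
  qed
 qed
 have ind: "integrable lborel (%y. indicator (cube (st f l x) x) y :: complex)"
  "(LI y. indicator (cube (st f l x) x) y :: complex) = cx (1 / (2 powi st f l x) ^ DIM('a))" for x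
 proof -
  have fin: "emeasure lborel (cube (st f l x) x) < \<infinity>" by (simp add: emeasure_cube)
  have "integrable lborel (%y. cx (indicator (cube (st f l x) x) y))" using fin by (intro integrable_of_real) simp
  then show "integrable lborel (%y. indicator (cube (st f l x) x) y :: complex)" by (simp add: of_real_indicator)
  have "(LI y. cx (indicator (cube (st f l x) x) y)) = cx (1 / (2 powi st f l x) ^ DIM('a))" using fin by (simp add: measure_def emeasure_cube)
  then show "(LI y. indicator (cube (st f l x) x) y :: complex) = cx (1 / (2 powi st f l x) ^ DIM('a))" by (simp add: of_real_indicator)
 qed
 have intP: "integrable (lborel \<Otimes>\<^sub>M lborel) (%z. P (fst z) (snd z))"
 proof (rule lborel_pair.Fubini_integrable[OF Pm])
  show "AE x in lborel. integrable lborel (%y. P (fst (x, y)) (snd (x, y)))"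
   unfolding fst_conv snd_conv P_eq by (intro AE_I2 integrable_mult_right ind)
  have "(LI y. norm (P x y)) = norm (indicator ?W x * H (ctr f l x) * f x)" for x
  proof -
   have "(LI y. norm (P x y)) = norm (indicator ?W x * H (ctr f l x) * f x * cx ((2 powi st f l x) ^ DIM('a))) * (LI y. norm (indicator (cube (st f l x) x) y :: complex))"
    unfolding P_eq norm_mult by simp
   also have "(LI y. norm (indicator (cube (st f l x) x) y :: complex)) = (LI y. indicator (cube (st f l x) x) y)"
    by (intro Bochner_Integration.integral_cong) (auto simp: indicator_def)
   also have "... = 1 / (2 powi st f l x) ^ DIM('a)" by (simp add: measure_def emeasure_cube)
   finally show ?thesis by (simp add: norm_mult norm_power norm_power_int)
  qed
  moreover have "integrable lborel (%x. norm (indicator ?W x * H (ctr f l x) * f x))"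
  proof (rule integrable_norm, rule integrable_bounded_mult(2)[OF f, where B=B])
   fix x show "norm (indicator ?W x * H (ctr f l x)) <= B" using B[of "ctr f l x"] order_trans[OF norm_ge_zero B] by (auto simp: indicator_def)
  qed measurable
  ultimately show "integrable lborel (%x. LINT y|lborel. norm (P (fst (x, y)) (snd (x, y))))" by simp
 qed
 have "(LI y. LINT x|lborel. P x y) = (LI x. LINT y|lborel. P x y)"
  by (rule lborel_pair.Fubini_integral) (use intP in \<open>simp add: case_prod_unfold\<close>)
 moreover have "(LI x. P x y) = indicator ?W y * H (ctr f l y) * good f l y" for y
 proof (cases "y \<in> ?W")
  case True
  have "(LI x. P x y) = (LI x. (indicator ?W y * H (ctr f l y) * cx ((2 powi st f l y) ^ DIM('a))) * (indicator (cube (st f l y) y) x * f x))"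
   by (intro Bochner_Integration.integral_cong) (auto simp: P_def S_def cube_def indicator_def)
  then show ?thesis using True by (simp add: good_def)
 qed (simp add: P_def)
 moreover have "(LI y. P x y) = indicator ?W x * H (ctr f l x) * f x" for x unfolding P_eq by (simp add: ind(2))
 ultimately show ?thesis by simp
qed

lemma conv_diff_right:
 assumes "nice K" "nice f" "nice g"
 shows "conv K (%x. f x - g x) x = conv K f x - conv K g x"
 unfolding conv_def using nice_translate_mult(1)[OF assms(1,2), of x] nice_translate_mult(1)[OF assms(1,3), of x] by (simp add: right_diff_distrib)

lemma nice_diff: "nice f ==> nice g ==> nice (%x. f x - g x)"
proof -
 assume f: "nice f" and g: "nice g"
 obtain B C where "!!x. norm (f x) <= B" "!!x. norm (g x) <= C" using f g unfolding nice_def by blast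
 then have "norm (f x - g x) <= B + C" for x using norm_triangle_ineq4[of "f x" "g x"] by (smt (verit) add_mono)
 then show ?thesis using f g unfolding nice_def by auto
qed

lemma dmf_gt_finite:
 fixes f :: "'a::euclidean_space => complex"
 assumes f: "nice f" and l: "l > 0"
 shows "emeasure lborel {x. l < dmf f x} < \<infinity>"
proof -
 define c where "c = (3 * real DIM('a)) ^ DIM('a)"
 have c: "c > 0" by (simp add: c_def)
 have [measurable]: "meas f" by (rule nice_measurable[OF f])
 have "emeasure lborel {x. l < dmf f x} <= emeasure lborel {x. ennreal (l / c) < maxf f x}"
 proof (intro emeasure_mono subsetI, clarify)
  fix x assume "l < dmf f x"
  then have "l < mf f x * c" by (simp only: dmf_def c_def mult.commute)
  then have "l / c < mf f x" using c by (simp only: pos_divide_less_eq)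
  moreover have "l / c > 0" using l c by simp
  ultimately show "ennreal (l / c) < maxf f x" unfolding mf_def by (cases "maxf f x") (auto simp: ennreal_less_iff)
 qed auto
 also have "... <= ennreal (10 ^ DIM('a) / (l / c)) * (NN y. enorm (f y))" by (rule maxf_weak_type) (use l c in auto)
 also have "... < \<infinity>" using nice_integrable[OF f] by (auto simp: integrable_iff_bounded ennreal_mult_less_top)
 finally show ?thesis .
qed

text \<open>The distribution of \<open>K * f\<close> at height \<open>l\<close>: the good part is square integrable with values of size
 at most a multiple of \<open>l\<close> on the bad set, the bad part is handled by its cancellation on each stopping
 cube. All three contributions are bounded by the same integral of the maximal function.\<close>

lemma cz_distribution:
 fixes K f :: "'a::euclidean_space => complex"
 assumes K: "nice K" and A: "A >= 0" "!!g. nice g ==> nsq (conv K g) <= A * nsq g"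
  and H: "H >= 0" "!!R h. R > 0 ==> norm h <= R / 2 ==>
    (NN x. enorm (K (x - h) - K x) * indicator {x. norm x >= R} x) <= ennreal H"
  and f: "nice f" and fc: "continuous_on UNIV f" and l: "l > 0"
 shows "emeasure lborel {x. l < norm (conv K f x)}
  <= ennreal (1 + 4 * A * 4 ^ DIM('a) + 2 * H * (1 + 2 ^ DIM('a))) * (NN x. ennreal (kap 2 (dmf f x / l)))"
proof -
 let ?D = "(2::real) ^ DIM('a)"
 have fi: "integrable lborel f" by (rule nice_integrable[OF f])
 obtain B where B: "B >= 0" "!!x. norm (f x) <= B" using nice_bound[OF f] by blast
 have [measurable]: "meas f" "meas K" using f K by (auto intro: nice_measurable)
 have [measurable]: "meas (good f l)" by (rule good_measurable[OF fi l])
 have [measurable]: "meas (ctr f l)" by (rule ctr_measurable[OF fi l])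
 define W where "W = badset f l"
 have [measurable]: "W \<in> sets borel" unfolding W_def by measurable
 define E where "E = {x. l < dmf f x}"
 have [measurable]: "E \<in> sets borel" unfolding E_def by measurable
 define k where "k x = kap 2 (dmf f x / l)" for x
 have [measurable]: "meas k" unfolding k_def by measurable
 have k0: "k x >= 0" for x unfolding k_def using l dmf_nonneg[of f x] by (intro kap_nonneg) auto
 have kE: "k x = dmf f x / l" "k x > 1" if "x \<in> E" for x using that l by (auto simp: E_def k_def kap_def)
 have knE: "k x = (dmf f x)^2 / l\<^sup>2" if "x \<notin> E" for x using that l dmf_nonneg[of f x] by (auto simp: E_def k_def kap_def power_divide)
 have WE: "x \<in> E" if x: "x \<in> W" for x
 proof -
  obtain n where "ennreal l < cavg f n x" using x unfolding W_def badset_def by blast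
  also have "cavg f n x <= ennreal (dmf f x)" by (rule cavg_le_dmf[OF B(2)])
  finally show ?thesis using l by (simp add: E_def ennreal_less_iff)
 qed
 have fN: "norm (f x) <= dmf f x" for x by (rule norm_le_dmf[OF B(2) fc])
 have fW: "norm (f x) <= l" if "x \<notin> W" for x
 proof (rule ccontr)
  assume "\<not> norm (f x) <= l"
  then have "\<exists>n. ennreal l < cavg f n x" using l by (intro cavg_gt[OF fc]) auto
  with that show False by (auto simp: W_def badset_def)
 qed
 define g where "g = good f l"
 have [measurable]: "meas g" unfolding g_def by measurable
 have gW: "norm (g x) <= ?D * l" if "x \<in> W" for x using good_norm_le[OF fi l, of x] that by (simp add: g_def W_def)
 have gnW: "g x = f x" if "x \<notin> W" for x using that by (simp add: g_def good_def W_def)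
 have D1: "1 <= ?D" by (rule one_le_power) simp
 have Wfin: "emeasure lborel W < \<infinity>"
 proof -
  have "emeasure lborel W <= emeasure lborel E" using WE by (intro emeasure_mono) auto
  also have "... < \<infinity>" unfolding E_def by (rule dmf_gt_finite[OF f l])
  finally show ?thesis .
 qed
 have ng: "nice g" unfolding nice_def
 proof
  have i: "integrable lborel (%x. norm (f x) + ?D * l * indicator W x)"
   using fi Wfin by (intro Bochner_Integration.integrable_add integrable_norm integrable_mult_right) auto
  show "integrable lborel g"
  proof (rule Bochner_Integration.integrable_bound[OF i])
   show "AE x in lborel. norm (g x) <= norm (norm (f x) + ?D * l * indicator W x)"
    using gW gnW l by (intro AE_I2) (auto simp: indicator_def add_increasing)
  qed simp
  have "norm (g x) <= ?D * l + l" for x using gW[of x] gnW[of x] fW[of x] l by (cases "x \<in> W") (auto simp: add_increasing add_increasing2)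
  then show "\<exists>B. \<forall>x. norm (g x) <= B" by blast
 qed
 define b where "b x = f x - g x" for x
 have nb: "nice b" unfolding b_def by (rule nice_diff[OF f ng])
 have [measurable]: "meas b" by (rule nice_measurable[OF nb])
 have bW: "b x = 0" if "x \<notin> W" for x using gnW[OF that] by (simp add: b_def)
 have split: "conv K f x = conv K g x + conv K b x" for x unfolding b_def by (subst conv_diff_right[OF K f ng]) simp

 \<comment> \<open>The good part by the Chebyshev inequality in mean square: off \<open>E\<close> it is at most \<open>dmf f\<close>, on \<open>E\<close> at most \<open>2\<^sup>d l\<close>.\<close>
 have G: "emeasure lborel {x. l / 2 < norm (conv K g x)} <= ennreal (4 * A * 4 ^ DIM('a)) * (NN x. ennreal (k x))"
 proof -
  have nK: "nice (conv K g)" by (rule nice_conv[OF K ng])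
  have [measurable]: "meas (conv K g)" by (rule nice_measurable[OF nK])
  have "emeasure lborel {x. l / 2 < norm (conv K g x)} = (NN x. indicator {x. l / 2 < norm (conv K g x)} x)"
   by (rule nn_integral_indicator[symmetric]) measurable
  also have "... <= (NN x. ennreal (4 / l\<^sup>2) * ennreal ((norm (conv K g x))^2))"
  proof (intro nn_integral_mono)
   fix x
   have "1 <= 4 / l\<^sup>2 * (norm (conv K g x))^2" if "l / 2 < norm (conv K g x)"
   proof -
    have "(l / 2)^2 <= (norm (conv K g x))^2" using that l by (intro power_mono) auto
    then show ?thesis using l by (simp add: power_divide field_simps)
   qed
   then show "indicator {x. l / 2 < norm (conv K g x)} x <= ennreal (4 / l\<^sup>2) * ennreal ((norm (conv K g x))^2)"
    by (auto simp: indicator_def ennreal_mult'[symmetric] intro!: order_trans[OF eq_refl[OF ennreal_1[symmetric]]] ennreal_leI)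
  qed
  also have "... = ennreal (4 / l\<^sup>2) * ennreal (nsq (conv K g))" by (simp add: nn_integral_cmult nsq_eq_nn_integral[OF nK])
  also have "... <= ennreal (4 / l\<^sup>2) * (ennreal A * ennreal (nsq g))"
   using A ng by (intro mult_left_mono) (auto simp: ennreal_mult'[symmetric] intro!: ennreal_leI)
  also have "ennreal (nsq g) = (NN x. ennreal ((norm (g x))^2))" by (rule nsq_eq_nn_integral[OF ng, symmetric])
  also have "... <= (NN x. ennreal (4 ^ DIM('a) * l\<^sup>2) * ennreal (k x))"
  proof (intro nn_integral_mono)
   fix x
   have D2: "?D\<^sup>2 = 4 ^ DIM('a)" by (simp add: power2_eq_square power_mult_distrib[symmetric])
   have F1: "(1::real) <= 4 ^ DIM('a)" by (rule one_le_power) simp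
   have "(norm (g x))^2 <= 4 ^ DIM('a) * l\<^sup>2 * k x"
   proof (cases "x \<in> E")
    case True
    have "norm (g x) <= ?D * l"
    proof (cases "x \<in> W")
     case False
     then have "norm (g x) <= 1 * l" using gnW fW by simp
     also have "... <= ?D * l" using D1 l by (intro mult_right_mono) auto
     finally show ?thesis .
    qed (rule gW)
    then have "(norm (g x))^2 <= (?D * l)^2" by (intro power_mono) auto
    also have "... = 4 ^ DIM('a) * l\<^sup>2 * 1" by (simp add: power_mult_distrib D2)
    also have "... <= 4 ^ DIM('a) * l\<^sup>2 * k x" using kE(2)[OF True] by (intro mult_left_mono) auto
    finally show ?thesis .
   next
    case False
    then have "x \<notin> W" using WE by blast
    then have "(norm (g x))^2 <= (dmf f x)^2" using gnW fN by (simp add: power_mono)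
    also have "... = 1 * (l\<^sup>2 * k x)" using knE[OF False] l by simp
    also have "... <= 4 ^ DIM('a) * (l\<^sup>2 * k x)" using F1 k0[of x] by (intro mult_right_mono) auto
    finally show ?thesis by (simp add: mult.assoc)
   qed
   then show "ennreal ((norm (g x))^2) <= ennreal (4 ^ DIM('a) * l\<^sup>2) * ennreal (k x)"
    using k0 by (simp add: ennreal_mult'[symmetric] ennreal_leI)
  qed
  also have "... = ennreal (4 ^ DIM('a) * l\<^sup>2) * (NN x. ennreal (k x))" by (simp add: nn_integral_cmult)
  finally have "emeasure lborel {x. l / 2 < norm (conv K g x)}
    <= ennreal (4 / l\<^sup>2) * (ennreal A * (ennreal (4 ^ DIM('a) * l\<^sup>2) * (NN x. ennreal (k x))))" by (simp add: mult_left_mono)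
  also have "... = ennreal (4 / l\<^sup>2 * A * (4 ^ DIM('a) * l\<^sup>2)) * (NN x. ennreal (k x))"
  proof -
   have "ennreal (4 / l\<^sup>2 * A * (4 ^ DIM('a) * l\<^sup>2)) = ennreal (4 / l\<^sup>2) * ennreal A * ennreal (4 ^ DIM('a) * l\<^sup>2)"
    using A by (subst ennreal_mult, simp, simp, subst ennreal_mult, simp_all)
   then show ?thesis by (simp only: mult.assoc)
  qed
  also have "4 / l\<^sup>2 * A * (4 ^ DIM('a) * l\<^sup>2) = 4 * A * 4 ^ DIM('a)" using l by simp
  finally show ?thesis .
 qed

 \<comment> \<open>Outside \<open>E\<close> the point is far from every stopping cube, so Hoermander's condition applies to the
   difference of the kernel at \<open>y\<close> and at the corner of its cube.\<close>
 have Bd: "emeasure lborel {x. x \<notin> E & l / 2 < norm (conv K b x)} <= ennreal (2 * H * (1 + ?D)) * (NN x. ennreal (k x))"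
 proof -
  have nK: "nice (conv K b)" by (rule nice_conv[OF K nb])
  have [measurable]: "meas (conv K b)" by (rule nice_measurable[OF nK])
  obtain BK where BK: "!!x. norm (K x) <= BK" using nice_bound[OF K] by blast
  have Kb: "conv K b x = (LI y. (K (x - y) - K (x - ctr f l y)) * b y)" for x
  proof -
   have Hm: "meas (%v. K (x - v))" by measurable
   have i1: "integrable lborel (%y. K (x - y) * b y)" by (rule nice_translate_mult(1)[OF K nb])
   have i2: "integrable lborel (%y. K (x - ctr f l y) * h y)" if "nice h" for h
    by (rule integrable_bounded_mult(2)[OF nice_integrable[OF that] _ BK]) measurable
   have ind: "indicator W y * K (x - ctr f l y) * h y = K (x - ctr f l y) * (indicator W y * h y)" for h :: "'a => complex" and y by simp
   have nW: "nice (%y. indicator W y * h y)" if h: "nice h" for h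
   proof -
    have [measurable]: "meas h" by (rule nice_measurable[OF h])
    obtain C where C: "C >= 0" "!!x. norm (h x) <= C" using nice_bound[OF h] by blast
    have "integrable lborel (%y. indicator W y * h y)"
     by (rule integrable_bounded_mult(2)[OF nice_integrable[OF h], where B=1]) (auto simp: indicator_def)
    moreover have "norm (indicator W y * h y) <= C" for y using C by (simp add: indicator_def)
    ultimately show ?thesis unfolding nice_def by blast
   qed
   have "(LI y. K (x - ctr f l y) * (indicator W y * g y)) = (LI y. K (x - ctr f l y) * (indicator W y * f y))"
    using bad_part_cancels[OF fi l Hm BK] unfolding W_def[symmetric] g_def[symmetric] by (simp only: ind)
   then have "(LI y. K (x - ctr f l y) * (indicator W y * f y) - K (x - ctr f l y) * (indicator W y * g y)) = 0"
    using i2[OF nW[OF f]] i2[OF nW[OF ng]] by simp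
   also have "(%y. K (x - ctr f l y) * (indicator W y * f y) - K (x - ctr f l y) * (indicator W y * g y)) = (%y. K (x - ctr f l y) * b y)"
    using gnW by (auto simp: b_def indicator_def fun_eq_iff algebra_simps)
   finally have z: "(LI y. K (x - ctr f l y) * b y) = 0" .
   have "(LI y. (K (x - y) - K (x - ctr f l y)) * b y) = (LI y. K (x - y) * b y) - (LI y. K (x - ctr f l y) * b y)"
    using i1 i2[OF nb] by (simp add: left_diff_distrib)
   then show ?thesis using z by (simp add: conv_def)
  qed
  have inner: "(NN x. enorm (K (x - y) - K (x - ctr f l y)) * indicator (- E) x) <= ennreal H" if y: "y \<in> W" for y
  proof -
   define n where "n = st f l y"
   define c where "c = corner n y"
   define R where "R = 2 * real DIM('a) / 2 powi n"
   have R: "R > 0" by (simp add: R_def)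
   have lc: "ennreal l < cavg f n y" using st_stops[OF fi l] y unfolding n_def W_def stops_def by blast
   have far: "norm (x - c) >= R" if "x \<notin> E" for x
   proof (rule ccontr)
    assume "\<not> norm (x - c) >= R"
    then have "cavg f n y <= ennreal (dmf f x)" by (intro cavg_le_of_near[OF B(2)]) (simp add: R_def c_def)
    with lc have "ennreal l < ennreal (dmf f x)" by (rule order_less_le_trans)
    with that l show False by (simp add: E_def ennreal_less_iff)
   qed
   define G where "G x = enorm (K (x - (y - c)) - K x) * indicator {x. norm x >= R} x" for x
   have [measurable]: "meas G" unfolding G_def by measurable
   have "(NN x. enorm (K (x - y) - K (x - ctr f l y)) * indicator (- E) x) <= (NN x. G (x - c))"
    using far by (intro nn_integral_mono) (auto simp: G_def indicator_def n_def[symmetric] c_def[symmetric])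
   also have "... = (NN x. G x)" by (rule nn_integral_translate) measurable
   also have "... <= ennreal H" unfolding G_def using R norm_corner_le[of y n] by (intro H(2)) (auto simp: R_def c_def)
   finally show ?thesis .
  qed
  have "emeasure lborel {x. x \<notin> E & l / 2 < norm (conv K b x)} = (NN x. indicator {x. x \<notin> E & l / 2 < norm (conv K b x)} x)"
   by (rule nn_integral_indicator[symmetric]) measurable
  also have "... <= (NN x. ennreal (2 / l) * (enorm (conv K b x) * indicator (- E) x))"
  proof (intro nn_integral_mono)
   fix x
   have "1 <= 2 / l * norm (conv K b x)" if "l / 2 < norm (conv K b x)" using that l by (simp add: field_simps)
   then show "indicator {x. x \<notin> E & l / 2 < norm (conv K b x)} x <= ennreal (2 / l) * (enorm (conv K b x) * indicator (- E) x)"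
    using l by (auto simp: indicator_def ennreal_mult'[symmetric] intro!: order_trans[OF eq_refl[OF ennreal_1[symmetric]]] ennreal_leI)
  qed
  also have "... = ennreal (2 / l) * (NN x. enorm (conv K b x) * indicator (- E) x)" by (rule nn_integral_cmult) measurable
  also have "(NN x. enorm (conv K b x) * indicator (- E) x)
   <= (NN x. (NN y. enorm (b y) * (enorm (K (x - y) - K (x - ctr f l y)) * indicator (- E) x)))"
  proof (intro nn_integral_mono)
   fix x
   have "enorm (conv K b x) <= (NN y. enorm ((K (x - y) - K (x - ctr f l y)) * b y))"
   proof -
    have "norm (conv K b x) = norm (integral\<^sup>L lborel (%y. (K (x - y) - K (x - ctr f l y)) * b y))" by (simp add: Kb)
    then show ?thesis by (cases "integrable lborel (%y. (K (x - y) - K (x - ctr f l y)) * b y)")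
       (auto simp: not_integrable_integral_eq nn_integral_eq_integral[OF integrable_norm] intro!: ennreal_leI integral_norm_bound)
   qed
   then have "enorm (conv K b x) * indicator (- E) x <= (NN y. enorm ((K (x - y) - K (x - ctr f l y)) * b y)) * indicator (- E) x"
    by (intro mult_right_mono) auto
   also have "... = (NN y. enorm ((K (x - y) - K (x - ctr f l y)) * b y) * indicator (- E) x)" by (rule nn_integral_multc[symmetric]) measurable
   also have "... = (NN y. enorm (b y) * (enorm (K (x - y) - K (x - ctr f l y)) * indicator (- E) x))"
    by (intro nn_integral_cong) (simp add: norm_mult ennreal_mult' ac_simps)
   finally show "enorm (conv K b x) * indicator (- E) x <= (NN y. enorm (b y) * (enorm (K (x - y) - K (x - ctr f l y)) * indicator (- E) x))" .
  qed
  also have "(NN x. (NN y. enorm (b y) * (enorm (K (x - y) - K (x - ctr f l y)) * indicator (- E) x)))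
   = (NN y. (NN x. enorm (b y) * (enorm (K (x - y) - K (x - ctr f l y)) * indicator (- E) x)))" by (rule lborel_pair.Fubini') measurable
  also have "... <= (NN y. ennreal (H * (1 + ?D) * l) * ennreal (k y))"
  proof (intro nn_integral_mono)
   fix y
   have "(NN x. enorm (b y) * (enorm (K (x - y) - K (x - ctr f l y)) * indicator (- E) x))
    = enorm (b y) * (NN x. enorm (K (x - y) - K (x - ctr f l y)) * indicator (- E) x)" by (rule nn_integral_cmult) measurable
   also have "... <= ennreal (H * (1 + ?D) * l) * ennreal (k y)"
   proof (cases "y \<in> W")
    case True
    then have yE: "y \<in> E" by (rule WE)
    have "norm (b y) <= norm (f y) + norm (g y)" unfolding b_def by (rule norm_triangle_ineq4)
    also have "... <= dmf f y + ?D * l" using fN gW[OF True] by (intro add_mono) auto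
    also have "... = l * k y + ?D * l * 1" using kE(1)[OF yE] l by simp
    also have "... <= l * k y + ?D * l * k y" using kE(2)[OF yE] l by (intro add_left_mono mult_left_mono) auto
    also have "... = (1 + ?D) * l * k y" by (simp add: algebra_simps)
    finally have bk: "norm (b y) <= (1 + ?D) * l * k y" .
    have "enorm (b y) * (NN x. enorm (K (x - y) - K (x - ctr f l y)) * indicator (- E) x)
     <= ennreal ((1 + ?D) * l * k y) * ennreal H" by (intro mult_mono ennreal_leI bk inner[OF True]) auto
    also have "... = ennreal (H * (1 + ?D) * l) * ennreal (k y)" using H(1) l k0[of y] by (simp add: ennreal_mult'[symmetric] ac_simps)
    finally show ?thesis .
   qed (simp add: bW)
   finally show "(NN x. enorm (b y) * (enorm (K (x - y) - K (x - ctr f l y)) * indicator (- E) x)) <= ennreal (H * (1 + ?D) * l) * ennreal (k y)" .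
  qed
  also have "... = ennreal (H * (1 + ?D) * l) * (NN x. ennreal (k x))" by (simp add: nn_integral_cmult)
  finally have "emeasure lborel {x. x \<notin> E & l / 2 < norm (conv K b x)} <= ennreal (2 / l) * (ennreal (H * (1 + ?D) * l) * (NN x. ennreal (k x)))"
   by (simp add: mult_left_mono)
  also have "... = ennreal (2 / l * (H * (1 + ?D) * l)) * (NN x. ennreal (k x))"
   using l H(1) by (simp add: mult.assoc[symmetric] ennreal_mult'[symmetric])
  also have "2 / l * (H * (1 + ?D) * l) = 2 * H * (1 + ?D)" using l by simp
  finally show ?thesis .
 qed

 have Eb: "emeasure lborel E <= ennreal 1 * (NN x. ennreal (k x))"
 proof -
  have "emeasure lborel E = (NN x. indicator E x)" by simp
  also have "... <= (NN x. ennreal (k x))"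
  proof (intro nn_integral_mono)
   fix x show "indicator E x <= ennreal (k x)"
    using kE(2)[of x] by (auto simp: indicator_def ennreal_1[symmetric] simp del: ennreal_1 intro!: ennreal_leI)
  qed
  finally show ?thesis by simp
 qed
 have [measurable]: "meas (conv K g)" "meas (conv K b)" by auto
 have "{x. l < norm (conv K f x)} \<subseteq> E \<union> ({x. l / 2 < norm (conv K g x)} \<union> {x. x \<notin> E & l / 2 < norm (conv K b x)})"
 proof
  fix x assume "x \<in> {x. l < norm (conv K f x)}"
  then have "l < norm (conv K g x) + norm (conv K b x)" using norm_triangle_ineq[of "conv K g x" "conv K b x"] by (simp add: split)
  then have "l / 2 < norm (conv K g x) \<or> l / 2 < norm (conv K b x)" by linarith
  then show "x \<in> E \<union> ({x. l / 2 < norm (conv K g x)} \<union> {x. x \<notin> E & l / 2 < norm (conv K b x)})" by blast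
 qed
 then have "emeasure lborel {x. l < norm (conv K f x)} <= emeasure lborel (E \<union> ({x. l / 2 < norm (conv K g x)} \<union> {x. x \<notin> E & l / 2 < norm (conv K b x)}))"
  by (intro emeasure_mono) auto
 also have "... <= emeasure lborel E + (emeasure lborel {x. l / 2 < norm (conv K g x)} + emeasure lborel {x. x \<notin> E & l / 2 < norm (conv K b x)})"
  by (intro order_trans[OF emeasure_subadditive] add_left_mono emeasure_subadditive) auto
 also have "... <= ennreal 1 * (NN x. ennreal (k x)) + (ennreal (4 * A * 4 ^ DIM('a)) * (NN x. ennreal (k x)) + ennreal (2 * H * (1 + ?D)) * (NN x. ennreal (k x)))"
  by (intro add_mono Eb G Bd)
 also have "... = ennreal (1 + 4 * A * 4 ^ DIM('a) + 2 * H * (1 + ?D)) * (NN x. ennreal (k x))"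
 proof -
  have "ennreal (1 + 4 * A * 4 ^ DIM('a) + 2 * H * (1 + ?D)) = ennreal 1 + (ennreal (4 * A * 4 ^ DIM('a)) + ennreal (2 * H * (1 + ?D)))"
   using A(1) H(1) by (simp add: add.assoc)
  then show ?thesis by (simp only: distrib_right)
 qed
 finally show ?thesis by (simp add: k_def)
qed

lemma pint_cnorm: "pint p (%x. norm (f x)) = pint p f" by (simp add: pint_def)

lemma cz_strong_type:
 fixes p :: real
 assumes p: "1 < p" "p < 2"
 shows "\<exists>C\<ge>0. \<forall>(K :: 'a::euclidean_space => complex) A H f. nice K --> A >= 0 --> (\<forall>g. nice g --> nsq (conv K g) <= A * nsq g) --> H >= 0 -->
  (\<forall>R h. R > 0 --> norm h <= R / 2 --> (NN x. enorm (K (x - h) - K x) * indicator {x. norm x >= R} x) <= ennreal H) -->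
  nice f --> continuous_on UNIV f --> pint p (conv K f) <= ennreal (C * (1 + A + H)) * pint p f"
proof -
 define c1 where "c1 = (p / (p - 1) + p / (2 - p)) * (4 * 4 ^ DIM('a) + 2 * (1 + 2 ^ DIM('a)))"
 define c2 where "c2 = ((3 * real DIM('a)) ^ DIM('a)) powr p * (10 ^ DIM('a) * (p / (p - 1) + p) * (2 ^ (DIM('a) + 1)) powr p)"
 have c0: "c1 >= 0" "c2 >= 0" using p by (auto simp: c1_def c2_def)
 have "pint p (conv K f) <= ennreal (c1 * c2 * (1 + A + H)) * pint p f"
  if K: "nice K" and A: "A >= 0" "\<forall>g. nice g --> nsq (conv K g) <= A * nsq g" and H: "H >= 0"
   "\<forall>R h. R > 0 --> norm h <= R / 2 --> (NN x. enorm (K (x - h) - K x) * indicator {x. norm x >= R} x) <= ennreal H"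
   and f: "nice f" "continuous_on UNIV f" for K f :: "'a => complex" and A H
 proof -
  have [measurable]: "meas f" "meas K" using f K by (auto intro: nice_measurable)
  let ?c = "1 + 4 * A * 4 ^ DIM('a) + 2 * H * (1 + 2 ^ DIM('a))"
  have "pint p (%x. norm (conv K f x)) <= ennreal (?c * (p / (p - 1) + p / (2 - p))) * pint p (dmf f)"
  proof (rule strong_type_of_distribution_bound)
   fix l :: real assume "l > 0"
   then show "emeasure lborel {x. l < norm (conv K f x)} <= ennreal ?c * (NN x. ennreal (kap 2 (dmf f x / l)))"
    using A H by (intro cz_distribution[OF K _ _ _ _ f]) auto
  qed (use p A H in \<open>auto simp: dmf_nonneg\<close>)
  also have "... <= ennreal (c1 * (1 + A + H)) * pint p (dmf f)"
  proof (intro mult_right_mono ennreal_leI)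
   define X where "X = (4::real) * 4 ^ DIM('a) + 2 * (1 + 2 ^ DIM('a))"
   have "1 <= X" by (simp add: X_def add_increasing)
   moreover have "A * (4 * 4 ^ DIM('a)) <= A * X" using A by (intro mult_left_mono) (auto simp: X_def)
   moreover have "H * (2 * (1 + 2 ^ DIM('a))) <= H * X" using H by (intro mult_left_mono) (auto simp: X_def)
   ultimately have "?c <= X + A * X + H * X" by (simp only: mult_ac)
   also have "... = X * (1 + A + H)" by (simp add: algebra_simps)
   finally have "?c <= (4 * 4 ^ DIM('a) + 2 * (1 + 2 ^ DIM('a))) * (1 + A + H)" by (simp only: X_def)
   then have "?c * (p / (p - 1) + p / (2 - p)) <= ((4 * 4 ^ DIM('a) + 2 * (1 + 2 ^ DIM('a))) * (1 + A + H)) * (p / (p - 1) + p / (2 - p))"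
    using p by (intro mult_right_mono) auto
   then show "?c * (p / (p - 1) + p / (2 - p)) <= c1 * (1 + A + H)" by (simp add: c1_def ac_simps)
  qed auto
  also have "pint p (dmf f) = ennreal (((3 * real DIM('a)) ^ DIM('a)) powr p) * pint p (mf f)" unfolding dmf_def by (rule pint_cmult) auto
  also have "ennreal (c1 * (1 + A + H)) * (ennreal (((3 * real DIM('a)) ^ DIM('a)) powr p) * pint p (mf f))
   <= ennreal (c1 * (1 + A + H)) * (ennreal (((3 * real DIM('a)) ^ DIM('a)) powr p) * (ennreal (10 ^ DIM('a) * (p / (p - 1) + p) * (2 ^ (DIM('a) + 1)) powr p) * pint p f))"
   using p by (intro mult_left_mono maximal_theorem) auto
  also have "... = ennreal (c1 * (1 + A + H) * c2) * pint p f" using c0 A H p by (simp add: c2_def mult.assoc[symmetric] ennreal_mult'[symmetric])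
  also have "c1 * (1 + A + H) * c2 = c1 * c2 * (1 + A + H)" by simp
  finally show ?thesis by (simp add: pint_cnorm)
 qed
 then show ?thesis using c0 by (intro exI[of _ "c1 * c2"]) auto
qed

section \<open>Khintchine's inequality\<close>

definition rsign :: "int set => int => real" where
 "rsign S j = (if j \<in> S then 1 else -1)"

text \<open>Splitting the subsets by membership of one index, which carries all moments of the random sum by induction.\<close>
lemma sum_signs_insert:
 fixes a :: "int => real" and \<phi> :: "real => real"
 assumes "finite J" "j \<notin> J"
 shows "(\<Sum>S\<in>Pow (insert j J). \<phi> (\<Sum>i\<in>insert j J. rsign S i * a i))
  = (\<Sum>S\<in>Pow J. \<phi> ((\<Sum>i\<in>J. rsign S i * a i) + a j) + \<phi> ((\<Sum>i\<in>J. rsign S i * a i) - a j))"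
proof -
 have inj: "inj_on (insert j) (Pow J)" using assms(2) by (intro inj_onI) (auto dest: insert_ident[THEN iffD1, rotated 2])
 have disj: "Pow J \<inter> insert j ` Pow J = {}" using assms(2) by auto
 have eq: "(\<Sum>i\<in>J. rsign (insert j S) i * a i) = (\<Sum>i\<in>J. rsign S i * a i)" for S
  using assms(2) by (intro sum.cong) (auto simp: rsign_def)
 have "(\<Sum>S\<in>Pow (insert j J). \<phi> (\<Sum>i\<in>insert j J. rsign S i * a i))
  = (\<Sum>S\<in>Pow J. \<phi> (\<Sum>i\<in>insert j J. rsign S i * a i)) + (\<Sum>S\<in>insert j ` Pow J. \<phi> (\<Sum>i\<in>insert j J. rsign S i * a i))"
  unfolding Pow_insert using assms(1) disj by (intro sum.union_disjoint) auto
 also have "(\<Sum>S\<in>insert j ` Pow J. \<phi> (\<Sum>i\<in>insert j J. rsign S i * a i)) = (\<Sum>S\<in>Pow J. \<phi> ((\<Sum>i\<in>J. rsign S i * a i) + a j))"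
  unfolding sum.reindex[OF inj] using assms by (intro sum.cong refl) (simp add: eq, simp add: rsign_def add.commute)
 also have "(\<Sum>S\<in>Pow J. \<phi> (\<Sum>i\<in>insert j J. rsign S i * a i)) = (\<Sum>S\<in>Pow J. \<phi> ((\<Sum>i\<in>J. rsign S i * a i) - a j))"
 proof (intro sum.cong refl)
  fix S assume "S \<in> Pow J"
  then have "j \<notin> S" using assms(2) by auto
  then show "\<phi> (\<Sum>i\<in>insert j J. rsign S i * a i) = \<phi> ((\<Sum>i\<in>J. rsign S i * a i) - a j)" using assms by (simp add: rsign_def)
 qed
 finally show ?thesis by (simp add: sum.distrib add.commute)
qed

lemma sign_moments:
 fixes a :: "int => real"
 assumes "finite J"
 shows "(\<Sum>S\<in>Pow J. (\<Sum>i\<in>J. rsign S i * a i) ^ 2) = 2 ^ card J * (\<Sum>i\<in>J. (a i)\<^sup>2)"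
  "(\<Sum>S\<in>Pow J. (\<Sum>i\<in>J. rsign S i * a i) ^ 4) <= 3 * 2 ^ card J * (\<Sum>i\<in>J. (a i)\<^sup>2)^2" using assms
proof (induction J rule: finite_induct)
 case empty
 {
  case 1
  then show ?case by simp
 next
  case 2
  then show ?case by simp
 }
next
 case (insert j J)
 let ?X = "%S. \<Sum>i\<in>J. rsign S i * a i"
 let ?s = "\<Sum>i\<in>J. (a i)\<^sup>2"
 have 2: "(\<Sum>S\<in>Pow J. 2 * ?X S ^ 2 + 2 * (a j)^2) = 2 ^ card (insert j J) * (?s + (a j)^2)"
  using insert by (simp add: sum.distrib sum_distrib_left[symmetric] card_Pow algebra_simps)
 {
  case 1
  have "(\<Sum>S\<in>Pow (insert j J). (\<Sum>i\<in>insert j J. rsign S i * a i) ^ 2) = (\<Sum>S\<in>Pow J. (?X S + a j) ^ 2 + (?X S - a j) ^ 2)"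
   by (rule sum_signs_insert) (use insert in auto)
  also have "... = (\<Sum>S\<in>Pow J. 2 * ?X S ^ 2 + 2 * (a j)^2)" by (intro sum.cong refl) (simp add: power2_eq_square algebra_simps)
  finally show ?case using 2 insert by (simp add: add.commute)
 next
  case 2
  have "(\<Sum>S\<in>Pow (insert j J). (\<Sum>i\<in>insert j J. rsign S i * a i) ^ 4) = (\<Sum>S\<in>Pow J. (?X S + a j) ^ 4 + (?X S - a j) ^ 4)"
   by (rule sum_signs_insert) (use insert in auto)
  also have "... = (\<Sum>S\<in>Pow J. 2 * ?X S ^ 4 + 12 * (a j)^2 * ?X S ^ 2 + 2 * (a j) ^ 4)"
   by (intro sum.cong refl) (simp add: power4_eq_xxxx power2_eq_square algebra_simps)
  also have "... = 2 * (\<Sum>S\<in>Pow J. ?X S ^ 4) + 12 * (a j)^2 * (\<Sum>S\<in>Pow J. ?X S ^ 2) + 2 ^ card J * (2 * (a j) ^ 4)"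
   using insert by (simp add: sum.distrib sum_distrib_left[symmetric] card_Pow)
  also have "... <= 2 * (3 * 2 ^ card J * ?s\<^sup>2) + 12 * (a j)^2 * (2 ^ card J * ?s) + 2 ^ card J * (2 * (a j) ^ 4)"
   using insert by (intro add_right_mono mult_left_mono add_mono) auto
  also have "... <= 3 * 2 ^ card (insert j J) * (?s + (a j)^2)^2"
  proof -
   have "0 <= 4 * 2 ^ card J * (a j) ^ 4" by simp
   moreover have "3 * 2 ^ card (insert j J) * (?s + (a j)^2)^2
    = 2 * (3 * 2 ^ card J * ?s\<^sup>2) + 12 * (a j)^2 * (2 ^ card J * ?s) + 2 ^ card J * (2 * (a j) ^ 4) + 4 * 2 ^ card J * (a j) ^ 4"
    using insert by (simp add: power4_eq_xxxx power2_eq_square algebra_simps)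
   ultimately show ?thesis by linarith
  qed
  finally show ?case using insert by (simp add: add.commute)
 }
qed

text \<open>The second moment is exact and the fourth is at most three times its square. Since \<open>|t|\<close> lies above
 \<open>3/2 t\<^sup>2 - 1/2 t\<^sup>4\<close>, applied at scale \<open>\<tau>\<close>, the first moment cannot be small.\<close>
lemma khintchine_real:
 fixes a :: "int => real"
 assumes J: "finite J"
 shows "2 ^ card J * L2_set a J <= 2 * (\<Sum>S\<in>Pow J. \<bar>\<Sum>i\<in>J. rsign S i * a i\<bar>)"
proof (cases "L2_set a J = 0")
 case True
 then show ?thesis by (simp add: sum_nonneg)
next
 case False
 let ?X = "%S. \<Sum>i\<in>J. rsign S i * a i"
 define \<sigma> where "\<sigma> = L2_set a J"
 define \<tau> where "\<tau> = 2 * \<sigma>"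
 have \<sigma>: "\<sigma> > 0" using False L2_set_nonneg[of a J] by (simp add: \<sigma>_def less_le)
 have s2: "(\<Sum>i\<in>J. (a i)\<^sup>2) = \<sigma>\<^sup>2" by (simp add: \<sigma>_def L2_set_def sum_nonneg)
 have pw: "\<bar>t\<bar> >= 3 / 2 * (t\<^sup>2 / \<tau>) - 1 / 2 * (t ^ 4 / \<tau> ^ 3)" for t
 proof -
  define u where "u = \<bar>t\<bar> / \<tau>"
  have \<tau>: "\<tau> > 0" using \<sigma> by (simp add: \<tau>_def)
  have t: "\<bar>t\<bar> = u * \<tau>" using \<tau> by (simp add: u_def)
  have "0 <= (u - 1)^2 * (u + 2) * u" using \<tau> by (intro mult_nonneg_nonneg add_nonneg_nonneg) (auto simp: u_def)
  also have "... = 2 * u - 3 * u\<^sup>2 + u ^ 4" by (simp add: power2_eq_square power4_eq_xxxx algebra_simps)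
  finally have "u >= 3 / 2 * u\<^sup>2 - 1 / 2 * u ^ 4" by simp
  then have "u * \<tau> >= (3 / 2 * u\<^sup>2 - 1 / 2 * u ^ 4) * \<tau>" using \<tau> by (intro mult_right_mono) auto
  moreover have "t\<^sup>2 / \<tau> = u\<^sup>2 * \<tau>" "t ^ 4 / \<tau> ^ 3 = u ^ 4 * \<tau>"
  proof -
   have "t\<^sup>2 = (u * \<tau>)^2" using t by (metis power2_abs)
   then show "t\<^sup>2 / \<tau> = u\<^sup>2 * \<tau>" using \<tau> by (simp add: power2_eq_square)
   have "t ^ 4 = (u * \<tau>) ^ 4" using t by (metis power_even_abs even_numeral)
   then show "t ^ 4 / \<tau> ^ 3 = u ^ 4 * \<tau>" using \<tau> by (simp add: power4_eq_xxxx power3_eq_cube)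
  qed
  ultimately show ?thesis using t by (simp add: algebra_simps)
 qed
 have \<tau>: "\<tau> > 0" using \<sigma> by (simp add: \<tau>_def)
 have "2 ^ card J * (\<sigma> / 2) <= 2 ^ card J * (3 / 2 * (\<sigma>\<^sup>2 / \<tau>) - 1 / 2 * (3 * \<sigma> ^ 4 / \<tau> ^ 3))"
  using \<sigma> by (intro mult_left_mono) (auto simp: \<tau>_def power2_eq_square power3_eq_cube power4_eq_xxxx)
 also have "... = 3 / 2 * (2 ^ card J * \<sigma>\<^sup>2 / \<tau>) - 1 / 2 * (3 * 2 ^ card J * (\<sigma>\<^sup>2)^2 / \<tau> ^ 3)"
  by (simp add: algebra_simps)
 also have "... <= 3 / 2 * ((\<Sum>S\<in>Pow J. ?X S ^ 2) / \<tau>) - 1 / 2 * ((\<Sum>S\<in>Pow J. ?X S ^ 4) / \<tau> ^ 3)"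
  using sign_moments[OF J, of a] \<tau> unfolding s2 by (intro diff_mono mult_left_mono divide_right_mono) auto
 also have "... = (\<Sum>S\<in>Pow J. 3 / 2 * (?X S ^ 2 / \<tau>) - 1 / 2 * (?X S ^ 4 / \<tau> ^ 3))"
  by (simp add: sum_subtractf sum_distrib_left sum_divide_distrib)
 also have "... <= (\<Sum>S\<in>Pow J. \<bar>?X S\<bar>)" by (intro sum_mono pw)
 finally show ?thesis by (simp add: \<sigma>_def)
qed

lemma khintchine:
 fixes a :: "int => complex"
 assumes J: "finite J"
 shows "2 ^ card J * L2_set (%j. norm (a j)) J <= 4 * (\<Sum>S\<in>Pow J. norm (\<Sum>i\<in>J. cx (rsign S i) * a i))"
proof -
 have "L2_set (%j. norm (a j)) J <= L2_set (%j. \<bar>Re (a j)\<bar> + \<bar>Im (a j)\<bar>) J" by (intro L2_set_mono) (auto simp: cmod_le)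
 also have "... <= L2_set (%j. \<bar>Re (a j)\<bar>) J + L2_set (%j. \<bar>Im (a j)\<bar>) J" by (rule L2_set_triangle_ineq)
 also have "... = L2_set (%j. Re (a j)) J + L2_set (%j. Im (a j)) J" by (simp add: L2_set_def)
 finally have "2 ^ card J * L2_set (%j. norm (a j)) J <= 2 ^ card J * (L2_set (%j. Re (a j)) J + L2_set (%j. Im (a j)) J)"
  by (intro mult_left_mono) auto
 also have "... <= 2 * (\<Sum>S\<in>Pow J. \<bar>\<Sum>i\<in>J. rsign S i * Re (a i)\<bar>) + 2 * (\<Sum>S\<in>Pow J. \<bar>\<Sum>i\<in>J. rsign S i * Im (a i)\<bar>)"
  using khintchine_real[OF J, of "%j. Re (a j)"] khintchine_real[OF J, of "%j. Im (a j)"] by (simp add: distrib_left)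
 also have "... <= 2 * (\<Sum>S\<in>Pow J. norm (\<Sum>i\<in>J. cx (rsign S i) * a i)) + 2 * (\<Sum>S\<in>Pow J. norm (\<Sum>i\<in>J. cx (rsign S i) * a i))"
 proof (intro add_mono mult_left_mono sum_mono)
  fix S
  have "(\<Sum>i\<in>J. rsign S i * Re (a i)) = Re (\<Sum>i\<in>J. cx (rsign S i) * a i)" by simp
  then show "\<bar>\<Sum>i\<in>J. rsign S i * Re (a i)\<bar> <= norm (\<Sum>i\<in>J. cx (rsign S i) * a i)" by (metis abs_Re_le_cmod)
  have "(\<Sum>i\<in>J. rsign S i * Im (a i)) = Im (\<Sum>i\<in>J. cx (rsign S i) * a i)" by simp
  then show "\<bar>\<Sum>i\<in>J. rsign S i * Im (a i)\<bar> <= norm (\<Sum>i\<in>J. cx (rsign S i) * a i)" by (metis abs_Im_le_cmod)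
 qed auto
 finally show ?thesis by simp
qed

section \<open>Families of dilated kernels\<close>

definition sc :: "int => ('a::euclidean_space => complex) => 'a => complex" where
 "sc j A = (%\<xi>. A (\<xi> /\<^sub>R (2 powi j)))"

text \<open>The shift \<open>w\<close> is measured in units of the wavelength \<open>2\<^sup>-\<^sup>j\<close>, the form in which it occurs in \<open>high_low\<close>.\<close>
definition dk :: "('a::euclidean_space => complex) => 'a => int => 'a => complex" where
 "dk A w j = (%x. ft (sc j A) (x - w /\<^sub>R (2 powi j)))"

abbreviation "dconv A w j \<equiv> conv (dk A w j)"

lemma sc_bumps: "A \<in> bumps ==> sc j A \<in> bumps" unfolding sc_def by (rule bumps_scale) auto

lemma ft_sc: "ft (sc j A) x = cx ((2 powi j) ^ DIM('a)) * ft A ((2 powi j) *\<^sub>R x)" for x :: "'a::euclidean_space"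
proof -
 let ?t = "(2::real) powi j"
 have "(LI \<xi>. iexp ((?t *\<^sub>R x) \<bullet> (0 + (1 / ?t) *\<^sub>R \<xi>)) * A (0 + (1 / ?t) *\<^sub>R \<xi>))
  = (1 / \<bar>1 / ?t\<bar> ^ DIM('a)) *\<^sub>R ft A (?t *\<^sub>R x)" unfolding ft_def by (rule integral_lborel_affine) simp
 then show ?thesis by (simp add: ft_def sc_def power_divide scaleR_conv_of_real inverse_eq_divide)
qed

lemma dk_eq: "dk A w j x = cx ((2 powi j) ^ DIM('a)) * ft A ((2 powi j) *\<^sub>R x - w)" for x :: "'a::euclidean_space"
 by (simp add: dk_def ft_sc scaleR_diff_right)

lemma schwartz_translate_nice: "A \<in> schwartz ==> nice (%x. ft A (x - w))" for w :: "'a::euclidean_space"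
 using schwartz_nice[OF ft_schwartz[of A]] integrable_translate[of "ft A" w] unfolding nice_def by blast

lemma dk_nice: "A \<in> bumps ==> nice (dk A w j)" unfolding dk_def by (intro schwartz_translate_nice bumps_schwartz sc_bumps)

lemma sum_min_dyadic:
 assumes "finite J" "R > (0::real)"
 shows "(\<Sum>j\<in>J. min (2 powi j * R) (1 / (2 powi j * R))) <= 4"
proof -
 define m where "m = \<lfloor>log 2 (1 / R)\<rfloor>"
 have m1: "2 powi m * R <= 1"
 proof -
  have "2 powr real_of_int m <= 2 powr log 2 (1 / R)" unfolding m_def by (intro powr_mono) auto
  then show ?thesis using assms(2) by (simp add: powr_real_of_int' pos_le_divide_eq)
 qed
 have m2: "1 <= 2 powi (m + 1) * R"
 proof -
  have "2 powr log 2 (1 / R) <= 2 powr real_of_int (m + 1)" unfolding m_def by (intro powr_mono) linarith+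
  then have "1 <= 2 powr real_of_int (m + 1) * R" using assms(2) by (simp add: pos_divide_le_eq)
  then show ?thesis using powr_real_of_int'[of 2 "m + 1"] by simp
 qed
 have geo: "(\<Sum>i\<in>I. (1 / 2 :: real) ^ i) <= 2" if "finite I" for I :: "nat set"
 proof -
  have "(\<Sum>i\<in>I. (1 / 2 :: real) ^ i) <= (\<Sum>i. (1 / 2 :: real) ^ i)"
   by (rule sum_le_suminf) (use that in \<open>auto intro: summable_geometric\<close>)
  also have "... = 2" by (subst suminf_geometric) auto
  finally show ?thesis .
 qed
 let ?F = "%j. min (2 powi j * R) (1 / (2 powi j * R))"
 let ?A = "{j\<in>J. j <= m}" and ?B = "{j\<in>J. m < j}"
 have "(\<Sum>j\<in>?A. ?F j) <= (\<Sum>j\<in>?A. (1 / 2) ^ nat (m - j))"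
 proof (intro sum_mono)
  fix j assume j: "j \<in> ?A"
  have "(2::real) powi j = 2 powi m * (1 / 2) ^ nat (m - j)"
  proof -
   have "(2::real) powi m = 2 powi (j + (m - j))" by simp
   also have "... = 2 powi j * 2 powi (m - j)" by (rule power_int_add) simp
   also have "(2::real) powi (m - j) = 2 ^ nat (m - j)" using j by (simp add: power_int_def)
   finally show ?thesis by (simp add: power_divide)
  qed
  then have "2 powi j * R = (2 powi m * R) * (1 / 2) ^ nat (m - j)" by simp
  also have "... <= 1 * (1 / 2) ^ nat (m - j)" by (intro mult_right_mono m1) auto
  finally show "?F j <= (1 / 2) ^ nat (m - j)" by simp
 qed
 also have "... = (\<Sum>i\<in>(%j. nat (m - j)) ` ?A. (1 / 2) ^ i)" by (subst sum.reindex) (auto simp: inj_on_def)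
 also have "... <= 2" by (rule geo) (use assms in auto)
 finally have 1: "(\<Sum>j\<in>?A. ?F j) <= 2" .
 have "(\<Sum>j\<in>?B. ?F j) <= (\<Sum>j\<in>?B. (1 / 2) ^ nat (j - (m + 1)))"
 proof (intro sum_mono)
  fix j assume j: "j \<in> ?B"
  have "(2::real) powi j = 2 powi (m + 1 + (j - (m + 1)))" by simp
  also have "... = 2 powi (m + 1) * 2 powi (j - (m + 1))" by (rule power_int_add) simp
  also have "(2::real) powi (j - (m + 1)) = 2 ^ nat (j - (m + 1))" using j by (simp add: power_int_def)
  finally have e: "2 powi j * R = (2 powi (m + 1) * R) * 2 ^ nat (j - (m + 1))" by simp
  have "1 * 2 ^ nat (j - (m + 1)) <= 2 powi j * R" unfolding e by (intro mult_right_mono m2) auto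
  then have "1 / (2 powi j * R) <= 1 / 2 ^ nat (j - (m + 1))" by (intro divide_left_mono) (use assms in auto)
  then show "?F j <= (1 / 2) ^ nat (j - (m + 1))" by (simp add: power_divide)
 qed
 also have "... = (\<Sum>i\<in>(%j. nat (j - (m + 1))) ` ?B. (1 / 2) ^ i)" by (subst sum.reindex) (auto simp: inj_on_def)
 also have "... <= 2" by (rule geo) (use assms in auto)
 finally have 2: "(\<Sum>j\<in>?B. ?F j) <= 2" .
 have "(\<Sum>j\<in>J. ?F j) = (\<Sum>j\<in>?A \<union> ?B. ?F j)" by (intro sum.cong) auto
 also have "... = (\<Sum>j\<in>?A. ?F j) + (\<Sum>j\<in>?B. ?F j)" using assms(1) by (intro sum.union_disjoint) auto
 finally show ?thesis using 1 2 by linarith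
qed

definition annular :: "('a::euclidean_space => complex) => bool" where
 "annular A \<longleftrightarrow> A \<in> bumps & (\<forall>\<xi>. norm \<xi> < 1 / 2 --> A \<xi> = 0) & (\<forall>\<xi>. norm \<xi> > 1.1 --> A \<xi> = 0)"

lemma sc_annular:
 assumes "annular A" "sc j A \<xi> ~= 0"
 shows "2 powi j / 2 <= norm \<xi>" "norm \<xi> <= 1.1 * 2 powi j"
proof -
 have "\<not> norm (\<xi> /\<^sub>R (2 powi j)) < 1 / 2" "\<not> norm (\<xi> /\<^sub>R (2 powi j)) > 1.1"
  using assms unfolding annular_def sc_def by blast+
 then show "2 powi j / 2 <= norm \<xi>" "norm \<xi> <= 1.1 * 2 powi j" by (simp_all add: field_simps not_less)
qed

lemma sc_annular_disjoint:
 assumes A: "annular A" "annular B" and ij: "\<bar>i - j\<bar> >= 2"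
 shows "sc i A \<xi> * cnj (sc j B \<xi>) = 0"
proof (rule ccontr)
 assume "sc i A \<xi> * cnj (sc j B \<xi>) ~= 0"
 then have nz: "sc i A \<xi> ~= 0" "sc j B \<xi> ~= 0" by auto
 have *: "(2::real) powi a * 4 <= 2 powi b" if "a + 2 <= b" for a b :: int
 proof -
  have "(2::real) powi (a + 2) <= 2 powi b" using that by (intro power_int_increasing) auto
  moreover have "(2::real) powi (a + 2) = 2 powi a * 4" by (subst power_int_add) auto
  ultimately show ?thesis by simp
 qed
 note b = sc_annular[OF A(1) nz(1)] sc_annular[OF A(2) nz(2)]
 have p: "(2::real) powi i > 0" "(2::real) powi j > 0" by auto
 show False
 proof (cases "i + 2 <= j")
  case True
  from *[OF this] b p show False by simp
 next
  case False
  then have "j + 2 <= i" using ij by linarith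
  from *[OF this] b p show False by simp
 qed
qed

definition kfam :: "('a::euclidean_space => complex) => 'a => int set => int set => 'a => complex" where
 "kfam A w J S x = (\<Sum>j\<in>J. cx (rsign S j) * dk A w j x)"

lemma abs_rsign: "\<bar>rsign S j\<bar> = 1" by (simp add: rsign_def)

lemma kfam_nice: "A \<in> bumps ==> finite J ==> nice (kfam A w J S)" unfolding kfam_def by (intro nice_sum nice_cmult dk_nice)

lemma conv_kfam:
 assumes A: "A \<in> bumps" and J: "finite J" and i: "!!j. j \<in> J ==> integrable lborel (%y. dk A w j (x - y) * f y)"
 shows "conv (kfam A w J S) f x = (\<Sum>j\<in>J. cx (rsign S j) * dconv A w j f x)"
proof -
 have "conv (kfam A w J S) f x = (LI y. (\<Sum>j\<in>J. cx (rsign S j) * (dk A w j (x - y) * f y)))"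
  unfolding conv_def kfam_def by (simp add: sum_distrib_right mult.assoc)
 also have "... = (\<Sum>j\<in>J. LINT y|lborel. cx (rsign S j) * (dk A w j (x - y) * f y))"
  by (rule Bochner_Integration.integral_sum) (use i in auto)
 finally show ?thesis by (simp add: conv_def)
qed

text \<open>Only neighbouring scales have overlapping frequency supports, and a change of signs does not affect
 orthogonality.\<close>

lemma kfam_L2:
 fixes A :: "'a::euclidean_space => complex"
 assumes A: "annular A"
 shows "\<exists>C\<ge>0. \<forall>w J S g. finite J --> nice g --> nsq (conv (kfam A w J S) g) <= C * nsq g"
proof -
 have Ab: "A \<in> bumps" using A by (simp add: annular_def)
 define M where "M = 1 + (LI x. norm (ft A x))"
 have M: "M > 0" unfolding M_def by (intro add_pos_nonneg integral_nonneg_AE) auto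
 have n1: "(LI x. norm (ft (sc j A) x)) <= M" for j
 proof -
  let ?t = "(2::real) powi j"
  have "(LI x. norm (ft (sc j A) x)) = ?t ^ DIM('a) * (LI x. norm (ft A (0 + ?t *\<^sub>R x)))"
   by (simp add: ft_sc norm_mult norm_power norm_power_int)
  also have "(LI x. norm (ft A (0 + ?t *\<^sub>R x))) = (1 / \<bar>?t\<bar> ^ DIM('a)) *\<^sub>R (LI x. norm (ft A x))"
   by (rule integral_lborel_affine) simp
  finally show ?thesis by (simp add: M_def)
 qed
 have "nsq (conv (kfam A w J S) g) <= (4 * M\<^sup>2) * nsq g" if J: "finite J" and g: "nice g" for w J S g
 proof -
  define F where "F j x = cx (rsign S j) * dconv A w j g x" for j x
  have nF: "nice (F j)" for j unfolding F_def by (intro nice_cmult nice_conv dk_nice Ab g)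
  have eq: "conv (kfam A w J S) g = (%x. \<Sum>j\<in>J. F j x)"
   unfolding F_def by (rule ext, rule conv_kfam[OF Ab J nice_translate_mult(1)[OF dk_nice[OF Ab] g]])
  have "nsq (conv (kfam A w J S) g) <= 2 * (\<Sum>j\<in>J. nsq (F j))" unfolding eq
  proof (rule almost_orthogonal[OF J nF])
   fix i j :: int assume ij: "\<bar>i - j\<bar> >= 2"
   have "ip (dconv A w i g) (dconv A w j g) = 0"
    unfolding dk_def by (rule ip_conv_zero) (use sc_annular_disjoint[OF A A ij] g Ab in \<open>auto intro: bumps_schwartz sc_bumps\<close>)
   then have "(LI x. (cx (rsign S i) * cnj (cx (rsign S j))) * (dconv A w i g x * cnj (dconv A w j g x))) = 0"
    unfolding ip_def by (simp only: integral_mult_right_zero mult_zero_right)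
   then show "ip (F i) (F j) = 0" unfolding ip_def F_def by (simp add: mult_ac)
  qed
  also have "(\<Sum>j\<in>J. nsq (F j)) = (\<Sum>j\<in>J. nsq (dconv A w j g))" by (simp add: nsq_def F_def norm_mult abs_rsign)
  also have "(\<Sum>j\<in>J. nsq (dconv A w j g)) <= 2 * M\<^sup>2 * nsq g" unfolding dk_def
   by (rule sum_nsq_conv_le[OF J _ _ n1 M g]) (use sc_annular_disjoint[OF A A] Ab in \<open>auto intro: bumps_schwartz sc_bumps\<close>)
  finally show ?thesis by simp
 qed
 then show ?thesis by (intro exI[of _ "4 * M\<^sup>2"]) auto
qed

text \<open>Hoermander's condition: at each scale the difference of the kernel is small either because the
 shift is small at that scale or because the ball removed is large, and these two bounds sum to a
 convergent series.\<close>

lemma kfam_hoermander: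
 fixes A :: "'a::euclidean_space => complex"
 assumes A: "A \<in> bumps"
 shows "\<exists>C\<ge>0. \<forall>w J S R h. finite J --> R > 0 --> norm h <= R / 2 -->
  (NN x. enorm (kfam A w J S (x - h) - kfam A w J S x) * indicator {x. norm x >= R} x) <= ennreal (C * (1 + norm w))"
proof -
 let ?a = "ft A"
 have aS: "?a \<in> schwartz" by (intro ft_schwartz bumps_schwartz A)
 have [measurable]: "meas (?a)" by (rule schwartz_measurable[OF aS])
 obtain B1 where B1: "B1 >= 0" "!!h. (NN x. enorm (?a (x + h) - ?a x)) <= ennreal (B1 * norm h)" using schwartz_L1_lipschitz[OF aS] by blast
 obtain B2 where B2: "B2 >= 0" "!!x. (1 + norm x) ^ 1 * norm (?a x) <= B2 * wgt x" using schwartz_wgt_bound[OF aS, of 1] by blast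
 define I where "I = integral\<^sup>L lborel (%x::'a. wgt x)"
 have I: "I >= 0" unfolding I_def by (auto intro!: integral_nonneg_AE simp: wgt_nonneg)
 define C where "C = B1 + 4 * (B2 * I)"
 have C0: "C >= 0" using B1 B2 I by (simp add: C_def)
 have mom: "(NN u. ennreal (norm (u + w) * norm (?a u))) <= ennreal ((1 + norm w) * (B2 * I))" for w
 proof -
  have "(NN u. ennreal (norm (u + w) * norm (?a u))) <= (NN u. ennreal (((1 + norm w) * B2) * wgt (u::'a)))"
  proof (intro nn_integral_mono ennreal_leI)
   fix u :: 'a
   have "norm (u + w) <= norm u + norm w" by (rule norm_triangle_ineq)
   also have "... <= (1 + norm w) * (1 + norm u)" by (simp add: algebra_simps)
   finally have "norm (u + w) * norm (?a u) <= (1 + norm w) * (1 + norm u) * norm (?a u)" by (intro mult_right_mono) auto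
   also have "... = (1 + norm w) * ((1 + norm u) ^ 1 * norm (?a u))" by simp
   also have "... <= (1 + norm w) * (B2 * wgt u)" by (intro mult_left_mono B2) auto
   finally show "norm (u + w) * norm (?a u) <= ((1 + norm w) * B2) * wgt u" by (simp only: mult.assoc)
  qed
  also have "... = ennreal (((1 + norm w) * B2) * I)" using B2 by (subst nn_integral_eq_integral) (auto simp: I_def wgt_nonneg integrable_wgt)
  finally show ?thesis by (simp only: mult.assoc)
 qed
 have one: "(NN x. enorm (dk A w j (x - h) - dk A w j x) * indicator {x. norm x >= R} x)
   <= ennreal (C * (1 + norm w) * min (2 powi j * R) (1 / (2 powi j * R)))" if R: "R > 0" and h: "norm h <= R / 2" for w h :: 'a and j R
 proof -
  let ?t = "(2::real) powi j"
  let ?d = "?t ^ DIM('a)"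
  have t: "?t > 0" by simp
  have [measurable]: "meas (dk A w j)" by (rule nice_measurable[OF dk_nice[OF A]])
  have nd: "norm (dk A w j x) = ?d * norm (?a (?t *\<^sub>R x - w))" for x by (simp add: dk_eq norm_mult norm_power norm_power_int)
  have small: "(NN x. enorm (dk A w j (x - h) - dk A w j x) * indicator {x. norm x >= R} x) <= ennreal (C * (1 + norm w) * (?t * R))"
  proof -
   have "(NN x. enorm (dk A w j (x - h) - dk A w j x) * indicator {x. norm x >= R} x)
    <= (NN x. ennreal ?d * enorm (?a ((- w + ?t *\<^sub>R x) + (- (?t *\<^sub>R h))) - ?a (- w + ?t *\<^sub>R x)))"
   proof (intro nn_integral_mono)
    fix x
    have "norm (dk A w j (x - h) - dk A w j x) = ?d * norm (?a ((- w + ?t *\<^sub>R x) + (- (?t *\<^sub>R h))) - ?a (- w + ?t *\<^sub>R x))"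
    proof -
     have e1: "dk A w j (x - h) = cx ?d * ?a ((- w + ?t *\<^sub>R x) + (- (?t *\<^sub>R h)))" by (simp add: dk_eq scaleR_diff_right algebra_simps)
     have e2: "dk A w j x = cx ?d * ?a (- w + ?t *\<^sub>R x)" by (simp add: dk_eq)
     show ?thesis unfolding e1 e2 right_diff_distrib[symmetric] norm_mult by (simp add: norm_power norm_power_int)
    qed
    then show "enorm (dk A w j (x - h) - dk A w j x) * indicator {x. norm x >= R} x <= ennreal ?d * enorm (?a ((- w + ?t *\<^sub>R x) + (- (?t *\<^sub>R h))) - ?a (- w + ?t *\<^sub>R x))"
     by (simp add: ennreal_mult' indicator_def)
   qed
   also have "... = ennreal ?d * (ennreal (1 / \<bar>?t\<bar> ^ DIM('a)) * (NN u. enorm (?a (u + (- (?t *\<^sub>R h))) - ?a u)))"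
    by (subst nn_integral_cmult, measurable, subst nn_integral_lborel_affine[of "%u. enorm (?a (u + (- (?t *\<^sub>R h))) - ?a u)" ?t "- w"]) auto
   also have "... = (NN u. enorm (?a (u + (- (?t *\<^sub>R h))) - ?a u))" by (simp add: mult.assoc[symmetric] ennreal_mult'[symmetric])
   also have "... <= ennreal (B1 * norm (- (?t *\<^sub>R h)))" by (rule B1)
   also have "... <= ennreal (C * (1 + norm w) * (?t * R))"
   proof (intro ennreal_leI)
    have "norm (- (?t *\<^sub>R h)) <= ?t * R" using h R by simp
    then have "B1 * norm (- (?t *\<^sub>R h)) <= B1 * (?t * R)" using B1 by (intro mult_left_mono) auto
    also have "... <= (C * (1 + norm w)) * (?t * R)"
    proof (rule mult_right_mono)
     have "B1 <= C * 1" using B2 I by (simp add: C_def)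
     also have "... <= C * (1 + norm w)" using C0 by (intro mult_left_mono) auto
     finally show "B1 <= C * (1 + norm w)" .
    qed (use R in auto)
    finally show "B1 * norm (- (?t *\<^sub>R h)) <= C * (1 + norm w) * (?t * R)" .
   qed
   finally show ?thesis .
  qed
  have large: "(NN x. enorm (dk A w j (x - h) - dk A w j x) * indicator {x. norm x >= R} x) <= ennreal (C * (1 + norm w) * (1 / (?t * R)))"
  proof -
   define G where "G x = ennreal (2 / R * (norm x * norm (dk A w j x)))" for x
   have [measurable]: "meas G" unfolding G_def by measurable
   have GI: "(NN x. G x) <= ennreal (2 / R * (1 / ?t * ((1 + norm w) * (B2 * I))))"
   proof -
    have "(NN x. G x) = (NN x. ennreal (2 / R * (?d / ?t)) * ennreal (norm ((- w + ?t *\<^sub>R x) + w) * norm (?a (- w + ?t *\<^sub>R x))))"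
     unfolding G_def nd using R by (intro nn_integral_cong) (simp add: ennreal_mult'[symmetric])
    also have "... = ennreal (2 / R * (?d / ?t)) * (ennreal (1 / \<bar>?t\<bar> ^ DIM('a)) * (NN u. ennreal (norm (u + w) * norm (?a u))))"
     by (subst nn_integral_cmult, measurable, subst nn_integral_lborel_affine[of "%u. ennreal (norm (u + w) * norm (?a u))" ?t "- w"]) auto
    also have "... <= ennreal (2 / R * (?d / ?t)) * (ennreal (1 / \<bar>?t\<bar> ^ DIM('a)) * ennreal ((1 + norm w) * (B2 * I)))"
     by (intro mult_left_mono mom) auto
    also have "... = ennreal (2 / R * (1 / ?t * ((1 + norm w) * (B2 * I))))" using R B2 I by (simp add: ennreal_mult'[symmetric])
    finally show ?thesis .
   qed
   have "(NN x. enorm (dk A w j (x - h) - dk A w j x) * indicator {x. norm x >= R} x)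
    <= (NN x. G (x - h) + G x)"
   proof (intro nn_integral_mono)
    fix x
    show "enorm (dk A w j (x - h) - dk A w j x) * indicator {x. norm x >= R} x <= G (x - h) + G x"
    proof (cases "norm x >= R")
     case True
     have n2: "norm (x - h) >= R / 2" using norm_triangle_ineq2[of x h] True h by linarith
     have *: "norm (dk A w j y) <= 2 / R * (norm y * norm (dk A w j y))" if "norm y >= R / 2" for y
     proof -
      have "1 * norm (dk A w j y) <= (2 / R * norm y) * norm (dk A w j y)" using that R by (intro mult_right_mono) (auto simp: field_simps)
      then show ?thesis by (simp only: mult_1 mult.assoc)
     qed
     have "norm (dk A w j (x - h) - dk A w j x) <= norm (dk A w j (x - h)) + norm (dk A w j x)" by (rule norm_triangle_ineq4)
     also have "... <= 2 / R * (norm (x - h) * norm (dk A w j (x - h))) + 2 / R * (norm x * norm (dk A w j x))"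
      using n2 True R by (intro add_mono *) auto
     finally have "enorm (dk A w j (x - h) - dk A w j x) <= ennreal (2 / R * (norm (x - h) * norm (dk A w j (x - h))) + 2 / R * (norm x * norm (dk A w j x)))"
      by (rule ennreal_leI)
     then show ?thesis using True R by (simp add: G_def)
    qed simp
   qed
   also have "... = (NN x. G x) + (NN x. G x)" using nn_integral_translate[of G h] by (simp add: nn_integral_add)
   also have "... <= ennreal (2 / R * (1 / ?t * ((1 + norm w) * (B2 * I)))) + ennreal (2 / R * (1 / ?t * ((1 + norm w) * (B2 * I))))"
    by (intro add_mono GI)
   also have "... = ennreal ((4 * (B2 * I)) * ((1 + norm w) * (1 / (?t * R))))"
    using R B2 I by (simp add: ennreal_plus[symmetric] field_simps del: ennreal_plus)
   also have "... <= ennreal (C * ((1 + norm w) * (1 / (?t * R))))" using R B1 by (intro ennreal_leI mult_right_mono) (auto simp: C_def)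
   finally show ?thesis by (simp only: mult.assoc)
  qed
  show ?thesis using small large by (auto simp: min_def)
 qed
 have "(NN x. enorm (kfam A w J S (x - h) - kfam A w J S x) * indicator {x. norm x >= R} x) <= ennreal (4 * C * (1 + norm w))"
  if J: "finite J" and R: "R > 0" and h: "norm h <= R / 2" for w h :: 'a and J S R
 proof -
  have [measurable]: "meas (dk A w j)" for j by (rule nice_measurable[OF dk_nice[OF A]])
  have "(NN x. enorm (kfam A w J S (x - h) - kfam A w J S x) * indicator {x. norm x >= R} x)
   <= (NN x. (\<Sum>j\<in>J. enorm (dk A w j (x - h) - dk A w j x) * indicator {x. norm x >= R} x))"
  proof (intro nn_integral_mono)
   fix x
   have "kfam A w J S (x - h) - kfam A w J S x = (\<Sum>j\<in>J. cx (rsign S j) * (dk A w j (x - h) - dk A w j x))"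
    by (simp add: kfam_def sum_subtractf right_diff_distrib)
   also have "norm ... <= (\<Sum>j\<in>J. norm (dk A w j (x - h) - dk A w j x))" by (rule sum_norm_le) (simp add: norm_mult rsign_def)
   finally have "enorm (kfam A w J S (x - h) - kfam A w J S x) <= (\<Sum>j\<in>J. enorm (dk A w j (x - h) - dk A w j x))"
    by (simp add: ennreal_leI sum_ennreal)
   then show "enorm (kfam A w J S (x - h) - kfam A w J S x) * indicator {x. norm x >= R} x <= (\<Sum>j\<in>J. enorm (dk A w j (x - h) - dk A w j x) * indicator {x. norm x >= R} x)"
    by (simp add: indicator_def)
  qed
  also have "... = (\<Sum>j\<in>J. (NN x. enorm (dk A w j (x - h) - dk A w j x) * indicator {x. norm x >= R} x))" by (rule nn_integral_sum) measurable
  also have "... <= (\<Sum>j\<in>J. ennreal (C * (1 + norm w) * min (2 powi j * R) (1 / (2 powi j * R))))" by (intro sum_mono one R h)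
  also have "... = ennreal (C * (1 + norm w) * (\<Sum>j\<in>J. min (2 powi j * R) (1 / (2 powi j * R))))"
   using C0 R by (simp add: sum_ennreal sum_distrib_left)
  also have "... <= ennreal (C * (1 + norm w) * 4)" using C0 by (intro ennreal_leI mult_left_mono sum_min_dyadic J R) auto
  finally show ?thesis by (simp add: mult_ac)
 qed
 then show ?thesis using C0 by (intro exI[of _ "4 * C"]) auto
qed

section \<open>Bounds in every exponent\<close>

lemma conv_reflect: "conv K f x = (LI u. K u * f (x - u))" unfolding conv_def using integral_reflect[of "%u. K u * f (x - u)" x] by simp

lemma conv_continuous:
 assumes K: "nice K" and f: "nice f" and fc: "continuous_on UNIV f"
 shows "continuous_on UNIV (conv K f)"
proof -
 have [measurable]: "meas K" "meas f" using K f by (auto intro: nice_measurable)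
 obtain B where B: "B >= 0" "!!x. norm (f x) <= B" using nice_bound[OF f] by blast
 show ?thesis
 proof (rule continuous_on_sequentiallyI)
  fix u :: "nat => 'a" and x assume u: "u \<longlonglongrightarrow> x"
  have "(%n. LINT v|lborel. K v * f (u n - v)) \<longlonglongrightarrow> (LI v. K v * f (x - v))"
  proof (rule integral_dominated_convergence[where w="%v. norm (K v) * B"])
   show "integrable lborel (%v. norm (K v) * B)" using nice_integrable[OF K] by simp
   show "AE v in lborel. (%n. K v * f (u n - v)) \<longlonglongrightarrow> K v * f (x - v)"
    by (intro AE_I2 tendsto_intros continuous_on_tendsto_compose[OF fc] u) auto
   show "AE v in lborel. norm (K v * f (u n - v)) <= norm (K v) * B" for n by (intro AE_I2) (simp add: norm_mult mult_left_mono B)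
  qed auto
  then show "(%n. conv K f (u n)) \<longlonglongrightarrow> conv K f x" by (simp add: conv_reflect)
 qed
qed

lemma tame_nice: "tame h ==> nice h"
proof -
 assume t: "tame h"
 then obtain R where c: "continuous_on UNIV h" and R: "!!x. norm x > R ==> h x = 0" by (auto simp: tame_def)
 obtain B where B: "B >= 0" "!!x. norm (h x) <= B" using tame_bounded[OF t] by blast
 have "integrable lborel h"
 proof (rule Bochner_Integration.integrable_bound[where f="%x. B * indicator (cball 0 R) x"])
  show "integrable lborel (%x. B * indicator (cball (0::'a) R) x)"
   using emeasure_lborel_cball_finite[of "0::'a" R] by (intro integrable_mult_right) simp
  show "AE x in lborel. norm (h x) <= norm (B * indicator (cball 0 R) x)" using B R by (intro AE_I2) (auto simp: indicator_def not_le)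
 qed (use borel_measurable_continuous_onI[OF c] in simp)
 then show ?thesis using B unfolding nice_def by blast
qed

lemma pint_uminus:
 fixes f :: "'a::euclidean_space => complex"
 assumes [measurable]: "meas f"
 shows "pint p (%x. f (- x)) = pint p f" unfolding pint_def using nn_integral_reflect[of "%x. ennreal (norm (f x) powr p)" 0] by simp

text \<open>The dual exponent: the transpose of convolution with \<open>K\<close> is, up to reflections, convolution with
 \<open>K\<close> again, so it suffices to test against the extremal function for Hoelder's inequality.\<close>

lemma duality:
 assumes K: "nice K" and p: "p > 2" and q: "q = p / (p - 1)" and D: "D >= 0"
  and bd: "!!h. nice h ==> continuous_on UNIV h ==> pint q (conv K h) <= ennreal (D powr q) * pint q h"
  and f: "nice f" and fc: "continuous_on UNIV f"
 shows "pint p (conv K f) <= ennreal (D powr p) * pint p f"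
proof -
 have q1: "q > 1" "1 / p + 1 / q = 1" "(p - 1) * q = p" proof -
  show "q > 1" "1 / p + 1 / q = 1" using p by (simp_all add: q field_simps)
  show "(p - 1) * q = p" using p by (simp add: q)
 qed
 define F where "F = conv K f"
 have nF: "nice F" and cF: "continuous_on UNIV F" unfolding F_def by (intro nice_conv K f conv_continuous fc)+
 have [measurable]: "meas F" "meas f" "meas K" using nF f K by (auto intro: nice_measurable)
 define h where "h x = cx (norm (F x) powr (p - 2)) * cnj (F x)" for x
 have nh: "norm (h x) = norm (F x) powr (p - 1)" for x
 proof (cases "F x = 0")
  case False
  have "norm (h x) = norm (F x) powr (p - 2) * norm (F x) powr 1" by (simp add: h_def norm_mult)
  also have "... = norm (F x) powr ((p - 2) + 1)" by (rule powr_add[symmetric])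
  finally show ?thesis by simp
 qed (use p in \<open>simp add: h_def\<close>)
 have Fh: "F x * h x = cx (norm (F x) powr p)" for x
 proof -
  have "F x * h x = cx (norm (F x) powr (p - 2)) * (F x * cnj (F x))" by (simp add: h_def)
  also have "F x * cnj (F x) = cx ((norm (F x))^2)" by (rule complex_norm_square[symmetric])
  also have "cx (norm (F x) powr (p - 2)) * cx ((norm (F x))^2) = cx (norm (F x) powr p)"
  proof (cases "F x = 0")
   case False
   have "norm (F x) powr p = norm (F x) powr ((p - 2) + 2)" by simp
   also have "... = norm (F x) powr (p - 2) * norm (F x) powr 2" by (rule powr_add)
   also have "norm (F x) powr 2 = (norm (F x))^2" using False powr_realpow[of "norm (F x)" 2] by simp
   finally show ?thesis by simp
  qed (use p in simp)
  finally show ?thesis .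
 qed
 have hc: "continuous_on UNIV h" unfolding h_def using p by (intro continuous_intros cF continuous_on_powr') auto
 have [measurable]: "meas h" by (rule borel_measurable_continuous_onI[OF hc])
 have hn: "nice h" unfolding nice_def
 proof
  have "integrable lborel (%x. norm (F x) powr (p - 1))" using nice_Lp[OF nF, of "p - 1"] p by (simp add: Lp_space_def)
  then show "integrable lborel h" by (rule Bochner_Integration.integrable_bound) (auto simp: nh)
  obtain B where B: "B >= 0" "!!x. norm (F x) <= B" using nice_bound[OF nF] by blast
  have "norm (h x) <= B powr (p - 1)" for x unfolding nh using B p by (intro powr_mono2) auto
  then show "\<exists>B. \<forall>x. norm (h x) <= B" by blast
 qed
 define I where "I = (LI x. norm (F x) powr p)"
 have I0: "I >= 0" unfolding I_def by (intro integral_nonneg_AE) auto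
 have iF: "integrable lborel (%x. norm (F x) powr p)" using nice_Lp[OF nF, of p] p by (simp add: Lp_space_def)
 have pF: "pint p F = ennreal I" unfolding pint_def I_def using iF by (subst nn_integral_eq_integral) auto
 define ht where "ht x = h (- x)" for x
 have htn: "nice ht" unfolding ht_def nice_def using nice_integrable[OF hn] nice_bound[OF hn] integrable_reflect[of h 0] by auto
 have htc: "continuous_on UNIV ht" unfolding ht_def by (intro continuous_on_compose2[OF hc] continuous_intros) auto
 define G where "G y = conv K ht (- y)" for y
 have nG: "nice (conv K ht)" by (rule nice_conv[OF K htn])
 have [measurable]: "meas (conv K ht)" by (rule nice_measurable[OF nG])
 have [measurable]: "meas G" unfolding G_def by measurable
 have "cx I = (LI x. conv K f x * h x)" unfolding I_def using Fh by (simp add: F_def flip: integral_complex_of_real)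
 also have "... = (LI y. f y * (LI x. K (x - y) * h x))" by (rule conv_adjoint[OF K f hn])
 also have "... = (LI y. f y * G y)"
 proof -
  have "(LI x. K (x - y) * h x) = G y" for y
  proof -
   have "G y = (LI x. K (0 - x - y) * h (0 - x))"
    unfolding G_def conv_def ht_def by (intro Bochner_Integration.integral_cong) (simp_all add: minus_diff_commute)
   then show ?thesis by (simp only: integral_reflect[of "%x. K (x - y) * h x" 0])
  qed
  then show ?thesis by simp
 qed
 finally have cI: "cx I = (LI y. f y * G y)" .
 have In: "I = norm (LI y. f y * G y)" unfolding cI[symmetric] using I0 by simp
 have "ennreal I <= (NN y. ennreal \<bar>norm (f y) * norm (G y)\<bar>)"
 proof (cases "integrable lborel (%y. f y * G y)")
  case True
  have "enorm (LI y. f y * G y) <= ennreal (LI y. norm (f y * G y))" by (intro ennreal_leI integral_norm_bound)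
  also have "... = (NN y. enorm (f y * G y))" using True by (subst nn_integral_eq_integral) auto
  finally show ?thesis using In by (simp add: norm_mult)
 qed (simp add: In not_integrable_integral_eq)
 also have "... <= ennreal (Lp_norm p f * (D * I powr (1 / q)))"
 proof (rule nn_Hoelder[OF _ _ _ q1(1,2)])
  show "pint p (%y. norm (f y)) <= ennreal (Lp_norm p f powr p)" using pint_eq_Lp_norm[OF nice_Lp[OF f], of p] p by (simp add: pint_cnorm)
  have "pint q (%y. norm (G y)) = pint q (conv K ht)" unfolding pint_cnorm G_def by (rule pint_uminus) measurable
  also have "... <= ennreal (D powr q) * pint q ht" by (rule bd[OF htn htc])
  also have "pint q ht = pint q h" unfolding ht_def by (rule pint_uminus) measurable
  also have "pint q h = pint p F" unfolding pint_def nh by (simp add: powr_powr q1(3))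
  finally show "pint q (%y. norm (G y)) <= ennreal ((D * I powr (1 / q)) powr q)" using D I0 q1 by (simp add: pF powr_mult powr_powr ennreal_mult')
 qed (use p D in \<open>auto simp: Lp_norm_nonneg\<close>)
 finally have le: "I <= Lp_norm p f * (D * I powr (1 / q))" using D by (simp add: Lp_norm_nonneg)
 have "I <= (D * Lp_norm p f) powr p"
 proof (cases "I = 0")
  case False
  then have I: "I > 0" using I0 by simp
  have "I powr (1 / p) * I powr (1 / q) <= (D * Lp_norm p f) * I powr (1 / q)" using le I q1(2) by (simp add: powr_add[symmetric] mult_ac)
  then have "I powr (1 / p) <= D * Lp_norm p f" using I by simp
  then have "(I powr (1 / p)) powr p <= (D * Lp_norm p f) powr p" using p by (intro powr_mono2) auto
  then show ?thesis using I p by (simp add: powr_powr)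
 qed simp
 also have "... = D powr p * Lp_norm p f powr p" using D by (simp add: powr_mult Lp_norm_nonneg)
 finally have "ennreal I <= ennreal (D powr p) * ennreal (Lp_norm p f powr p)" by (simp add: ennreal_mult'[symmetric] ennreal_leI)
 then show ?thesis using pint_eq_Lp_norm[OF nice_Lp[OF f], of p] p by (simp add: pF[symmetric] F_def[symmetric])
qed

text \<open>Below 2 from the decomposition, at 2 from orthogonality, above 2 by duality. The constant may grow
 linearly with the shift, as Hoermander's condition does.\<close>
lemma kfam_Lp_nice:
 fixes A :: "'a::euclidean_space => complex"
 assumes A: "annular A" and p: "p > 1"
 shows "\<exists>C\<ge>1. \<forall>w J S f. finite J --> nice f --> continuous_on UNIV f -->
  pint p (conv (kfam A w J S) f) <= ennreal ((C * (1 + norm w)) powr p) * pint p f"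
proof -
 have Ab: "A \<in> bumps" using A by (simp add: annular_def)
 obtain C2 where C2: "C2 >= 0" "!!w J S g. finite J ==> nice g ==> nsq (conv (kfam A w J S) g) <= C2 * nsq g" using kfam_L2[OF A] by blast
 obtain C3 where C3: "C3 >= 0" "!!w J S R h. finite J ==> R > 0 ==> norm h <= R / 2 ==>
  (NN x. enorm (kfam A w J S (x - h) - kfam A w J S x) * indicator {x. norm x >= R} x) <= ennreal (C3 * (1 + norm w))"
  using kfam_hoermander[OF Ab] by blast
 have low: "\<exists>C\<ge>1. \<forall>w J S f. finite J --> nice f --> continuous_on UNIV f -->
  pint p (conv (kfam A w J S) f) <= ennreal ((C * (1 + norm w)) powr p) * pint p f" if p: "1 < p" "p < 2" for p
 proof -
  obtain C where C: "C >= 0" "!!(K :: 'a => complex) A H f. nice K ==> A >= 0 ==> (\<forall>g. nice g --> nsq (conv K g) <= A * nsq g) ==> H >= 0 ==>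
   (\<forall>R h. R > 0 --> norm h <= R / 2 --> (NN x. enorm (K (x - h) - K x) * indicator {x. norm x >= R} x) <= ennreal H) ==>
   nice f ==> continuous_on UNIV f ==> pint p (conv K f) <= ennreal (C * (1 + A + H)) * pint p f" using cz_strong_type[OF p, where 'a='a] by blast
  define E where "E = max 1 (C * (1 + C2 + C3))"
  have "pint p (conv (kfam A w J S) f) <= ennreal ((E * (1 + norm w)) powr p) * pint p f"
   if J: "finite J" and f: "nice f" "continuous_on UNIV f" for w J S f
  proof -
   have "pint p (conv (kfam A w J S) f) <= ennreal (C * (1 + C2 + C3 * (1 + norm w))) * pint p f" using C2 C3 J f by (intro C kfam_nice Ab) auto
   also have "... <= ennreal ((E * (1 + norm w)) powr p) * pint p f"
   proof (intro mult_right_mono ennreal_leI)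
    have "C * (1 + C2 + C3 * (1 + norm w)) <= C * ((1 + C2 + C3) * (1 + norm w))" using C C2 C3 by (intro mult_left_mono) (auto simp: algebra_simps)
    also have "... <= E * (1 + norm w)" unfolding mult.assoc[symmetric] by (intro mult_right_mono) (auto simp: E_def)
    also have "... = (E * (1 + norm w)) powr 1" by (simp add: E_def)
    also have "... <= (E * (1 + norm w)) powr p"
    proof (rule powr_mono)
     have "1 * 1 <= E * (1 + norm w)" by (intro mult_mono) (auto simp: E_def)
     then show "1 <= E * (1 + norm w)" by simp
    qed (use p in simp)
    finally show "C * (1 + C2 + C3 * (1 + norm w)) <= (E * (1 + norm w)) powr p" .
   qed simp
   finally show ?thesis .
  qed
  then show ?thesis by (intro exI[of _ E]) (auto simp: E_def)
 qed
 consider "p < 2" | "p = 2" | "p > 2" by linarith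
 then show ?thesis
 proof cases
  case 1
  then show ?thesis using low p by blast
 next
  case 2
  define E where "E = max 1 C2"
  have pn: "pint 2 g = ennreal (nsq g)" if "nice g" for g :: "'a => complex" using nsq_eq_nn_integral[OF that] by (simp add: pint_def)
  have "pint p (conv (kfam A w J S) f) <= ennreal ((E * (1 + norm w)) powr p) * pint p f"
   if J: "finite J" and f: "nice f" "continuous_on UNIV f" for w J S f
  proof -
   have "nsq (conv (kfam A w J S) f) <= C2 * nsq f" by (rule C2(2)[OF J f(1)])
   also have "... <= (E * (1 + norm w)) powr p * nsq f"
   proof (intro mult_right_mono nsq_nonneg)
    have "C2 <= E * 1" by (simp add: E_def)
    also have "... <= E * (1 + norm w)" by (intro mult_left_mono) (auto simp: E_def)
    also have "... = (E * (1 + norm w)) powr 1" by (simp add: E_def)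
    also have "... <= (E * (1 + norm w)) powr p"
    proof (rule powr_mono)
     have "1 * 1 <= E * (1 + norm w)" by (intro mult_mono) (auto simp: E_def)
     then show "1 <= E * (1 + norm w)" by simp
    qed (use p in simp)
    finally show "C2 <= (E * (1 + norm w)) powr p" .
   qed
   finally show ?thesis unfolding 2 pn[OF f(1)] pn[OF nice_conv[OF kfam_nice[OF Ab J] f(1)]] by (simp add: ennreal_mult'[symmetric] ennreal_leI)
  qed
  then show ?thesis by (intro exI[of _ E]) (auto simp: E_def)
 next
  case 3
  define q where "q = p / (p - 1)"
  have q: "1 < q" "q < 2" using 3 by (auto simp: q_def field_simps)
  obtain C where C: "C >= 1" "!!w J S f. finite J ==> nice f ==> continuous_on UNIV f ==>
   pint q (conv (kfam A w J S) f) <= ennreal ((C * (1 + norm w)) powr q) * pint q f" using low[OF q] by blast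
  have "pint p (conv (kfam A w J S) f) <= ennreal ((C * (1 + norm w)) powr p) * pint p f"
   if J: "finite J" and f: "nice f" "continuous_on UNIV f" for w J S f
  proof (rule duality[OF kfam_nice[OF Ab J] 3 q_def _ _ f])
   show "0 <= C * (1 + norm w)" using C(1) by simp
   show "pint q (conv (kfam A w J S) h) <= ennreal ((C * (1 + norm w)) powr q) * pint q h"
    if "nice h" "continuous_on UNIV h" for h by (rule C(2)[OF J that])
  qed
  then show ?thesis using C by blast
 qed
qed

lemma conv_diff_Lp:
 assumes "nice K" "f \<in> Lp_space p" "g \<in> Lp_space p" "p >= 1"
 shows "conv K f x - conv K g x = conv K (%y. f y - g y) x"
 unfolding conv_def using Lp_conv_integrable[OF assms(1,2,4), of x] Lp_conv_integrable[OF assms(1,3,4), of x] by (simp add: right_diff_distrib)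

text \<open>The constant for continuous functions survives, up to a factor, for all of \<open>L\<^sup>p\<close>: convolutions with a nice
 kernel converge pointwise under approximation in \<open>L\<^sup>p\<close>, and Fatou's lemma applies.\<close>

lemma kfam_Lp:
 assumes A: "annular A" and p: "p > 1"
 shows "\<exists>C\<ge>1. \<forall>w J S f. finite J --> f \<in> Lp_space p -->
  pint p (conv (kfam A w J S) f) <= ennreal ((C * (1 + norm w)) powr p) * pint p f"
proof -
 have Ab: "A \<in> bumps" using A by (simp add: annular_def)
 obtain C where C: "C >= 1" "!!w J S f. finite J ==> nice f ==> continuous_on UNIV f ==>
  pint p (conv (kfam A w J S) f) <= ennreal ((C * (1 + norm w)) powr p) * pint p f" using kfam_Lp_nice[OF A p] by blast
 have "pint p (conv (kfam A w J S) f) <= ennreal ((2 * C * (1 + norm w)) powr p) * pint p f" if J: "finite J" and f: "f \<in> Lp_space p" for w J S f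
 proof -
  define K where "K = kfam A w J S"
  have K: "nice K" unfolding K_def by (rule kfam_nice[OF Ab J])
  have [measurable]: "meas K" "meas f" using K f by (auto intro: nice_measurable simp: Lp_space_iff)
  define D where "D = (C * (1 + norm w)) powr p"
  have "\<forall>n. \<exists>h. tame h & pint p (%x. f x - h x) < ennreal ((1 / real (Suc n)) powr p)" using f p by (intro allI tame_dense) auto
  then obtain h where h: "!!n. tame (h n)" "!!n. pint p (%x. f x - h n x) < ennreal ((1 / real (Suc n)) powr p)" by metis
  have hn: "nice (h n)" for n by (rule tame_nice[OF h(1)])
  have hc: "continuous_on UNIV (h n)" for n using h(1) by (simp add: tame_def)
  have hL: "h n \<in> Lp_space p" for n using nice_Lp[OF hn] p by simp
  have [measurable]: "meas (h n)" for n by (rule nice_measurable[OF hn])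
  have conv: "(%n. conv K (h n) x) \<longlonglongrightarrow> conv K f x" for x
  proof -
   define q where "q = p / (p - 1)"
   have q: "q > 1" "1 / p + 1 / q = 1" using p by (auto simp: q_def field_simps)
   have Kt: "(%y. K (x - y)) \<in> Lp_space q"
    using nice_Lp[OF K, of q] q integrable_reflect[of "%y. norm (K y) powr q" x] by (auto simp: Lp_space_def)
   define k where "k = Lp_norm q (%y. K (x - y))"
   have bd: "norm (conv K f x - conv K (h n) x) <= k * (1 / real (Suc n))" for n
   proof -
    have "enorm (conv K f x - conv K (h n) x) <= (NN y. ennreal (norm (K (x - y)) * norm (f y - h n y)))"
     unfolding conv_diff_Lp[OF K f hL less_imp_le[OF p]] by (rule conv_norm_le)
    also have "... = (NN y. ennreal \<bar>norm (f y - h n y) * norm (K (x - y))\<bar>)" by (simp add: mult.commute)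
    also have "... <= ennreal (1 / real (Suc n) * k)"
    proof (rule nn_Hoelder[OF _ _ p q])
     show "pint p (%y. norm (f y - h n y)) <= ennreal ((1 / real (Suc n)) powr p)" using h(2)[of n] by (simp add: pint_cnorm)
     show "pint q (%y. norm (K (x - y))) <= ennreal (k powr q)" unfolding pint_cnorm k_def using pint_eq_Lp_norm[OF Kt] q by simp
    qed (auto simp: k_def Lp_norm_nonneg)
    finally show ?thesis by (simp add: k_def Lp_norm_nonneg mult.commute)
   qed
   have "(%n. k * (1 / real (Suc n))) \<longlonglongrightarrow> k * 0" by (intro tendsto_intros LIMSEQ_Suc lim_1_over_n)
   then have "(%n. conv K f x - conv K (h n) x) \<longlonglongrightarrow> 0" using Lim_null_comparison[OF always_eventually[OF allI[OF bd]]] by simp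
   from tendsto_diff[OF tendsto_const[of "conv K f x"] this] show ?thesis by simp
  qed
  have "pint p (conv K f) <= (NN x. liminf (%n. ennreal (norm (conv K (h n) x) powr p)))" unfolding pint_def
  proof (intro nn_integral_mono)
   fix x
   have "(%n. ennreal (norm (conv K (h n) x) powr p)) \<longlonglongrightarrow> ennreal (norm (conv K f x) powr p)"
    using p by (intro tendsto_ennrealI tendsto_powr' tendsto_norm conv tendsto_const) auto
   then show "ennreal (norm (conv K f x) powr p) <= liminf (%n. ennreal (norm (conv K (h n) x) powr p))"
    using lim_imp_Liminf[OF trivial_limit_sequentially] by fastforce
  qed
  also have "... <= liminf (%n. pint p (conv K (h n)))" unfolding pint_def by (rule nn_integral_liminf) measurable
  also have "... <= ennreal D * (ennreal (2 powr p) * pint p f)"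
  proof -
   have b: "pint p (conv K (h n)) <= ennreal D * (ennreal (2 powr p) * (pint p f + ennreal ((1 / real (Suc n)) powr p)))" for n
   proof -
    have "pint p (h n) = pint p (%x. h n x - 0)" by simp
    also have "... <= ennreal (2 powr p) * (pint p (%x. h n x - f x) + pint p (%x. f x - 0))" by (rule pint_diff_triangle) (use p in auto)
    also have "... <= ennreal (2 powr p) * (pint p f + ennreal ((1 / real (Suc n)) powr p))"
     using h(2)[of n] by (intro mult_left_mono) (auto simp: pint_def norm_minus_commute add.commute intro!: add_mono)
    finally have "ennreal D * pint p (h n) <= ennreal D * (ennreal (2 powr p) * (pint p f + ennreal ((1 / real (Suc n)) powr p)))"
     by (intro mult_left_mono) auto
    then show ?thesis using C(2)[OF J hn hc, of w S n] unfolding K_def D_def by (rule order_trans[rotated])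
   qed
   have "(%n. (1 / real (Suc n)) powr p) \<longlonglongrightarrow> 0 powr p"
    by (rule tendsto_powr'[OF LIMSEQ_Suc[OF lim_1_over_n] tendsto_const]) (use p in auto)
   then have "(%n. ennreal ((1 / real (Suc n)) powr p)) \<longlonglongrightarrow> ennreal 0" by (intro tendsto_ennrealI) simp
   then have "(%n. ennreal D * (ennreal (2 powr p) * (pint p f + ennreal ((1 / real (Suc n)) powr p)))) \<longlonglongrightarrow> ennreal D * (ennreal (2 powr p) * (pint p f + ennreal 0))"
    by (intro ennreal_tendsto_cmult tendsto_add tendsto_const) auto
   then have "liminf (%n. ennreal D * (ennreal (2 powr p) * (pint p f + ennreal ((1 / real (Suc n)) powr p)))) = ennreal D * (ennreal (2 powr p) * pint p f)"
    by (subst lim_imp_Liminf) auto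
   moreover have "liminf (%n. pint p (conv K (h n))) <= liminf (%n. ennreal D * (ennreal (2 powr p) * (pint p f + ennreal ((1 / real (Suc n)) powr p))))"
    by (intro Liminf_mono always_eventually allI b)
   ultimately show ?thesis by simp
  qed
  also have "... = ennreal (D * 2 powr p) * pint p f" by (simp add: D_def ennreal_mult' mult.assoc)
  also have "D * 2 powr p = (2 * C * (1 + norm w)) powr p" unfolding D_def by (subst powr_mult[symmetric]) (simp add: mult_ac)
  finally show ?thesis by (simp add: K_def)
 qed
 then show ?thesis using C(1) by (intro exI[of _ "2 * C"]) auto
qed

text \<open>Khintchine's inequality turns the uniform bound over all choices of signs into the square
 function bound.\<close>

definition sqf :: "('a::euclidean_space => complex) => 'a => int set => ('a => complex) => 'a => real" where
 "sqf A w J f x = L2_set (%j. norm (dconv A w j f x)) J"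

lemma sqf_measurable [measurable]:
 assumes "A \<in> bumps" and [measurable]: "meas f"
 shows "meas (sqf A w J f)"
proof -
 have [measurable]: "meas (dk A w j)" for j by (rule nice_measurable[OF dk_nice[OF assms(1)]])
 show ?thesis unfolding sqf_def[abs_def] L2_set_def by measurable
qed

text \<open>Jensen's inequality; convexity of the power is used on the open half line, hence the limit.\<close>
lemma powr_average_le:
 fixes y :: "'i => real"
 assumes "finite T" "T ~= {}" "p >= 1" "!!i. i \<in> T ==> y i >= 0"
 shows "((\<Sum>i\<in>T. y i) / real (card T)) powr p <= (\<Sum>i\<in>T. y i powr p) / real (card T)"
proof -
 have ct: "real (card T) > 0" using assms(1,2) by (simp add: card_gt_0_iff)
 have *: "((\<Sum>i\<in>T. y i + e) / real (card T)) powr p <= (\<Sum>i\<in>T. (y i + e) powr p) / real (card T)" if e: "e > 0" for e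
 proof -
  have "(\<Sum>i\<in>T. (1 / real (card T)) *\<^sub>R (y i + e)) powr p <= (\<Sum>i\<in>T. (1 / real (card T)) * (y i + e) powr p)"
   by (rule convex_on_sum[OF assms(1,2) powr_convex[OF assms(3)]]) (use ct e assms(4) in \<open>auto intro: add_nonneg_pos\<close>)
  then show ?thesis by (simp add: sum_divide_distrib)
 qed
 have L1: "((%e. ((\<Sum>i\<in>T. y i + e) / real (card T)) powr p) \<longlongrightarrow> ((\<Sum>i\<in>T. y i + 0) / real (card T)) powr p) (at_right 0)"
 proof (rule tendsto_powr'[OF _ tendsto_const])
  show "((%e. (\<Sum>i\<in>T. y i + e) / real (card T)) \<longlongrightarrow> (\<Sum>i\<in>T. y i + 0) / real (card T)) (at_right 0)"
   using ct by (intro tendsto_intros) auto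
  have "\<forall>\<^sub>F e in at_right 0. 0 <= (\<Sum>i\<in>T. y i + e) / real (card T)"
   by (rule eventually_mono[OF eventually_at_right_less[of 0]]) (use assms(4) in \<open>auto intro!: divide_nonneg_nonneg sum_nonneg add_nonneg_nonneg\<close>)
  then show "(\<Sum>i\<in>T. y i + 0) / real (card T) ~= 0 \<or> p > 0 & (\<forall>\<^sub>F e in at_right 0. 0 <= (\<Sum>i\<in>T. y i + e) / real (card T))"
   using assms(3) by simp
 qed
 have L2: "((%e. (\<Sum>i\<in>T. (y i + e) powr p) / real (card T)) \<longlongrightarrow> (\<Sum>i\<in>T. (y i + 0) powr p) / real (card T)) (at_right 0)"
 proof (intro tendsto_divide tendsto_sum tendsto_const)
  fix i assume "i \<in> T"
  then have "\<forall>\<^sub>F e in at_right 0. 0 <= y i + e" by (intro eventually_mono[OF eventually_at_right_less[of 0]]) (use assms(4) in auto)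
  then show "((%e. (y i + e) powr p) \<longlongrightarrow> (y i + 0) powr p) (at_right 0)"
   using assms(3) by (intro tendsto_powr'[OF tendsto_add[OF tendsto_const tendsto_ident_at] tendsto_const]) simp
 qed (use ct in simp)
 have "((\<Sum>i\<in>T. y i + 0) / real (card T)) powr p <= (\<Sum>i\<in>T. (y i + 0) powr p) / real (card T)"
  by (rule tendsto_le[OF _ L2 L1]) (auto intro!: eventually_mono[OF eventually_at_right_less[of 0]] *)
 then show ?thesis by simp
qed

lemma square_function_Lp:
 assumes A: "annular A" and p: "p > 1"
 shows "\<exists>C\<ge>1. \<forall>w J f. finite J --> f \<in> Lp_space p --> pint p (sqf A w J f) <= ennreal ((C * (1 + norm w)) powr p) * pint p f"
proof -
 have Ab: "A \<in> bumps" using A by (simp add: annular_def)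
 obtain C where C: "C >= 1" "!!w J S f. finite J ==> f \<in> Lp_space p ==>
  pint p (conv (kfam A w J S) f) <= ennreal ((C * (1 + norm w)) powr p) * pint p f" using kfam_Lp[OF A p] by blast
 have "pint p (sqf A w J f) <= ennreal ((4 * C * (1 + norm w)) powr p) * pint p f" if J: "finite J" and f: "f \<in> Lp_space p" for w J f
 proof -
  have [measurable]: "meas f" using f by (simp add: Lp_space_iff)
  have [measurable]: "meas (kfam A w J S)" for S by (rule nice_measurable[OF kfam_nice[OF Ab J]])
  let ?T = "Pow J"
  have T: "finite ?T" "?T ~= {}" "real (card ?T) = 2 ^ card J" using J by (auto simp: card_Pow)
  have pw: "sqf A w J f x powr p <= 4 powr p * ((\<Sum>S\<in>?T. norm (conv (kfam A w J S) f x) powr p) / real (card ?T))" for x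
  proof -
   have "2 ^ card J * sqf A w J f x <= 4 * (\<Sum>S\<in>?T. norm (conv (kfam A w J S) f x))"
    unfolding sqf_def conv_kfam[OF Ab J Lp_conv_integrable[OF dk_nice[OF Ab] f less_imp_le[OF p]]] by (rule khintchine[OF J])
   then have "sqf A w J f x <= 4 * ((\<Sum>S\<in>?T. norm (conv (kfam A w J S) f x)) / real (card ?T))" unfolding T(3) by (simp add: field_simps)
   then have "sqf A w J f x powr p <= (4 * ((\<Sum>S\<in>?T. norm (conv (kfam A w J S) f x)) / real (card ?T))) powr p"
    using p by (intro powr_mono2) (auto simp: sqf_def)
   also have "... = 4 powr p * ((\<Sum>S\<in>?T. norm (conv (kfam A w J S) f x)) / real (card ?T)) powr p" by (rule powr_mult)
   also have "... <= 4 powr p * ((\<Sum>S\<in>?T. norm (conv (kfam A w J S) f x) powr p) / real (card ?T))"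
    using p T by (intro mult_left_mono powr_average_le) auto
   finally show ?thesis .
  qed
  have "pint p (sqf A w J f) <= (NN x. ennreal (4 powr p / real (card ?T)) * (\<Sum>S\<in>?T. ennreal (norm (conv (kfam A w J S) f x) powr p)))"
   unfolding pint_def
  proof (intro nn_integral_mono)
   fix x
   have "norm (sqf A w J f x) powr p = sqf A w J f x powr p" by (simp add: sqf_def)
   also have "... <= 4 powr p / real (card ?T) * (\<Sum>S\<in>?T. norm (conv (kfam A w J S) f x) powr p)" using pw[of x] by simp
   finally have "ennreal (norm (sqf A w J f x) powr p) <= ennreal (4 powr p / real (card ?T) * (\<Sum>S\<in>?T. norm (conv (kfam A w J S) f x) powr p))"
    by (rule ennreal_leI)
   then show "ennreal (norm (sqf A w J f x) powr p) <= ennreal (4 powr p / real (card ?T)) * (\<Sum>S\<in>?T. ennreal (norm (conv (kfam A w J S) f x) powr p))"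
    by (simp only: ennreal_mult'[of "4 powr p / real (card ?T)"] sum_ennreal powr_ge_zero divide_nonneg_nonneg of_nat_0_le_iff)
  qed
  also have "... = ennreal (4 powr p / real (card ?T)) * (\<Sum>S\<in>?T. pint p (conv (kfam A w J S) f))"
   by (subst nn_integral_cmult, measurable, subst nn_integral_sum) (auto simp: pint_def)
  also have "... <= ennreal (4 powr p / real (card ?T)) * (\<Sum>S\<in>?T. ennreal ((C * (1 + norm w)) powr p) * pint p f)"
   by (intro mult_left_mono sum_mono C J f) auto
  also have "... = ennreal (4 powr p / real (card ?T)) * (ennreal (real (card ?T)) * (ennreal ((C * (1 + norm w)) powr p) * pint p f))"
   by (simp add: ennreal_of_nat_eq_real_of_nat)
  also have "... = ennreal ((4 * C * (1 + norm w)) powr p) * pint p f"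
  proof -
   have "ennreal (4 powr p / real (card ?T)) * ennreal (real (card ?T)) = ennreal (4 powr p)" using T by (simp add: ennreal_mult'[symmetric])
   moreover have "ennreal (4 powr p) * ennreal ((C * (1 + norm w)) powr p) = ennreal ((4 * C * (1 + norm w)) powr p)"
    using C(1) by (simp add: ennreal_mult'[symmetric] powr_mult mult.assoc)
   ultimately show ?thesis by (simp only: mult.assoc[symmetric])
  qed
  finally show ?thesis .
 qed
 then show ?thesis using C(1) by (intro exI[of _ "4 * C"]) auto
qed

section \<open>Frequency localisation of products\<close>

text \<open>The product of two band-limited functions is band-limited to the sum of the bands. The functions
 \<open>f\<close> and \<open>g\<close> have no Fourier transform in the elementary sense, so they are moved outside by Fubini's
 theorem, which leaves an integral of three kernels.\<close>

lemma conv_product_zero: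
 assumes A: "A \<in> schwartz" and B: "B \<in> schwartz" and C: "C \<in> schwartz"
  and z: "!!\<xi> \<zeta>. A \<xi> * B \<zeta> * C (\<xi> + \<zeta>) = 0"
  and f: "f \<in> Lp_space p" "p >= 1" and g: "g \<in> Lp_space q" "q >= 1"
 shows "conv (ft C) (%y. conv (ft A) f y * conv (ft B) g y) x = 0"
proof -
 have n: "nice (ft A)" "nice (ft B)" "nice (ft C)" by (intro schwartz_nice ft_schwartz A B C)+
 have [measurable]: "meas f" "meas g" "meas (ft A)"
  "meas (ft B)" "meas (ft C)" using f g n by (auto simp: Lp_space_iff intro: nice_measurable)
 obtain M where M: "!!y. norm (conv (ft B) g y) <= M" using conv_Lp_bounded[OF n(2) g] by blast
 obtain N where N: "!!y. norm (ft A y) <= N" using nice_bound[OF n(1)] by blast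
 have ci: "integrable lborel (%y. ft C (x - y))" using nice_integrable[OF n(3)] by (simp add: integrable_reflect)
 have inner: "(LI y. ft A (y - u) * (ft C (x - y) * conv (ft B) g y)) = 0" for u
 proof -
  have "(LI y. ft A (y - u) * (ft C (x - y) * conv (ft B) g y))
   = (LI y. conv (ft B) g y * (ft C (x - y) * ft A (y - u)))" by (simp add: ac_simps)
  also have "... = (LI v. g v * (LI y. ft B (y - v) * (ft C (x - y) * ft A (y - u))))"
   by (rule conv_adjoint_Lp[OF n(2) g]) (rule integrable_bounded_mult(1)[OF ci _ N], measurable)
  also have "... = 0"
  proof -
   have "(LI y. ft B (y - v) * (ft C (x - y) * ft A (y - u))) = 0" for v using trilinear_orthogonality[OF A B C z, of x u v] by (simp add: ac_simps)
   then show ?thesis by simp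
  qed
  finally show ?thesis .
 qed
 have "conv (ft C) (%y. conv (ft A) f y * conv (ft B) g y) x = (LI y. conv (ft A) f y * (ft C (x - y) * conv (ft B) g y))"
  unfolding conv_def[of "ft C"] by (simp add: ac_simps)
 also have "... = (LI u. f u * (LI y. ft A (y - u) * (ft C (x - y) * conv (ft B) g y)))"
  by (rule conv_adjoint_Lp[OF n(1) f]) (rule integrable_bounded_mult(1)[OF ci _ M], measurable)
 also have "... = 0" by (simp only: inner) simp
 finally show ?thesis .
qed

section \<open>Dilated kernels\<close>

lemma dk_0: "dk A 0 j = ft (sc j A)" by (simp add: dk_def)

lemma conv_shift: "dconv A 0 j f (x - w /\<^sub>R (2 powi k)) = conv (dk A ((2 powi (j - k)) *\<^sub>R w) j) f x"
proof -
 have "((2 powi (j - k)) *\<^sub>R w) /\<^sub>R (2 powi j) = w /\<^sub>R (2 powi k)" by (simp add: power_int_diff field_simps)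
 then show ?thesis unfolding conv_def dk_def by (simp only:) (simp add: algebra_simps)
qed

lemma conv_dk_scale:
 fixes x :: "'a::euclidean_space"
 shows "dconv A 0 j f x = (LI w. ft A w * f (x - w /\<^sub>R (2 powi j)))"
  and "A \<in> bumps ==> meas f ==> (NN y. ennreal (norm (dk A 0 j (x - y)) * norm (f y))) = (NN w. ennreal (norm (ft A w) * norm (f (x - w /\<^sub>R (2 powi j)))))"
proof -
 let ?t = "(2::real) powi j"
 have t: "?t > 0" "?t ~= 0" by auto
 have "dconv A 0 j f x = (LI u. (?t ^ DIM('a)) *\<^sub>R (ft A (0 + ?t *\<^sub>R u) * f (x - (0 + ?t *\<^sub>R u) /\<^sub>R ?t)))"
  unfolding conv_reflect by (intro Bochner_Integration.integral_cong) (simp_all add: dk_eq scaleR_conv_of_real)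
 also have "... = (?t ^ DIM('a)) *\<^sub>R (LI u. ft A (0 + ?t *\<^sub>R u) * f (x - (0 + ?t *\<^sub>R u) /\<^sub>R ?t))"
  by (rule integral_scaleR_right)
 also have "(LI u. ft A (0 + ?t *\<^sub>R u) * f (x - (0 + ?t *\<^sub>R u) /\<^sub>R ?t)) = (1 / \<bar>?t\<bar> ^ DIM('a)) *\<^sub>R (LI w. ft A w * f (x - w /\<^sub>R ?t))"
  by (rule integral_lborel_affine[where f="%w. ft A w * f (x - w /\<^sub>R ?t)"]) simp
 finally show "dconv A 0 j f x = (LI w. ft A w * f (x - w /\<^sub>R ?t))" using t by simp
 assume A: "A \<in> bumps" and [measurable]: "meas f"
 have [measurable]: "meas (ft A)" by (intro schwartz_measurable ft_schwartz bumps_schwartz A)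
 have [measurable]: "meas (dk A 0 j)" by (rule nice_measurable[OF dk_nice[OF A]])
 have "(NN y. ennreal (norm (dk A 0 j (x - y)) * norm (f y))) = (NN u. ennreal (norm (dk A 0 j u) * norm (f (x - u))))"
  using nn_integral_reflect[of "%u. ennreal (norm (dk A 0 j u) * norm (f (x - u)))" x] by simp
 also have "... = (NN u. ennreal (?t ^ DIM('a)) * ennreal (norm (ft A (0 + ?t *\<^sub>R u)) * norm (f (x - (0 + ?t *\<^sub>R u) /\<^sub>R ?t))))"
  by (simp add: dk_eq norm_mult norm_power norm_power_int ennreal_mult'[symmetric] mult.assoc)
 also have "... = ennreal (?t ^ DIM('a)) * (ennreal (1 / \<bar>?t\<bar> ^ DIM('a)) * (NN w. ennreal (norm (ft A w) * norm (f (x - w /\<^sub>R ?t)))))"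
  by (subst nn_integral_cmult, measurable,
    subst nn_integral_lborel_affine[where f="%w. ennreal (norm (ft A w) * norm (f (x - w /\<^sub>R ?t)))"]) auto
 finally show "(NN y. ennreal (norm (dk A 0 j (x - y)) * norm (f y))) = (NN w. ennreal (norm (ft A w) * norm (f (x - w /\<^sub>R ?t))))"
  using ennreal_inverse_cancel[of "?t ^ DIM('a)"] t by simp
qed

lemma conv_dk_norm_le:
 assumes "A \<in> bumps" "meas f"
 shows "enorm (dconv A 0 j f x) <= (NN w. ennreal (norm (ft A w) * norm (f (x - w /\<^sub>R (2 powi j)))))"
 using conv_norm_le[of "dk A 0 j" f x] unfolding conv_dk_scale(2)[OF assms] .

text \<open>The kernel is bounded by a dilate of the weight, up to the cost of the shift.\<close>
lemma conv_dk_le_maxf: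
 fixes A :: "'a::euclidean_space => complex"
 assumes A: "A \<in> bumps"
 shows "\<exists>C\<ge>1. \<forall>w j f x. meas f -->
  enorm (dconv A w j f x) <= ennreal (C * (1 + norm w) ^ (DIM('a) + 1)) * maxf f x"
proof -
 obtain B where B: "B >= 0" "!!x. norm (ft A x) <= B * wgt x" using schwartz_wgt_bound[OF ft_schwartz[OF bumps_schwartz[OF A]], of 0] by blast
 define C where "C = max 1 (B * 2 ^ (DIM('a) + 2))"
 have "enorm (dconv A w j f x) <= ennreal (C * (1 + norm w) ^ (DIM('a) + 1)) * maxf f x" if [measurable]: "meas f" for w j f x
 proof -
  let ?t = "(2::real) powi j" and ?W = "(1 + norm w) ^ (DIM('a) + 1)"
  have le: "norm (dk A w j (x - y)) * norm (f y) <= (B * ?W) * (?t ^ DIM('a) * wgt (?t *\<^sub>R (x - y)) * norm (f y))" for y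
  proof -
   have "norm (dk A w j (x - y)) = ?t ^ DIM('a) * norm (ft A (?t *\<^sub>R (x - y) - w))" by (simp add: dk_eq norm_mult norm_power norm_power_int)
   also have "... <= ?t ^ DIM('a) * (B * (?W * wgt (?t *\<^sub>R (x - y))))" using wgt_shift[of "?t *\<^sub>R (x - y)" "- w"] B(1)
    by (intro mult_left_mono order_trans[OF B(2)]) auto
   finally have "norm (dk A w j (x - y)) * norm (f y) <= ?t ^ DIM('a) * (B * (?W * wgt (?t *\<^sub>R (x - y)))) * norm (f y)"
    by (rule mult_right_mono) simp
   then show ?thesis by (simp add: mult_ac)
  qed
  have "enorm (dconv A w j f x) <= (NN y. ennreal (norm (dk A w j (x - y)) * norm (f y)))" by (rule conv_norm_le)
  also have "... <= (NN y. ennreal (B * ?W) * ennreal (?t ^ DIM('a) * wgt (?t *\<^sub>R (x - y)) * norm (f y)))"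
  proof (intro nn_integral_mono)
   show "ennreal (norm (dk A w j (x - y)) * norm (f y)) <= ennreal (B * ?W) * ennreal (?t ^ DIM('a) * wgt (?t *\<^sub>R (x - y)) * norm (f y))" for y
    using ennreal_leI[OF le[of y]] B(1) by (simp only: ennreal_mult' mult_nonneg_nonneg zero_le_power add_nonneg_nonneg norm_ge_zero zero_le_one)
  qed
  also have "... = ennreal (B * ?W) * (NN y. ennreal (?t ^ DIM('a) * wgt (?t *\<^sub>R (x - y)) * norm (f y)))" by (rule nn_integral_cmult) measurable
  also have "... <= ennreal (B * ?W) * (ennreal (2 ^ (DIM('a) + 2)) * maxf f x)" by (intro mult_left_mono conv_wgt_le_maxf) auto
  also have "... = ennreal ((B * ?W) * 2 ^ (DIM('a) + 2)) * maxf f x"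
   using B(1) by (simp only: ennreal_mult' mult.assoc[symmetric] mult_nonneg_nonneg zero_le_power add_nonneg_nonneg norm_ge_zero zero_le_one zero_le_numeral)
  also have "... <= ennreal (C * ?W) * maxf f x"
  proof (intro mult_right_mono ennreal_leI)
   have "(B * ?W) * 2 ^ (DIM('a) + 2) = (B * 2 ^ (DIM('a) + 2)) * ?W" by simp
   also have "... <= C * ?W" by (intro mult_right_mono) (auto simp: C_def)
   finally show "(B * ?W) * 2 ^ (DIM('a) + 2) <= C * ?W" .
  qed simp
  finally show ?thesis .
 qed
 then show ?thesis by (intro exI[of _ C]) (auto simp: C_def)
qed

lemma conv_dk_le_mf:
 fixes A :: "'a::euclidean_space => complex"
 assumes A: "A \<in> bumps"
 shows "\<exists>C\<ge>1. \<forall>w j f x. meas f --> maxf f x < \<infinity> -->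
  norm (dconv A w j f x) <= C * (1 + norm w) ^ (DIM('a) + 1) * mf f x"
proof -
 obtain C where C: "C >= 1" "!!w j f x. meas f ==>
  enorm (dconv A w j f x) <= ennreal (C * (1 + norm w) ^ (DIM('a) + 1)) * maxf f x" using conv_dk_le_maxf[OF A] by blast
 have "norm (dconv A w j f x) <= C * (1 + norm w) ^ (DIM('a) + 1) * mf f x" if m: "meas f" and fin: "maxf f x < \<infinity>" for w j f x
 proof -
  have "maxf f x = ennreal (mf f x)" using fin by (simp add: mf_def less_top)
  then have "enorm (dconv A w j f x) <= ennreal (C * (1 + norm w) ^ (DIM('a) + 1) * mf f x)"
   using C(2)[OF m, of w j x] C(1) by (simp add: ennreal_mult' mf_nonneg)
  then show ?thesis using C(1) by (simp add: ennreal_le_iff mf_nonneg)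
 qed
 then show ?thesis using C(1) by blast
qed

section \<open>Convergence of low-frequency truncations\<close>

lemma integral_norm_dk: "(LI y. norm (dk A 0 j y)) = (LI y. norm (ft A y))" for A :: "'a::euclidean_space => complex"
proof -
 let ?t = "(2::real) powi j"
 have "(LI y. norm (dk A 0 j y)) = ?t ^ DIM('a) * (LI y. norm (ft A (0 + ?t *\<^sub>R y)))" by (simp add: dk_eq norm_mult norm_power norm_power_int)
 also have "(LI y. norm (ft A (0 + ?t *\<^sub>R y))) = (1 / \<bar>?t\<bar> ^ DIM('a)) *\<^sub>R (LI y. norm (ft A y))"
  by (rule integral_lborel_affine[where f="%y. norm (ft A y)"]) simp
 finally show ?thesis by simp
qed

text \<open>At scale \<open>j\<close> the kernel has height of order \<open>2\<^sup>j\<^sup>d\<close> and an integral that does not depend on \<open>j\<close>.\<close>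
lemma conv_dk_low_bound:
 fixes A :: "'a::euclidean_space => complex"
 assumes A: "A \<in> bumps" and f: "f \<in> Lp_space p" and p: "p >= 1"
 shows "\<exists>M\<ge>0. \<exists>N\<ge>0. \<forall>e>0. \<forall>j x. norm (dconv A 0 j f x) <= e * M + (2 powi j) ^ DIM('a) * e powr (1 - p) * N"
proof -
 obtain B where B: "B >= 0" "!!x. norm (ft A x) <= B" using ft_bounded[OF ft_schwartz[OF bumps_schwartz[OF A]]] by blast
 define M where "M = (LI y. norm (ft A y))"
 have M0: "M >= 0" unfolding M_def by (intro integral_nonneg_AE) auto
 define N where "N = B * Lp_norm p f powr p"
 have "norm (dconv A 0 j f x) <= e * M + (2 powi j) ^ DIM('a) * e powr (1 - p) * N" if e: "e > 0" for e j x
 proof -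
  have b: "norm (dk A 0 j y) <= (2 powi j) ^ DIM('a) * B" for y using B(2) by (simp add: dk_eq norm_mult norm_power norm_power_int mult_left_mono)
  have "enorm (dconv A 0 j f x) <= ennreal (e * M + (2 powi j) ^ DIM('a) * B * e powr (1 - p) * Lp_norm p f powr p)"
   using order_trans[OF conv_norm_le conv_Lp_bound[OF dk_nice[OF A] b f p e]] unfolding integral_norm_dk M_def .
  then show ?thesis using e M0 B(1) by (subst (asm) ennreal_le_iff) (auto simp: N_def mult_ac)
 qed
 then show ?thesis using M0 B(1) by (intro exI[of _ M] conjI exI[of _ N]) (auto simp: N_def)
qed

lemma conv_dk_tendsto_0:
 fixes A :: "'a::euclidean_space => complex"
 assumes A: "A \<in> bumps" and f: "f \<in> Lp_space p" and p: "p >= 1"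
 shows "(%n. dconv A 0 (- int n - 1) f x) \<longlonglongrightarrow> 0"
proof (rule LIMSEQ_I)
 obtain M N where MN: "M >= 0" "!!e j x. e > 0 ==> norm (dconv A 0 j f x) <= e * M + (2 powi j) ^ DIM('a) * e powr (1 - p) * N"
  using conv_dk_low_bound[OF A f p] by blast
 fix r :: real assume r: "r > 0"
 define e where "e = r / (2 * (M + 1))"
 have e: "e > 0" "e * M < r / 2" using r MN(1) by (auto simp: e_def field_simps)
 have L: "(%n. ((1 / 2) ^ DIM('a) * e powr (1 - p) * N) * ((1 / 2) ^ DIM('a)) ^ n) \<longlonglongrightarrow> 0"
  by (intro tendsto_mult_right_zero LIMSEQ_realpow_zero) (auto simp: power_less_one_iff)
 have E: "((2::real) powi (- int n - 1)) ^ DIM('a) * e powr (1 - p) * N = ((1 / 2) ^ DIM('a) * e powr (1 - p) * N) * ((1 / 2) ^ DIM('a)) ^ n" for n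
 proof -
  have a: "(2::real) powi (- int n - 1) = (1 / 2) * (1 / 2) ^ n" by (simp add: power_int_diff power_int_minus power_divide field_simps)
  have b: "((1 / 2) * (1 / 2) ^ n) ^ DIM('a) = (1 / 2) ^ DIM('a) * (((1::real) / 2) ^ DIM('a)) ^ n"
   by (simp only: power_mult_distrib power_mult[symmetric] mult.commute)
  show ?thesis unfolding a b by (simp only: mult_ac)
 qed
 obtain n0 where n0: "!!n. n >= n0 ==> \<bar>((2::real) powi (- int n - 1)) ^ DIM('a) * e powr (1 - p) * N\<bar> < r / 2"
  using LIMSEQ_D[OF L, of "r / 2"] r unfolding E by auto
 have "norm (dconv A 0 (- int n - 1) f x - 0) < r" if "n >= n0" for n using MN(2)[OF e(1), of "- int n - 1" x] e(2) n0[OF that] by simp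
 then show "\<exists>n0. \<forall>n\<ge>n0. norm (dconv A 0 (- int n - 1) f x - 0) < r" by blast
qed

lemma conv_dk_tendsto_tame:
 fixes A :: "'a::euclidean_space => complex"
 assumes A: "A \<in> bumps" and A0: "cx ((2 * pi) ^ DIM('a)) * A 0 = 1" and h: "tame h"
 shows "(%n. dconv A 0 (int n) h x) \<longlonglongrightarrow> h x"
proof -
 have S: "A \<in> schwartz" by (rule bumps_schwartz[OF A])
 have [measurable]: "meas (ft A)" by (intro schwartz_measurable ft_schwartz S)
 have hc: "continuous_on UNIV h" using h by (simp add: tame_def)
 have [measurable]: "meas h" by (rule borel_measurable_continuous_onI[OF hc])
 obtain B where B: "B >= 0" "!!x. norm (h x) <= B" using tame_bounded[OF h] by blast
 have L: "(%n. LINT w|lborel. ft A w * h (x - w /\<^sub>R (2 powi (int n)))) \<longlonglongrightarrow> (LI w. ft A w * h x)"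
 proof (rule integral_dominated_convergence[where w="%w. norm (ft A w) * B"])
  show "integrable lborel (%w. norm (ft A w) * B)" using schwartz_integrable[OF ft_schwartz[OF S]] by simp
  show "AE w in lborel. (%n. ft A w * h (x - w /\<^sub>R (2 powi (int n)))) \<longlonglongrightarrow> ft A w * h x"
  proof (intro AE_I2 tendsto_mult tendsto_const)
   fix w
   have "(%n. x - inverse (2 ^ n) *\<^sub>R w) \<longlonglongrightarrow> x - 0 *\<^sub>R w" by (intro tendsto_intros LIMSEQ_inverse_realpow_zero) simp
   then have "(%n. x - w /\<^sub>R (2 powi (int n))) \<longlonglongrightarrow> x" by simp
   then show "(%n. h (x - w /\<^sub>R (2 powi (int n)))) \<longlonglongrightarrow> h x" by (rule continuous_on_tendsto_compose[OF hc]) auto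
  qed
  show "AE w in lborel. norm (ft A w * h (x - w /\<^sub>R (2 powi (int n)))) <= norm (ft A w) * B" for n
   by (intro AE_I2) (simp add: norm_mult mult_left_mono B)
 qed measurable
 have I: "(LI w. ft A w * h x) = h x" using ft_ft[OF S, of 0] A0 by (simp add: ft_def[of "ft A"])
 show ?thesis unfolding conv_dk_scale(1) using L unfolding I .
qed

text \<open>Almost everywhere convergence: the error is controlled by the maximal function of \<open>f - h\<close> for any
 continuous \<open>h\<close> of compact support, and these are dense.\<close>

lemma conv_dk_tendsto_AE:
 fixes A :: "'a::euclidean_space => complex"
 assumes A: "A \<in> bumps" and A0: "cx ((2 * pi) ^ DIM('a)) * A 0 = 1" and f: "f \<in> Lp_space p" and p: "p > 1"
 shows "AE x in lborel. (%n. dconv A 0 (int n) f x) \<longlonglongrightarrow> f x"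
proof -
 have [measurable]: "meas f" using f by (simp add: Lp_space_iff)
 obtain C where C: "C >= 1" "!!w j f x. meas f ==> maxf f x < \<infinity> ==>
  norm (dconv A w j f x) <= C * (1 + norm w) ^ (DIM('a) + 1) * mf f x" using conv_dk_le_mf[OF A] by blast
 have "\<forall>n. \<exists>h. tame h & pint p (%x. f x - h x) < ennreal (1 / real (Suc n))" using f p by (intro allI tame_dense) auto
 then obtain h where h: "!!n. tame (h n)" "!!n. pint p (%x. f x - h n x) < ennreal (1 / real (Suc n))" by metis
 have hL: "h n \<in> Lp_space p" for n using nice_Lp[OF tame_nice[OF h(1)]] p by simp
 have [measurable]: "meas (h n)" for n using hL by (simp add: Lp_space_iff)
 define u where "u n x = f x - h n x" for n x
 have [measurable]: "meas (u n)" for n unfolding u_def by measurable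
 have uL: "u n \<in> Lp_space p" for n using h(2)[of n] by (auto simp: Lp_space_iff u_def[symmetric] intro: less_trans)
 define K where "K = 10 ^ DIM('a) * (p / (p - 1) + p) * (2 ^ (DIM('a) + 1)) powr p"
 have K: "K >= 0" using p by (auto simp: K_def)
 define G where "G n x = ennreal (mf (u n) x powr p) + ennreal (norm (u n x) powr p)" for n x
 have [measurable]: "meas (G n)" for n unfolding G_def by measurable
 have Gi: "(NN x. G n x) <= ennreal ((K + 1) * (1 / real (Suc n)))" for n
 proof -
  have "(NN x. G n x) = pint p (mf (u n)) + pint p (u n)" unfolding G_def by (subst nn_integral_add) (auto simp: pint_def mf_nonneg)
  also have "... <= ennreal K * pint p (u n) + pint p (u n)" unfolding K_def by (intro add_right_mono maximal_theorem p) measurable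
  also have "... = ennreal (K + 1) * pint p (u n)" using K by (simp add: distrib_right)
  also have "... <= ennreal (K + 1) * ennreal (1 / real (Suc n))" using h(2)[of n] by (intro mult_left_mono) (auto simp: u_def[symmetric])
  also have "... = ennreal ((K + 1) * (1 / real (Suc n)))" using K by (intro ennreal_mult'[symmetric]) simp
  finally show ?thesis .
 qed
 have "(%n. (K + 1) * (1 / real (Suc n))) \<longlonglongrightarrow> (K + 1) * 0" by (intro tendsto_mult tendsto_const LIMSEQ_Suc[OF lim_1_over_n])
 then have l0: "(%n. ennreal ((K + 1) * (1 / real (Suc n)))) \<longlonglongrightarrow> ennreal 0" by (intro tendsto_ennrealI) simp
 have "(NN x. liminf (%n. G n x)) <= liminf (%n. (NN x. G n x))" by (rule nn_integral_liminf) measurable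
 also have "... <= liminf (%n. ennreal ((K + 1) * (1 / real (Suc n))))" by (intro Liminf_mono always_eventually allI Gi)
 also have "... = 0" using lim_imp_Liminf[OF _ l0] by simp
 finally have "(NN x. liminf (%n. G n x)) = 0" by simp
 then have "AE x in lborel. liminf (%n. G n x) = 0" by (subst (asm) nn_integral_0_iff_AE) measurable
 moreover have "AE x in lborel. \<forall>n. maxf (u n) x < \<infinity>" unfolding AE_all_countable using maxf_finite_AE[OF uL p] by blast
 ultimately show ?thesis
 proof eventually_elim
  case (elim x)
  show ?case
  proof (rule LIMSEQ_I)
   fix r :: real assume r: "r > 0"
   define d where "d = r / (C + 3)"
   have d: "d > 0" "(C + 3) * d = r" using r C(1) by (auto simp: d_def)
   have "\<exists>n. G n x < ennreal (d powr p)"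
   proof (rule ccontr)
    assume "\<not> ?thesis"
    then have "ennreal (d powr p) <= liminf (%n. G n x)" by (intro Liminf_bounded always_eventually) (auto simp: not_less)
    then show False using elim(1) d(1) by simp
   qed
   then obtain n where n: "G n x < ennreal (d powr p)" by blast
   have "ennreal (mf (u n) x powr p) < ennreal (d powr p)" "ennreal (norm (u n x) powr p) < ennreal (d powr p)"
    using n unfolding G_def by (auto intro: le_less_trans[OF _ n[unfolded G_def]])
   then have m: "mf (u n) x <= d" "norm (u n x) <= d"
    using powr_less_mono2[of p d "mf (u n) x"] powr_less_mono2[of p d "norm (u n x)"] d(1) p by (auto simp: ennreal_less_iff intro: leI)
   obtain N where N: "!!m. m >= N ==> norm (dconv A 0 (int m) (h n) x - h n x) < d"
    using LIMSEQ_D[OF conv_dk_tendsto_tame[OF A A0 h(1)[of n], of x] d(1)] by blast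
   have "norm (dconv A 0 (int m) f x - f x) < r" if "m >= N" for m
   proof -
    have "dconv A 0 (int m) f x - f x = dconv A 0 (int m) (u n) x + (dconv A 0 (int m) (h n) x - h n x) - u n x"
    proof -
     have "dconv A 0 (int m) (u n) x = dconv A 0 (int m) f x - dconv A 0 (int m) (h n) x"
      using conv_diff_Lp[OF dk_nice[OF A, of 0 "int m"] f hL[of n], of x] p unfolding u_def by simp
     then show ?thesis by (simp add: u_def[of n x])
    qed
    also have "norm ... <= norm (dconv A 0 (int m) (u n) x) + norm (dconv A 0 (int m) (h n) x - h n x) + norm (u n x)"
     by (rule order_trans[OF norm_triangle_ineq4 add_right_mono[OF norm_triangle_ineq]])
    also have "... < C * d + d + d"
    proof -
     have "norm (dconv A 0 (int m) (u n) x) <= C * mf (u n) x" using C(2)[of "u n" x 0 "int m"] elim(2) by simp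
     also have "... <= C * d" using C(1) m(1) by (intro mult_left_mono) auto
     finally show ?thesis using N[OF that] m(2) by linarith
    qed
    also have "... <= r" using d by (auto simp: distrib_right)
    finally show ?thesis .
   qed
   then show "\<exists>N. \<forall>m\<ge>N. norm (dconv A 0 (int m) f x - f x) < r" by blast
  qed
 qed
qed

section \<open>Littlewood--Paley pieces and fractional derivatives\<close>

text \<open>Here and in \<open>hi\<close> the factor of the inverse Fourier transform is part of the multiplier, so that convolution
 with \<open>ft\<close> of it is the Littlewood--Paley truncation.\<close>
definition lo :: "('a::euclidean_space => real) => 'a => complex" where
 "lo \<eta> \<xi> = cx (\<eta> \<xi>) / cx ((2 * pi) ^ DIM('a))"

text \<open>The exponent records powers of \<open>|\<xi>|\<close> moved into the piece: \<open>a = 0\<close> is the Littlewood--Paley projection,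
 \<open>a = s\<close> belongs to \<open>D\<^sup>s\<close> of it and \<open>a = -s\<close> recovers it from \<open>D\<^sup>s\<close>.\<close>
definition hi :: "('a::euclidean_space => real) => real => 'a => complex" where
 "hi \<eta> a \<xi> = cx (norm \<xi> powr a) * (cx (lp_chi \<eta> \<xi>) / cx ((2 * pi) ^ DIM('a)))"

abbreviation "lowp \<eta> j \<equiv> conv (dk (lo \<eta>) 0 j)"

abbreviation "piece \<eta> a j \<equiv> conv (dk (hi \<eta> a) 0 j)"

lemma lo_bumps: "lp_cutoff \<eta> ==> lo \<eta> \<in> bumps"
 using bumps_cmult[OF cutoff_bumps(1), of \<eta> "1 / cx ((2 * pi) ^ DIM('a))"] by (simp add: lo_def[abs_def])

lemma hi_annular: "lp_cutoff \<eta> ==> annular (hi \<eta> a)" for \<eta> :: "'a::euclidean_space => real"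
proof -
 assume \<eta>: "lp_cutoff \<eta>"
 have "(%\<xi>. cx (norm \<xi> powr a) * (1 / cx ((2 * pi) ^ DIM('a)) * cx (lp_chi \<eta> \<xi>))) \<in> bumps"
  by (rule bumps_norm_powr_mult[OF bumps_cmult[OF cutoff_bumps(2)[OF \<eta>]], of "1/2"]) (auto simp: cutoff_bumps(5)[OF \<eta>])
 then have "hi \<eta> a \<in> bumps" by (simp add: hi_def[abs_def])
 then show ?thesis unfolding annular_def by (auto simp: hi_def cutoff_bumps(5,6)[OF \<eta>])
qed

lemma hi_bumps: "lp_cutoff \<eta> ==> hi \<eta> a \<in> bumps" using hi_annular by (auto simp: annular_def)

lemma sc_hi_telescope: "sc j (hi \<eta> 0) \<xi> = sc j (lo \<eta>) \<xi> - sc (j - 1) (lo \<eta>) \<xi>"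
proof (cases "\<xi> = 0")
 case True
 then show ?thesis by (simp add: sc_def hi_def lo_def)
next
 case False
 have e: "2 *\<^sub>R (\<xi> /\<^sub>R (2 powi j)) = \<xi> /\<^sub>R (2 powi (j - 1))" by (simp add: power_int_diff inverse_eq_divide)
 show ?thesis unfolding sc_def hi_def lo_def lp_chi_def e using False by (simp add: diff_divide_distrib)
qed

lemma lo_telescope:
 assumes \<eta>: "lp_cutoff \<eta>" and f: "f \<in> Lp_space p" "p >= 1"
 shows "piece \<eta> 0 j f x = lowp \<eta> j f x - lowp \<eta> (j - 1) f x"
proof -
 have "sc i (lo \<eta>) \<in> schwartz" for i by (intro bumps_schwartz sc_bumps lo_bumps \<eta>)
 then have "ft (sc j (hi \<eta> 0)) y = ft (sc j (lo \<eta>)) y - ft (sc (j - 1) (lo \<eta>)) y" for y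
  unfolding ft_def sc_hi_telescope by (simp add: right_diff_distrib integrable_iexp_mult schwartz_integrable)
 then show ?thesis
  using Lp_conv_integrable[OF dk_nice[OF lo_bumps[OF \<eta>]] f, of 0 j x] Lp_conv_integrable[OF dk_nice[OF lo_bumps[OF \<eta>]] f, of 0 "j - 1" x]
  by (simp add: conv_def dk_0 left_diff_distrib)
qed

text \<open>Homogeneity: on the piece of frequency \<open>2\<^sup>j\<close> the multiplier \<open>|\<xi>|\<^sup>s\<close> is \<open>2\<^sup>j\<^sup>s\<close> times a multiplier of unit scale.\<close>
lemma hi_frac: "cx (norm \<xi> powr s) * sc j (hi \<eta> a) \<xi> = cx (2 powr (j * s)) * sc j (hi \<eta> (a + s)) \<xi>"
proof -
 have "norm \<xi> powr s = 2 powr (j * s) * norm (\<xi> /\<^sub>R (2 powi j)) powr s"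
 proof -
  have "(2::real) powr j = 2 powi j" by (simp add: powr_real_of_int')
  then have "norm \<xi> = 2 powr j * norm (\<xi> /\<^sub>R (2 powi j))" by (simp add: norm_power_int)
  then have "norm \<xi> powr s = (2 powr j * norm (\<xi> /\<^sub>R (2 powi j))) powr s" by (rule arg_cong)
  also have "... = (2 powr j) powr s * norm (\<xi> /\<^sub>R (2 powi j)) powr s" by (rule powr_mult)
  finally show ?thesis by (simp add: powr_powr)
 qed
 then show ?thesis by (simp add: sc_def hi_def powr_add mult_ac)
qed

lemma ft_hi_frac: "ft (%\<xi>. cx (norm \<xi> powr s) * sc j (hi \<eta> a) \<xi>) x = cx (2 powr (j * s)) * ft (sc j (hi \<eta> (a + s))) x"
proof -
 have "exp z * (cx (2 powr (j * s)) * w) = cx (2 powr (j * s)) * (exp z * w)" for z w by simp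
 then show ?thesis unfolding hi_frac ft_def by (simp only: integral_mult_right_zero)
qed

lemma Cn_iexp: "Cn n (%\<xi>::'a::euclidean_space. iexp (x \<bullet> \<xi>))"
proof (induction n)
 case 0
 show ?case using has_derivative_iexp[of x] by (auto simp: differentiable_def)
next
 case (Suc n)
 have "pd b (%\<xi>. iexp (x \<bullet> \<xi>)) = (%\<xi>. \<i> * cx (x \<bullet> b) * iexp (x \<bullet> \<xi>))" for b
  by (rule ext) (rule pd_eqI[OF has_derivative_iexp])
 then show ?case using has_derivative_iexp[of x] Suc by (auto simp: differentiable_def intro!: Cn_cmult)
qed

text \<open>The reflected translate is the transform of a bump times a character; it serves as test function.\<close>
lemma bump_kernel_schwartz:
 assumes A: "A \<in> bumps"
 shows "(%y. ft A (x - y)) \<in> schwartz"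
proof -
 define B where "B \<xi> = A (- \<xi>) * iexp ((- x) \<bullet> \<xi>)" for \<xi>
 have "(%\<xi>. A ((- 1) *\<^sub>R \<xi>)) \<in> bumps"
 proof -
  obtain R where R: "!!x. norm x > R ==> A x = 0" using A unfolding bumps_def by blast
  then have "\<forall>\<xi>. norm \<xi> > R --> A ((- 1) *\<^sub>R \<xi>) = 0" by simp
  then show ?thesis using A Cn_scale[of _ A "- 1"] unfolding bumps_def smooth_iff_Cn by blast
 qed
 then have "B \<in> bumps" unfolding B_def using bumps_smooth_mult[of "%\<xi>. A (- \<xi>)"] Cn_iexp[of _ "- x"] by (simp add: smooth_iff_Cn)
 moreover have "ft A (x - y) = ft B y" for y
 proof -
  have "ft A (x - y) = (LI \<xi>. iexp ((x - y) \<bullet> (0 - \<xi>)) * A (0 - \<xi>))" unfolding ft_def by (rule integral_reflect[symmetric])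
  also have "... = ft B y" unfolding ft_def
  proof (intro Bochner_Integration.integral_cong refl)
   fix \<xi>
   have "iexp ((x - y) \<bullet> (0 - \<xi>)) = iexp (y \<bullet> \<xi>) * iexp ((- x) \<bullet> \<xi>)"
    unfolding exp_add[symmetric] by (rule arg_cong[where f=exp]) (simp add: inner_diff_left algebra_simps)
   then show "iexp ((x - y) \<bullet> (0 - \<xi>)) * A (0 - \<xi>) = iexp (y \<bullet> \<xi>) * B \<xi>" by (simp add: B_def)
  qed
  finally show ?thesis .
 qed
 ultimately show ?thesis using ft_schwartz[OF bumps_schwartz] by simp
qed

text \<open>Testing the equation that defines \<open>D\<^sup>s f\<close> against the kernels of the Littlewood--Paley projections
 expresses the frequency pieces of \<open>f\<close> through those of \<open>D\<^sup>s f\<close>.\<close>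

lemma frac_D_piece:
 assumes \<eta>: "lp_cutoff \<eta>" and f: "is_frac_D s f Df"
 shows "piece \<eta> 0 j f x = cx (2 powr (- (j * s))) * piece \<eta> (- s) j Df x"
proof -
 let ?A = "sc j (hi \<eta> (- s))"
 have b: "?A \<in> bumps" by (intro sc_bumps hi_bumps \<eta>)
 have "piece \<eta> (- s) j Df x = (LI y. Df y * ft ?A (x - y))" by (simp add: conv_def dk_0 mult.commute)
 also have "... = frac_D_distr s f (%y. ft ?A (x - y))" using f bump_kernel_schwartz[OF b] unfolding is_frac_D_def distr_eq_fun_def by simp
 also have "... = (LI y. cx (2 powr (j * s)) * (ft (sc j (hi \<eta> 0)) (x - y) * f y))"
  unfolding frac_D_distr_def frac_D_ft[OF bumps_schwartz[OF b]] ft_hi_frac by (simp add: mult_ac)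
 also have "... = cx (2 powr (j * s)) * piece \<eta> 0 j f x" by (simp add: conv_def dk_0)
 finally show ?thesis by (simp add: powr_minus)
qed

lemma lp_proj_frac_D:
 assumes \<eta>: "lp_cutoff \<eta>"
 shows "lp_proj \<eta> k (frac_D_distr s h) x = cx (2 powr (k * s)) * piece \<eta> s k h x"
proof -
 have b: "sc k (hi \<eta> 0) \<in> schwartz" by (intro bumps_schwartz sc_bumps hi_bumps \<eta>)
 have "lp_kernel \<eta> k z = ft (sc k (hi \<eta> 0)) z" for z
 proof -
  have "sc k (hi \<eta> 0) \<xi> = cx (lp_chi \<eta> (\<xi> /\<^sub>R (2 powi k))) / cx ((2 * pi) ^ DIM('a))" for \<xi>
   by (cases "\<xi> = 0") (simp_all add: sc_def hi_def lp_chi_def)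
  then show ?thesis unfolding lp_kernel_def inv_fourier_eq_ft ft_def by simp
 qed
 then have "lp_proj \<eta> k (frac_D_distr s h) x = (LI y. cx (2 powr (k * s)) * (ft (sc k (hi \<eta> s)) (x - y) * h y))"
  unfolding lp_proj_def frac_D_distr_def by (simp add: frac_D_ft[OF b] ft_hi_frac mult_ac)
 then show ?thesis by (simp add: conv_def dk_0)
qed

section \<open>Paraproduct estimates\<close>

text \<open>Minkowski's inequality for the Euclidean norm, by testing against the unit vector \<open>a / |a|\<close>.\<close>

lemma L2_set_Minkowski:
 fixes F :: "'i => 'a::euclidean_space => real"
 assumes K: "finite K" and [measurable]: "!!k. meas (F k)" and F: "!!k w. F k w >= 0"
  and a: "!!k. a k >= 0" and le: "!!k. k \<in> K ==> ennreal (a k) <= (NN w. ennreal (F k w))"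
 shows "ennreal (L2_set a K) <= (NN w. ennreal (L2_set (%k. F k w) K))"
proof (cases "L2_set a K = 0")
 case False
 define S where "S = L2_set a K"
 have S: "S > 0" using False L2_set_nonneg[of a K] unfolding S_def by linarith
 have S2: "(\<Sum>k\<in>K. (a k)\<^sup>2) = S\<^sup>2" unfolding S_def L2_set_def by (simp add: sum_nonneg)
 have c1: "L2_set (%k. a k / S) K = 1" using S by (simp add: L2_set_def power_divide S2 flip: sum_divide_distrib)
 have "S = (\<Sum>k\<in>K. a k * (a k / S))"
  using S by (simp add: S2 power2_eq_square[symmetric] flip: sum_divide_distrib) (simp add: power2_eq_square)
 then have "ennreal S = (\<Sum>k\<in>K. ennreal (a k) * ennreal (a k / S))" using a S by (simp add: ennreal_mult'[symmetric] sum_ennreal)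
 also have "... <= (\<Sum>k\<in>K. (NN w. ennreal (F k w)) * ennreal (a k / S))" by (intro sum_mono mult_right_mono le) auto
 also have "... = (NN w. (\<Sum>k\<in>K. ennreal (F k w) * ennreal (a k / S)))" by (subst nn_integral_sum) (auto simp: nn_integral_multc)
 also have "... <= (NN w. ennreal (L2_set (%k. F k w) K))"
 proof (intro nn_integral_mono)
  fix w
  have "(\<Sum>k\<in>K. ennreal (F k w) * ennreal (a k / S)) = ennreal (\<Sum>k\<in>K. F k w * (a k / S))"
   using a S F by (simp add: ennreal_mult'[symmetric] sum_ennreal)
  also have "... <= ennreal (L2_set (%k. F k w) K)"
  proof (intro ennreal_leI)
   have "(\<Sum>k\<in>K. F k w * (a k / S)) <= (\<Sum>k\<in>K. \<bar>F k w\<bar> * \<bar>a k / S\<bar>)"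
    using a S F by (intro sum_mono) (simp add: abs_mult[symmetric])
   also have "... <= L2_set (%k. F k w) K * L2_set (%k. a k / S) K" by (rule L2_set_mult_ineq)
   finally show "(\<Sum>k\<in>K. F k w * (a k / S)) <= L2_set (%k. F k w) K" by (simp add: c1)
  qed
  finally show "(\<Sum>k\<in>K. ennreal (F k w) * ennreal (a k / S)) <= ennreal (L2_set (%k. F k w) K)" .
 qed
 finally show ?thesis by (simp add: S_def)
qed simp

text \<open>The norm of \<open>L\<^sup>1\<close> with values in \<open>l\<^sup>2\<close>, in which the Hardy norm is the supremum over \<open>K\<close>, by
 monotone convergence.\<close>
definition mixed :: "int set => (int => 'a::euclidean_space => complex) => ennreal" where
 "mixed K U = (NN x. ennreal (L2_set (%k. norm (U k x)) K))"

lemma mixed_mono: "(!!k x. norm (U k x) <= norm (V k x)) ==> mixed K U <= mixed K V"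
 unfolding mixed_def by (intro nn_integral_mono ennreal_leI L2_set_mono) auto

lemma mixed_add:
 assumes [measurable]: "!!k. meas (U k)" "!!k. meas (V k)"
 shows "mixed K (%k x. U k x + V k x) <= mixed K U + mixed K V"
proof -
 have "ennreal (L2_set (%k. norm (U k x + V k x)) K) <= ennreal (L2_set (%k. norm (U k x)) K) + ennreal (L2_set (%k. norm (V k x)) K)" for x
 proof -
  have "L2_set (%k. norm (U k x + V k x)) K <= L2_set (%k. norm (U k x) + norm (V k x)) K" by (intro L2_set_mono norm_triangle_ineq) auto
  also have "... <= L2_set (%k. norm (U k x)) K + L2_set (%k. norm (V k x)) K" by (rule L2_set_triangle_ineq)
  finally show ?thesis by (simp add: ennreal_leI flip: ennreal_plus)
 qed
 then have "mixed K (%k x. U k x + V k x) <= (NN x. ennreal (L2_set (%k. norm (U k x)) K) + ennreal (L2_set (%k. norm (V k x)) K))"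
  unfolding mixed_def by (intro nn_integral_mono)
 also have "... = mixed K U + mixed K V" unfolding mixed_def L2_set_def by (rule nn_integral_add) measurable
 finally show ?thesis .
qed

lemma mixed_sum:
 assumes "finite I" and [measurable]: "!!i k. meas (U i k)"
 shows "mixed K (%k x. \<Sum>i\<in>I. U i k x) <= (\<Sum>i\<in>I. mixed K (U i))" using assms(1)
proof (induction I)
 case (insert i I)
 then have "mixed K (%k x. \<Sum>i\<in>insert i I. U i k x) <= mixed K (U i) + mixed K (%k x. \<Sum>i\<in>I. U i k x)" by (simp add: mixed_add)
 with insert show ?case by (auto intro: order_trans[OF _ add_left_mono])
qed (simp add: mixed_def L2_set_def)

lemma mixed_cmult:
 assumes [measurable]: "!!k. meas (U k)"
 shows "mixed K (%k x. c * U k x) = enorm c * mixed K U"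
proof -
 have "ennreal (L2_set (%k. norm (c * U k x)) K) = enorm c * ennreal (L2_set (%k. norm (U k x)) K)" for x
  by (simp add: norm_mult L2_set_right_distrib[symmetric] ennreal_mult')
 then show ?thesis unfolding mixed_def L2_set_def by (simp add: nn_integral_cmult)
qed

lemma geometric_sum_le:
 fixes r :: real
 assumes K: "finite K" and N: "!!k. k \<in> K ==> k <= N" and r: "r > 0"
 shows "(\<Sum>k\<in>K. 2 powr (real_of_int k * r)) <= 2 powr (real_of_int N * r) / (1 - 2 powr (- r))"
proof -
 let ?q = "(2::real) powr (- r)"
 have q: "0 < ?q" "?q < 1" using r by (auto simp: powr_less_one)
 have e: "2 powr (real_of_int k * r) = 2 powr (real_of_int N * r) * ?q ^ nat (N - k)" if "k \<in> K" for k
 proof -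
  have "?q ^ nat (N - k) = 2 powr (- r * real (nat (N - k)))" by (simp add: powr_realpow[symmetric] powr_powr)
  then show ?thesis using N[OF that] by (simp add: powr_add[symmetric] algebra_simps)
 qed
 have "(\<Sum>k\<in>K. 2 powr (real_of_int k * r)) = 2 powr (real_of_int N * r) * (\<Sum>k\<in>K. ?q ^ nat (N - k))"
  unfolding sum_distrib_left by (intro sum.cong refl e)
 also have "(\<Sum>k\<in>K. ?q ^ nat (N - k)) = (\<Sum>n\<in>(%k. nat (N - k)) ` K. ?q ^ n)"
 proof (rule sum.reindex_cong[symmetric, where l="%k. nat (N - k)"])
  show "inj_on (%k. nat (N - k)) K" using N by (intro inj_onI) (force dest: N)
 qed simp_all
 also have "... <= (\<Sum>n. ?q ^ n)" using q K by (intro sum_le_suminf summable_geometric) auto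
 also have "... = 1 / (1 - ?q)" using q by (intro suminf_geometric) simp
 finally show ?thesis by (simp add: mult_left_mono)
qed

lemma sqf_Lp_norm:
 assumes A: "annular A" and p: "p > 1"
 shows "\<exists>C\<ge>1. \<forall>w J f. finite J --> f \<in> Lp_space p --> pint p (sqf A w J f) <= ennreal ((C * (1 + norm w) * Lp_norm p f) powr p)"
proof -
 obtain C where C: "C >= 1" "!!w J f. finite J ==> f \<in> Lp_space p ==> pint p (sqf A w J f) <= ennreal ((C * (1 + norm w)) powr p) * pint p f"
  using square_function_Lp[OF A p] by blast
 have "pint p (sqf A w J f) <= ennreal ((C * (1 + norm w) * Lp_norm p f) powr p)" if J: "finite J" and f: "f \<in> Lp_space p" for w J f
 proof -
  have "ennreal ((C * (1 + norm w)) powr p) * pint p f = ennreal ((C * (1 + norm w) * Lp_norm p f) powr p)"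
   using p by (simp add: pint_eq_Lp_norm[OF f] ennreal_mult'[symmetric] powr_mult)
  then show ?thesis using C(2)[OF J f, of w] by simp
 qed
 then show ?thesis using C(1) by blast
qed

lemma mf_Lp_norm:
 assumes p: "p > 1"
 shows "\<exists>C\<ge>0. \<forall>f::'a::euclidean_space => complex. f \<in> Lp_space p --> pint p (mf f) <= ennreal ((C * Lp_norm p f) powr p)"
proof -
 define K where "K = 10 ^ DIM('a) * (p / (p - 1) + p) * (2 ^ (DIM('a) + 1)) powr p"
 have K: "K >= 0" using p by (auto simp: K_def)
 have "pint p (mf f) <= ennreal ((K powr (1 / p) * Lp_norm p f) powr p)" if f: "f \<in> Lp_space p" for f :: "'a => complex"
 proof -
  have "pint p (mf f) <= ennreal K * pint p f" unfolding K_def using f by (intro maximal_theorem p) (simp add: Lp_space_iff)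
  also have "... = ennreal ((K powr (1 / p) * Lp_norm p f) powr p)"
   using p K by (simp add: pint_eq_Lp_norm[OF f] ennreal_mult'[symmetric] powr_mult powr_powr)
  finally show ?thesis .
 qed
 then show ?thesis by (intro exI[of _ "K powr (1 / p)"]) auto
qed

lemma nn_integral_conv_dk_le:
 assumes A: "A \<in> bumps" and [measurable]: "meas u"
 shows "(NN x. enorm (dconv A 0 k u x)) <= ennreal (LI y. norm (ft A y)) * (NN x. enorm (u x))"
proof -
 have [measurable]: "meas (dk A 0 k)" by (rule nice_measurable[OF dk_nice[OF A]])
 have "(NN x. enorm (dconv A 0 k u x)) <= (NN x. (NN y. ennreal (norm (dk A 0 k (x - y)) * norm (u y))))" by (intro nn_integral_mono conv_norm_le)
 also have "... = (NN x. enorm (dk A 0 k x)) * (NN x. enorm (u x))" by (rule nn_integral_conv_le) measurable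
 also have "(NN x. enorm (dk A 0 k x)) = ennreal (LI y. norm (ft A y))"
  unfolding integral_norm_dk[symmetric, of A k] using nice_integrable[OF dk_nice[OF A, of 0 k]] by (subst nn_integral_eq_integral) auto
 finally show ?thesis .
qed

lemma sc_lo_support: "lp_cutoff \<eta> ==> sc j (lo \<eta>) \<xi> ~= 0 ==> norm \<xi> <= 1.1 * 2 powi j"
 using cutoff_bumps(3)[of \<eta> "\<xi> /\<^sub>R (2 powi j)"] by (force simp: sc_def lo_def field_simps not_less)

lemma powi_increasing: "a <= b ==> (2::real) powi a <= 2 powi b" by (intro power_int_increasing) auto

text \<open>The factor combines \<open>2\<^sup>k\<^sup>s\<close> from \<open>D\<^sup>s\<close> of the product with \<open>2\<^sup>-\<^sup>j\<^sup>s\<close> from expressing a piece of the first function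
 through its fractional derivative \<open>F\<close>.\<close>
definition high_high_sum :: "('a::euclidean_space => real) => real => int => int => ('a => complex) => ('a => complex) => int set => int => 'a => complex" where
 "high_high_sum \<eta> s l m F g J k x = (\<Sum>j\<in>J. cx (2 powr (real_of_int (k - j) * s)) *
  piece \<eta> s k (%y. piece \<eta> (- s) (j - l) F y * piece \<eta> 0 (j - m) g y) x)"

text \<open>High-high interactions occupy a ball of radius comparable to \<open>2\<^sup>j\<close>, so only the pieces with
 \<open>k <= j + 2\<close> survive. For these the factor \<open>2\<^sup>(\<^sup>k\<^sup>-\<^sup>j\<^sup>)\<^sup>s\<close> is summable because \<open>s > 0\<close>, and the sum over
 \<open>j\<close> is left to Cauchy and Schwarz.\<close>
lemma high_high:
 fixes \<eta> :: "'a::euclidean_space => real"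
 assumes \<eta>: "lp_cutoff \<eta>" and s: "s > 0" and pq: "1 < p" "1 < q" "1 / p + 1 / q = 1"
 shows "\<exists>C\<ge>0. \<forall>F g J K l m. F \<in> Lp_space p --> g \<in> Lp_space q --> finite J --> finite K --> l >= 0 --> m >= 0 -->
  mixed K (high_high_sum \<eta> s l m F g J) <= ennreal (C * (Lp_norm p F * Lp_norm q g))"
proof -
 obtain C1 where C1: "C1 >= 1" "!!w J f. finite J ==> f \<in> Lp_space p ==>
  pint p (sqf (hi \<eta> (- s)) w J f) <= ennreal ((C1 * (1 + norm w) * Lp_norm p f) powr p)"
  using sqf_Lp_norm[OF hi_annular[OF \<eta>] pq(1), of "- s"] by blast
 obtain C2 where C2: "C2 >= 1" "!!w J f. finite J ==> f \<in> Lp_space q ==>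
  pint q (sqf (hi \<eta> 0) w J f) <= ennreal ((C2 * (1 + norm w) * Lp_norm q f) powr q)"
  using sqf_Lp_norm[OF hi_annular[OF \<eta>] pq(2), of 0] by blast
 define M where "M = (LI y. norm (ft (hi \<eta> s) y))"
 have M: "M >= 0" unfolding M_def by (intro integral_nonneg_AE) auto
 define G where "G = 2 powr (2 * s) / (1 - 2 powr (- s))"
 have G: "G >= 0" using s by (auto simp: G_def powr_less_one intro!: divide_nonneg_nonneg less_imp_le)
 have "mixed K (high_high_sum \<eta> s l m F g J) <= ennreal ((G * M * (C1 * C2)) * (Lp_norm p F * Lp_norm q g))"
  if F: "F \<in> Lp_space p" and g: "g \<in> Lp_space q" and J: "finite J" and K: "finite K" and lm: "l >= 0" "m >= 0" for F g J K l m
 proof -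
  have [measurable]: "meas F" "meas g" using F g by (auto simp: Lp_space_iff)
  have [measurable]: "meas (dk (hi \<eta> a) 0 k)" for k a by (rule nice_measurable[OF dk_nice[OF hi_bumps[OF \<eta>]]])
  define \<alpha> where "\<alpha> j = piece \<eta> (- s) j F" for j
  define \<beta> where "\<beta> j = piece \<eta> 0 j g" for j
  have [measurable]: "meas (\<alpha> j)" "meas (\<beta> j)" for j unfolding \<alpha>_def \<beta>_def by measurable
  define u where "u = (%j y. \<alpha> (j - l) y * \<beta> (j - m) y)"
  have [measurable]: "meas (u j)" for j unfolding u_def by measurable
  have z: "piece \<eta> s k (u j) x = 0" if "\<not> k <= j + 2" for k j x unfolding u_def \<alpha>_def \<beta>_def dk_0
  proof (rule conv_product_zero[OF _ _ _ _ F _ g])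
   show "sc (j - l) (hi \<eta> (- s)) \<xi> * sc (j - m) (hi \<eta> 0) \<zeta> * sc k (hi \<eta> s) (\<xi> + \<zeta>) = 0" for \<xi> \<zeta>
   proof (rule ccontr)
    assume "\<not> ?thesis"
    then have nz: "sc (j - l) (hi \<eta> (- s)) \<xi> ~= 0" "sc (j - m) (hi \<eta> 0) \<zeta> ~= 0" "sc k (hi \<eta> s) (\<xi> + \<zeta>) ~= 0" by auto
    have "(2::real) powi (j + 3) = 8 * 2 powi j" by (simp add: power_int_add)
    moreover have "(2::real) powi (j + 3) <= 2 powi k" "(2::real) powi (j - l) <= 2 powi j" "(2::real) powi (j - m) <= 2 powi j"
     using that lm by (intro powi_increasing; simp)+
    moreover have "(2::real) powi j > 0" by simp
    ultimately show False
     using sc_annular(2)[OF hi_annular[OF \<eta>] nz(1)] sc_annular(2)[OF hi_annular[OF \<eta>] nz(2)] sc_annular(1)[OF hi_annular[OF \<eta>] nz(3)]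
      norm_triangle_ineq[of \<xi> \<zeta>] by linarith
   qed
  qed (use pq in \<open>auto intro!: bumps_schwartz sc_bumps hi_bumps \<eta>\<close>)
  let ?t = "%k j. 2 powr (real_of_int (k - j) * s)"
  have "(NN x. (\<Sum>j\<in>J. enorm (u j x)))
   <= (NN x. ennreal \<bar>sqf (hi \<eta> (- s)) 0 ((%j. j - l) ` J) F x * sqf (hi \<eta> 0) 0 ((%j. j - m) ` J) g x\<bar>)"
  proof (intro nn_integral_mono)
   fix x
   have r: "L2_set h ((%j. j - l) ` J) = L2_set (%j. h (j - l)) J" for h :: "int => real" and l
    unfolding L2_set_def by (subst sum.reindex) (auto simp: inj_on_def)
   have "(\<Sum>j\<in>J. norm (u j x)) = (\<Sum>j\<in>J. \<bar>norm (\<alpha> (j - l) x)\<bar> * \<bar>norm (\<beta> (j - m) x)\<bar>)" by (simp add: u_def norm_mult)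
   also have "... <= L2_set (%j. norm (\<alpha> (j - l) x)) J * L2_set (%j. norm (\<beta> (j - m) x)) J" by (rule L2_set_mult_ineq)
   also have "... = sqf (hi \<eta> (- s)) 0 ((%j. j - l) ` J) F x * sqf (hi \<eta> 0) 0 ((%j. j - m) ` J) g x"
    by (simp add: sqf_def r \<alpha>_def \<beta>_def)
   finally show "(\<Sum>j\<in>J. enorm (u j x)) <= ennreal \<bar>sqf (hi \<eta> (- s)) 0 ((%j. j - l) ` J) F x * sqf (hi \<eta> 0) 0 ((%j. j - m) ` J) g x\<bar>"
    by (simp add: sum_ennreal ennreal_leI)
  qed
  also have "... <= ennreal ((C1 * (1 + norm (0::'a)) * Lp_norm p F) * (C2 * (1 + norm (0::'a)) * Lp_norm q g))"
   using J C1 C2 F g by (intro nn_Hoelder[OF _ _ pq] C1(2) C2(2) sqf_measurable hi_bumps \<eta>) (auto simp: Lp_norm_nonneg)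
  finally have S: "(NN x. (\<Sum>j\<in>J. enorm (u j x))) <= ennreal ((C1 * (1 + norm (0::'a)) * Lp_norm p F) * (C2 * (1 + norm (0::'a)) * Lp_norm q g))" .
  have "(NN x. ennreal (L2_set (%k. norm (\<Sum>j\<in>J. cx (?t k j) * piece \<eta> s k (u j) x)) K))
   <= (NN x. (\<Sum>j\<in>J. \<Sum>k\<in>{k\<in>K. k <= j + 2}. ennreal (?t k j) * enorm (piece \<eta> s k (u j) x)))"
  proof (intro nn_integral_mono)
   fix x
   have "L2_set (%k. norm (\<Sum>j\<in>J. cx (?t k j) * piece \<eta> s k (u j) x)) K
    <= (\<Sum>k\<in>K. norm (\<Sum>j\<in>J. cx (?t k j) * piece \<eta> s k (u j) x))" by (rule L2_set_le_sum) auto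
   also have "... <= (\<Sum>k\<in>K. \<Sum>j\<in>J. ?t k j * norm (piece \<eta> s k (u j) x))" by (intro sum_mono sum_norm_le) (simp add: norm_mult)
   also have "... = (\<Sum>j\<in>J. \<Sum>k\<in>K. ?t k j * norm (piece \<eta> s k (u j) x))" by (rule sum.swap)
   also have "... = (\<Sum>j\<in>J. \<Sum>k\<in>{k\<in>K. k <= j + 2}. ?t k j * norm (piece \<eta> s k (u j) x))"
    using K z by (intro sum.cong refl sum.mono_neutral_right) auto
   finally show "ennreal (L2_set (%k. norm (\<Sum>j\<in>J. cx (?t k j) * piece \<eta> s k (u j) x)) K)
    <= (\<Sum>j\<in>J. \<Sum>k\<in>{k\<in>K. k <= j + 2}. ennreal (?t k j) * enorm (piece \<eta> s k (u j) x))"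
    by (simp add: ennreal_mult'[symmetric] sum_ennreal sum_nonneg ennreal_leI)
  qed
  also have "... = (\<Sum>j\<in>J. \<Sum>k\<in>{k\<in>K. k <= j + 2}. ennreal (?t k j) * (NN x. enorm (piece \<eta> s k (u j) x)))"
   by (simp add: nn_integral_sum nn_integral_cmult)
  also have "... <= (\<Sum>j\<in>J. \<Sum>k\<in>{k\<in>K. k <= j + 2}. ennreal (?t k j) * (ennreal M * (NN x. enorm (u j x))))"
   unfolding M_def by (intro sum_mono mult_left_mono nn_integral_conv_dk_le hi_bumps \<eta>) auto
  also have "... = (\<Sum>j\<in>J. ennreal (\<Sum>k\<in>{k\<in>K. k <= j + 2}. ?t k j) * (ennreal M * (NN x. enorm (u j x))))"
   by (simp only: sum_distrib_right[symmetric] sum_ennreal powr_ge_zero)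
  also have "... <= (\<Sum>j\<in>J. ennreal G * (ennreal M * (NN x. enorm (u j x))))"
  proof (intro sum_mono mult_right_mono ennreal_leI)
   fix j
   have "(\<Sum>k\<in>{k\<in>K. k <= j + 2}. ?t k j) = 2 powr (- real_of_int j * s) * (\<Sum>k\<in>{k\<in>K. k <= j + 2}. 2 powr (real_of_int k * s))"
    by (simp add: sum_distrib_left powr_add[symmetric] algebra_simps)
   also have "... <= 2 powr (- real_of_int j * s) * (2 powr (real_of_int (j + 2) * s) / (1 - 2 powr (- s)))"
    using K s by (intro mult_left_mono geometric_sum_le) auto
   also have "... = G" by (simp add: G_def powr_add[symmetric] algebra_simps)
   finally show "(\<Sum>k\<in>{k\<in>K. k <= j + 2}. ?t k j) <= G" .
  qed simp
  also have "... = ennreal (G * M) * (NN x. (\<Sum>j\<in>J. enorm (u j x)))"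
   by (subst nn_integral_sum) (use G M in \<open>simp_all add: sum_distrib_left ennreal_mult' mult.assoc del: sum_ennreal\<close>)
  also have "... <= ennreal (G * M) * ennreal ((C1 * (1 + norm (0::'a)) * Lp_norm p F) * (C2 * (1 + norm (0::'a)) * Lp_norm q g))"
   by (intro mult_left_mono S) simp
  also have "... = ennreal ((G * M * (C1 * C2)) * (Lp_norm p F * Lp_norm q g))" using G M by (simp add: ennreal_mult'[symmetric] mult_ac)
  finally show ?thesis unfolding mixed_def high_high_sum_def u_def \<alpha>_def \<beta>_def .
 qed
 then show ?thesis using G M C1(1) C2(1) by (intro exI[of _ "G * M * (C1 * C2)"]) auto
qed

definition high_low_sum :: "('a::euclidean_space => real) => real => ('a => complex) => ('a => complex) => int set => int => 'a => complex" where
 "high_low_sum \<eta> s F g J k x = (\<Sum>j\<in>J. cx (2 powr (real_of_int (k - j) * s)) *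
  piece \<eta> s k (%y. piece \<eta> (- s) j F y * lowp \<eta> (j - 3) g y) x)"

text \<open>High-low interactions stay in the annulus of radius \<open>2\<^sup>j\<close>, so only \<open>k = j - 1, j, j + 1\<close> matter
 and the square function can be taken in \<open>k\<close>. The convolution that is left is written as an average over
 translates by \<open>2\<^sup>-\<^sup>kw\<close>, whose cost is a power of \<open>1 + |w|\<close>.\<close>

lemma high_low:
 fixes \<eta> :: "'a::euclidean_space => real"
 assumes \<eta>: "lp_cutoff \<eta>" and s: "s > 0" and pq: "1 < p" "1 < q" "1 / p + 1 / q = 1"
 shows "\<exists>C\<ge>0. \<forall>F g J K. F \<in> Lp_space p --> g \<in> Lp_space q --> finite J --> finite K -->
  mixed K (high_low_sum \<eta> s F g J) <= ennreal (C * (Lp_norm p F * Lp_norm q g))"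
proof -
 let ?d = "DIM('a) + 1" and ?m = "hi \<eta> (- s)"
 obtain C1 where C1: "C1 >= 1" "!!w J f. finite J ==> f \<in> Lp_space p ==> pint p (sqf ?m w J f) <= ennreal ((C1 * (1 + norm w) * Lp_norm p f) powr p)"
  using sqf_Lp_norm[OF hi_annular[OF \<eta>] pq(1), of "- s"] by blast
 obtain C2 where C2: "C2 >= 0" "!!f::'a => complex. f \<in> Lp_space q ==> pint q (mf f) <= ennreal ((C2 * Lp_norm q f) powr q)"
  using mf_Lp_norm[OF pq(2)] by blast
 obtain C3 where C3: "C3 >= 1" "!!w j f x. meas f ==> maxf f x < \<infinity> ==>
  norm (conv (dk (lo \<eta>) w j) f x) <= C3 * (1 + norm w) ^ ?d * mf f x" using conv_dk_le_mf[OF lo_bumps[OF \<eta>]] by blast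
 define \<psi> where "\<psi> = ft (hi \<eta> s)"
 have \<psi>S: "\<psi> \<in> schwartz" unfolding \<psi>_def by (intro ft_schwartz bumps_schwartz hi_bumps \<eta>)
 have [measurable]: "meas \<psi>" by (rule schwartz_measurable[OF \<psi>S])
 obtain B where B: "B >= 0" "!!w. (1 + norm w) ^ (?d + 1) * norm (\<psi> w) <= B * wgt w" using schwartz_wgt_bound[OF \<psi>S, of "?d + 1"] by blast
 define W where "W w = 2 powr s * C3 * (1 + norm w) ^ ?d * norm (\<psi> w)" for w
 have W0: "W w >= 0" for w unfolding W_def using C3(1) by simp
 have [measurable]: "meas W" unfolding W_def by measurable
 define I where "I = (LI w. wgt (w::'a))"
 have I0: "I >= 0" unfolding I_def by (intro integral_nonneg_AE) (simp add: wgt_nonneg)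
 define E where "E = 2 powr s * C3 * B * I * (C2 * (C1 * 2))"
 have E0: "E >= 0" using C1(1) C2(1) C3(1) B(1) I0 by (simp add: E_def)
 have one: "mixed K (%k x. cx (2 powr (real_of_int (- i) * s)) * piece \<eta> s k (%y. piece \<eta> (- s) (k + i) F y * lowp \<eta> (k + i - 3) g y) x)
  <= ennreal (E * (Lp_norm p F * Lp_norm q g))"
  if F: "F \<in> Lp_space p" and g: "g \<in> Lp_space q" and K: "finite K" and i: "i \<in> {-1, 0, 1}" for F g K i
 proof -
  have [measurable]: "meas F" "meas g" using F g by (auto simp: Lp_space_iff)
  define \<alpha> where "\<alpha> j = piece \<eta> (- s) j F" for j
  define \<gamma> where "\<gamma> j = lowp \<eta> j g" for j
  have [measurable]: "meas (dk (hi \<eta> a) 0 j)" "meas (dk (lo \<eta>) 0 j)" for a j by (intro nice_measurable dk_nice hi_bumps lo_bumps \<eta>)+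
  have [measurable]: "meas (\<alpha> j)" "meas (\<gamma> j)" for j unfolding \<alpha>_def \<gamma>_def by measurable
  have i2: "(2::real) powi i <= 2" "(2::real) powi (i - 3) <= 1" "2 powr (real_of_int (- i) * s) <= 2 powr s"
   using i s by (auto simp: power_int_minus)
  define S where "S x w = L2_set (%k. norm (\<alpha> (k + i) (x - w /\<^sub>R (2 powi k)))) K" for x w
  have S0: "S x w >= 0" for x w by (simp add: S_def)
  have Sm[measurable]: "(%(x, w). S x w) \<in> borel_measurable (borel \<Otimes>\<^sub>M borel)" unfolding S_def L2_set_def by measurable
  have Ssq: "S x w = sqf ?m ((2 powi i) *\<^sub>R w) ((%k. k + i) ` K) F x" for x w
  proof -
   have "\<alpha> (k + i) (x - w /\<^sub>R (2 powi k)) = conv (dk ?m ((2 powi i) *\<^sub>R w) (k + i)) F x" for k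
    unfolding \<alpha>_def conv_shift by simp
   then show ?thesis unfolding S_def sqf_def L2_set_def by (subst sum.reindex) (auto simp: inj_on_def)
  qed
  define U where "U k x = cx (2 powr (real_of_int (- i) * s)) * piece \<eta> s k (%y. \<alpha> (k + i) y * \<gamma> (k + i - 3) y) x" for k x
  \<comment> \<open>Minkowski's inequality moves the norm in \<open>k\<close> inside the average over \<open>w\<close>; the low-frequency factor is
    bounded by the maximal function before that, as it must not depend on \<open>k\<close>.\<close>
  have pw: "ennreal (L2_set (%k. norm (U k x)) K) <= (NN w. ennreal (W w * (mf g x * S x w)))" if fin: "maxf g x < \<infinity>" for x
  proof -
   define P where "P k w = W w * mf g x * norm (\<alpha> (k + i) (x - w /\<^sub>R (2 powi k)))" for k w
   have "ennreal (L2_set (%k. norm (U k x)) K) <= (NN w. ennreal (L2_set (%k. P k w) K))"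
   proof (rule L2_set_Minkowski[OF K])
    fix k
    let ?z = "%w. x - w /\<^sub>R (2 powi k)"
    have "enorm (U k x)
     = ennreal (2 powr (real_of_int (- i) * s)) * enorm (piece \<eta> s k (%y. \<alpha> (k + i) y * \<gamma> (k + i - 3) y) x)"
     by (simp add: U_def norm_mult ennreal_mult')
    also have "... <= ennreal (2 powr s) * (NN w. ennreal (norm (\<psi> w) * norm (\<alpha> (k + i) (?z w) * \<gamma> (k + i - 3) (?z w))))"
     unfolding \<psi>_def by (intro mult_mono ennreal_leI i2 conv_dk_norm_le hi_bumps \<eta>) auto
    also have "... = (NN w. ennreal (2 powr s * (norm (\<psi> w) * norm (\<alpha> (k + i) (?z w) * \<gamma> (k + i - 3) (?z w)))))"
     by (simp add: nn_integral_cmult[symmetric] ennreal_mult')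
    also have "... <= (NN w. ennreal (P k w))"
    proof (intro nn_integral_mono ennreal_leI)
     fix w
     have "norm (\<gamma> (k + i - 3) (?z w)) <= C3 * (1 + norm ((2 powi (i - 3)) *\<^sub>R w)) ^ ?d * mf g x"
      unfolding \<gamma>_def conv_shift using C3(2)[OF _ fin, of "(2 powi (i - 3)) *\<^sub>R w" "k + i - 3"] by (simp add: algebra_simps)
     also have "... <= C3 * (1 + norm w) ^ ?d * mf g x" using C3(1) i2(2) by (intro mult_right_mono mult_left_mono power_mono add_left_mono mf_nonneg)
       (auto simp: norm_power_int intro: mult_left_le_one_le)
     finally have "norm (\<alpha> (k + i) (?z w)) * norm (\<gamma> (k + i - 3) (?z w))
      <= norm (\<alpha> (k + i) (?z w)) * (C3 * (1 + norm w) ^ ?d * mf g x)" by (rule mult_left_mono) simp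
     then have "2 powr s * (norm (\<psi> w) * norm (\<alpha> (k + i) (?z w) * \<gamma> (k + i - 3) (?z w)))
      <= 2 powr s * (norm (\<psi> w) * (norm (\<alpha> (k + i) (?z w)) * (C3 * (1 + norm w) ^ ?d * mf g x)))"
      unfolding norm_mult by (intro mult_left_mono[of _ _ "2 powr s"] mult_left_mono[of _ _ "norm (\<psi> w)"]) (assumption, simp_all)
     then show "2 powr s * (norm (\<psi> w) * norm (\<alpha> (k + i) (?z w) * \<gamma> (k + i - 3) (?z w))) <= P k w"
      by (simp only: P_def W_def mult_ac)
    qed
    finally show "enorm (U k x)
     <= (NN w. ennreal (P k w))" .
   qed (auto simp: P_def W0 mf_nonneg)
   moreover have "L2_set (%k. P k w) K = W w * (mf g x * S x w)" for w
    unfolding P_def S_def by (subst L2_set_right_distrib[symmetric]) (simp_all add: W0 mf_nonneg mult.assoc)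
   ultimately show ?thesis by simp
  qed
  have "(NN x. ennreal (L2_set (%k. norm (U k x)) K)) <= (NN x. (NN w. ennreal (W w * (mf g x * S x w))))"
   by (intro nn_integral_mono_AE eventually_mono[OF maxf_finite_AE[OF g pq(2)]] pw)
  also have "... = (NN w. (NN x. ennreal (W w * (mf g x * S x w))))" by (rule lborel_pair.Fubini'[symmetric]) measurable
  also have "... <= (NN w. ennreal (2 powr s * C3 * B * (C2 * (C1 * 2)) * (Lp_norm p F * Lp_norm q g)) * ennreal (wgt (w::'a)))"
  proof (intro nn_integral_mono)
   fix w :: 'a
   let ?v = "(2 powi i) *\<^sub>R w"
   have "(NN x. ennreal (W w * (mf g x * S x w))) = ennreal (W w) * (NN x. ennreal \<bar>S x w * mf g x\<bar>)"
    by (simp add: W0 S0 mf_nonneg ennreal_mult' abs_mult nn_integral_cmult mult.commute)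
   also have "... <= ennreal (W w) * ennreal ((C1 * (1 + norm ?v) * Lp_norm p F) * (C2 * Lp_norm q g))" unfolding Ssq using K C1 C2 F g
    by (intro mult_left_mono nn_Hoelder[OF _ _ pq] C1(2) C2(2) sqf_measurable hi_bumps \<eta> mf_measurable) (auto simp: Lp_norm_nonneg)
   also have "... <= ennreal (W w * ((C1 * (2 * (1 + norm w)) * Lp_norm p F) * (C2 * Lp_norm q g)))"
   proof -
    have "norm ?v <= 2 * norm w" using i2(1) by (simp add: norm_power_int mult_right_mono)
    then have "(C1 * (1 + norm ?v) * Lp_norm p F) * (C2 * Lp_norm q g) <= (C1 * (2 * (1 + norm w)) * Lp_norm p F) * (C2 * Lp_norm q g)"
     using C1(1) C2(1) by (intro mult_right_mono mult_left_mono) (auto simp: Lp_norm_nonneg)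
    then show ?thesis by (simp only: ennreal_mult'[OF W0, symmetric] ennreal_leI mult_left_mono W0)
   qed
   also have "W w * ((C1 * (2 * (1 + norm w)) * Lp_norm p F) * (C2 * Lp_norm q g))
    = 2 powr s * C3 * (C2 * (C1 * 2)) * (Lp_norm p F * Lp_norm q g) * ((1 + norm w) ^ (?d + 1) * norm (\<psi> w))" by (simp add: W_def mult_ac)
   also have "ennreal ... <= ennreal (2 powr s * C3 * (C2 * (C1 * 2)) * (Lp_norm p F * Lp_norm q g) * (B * wgt w))"
    using C1(1) C2(1) C3(1) by (intro ennreal_leI mult_left_mono B) (auto simp: Lp_norm_nonneg)
   also have "... = ennreal (2 powr s * C3 * B * (C2 * (C1 * 2)) * (Lp_norm p F * Lp_norm q g)) * ennreal (wgt w)"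
    using C1(1) C2(1) C3(1) B(1) by (subst ennreal_mult'[symmetric]) (auto simp: Lp_norm_nonneg mult_ac)
   finally show "(NN x. ennreal (W w * (mf g x * S x w))) <= ennreal (2 powr s * C3 * B * (C2 * (C1 * 2)) * (Lp_norm p F * Lp_norm q g)) * ennreal (wgt w)" .
  qed
  also have "... = ennreal (2 powr s * C3 * B * (C2 * (C1 * 2)) * (Lp_norm p F * Lp_norm q g)) * ennreal I"
   unfolding I_def by (subst nn_integral_cmult) (auto simp: nn_integral_eq_integral integrable_wgt wgt_nonneg)
  also have "... = ennreal (E * (Lp_norm p F * Lp_norm q g))"
   using C1(1) C2(1) C3(1) B(1) by (subst ennreal_mult'[symmetric]) (auto simp: Lp_norm_nonneg E_def mult_ac)
  finally show ?thesis unfolding mixed_def U_def \<alpha>_def \<gamma>_def .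
 qed
 have "mixed K (high_low_sum \<eta> s F g J) <= ennreal (3 * E * (Lp_norm p F * Lp_norm q g))"
  if F: "F \<in> Lp_space p" and g: "g \<in> Lp_space q" and J: "finite J" and K: "finite K" for F g J K
 proof -
  have [measurable]: "meas F" "meas g" using F g by (auto simp: Lp_space_iff)
  have [measurable]: "meas (dk (hi \<eta> a) 0 j)" "meas (dk (lo \<eta>) 0 j)" for a j by (intro nice_measurable dk_nice hi_bumps lo_bumps \<eta>)+
  define V where "V k j x = cx (2 powr (real_of_int (k - j) * s)) *
   piece \<eta> s k (%y. piece \<eta> (- s) j F y * lowp \<eta> (j - 3) g y) x" for k j x
  have [measurable]: "meas (V k j)" for k j unfolding V_def by measurable
  \<comment> \<open>The index \<open>j - 3\<close> keeps the low frequencies below \<open>0.14 * 2\<^sup>j\<close>, hence the product between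
    \<open>0.36 * 2\<^sup>j\<close> and \<open>1.24 * 2\<^sup>j\<close>.\<close>
  have z: "V k j x = 0" if kj: "j \<notin> {k - 1, k, k + 1}" for k j x
  proof -
   have "piece \<eta> s k (%y. piece \<eta> (- s) j F y * lowp \<eta> (j - 3) g y) x = 0" unfolding dk_0
   proof (rule conv_product_zero[OF _ _ _ _ F _ g])
    show "sc j ?m \<xi> * sc (j - 3) (lo \<eta>) \<zeta> * sc k (hi \<eta> s) (\<xi> + \<zeta>) = 0" for \<xi> \<zeta>
    proof (rule ccontr)
     assume "\<not> ?thesis"
     then have nz: "sc j ?m \<xi> ~= 0" "sc (j - 3) (lo \<eta>) \<zeta> ~= 0" "sc k (hi \<eta> s) (\<xi> + \<zeta>) ~= 0" by auto
     have t: "(2::real) powi (j - 3) = 2 powi j / 8" "(2::real) powi (j + 2) = 4 * 2 powi j" "(2::real) powi (k + 2) = 4 * 2 powi k"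
      by (simp_all add: power_int_add power_int_diff)
     have pos: "(2::real) powi j > 0" by simp
     note b = sc_annular[OF hi_annular[OF \<eta>] nz(1)] sc_lo_support[OF \<eta> nz(2)] sc_annular[OF hi_annular[OF \<eta>] nz(3)]
      norm_triangle_ineq[of \<xi> \<zeta>] norm_triangle_ineq2[of \<xi> "- \<zeta>"]
     consider "j + 2 <= k" | "k + 2 <= j" using kj by force
     then show False
     proof cases
      case 1
      then show False using powi_increasing[OF 1] b t pos by simp
     next
      case 2
      then show False using powi_increasing[OF 2] b t pos by simp
     qed
    qed
   qed (use pq in \<open>auto intro!: bumps_schwartz sc_bumps hi_bumps lo_bumps \<eta>\<close>)
   then show ?thesis by (simp add: V_def)
  qed
  have "high_low_sum \<eta> s F g J k x = (\<Sum>i\<in>{-1, 0, 1}. if k + i \<in> J then V k (k + i) x else 0)" for k x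
  proof -
   have "high_low_sum \<eta> s F g J k x = (\<Sum>j\<in>J \<inter> {k - 1, k, k + 1}. V k j x)"
    unfolding high_low_sum_def V_def[symmetric] using J z by (intro sum.mono_neutral_right) auto
   also have "... = (\<Sum>j\<in>{k - 1, k, k + 1}. if j \<in> J then V k j x else 0)" by (subst Int_commute, subst sum.inter_restrict) auto
   finally show ?thesis by simp
  qed
  then have "mixed K (high_low_sum \<eta> s F g J) = mixed K (%k x. \<Sum>i\<in>{-1, 0, 1}. if k + i \<in> J then V k (k + i) x else 0)"
   by (simp add: mixed_def)
  also have "... <= (\<Sum>i\<in>{-1, 0, 1}. mixed K (%k x. if k + i \<in> J then V k (k + i) x else 0))" by (rule mixed_sum) auto
  also have "... <= (\<Sum>i\<in>{-1, 0, 1}. mixed K (%k. V k (k + i)))" by (intro sum_mono mixed_mono) auto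
  also have "... <= (\<Sum>i\<in>{-1::int, 0, 1}. ennreal (E * (Lp_norm p F * Lp_norm q g)))"
   unfolding V_def using one[OF F g K] by (intro sum_mono) (simp add: algebra_simps)
  also have "... = ennreal (3 * E * (Lp_norm p F * Lp_norm q g))" using E0 by (simp add: ennreal_mult' mult.assoc)
  finally show ?thesis .
 qed
 then show ?thesis using E0 by (intro exI[of _ "3 * E"]) auto
qed

lemma conv_cmult: "conv K (%y. c * u y) x = c * conv K u x"
proof -
 have "K (x - y) * (c * u y) = c * (K (x - y) * u y)" for y by simp
 then show ?thesis by (simp only: conv_def integral_mult_right_zero)
qed

lemma conv_sum:
 assumes "finite I" "!!i. i \<in> I ==> integrable lborel (%y. K (x - y) * u i y)"
 shows "conv K (%y. \<Sum>i\<in>I. u i y) x = (\<Sum>i\<in>I. conv K (u i) x)"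
 unfolding conv_def sum_distrib_left using assms by (intro Bochner_Integration.integral_sum) auto

lemma conv_add:
 assumes "integrable lborel (%y. K (x - y) * u y)" "integrable lborel (%y. K (x - y) * v y)"
 shows "conv K (%y. u y + v y) x = conv K u x + conv K v x" unfolding conv_def using assms by (simp add: distrib_left)

lemma telescope_int: "(\<Sum>j\<in>{- int n..int n}. P j - P (j - 1)) = P (int n) - P (- int n - 1)" for P :: "int => 'b::ab_group_add"
proof (induction n)
 case (Suc n)
 have "{- int (Suc n)..int (Suc n)} = insert (- int n - 1) (insert (int n + 1) {- int n..int n})" by auto
 then show ?case using Suc by (simp add: algebra_simps)
qed simp

text \<open>Bony's decomposition, with gap three: \<open>F\<^sub>jG\<^sub>j - F\<^sub>j\<^sub>-\<^sub>1G\<^sub>j\<^sub>-\<^sub>1\<close> equals \<open>a\<^sub>jG\<^sub>j + F\<^sub>j\<^sub>-\<^sub>1b\<^sub>j\<close> for the increments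
 \<open>a\<close> and \<open>b\<close>, and \<open>G\<^sub>j\<close>, \<open>F\<^sub>j\<^sub>-\<^sub>1\<close> exceed \<open>G\<^sub>j\<^sub>-\<^sub>3\<close>, \<open>F\<^sub>j\<^sub>-\<^sub>3\<close> by at most three increments.\<close>

definition near_diagonal :: "(int \<times> int) set" where
 "near_diagonal = {(0, 0), (0, 1), (0, 2), (1, 0), (2, 0)}"

lemma paraproduct_decomposition:
 fixes F G a b :: "int => complex"
 assumes a: "!!j. a j = F j - F (j - 1)" and b: "!!j. b j = G j - G (j - 1)"
 shows "F (int n) * G (int n) - F (- int n - 1) * G (- int n - 1)
  = (\<Sum>j\<in>{- int n..int n}. a j * G (j - 3) + b j * F (j - 3) + (\<Sum>(l, m)\<in>near_diagonal. a (j - l) * b (j - m)))"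
proof -
 define P where "P j = F j * G j" for j
 have "a j * G (j - 3) + b j * F (j - 3) + (\<Sum>(l, m)\<in>near_diagonal. a (j - l) * b (j - m)) = P j - P (j - 1)" for j
  by (simp add: near_diagonal_def P_def a b diff_diff_eq algebra_simps)
 then show ?thesis using telescope_int[of P n] by (simp add: P_def)
qed

text \<open>The product of the lowest frequencies is removed as well, so that only finitely many increments are left; it
 tends to zero with \<open>n\<close>.\<close>
definition band :: "('a::euclidean_space => real) => ('a => complex) => ('a => complex) => nat => 'a => complex" where
 "band \<eta> f g n y = lowp \<eta> (int n) f y * lowp \<eta> (int n) g y - lowp \<eta> (- int n - 1) f y * lowp \<eta> (- int n - 1) g y"

text \<open>A near-diagonal piece has index \<open>j - l\<close> with \<open>l <= 2\<close>, so its gain \<open>2\<^sup>-\<^sup>(\<^sup>j\<^sup>-\<^sup>l\<^sup>)\<^sup>s\<close> differs from \<open>2\<^sup>-\<^sup>j\<^sup>s\<close> by at most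
 \<open>2\<^sup>2\<^sup>s\<close>.\<close>
lemma paraproduct_bound:
 fixes \<eta> :: "'a::euclidean_space => real"
 assumes \<eta>: "lp_cutoff \<eta>" and s: "s > 0" and p: "1 < p1" "1 < q1" "1 / p1 + 1 / q1 = 1" "1 < p2" "1 < q2" "1 / p2 + 1 / q2 = 1"
 shows "\<exists>C\<ge>0. \<forall>f g Df Dg K n. is_frac_D s f Df --> is_frac_D s g Dg -->
  Df \<in> Lp_space p1 --> g \<in> Lp_space q1 --> f \<in> Lp_space p2 --> Dg \<in> Lp_space q2 --> finite K -->
  mixed K (%k x. cx (2 powr (real_of_int k * s)) * piece \<eta> s k (band \<eta> f g n) x)
  <= ennreal (C * (Lp_norm p1 Df * Lp_norm q1 g + Lp_norm p2 f * Lp_norm q2 Dg))"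
proof -
 obtain C1 where C1: "C1 >= 0" "!!F g J K. F \<in> Lp_space p1 ==> g \<in> Lp_space q1 ==> finite J ==> finite K ==>
  mixed K (high_low_sum \<eta> s F g J) <= ennreal (C1 * (Lp_norm p1 F * Lp_norm q1 g))" using high_low[OF \<eta> s p(1-3)] by blast
 have p': "1 / q2 + 1 / p2 = 1" using p(6) by simp
 obtain C2 where C2: "C2 >= 0" "!!F g J K. F \<in> Lp_space q2 ==> g \<in> Lp_space p2 ==> finite J ==> finite K ==>
  mixed K (high_low_sum \<eta> s F g J) <= ennreal (C2 * (Lp_norm q2 F * Lp_norm p2 g))" using high_low[OF \<eta> s p(5) p(4) p'] by blast
 obtain C3 where C3: "C3 >= 0" "!!F g J K l m. F \<in> Lp_space p1 ==> g \<in> Lp_space q1 ==> finite J ==> finite K ==> l >= 0 ==> m >= 0 ==>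
  mixed K (high_high_sum \<eta> s l m F g J) <= ennreal (C3 * (Lp_norm p1 F * Lp_norm q1 g))" using high_high[OF \<eta> s p(1-3)] by blast
 define C where "C = C1 + C2 + 5 * (2 powr (2 * s) * C3)"
 have "mixed K (%k x. cx (2 powr (real_of_int k * s)) * piece \<eta> s k (band \<eta> f g n) x)
  <= ennreal (C * (Lp_norm p1 Df * Lp_norm q1 g + Lp_norm p2 f * Lp_norm q2 Dg))"
  if D: "is_frac_D s f Df" "is_frac_D s g Dg" and L: "Df \<in> Lp_space p1" "g \<in> Lp_space q1" "f \<in> Lp_space p2" "Dg \<in> Lp_space q2"
   and K: "finite K" for f g Df Dg K n
 proof -
  define \<phi> where "\<phi> j = lowp \<eta> j f" for j
  define \<gamma> where "\<gamma> j = lowp \<eta> j g" for j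
  define a where "a j = piece \<eta> 0 j f" for j
  define b where "b j = piece \<eta> 0 j g" for j
  have [measurable]: "meas Df" "meas g" "meas f" "meas Dg" using L by (auto simp: Lp_space_iff)
  have nh: "nice (dk (hi \<eta> c) 0 k)" and nl: "nice (dk (lo \<eta>) 0 k)" for k c by (intro dk_nice hi_bumps lo_bumps \<eta>)+
  have [measurable]: "meas (dk (hi \<eta> c) 0 j)" "meas (dk (lo \<eta>) 0 j)" for c j by (intro nice_measurable nh nl)+
  have [measurable]: "meas (\<phi> j)" "meas (\<gamma> j)" "meas (a j)" "meas (b j)" for j unfolding \<phi>_def \<gamma>_def a_def b_def by measurable
  have ge1: "q1 >= 1" "p2 >= 1" using p by auto
  have bd: "\<exists>M. \<forall>x. norm (\<phi> j x) <= M" "\<exists>M. \<forall>x. norm (\<gamma> j x) <= M" "\<exists>M. \<forall>x. norm (a j x) <= M" "\<exists>M. \<forall>x. norm (b j x) <= M" for j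
   unfolding \<phi>_def \<gamma>_def a_def b_def
   using conv_Lp_bounded[OF nl L(3) ge1(2)] conv_Lp_bounded[OF nl L(2) ge1(1)] conv_Lp_bounded[OF nh L(3) ge1(2)] conv_Lp_bounded[OF nh L(2) ge1(1)] by meson+
  have int: "integrable lborel (%y. dk (hi \<eta> s) 0 k (x - y) * (u y * v y))"
   if u: "\<exists>M. \<forall>x. norm (u x) <= M" "\<exists>M. \<forall>x. norm (v x) <= M" and [measurable]: "meas u" "meas v" for u v x k
  proof -
   obtain M N where MN: "!!x. norm (u x) <= M" "!!x. norm (v x) <= N" using u by blast
   have "norm (u y * v y) <= M * N" for y unfolding norm_mult using MN order_trans[OF norm_ge_zero MN(1)] by (intro mult_mono) auto
   then show ?thesis using nice_integrable[OF nh[of s k]] by (intro integrable_bounded_mult(1)[where B="M * N"]) (auto simp: integrable_reflect)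
  qed
  have aF: "a j = (%y. cx (2 powr (- (real_of_int j * s))) * piece \<eta> (- s) j Df y)" for j
   unfolding a_def using frac_D_piece[OF \<eta> D(1)] by auto
  have bF: "b j = (%y. cx (2 powr (- (real_of_int j * s))) * piece \<eta> (- s) j Dg y)" for j
   unfolding b_def using frac_D_piece[OF \<eta> D(2)] by auto
  let ?J = "{- int n..int n}"
  let ?c = "piece \<eta> s" and ?t = "%r. cx (2 powr (r * s))"
  have tm: "?t r * ?t r' = ?t (r + r')" for r r' by (simp add: powr_add distrib_right flip: of_real_mult)
  have scale: "?t (real_of_int k) * ?c k (%y. (cx (2 powr (- (real_of_int j * s))) * w y) * v y) x = ?t (real_of_int (k - j)) * ?c k (%y. w y * v y) x" for k j w v x
  proof -
   have "?t (real_of_int k) * cx (2 powr (- (real_of_int j * s))) = ?t (real_of_int (k - j))" using tm[of "real_of_int k" "- real_of_int j"] by simp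
   then show ?thesis unfolding mult.assoc[of "cx _"] conv_cmult by (simp only: mult.assoc[symmetric])
  qed
  let ?W = "%t k x. ?t (real_of_int (fst t)) * high_high_sum \<eta> s (fst t) (snd t) Df g ?J k x"
  have H: "?t (real_of_int k) * ?c k (band \<eta> f g n) x
   = (high_low_sum \<eta> s Df g ?J k x + high_low_sum \<eta> s Dg f ?J k x) + (\<Sum>t\<in>near_diagonal. ?W t k x)" for k x
  proof -
   have "band \<eta> f g n y = (\<Sum>j\<in>?J. a j y * \<gamma> (j - 3) y + b j y * \<phi> (j - 3) y + (\<Sum>t\<in>near_diagonal. a (j - fst t) y * b (j - snd t) y))" for y
    using paraproduct_decomposition[of "%j. a j y" "%j. \<phi> j y" "%j. b j y" "%j. \<gamma> j y" n]
    by (simp add: a_def b_def \<phi>_def \<gamma>_def band_def lo_telescope[OF \<eta> L(3) ge1(2)] lo_telescope[OF \<eta> L(2) ge1(1)] case_prod_beta)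
   then have "band \<eta> f g n = (%y. \<Sum>j\<in>?J. a j y * \<gamma> (j - 3) y + b j y * \<phi> (j - 3) y + (\<Sum>t\<in>near_diagonal. a (j - fst t) y * b (j - snd t) y))" by auto
   then have "?c k (band \<eta> f g n) x
    = (\<Sum>j\<in>?J. ?c k (%y. a j y * \<gamma> (j - 3) y) x + ?c k (%y. b j y * \<phi> (j - 3) y) x + (\<Sum>t\<in>near_diagonal. ?c k (%y. a (j - fst t) y * b (j - snd t) y) x))"
    by (simp add: conv_sum conv_add int bd near_diagonal_def distrib_left sum_distrib_left)
   then have "?t (real_of_int k) * ?c k (band \<eta> f g n) x
    = (\<Sum>j\<in>?J. ?t (real_of_int k) * ?c k (%y. a j y * \<gamma> (j - 3) y) x) + (\<Sum>j\<in>?J. ?t (real_of_int k) * ?c k (%y. b j y * \<phi> (j - 3) y) x)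
     + (\<Sum>j\<in>?J. \<Sum>t\<in>near_diagonal. ?t (real_of_int k) * ?c k (%y. a (j - fst t) y * b (j - snd t) y) x)"
    by (simp only: sum_distrib_left distrib_left sum.distrib)
   also have "(\<Sum>j\<in>?J. ?t (real_of_int k) * ?c k (%y. a j y * \<gamma> (j - 3) y) x) = high_low_sum \<eta> s Df g ?J k x"
    unfolding aF scale by (simp add: \<gamma>_def high_low_sum_def)
   also have "(\<Sum>j\<in>?J. ?t (real_of_int k) * ?c k (%y. b j y * \<phi> (j - 3) y) x) = high_low_sum \<eta> s Dg f ?J k x"
    unfolding bF scale by (simp add: \<phi>_def high_low_sum_def)
   also have "(\<Sum>j\<in>?J. \<Sum>t\<in>near_diagonal. ?t (real_of_int k) * ?c k (%y. a (j - fst t) y * b (j - snd t) y) x) = (\<Sum>t\<in>near_diagonal. ?W t k x)"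
   proof (subst sum.swap, unfold aF scale high_high_sum_def sum_distrib_left, intro sum.cong refl)
    fix t :: "int \<times> int" and j
    have "?t (real_of_int (k - (j - fst t))) = ?t (real_of_int (fst t)) * ?t (real_of_int (k - j))" unfolding tm by (simp add: algebra_simps)
    then show "?t (real_of_int (k - (j - fst t))) * ?c k (%y. piece \<eta> (- s) (j - fst t) Df y * b (j - snd t) y) x
     = ?t (real_of_int (fst t)) * (?t (real_of_int (k - j)) * ?c k (%y. piece \<eta> (- s) (j - fst t) Df y * piece \<eta> 0 (j - snd t) g y) x)"
     by (simp add: b_def mult.assoc)
   qed
   finally show ?thesis .
  qed
  let ?X = "Lp_norm p1 Df * Lp_norm q1 g" and ?Y = "Lp_norm p2 f * Lp_norm q2 Dg"
  have hm[measurable]: "meas (high_low_sum \<eta> s Df g ?J k)" "meas (high_low_sum \<eta> s Dg f ?J k)" "meas (high_high_sum \<eta> s l m Df g ?J k)" for k l m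
   unfolding high_low_sum_def[abs_def] high_high_sum_def[abs_def] by measurable
  have "mixed K (%k x. ?t (real_of_int k) * ?c k (band \<eta> f g n) x)
   <= mixed K (high_low_sum \<eta> s Df g ?J) + mixed K (high_low_sum \<eta> s Dg f ?J) + (\<Sum>t\<in>near_diagonal. mixed K (?W t))"
   unfolding H by (intro order_trans[OF mixed_add] add_mono mixed_add mixed_sum) (auto simp: near_diagonal_def)
  also have "... <= ennreal (C1 * ?X) + ennreal (C2 * (Lp_norm q2 Dg * Lp_norm p2 f)) + (\<Sum>t\<in>near_diagonal. ennreal (2 powr (2 * s)) * ennreal (C3 * ?X))"
   unfolding mixed_cmult[OF hm(3)] using K L s by (intro add_mono sum_mono mult_mono C1(2) C2(2) C3(2)) (auto simp: near_diagonal_def)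
  also have "... = ennreal (C1 * ?X + C2 * ?Y + 5 * (2 powr (2 * s) * (C3 * ?X)))"
  proof -
   have "of_nat (card near_diagonal) = ennreal 5" by (simp add: near_diagonal_def)
   then show ?thesis using C1(1) C2(1) C3(1) by (simp add: ennreal_mult'[symmetric] Lp_norm_nonneg mult_ac del: ennreal_numeral flip: ennreal_plus)
  qed
  also have "... <= ennreal (C * (?X + ?Y))"
   using C1(1) C2(1) C3(1) by (intro ennreal_leI) (simp add: C_def algebra_simps Lp_norm_nonneg add_nonneg_nonneg)
  finally show ?thesis .
 qed
 moreover have "C >= 0" using C1(1) C2(1) C3(1) by (simp add: C_def)
 ultimately show ?thesis by blast
qed

section \<open>Fractional derivatives of Schwartz functions are integrable\<close>

definition lap :: "('a::euclidean_space => complex) => 'a => complex" where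
 "lap f x = (\<Sum>b\<in>Basis. pd b (pd b f) x)"

lemma schwartz_sum:
 assumes "finite I" "I ~= {}" "!!i. i \<in> I ==> F i \<in> schwartz"
 shows "(%x. \<Sum>i\<in>I. F i x) \<in> schwartz" using assms by (induction I rule: finite_ne_induct) (auto intro: schwartz_add)

lemma lap_schwartz: "f \<in> schwartz ==> lap f \<in> schwartz" unfolding lap_def[abs_def] by (intro schwartz_sum schwartz_pd) auto

lemma ft_lap:
 assumes f: "f \<in> schwartz"
 shows "ft (lap f) x = - cx ((norm x)^2) * ft f x"
proof -
 have "ft (lap f) x = (\<Sum>b\<in>Basis. ft (pd b (pd b f)) x)" unfolding ft_def lap_def sum_distrib_left
  using f by (intro Bochner_Integration.integral_sum integrable_iexp_mult schwartz_integrable schwartz_pd) auto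
 also have "... = (\<Sum>b\<in>Basis. - cx ((x \<bullet> b)^2) * ft f x)"
 proof (intro sum.cong refl)
  fix b :: 'a assume b: "b \<in> Basis"
  have "ft (pd b (pd b f)) x = (\<i> * \<i>) * (cx (x \<bullet> b) * cx (x \<bullet> b)) * ft f x"
   unfolding ft_pd[OF schwartz_pd[OF f b] b] ft_pd[OF f b] by (simp only: mult_minus_left mult_minus_right minus_minus mult_ac)
  then show "ft (pd b (pd b f)) x = - cx ((x \<bullet> b)^2) * ft f x" by (simp add: power2_eq_square)
 qed
 finally show ?thesis by (simp add: norm_sq_sum sum_distrib_right sum_negf)
qed

lemma ft_cmult: "ft (%\<xi>. z * A \<xi>) x = z * ft A x"
proof -
 have "exp w * (z * A \<xi>) = z * (exp w * A \<xi>)" for w \<xi> by simp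
 then show ?thesis by (simp only: ft_def integral_mult_right_zero)
qed

lemma conv_ft:
 assumes A: "A \<in> schwartz" and u: "u \<in> schwartz"
 shows "conv (ft A) u x = ft (%\<xi>. A \<xi> * ft u (- \<xi>)) x"
proof -
 have "conv (ft A) u x = (LI y. ft A (y - (- x)) * u (- y))" using integral_reflect[of "%y. ft A (x - y) * u y" 0] by (simp add: conv_def add.commute)
 also have "... = (LI \<xi>. A \<xi> * (LI y. iexp ((y - (- x)) \<bullet> \<xi>) * u (- y)))"
  using schwartz_integrable[OF A] schwartz_integrable[OF u] integrable_reflect[of u 0] by (intro integral_ft_mult) auto
 also have "... = (LI \<xi>. iexp (x \<bullet> \<xi>) * (A \<xi> * ft u (- \<xi>)))"
 proof (intro Bochner_Integration.integral_cong refl)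
  fix \<xi>
  have e: "iexp ((y - (- x)) \<bullet> \<xi>) = iexp (x \<bullet> \<xi>) * iexp ((- \<xi>) \<bullet> (0 - y))" for y
   unfolding exp_add[symmetric] by (rule arg_cong[where f=exp]) (simp add: inner_add_left inner_commute algebra_simps)
  have "(LI y. iexp ((y - (- x)) \<bullet> \<xi>) * u (- y))
   = (LI y. iexp (x \<bullet> \<xi>) * (iexp ((- \<xi>) \<bullet> (0 - y)) * u (0 - y)))" unfolding e by (simp only: mult.assoc diff_0)
  also have "... = iexp (x \<bullet> \<xi>) * ft u (- \<xi>)"
   unfolding ft_def by (simp only: integral_mult_right_zero integral_reflect[of "%y. iexp ((- \<xi>) \<bullet> y) * u y" 0])
  finally show "A \<xi> * (LI y. iexp ((y - (- x)) \<bullet> \<xi>) * u (- y)) = iexp (x \<bullet> \<xi>) * (A \<xi> * ft u (- \<xi>))" by simp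
 qed
 finally show ?thesis by (simp only: ft_def[of "%\<xi>. A \<xi> * ft u (- \<xi>)"])
qed

text \<open>A frequency piece of \<open>D\<^sup>s \<phi>\<close> has \<open>L\<^sup>1\<close> norm of order \<open>2\<^sup>k\<^sup>s\<close>; moving \<open>2m\<close> derivatives onto \<open>\<phi>\<close>
 improves this to \<open>2\<^sup>k\<^sup>(\<^sup>s\<^sup>-\<^sup>2\<^sup>m\<^sup>)\<close>.\<close>

lemma frac_D_piece_L1:
 assumes \<eta>: "lp_cutoff \<eta>" and \<phi>: "\<phi> \<in> schwartz"
 shows "\<exists>C\<ge>0. \<forall>k. (NN x. enorm (ft (%\<xi>. sc k (hi \<eta> 0) \<xi> * (cx (norm \<xi> powr s) * ft \<phi> (- \<xi>))) x))
  <= ennreal (C * 2 powr (real_of_int k * (s - 2 * real m)))"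
proof -
 define u where "u = (lap ^^ m) \<phi>"
 have u: "u \<in> schwartz & (\<forall>x. ft u x = (- cx ((norm x)^2)) ^ m * ft \<phi> x)"
  unfolding u_def by (induction m) (auto simp: \<phi> lap_schwartz ft_lap)
 then have uS: "u \<in> schwartz" and fu: "!!x. ft u x = (- cx ((norm x)^2)) ^ m * ft \<phi> x" by auto
 let ?h = "hi \<eta> (s - 2 * real m)"
 define C where "C = (LI y. norm (ft ?h y)) * (LI y. norm (u y))"
 have C: "C >= 0" unfolding C_def by (intro mult_nonneg_nonneg integral_nonneg_AE) auto
 have "(NN x. enorm (ft (%\<xi>. sc k (hi \<eta> 0) \<xi> * (cx (norm \<xi> powr s) * ft \<phi> (- \<xi>))) x))
  <= ennreal (C * 2 powr (real_of_int k * (s - 2 * real m)))" for k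
 proof -
  define z where "z = (- 1) ^ m * cx (2 powr (real_of_int k * (s - 2 * real m)))"
  have "sc k (hi \<eta> 0) \<xi> * (cx (norm \<xi> powr s) * ft \<phi> (- \<xi>)) = z * (sc k ?h \<xi> * ft u (- \<xi>))" for \<xi>
  proof (cases "\<xi> = 0")
   case False
   have sg: "(- 1) ^ m * (- cx ((norm \<xi>)^2)) ^ m = cx (norm \<xi> powr (2 * real m))"
   proof -
    have "(norm \<xi> powr (2 * real m)) = ((norm \<xi>)^2) ^ m" using False powr_realpow[of "norm \<xi>" "2 * m"] by (simp add: power_mult)
    then show ?thesis by (simp flip: power_mult_distrib)
   qed
   have "sc k (hi \<eta> 0) \<xi> * (cx (norm \<xi> powr s) * ft \<phi> (- \<xi>))
    = (cx (norm \<xi> powr (s - 2 * real m)) * sc k (hi \<eta> 0) \<xi>) * cx (norm \<xi> powr (2 * real m)) * ft \<phi> (- \<xi>)"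
    using False by (simp add: powr_diff)
   also have "... = cx (2 powr (real_of_int k * (s - 2 * real m))) * sc k ?h \<xi> * ((- 1) ^ m * (- cx ((norm \<xi>)^2)) ^ m) * ft \<phi> (- \<xi>)"
    unfolding hi_frac sg by simp
   also have "... = z * (sc k ?h \<xi> * ft u (- \<xi>))" unfolding z_def fu norm_minus_cancel by (simp only: mult_ac)
   finally show ?thesis .
  qed (simp add: sc_def hi_def)
  then have e: "ft (%\<xi>. sc k (hi \<eta> 0) \<xi> * (cx (norm \<xi> powr s) * ft \<phi> (- \<xi>))) x = z * conv (dk ?h 0 k) u x" for x
   unfolding dk_0 by (subst conv_ft) (auto simp: ft_cmult intro!: uS bumps_schwartz sc_bumps hi_bumps \<eta>)
  have [measurable]: "meas u" "meas (dk ?h 0 k)" by (intro schwartz_measurable uS, intro nice_measurable dk_nice hi_bumps \<eta>)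
  have "(NN x. enorm (z * conv (dk ?h 0 k) u x)) = enorm z * (NN x. enorm (conv (dk ?h 0 k) u x))"
   by (simp add: norm_mult ennreal_mult' nn_integral_cmult)
  also have "... <= enorm z * (ennreal (LI y. norm (ft ?h y)) * (NN x. enorm (u x)))"
   by (intro mult_left_mono nn_integral_conv_dk_le hi_bumps \<eta>) auto
  also have "(NN x. enorm (u x)) = ennreal (LI x. norm (u x))" using schwartz_integrable[OF uS] by (subst nn_integral_eq_integral) auto
  also have "norm z = 2 powr (real_of_int k * (s - 2 * real m))" by (simp add: z_def norm_mult norm_power)
  finally show ?thesis unfolding e by (simp add: C_def ennreal_mult'[symmetric] integral_nonneg_AE mult_ac)
 qed
 then show ?thesis using C by blast
qed

text \<open>Summing the pieces, with \<open>m = 0\<close> for \<open>k <= 0\<close> and with \<open>2m > s\<close> for \<open>k > 0\<close>.\<close>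

lemma frac_D_nice:
 fixes \<phi> :: "'a::euclidean_space => complex" and \<eta> :: "'a => real"
 assumes \<eta>: "lp_cutoff \<eta>" and s: "s > 0" and \<phi>: "\<phi> \<in> schwartz"
 shows "nice (frac_D s \<phi>)"
proof -
 define c where "c = cx ((2 * pi) ^ DIM('a))"
 define v where "v \<xi> = cx (norm \<xi> powr s) * ft \<phi> (- \<xi>)" for \<xi>
 have fS: "ft \<phi> \<in> schwartz" by (rule ft_schwartz[OF \<phi>])
 have [measurable]: "meas (ft \<phi>)" by (rule schwartz_measurable[OF fS])
 have [measurable]: "meas v" unfolding v_def by measurable
 obtain m :: nat where "s < real m" using reals_Archimedean2 by blast
 then have m: "s < 2 * real m" using of_nat_0_le_iff[of m, where 'a=real] by linarith
 obtain B where B: "B >= 0" "!!x. (1 + norm x) ^ (2 * m) * norm (ft \<phi> x) <= B * wgt x" using schwartz_wgt_bound[OF fS, of "2 * m"] by blast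
 have vi: "integrable lborel v"
 proof (rule Bochner_Integration.integrable_bound[where f="%x. B * wgt (x::'a)"])
  show "integrable lborel (%x. B * wgt (x::'a))" by (intro integrable_mult_right integrable_wgt)
  show "AE x in lborel. norm (v x) <= norm (B * wgt x)"
  proof (intro AE_I2)
   fix x :: 'a
   have "norm x powr s <= (1 + norm x) powr s" using s by (intro powr_mono2) auto
   also have "... <= (1 + norm x) powr (real (2 * m))" using m by (intro powr_mono) auto
   also have "... = (1 + norm x) ^ (2 * m)" by (rule powr_realpow) (simp add: add_pos_nonneg)
   finally have "norm (v x) <= (1 + norm (- x)) ^ (2 * m) * norm (ft \<phi> (- x))" by (simp add: v_def norm_mult mult_right_mono)
   also have "... <= B * wgt x" using B(2)[of "- x"] by (simp add: wgt_minus)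
   finally show "norm (v x) <= norm (B * wgt x)" by simp
  qed
 qed measurable
 have ev: "frac_D s \<phi> x = ft (%\<xi>. 1 / c * v \<xi>) x" for x
  unfolding ft_cmult by (simp add: frac_D_def inv_fourier_eq_ft fourier_eq_ft c_def v_def[abs_def])
 have [measurable]: "meas (frac_D s \<phi>)" unfolding ev[abs_def] ft_def by measurable
 have bd: "norm (frac_D s \<phi> x) <= (LI \<xi>. norm (1 / c * v \<xi>))" for x unfolding ev by (rule norm_ft_le)
 define P where "P k = ft (%\<xi>. sc k (hi \<eta> 0) \<xi> * v \<xi>)" for k
 obtain C0 where C0: "C0 >= 0" "!!k. (NN x. enorm (P k x)) <= ennreal (C0 * 2 powr (real_of_int k * s))"
  using frac_D_piece_L1[OF \<eta> \<phi>, of s 0] unfolding P_def v_def by auto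
 obtain C1 where C1: "C1 >= 0" "!!k. (NN x. enorm (P k x)) <= ennreal (C1 * 2 powr (real_of_int k * (s - 2 * real m)))"
  using frac_D_piece_L1[OF \<eta> \<phi>, of s m] unfolding P_def v_def by auto
 have lob: "norm (sc k (lo \<eta>) \<xi>) <= norm (1 / c)" for k \<xi>
 proof -
  have h: "\<forall>y. 0 <= \<eta> y" "\<forall>x y. norm x <= norm y --> \<eta> y <= \<eta> x" using \<eta> unfolding lp_cutoff_def by blast+
  have "0 <= \<eta> y" "\<eta> y <= 1" for y using h(1)[rule_format, of y] h(2)[rule_format, of 0 y] cutoff_bumps(4)[OF \<eta>, of 0] by simp_all
  then show ?thesis by (simp add: sc_def lo_def c_def norm_divide divide_right_mono)
 qed
 have lom: "meas (sc k (lo \<eta>))" for k by (intro schwartz_measurable bumps_schwartz sc_bumps lo_bumps \<eta>)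
 have li: "integrable lborel (%\<xi>. sc k (lo \<eta>) \<xi> * v \<xi>)" for k by (rule integrable_bounded_mult(2)[OF vi lom lob])
 have Pi: "P k x = ft (%\<xi>. sc k (lo \<eta>) \<xi> * v \<xi>) x - ft (%\<xi>. sc (k - 1) (lo \<eta>) \<xi> * v \<xi>) x" for k x
  unfolding P_def ft_def sc_hi_telescope by (simp add: left_diff_distrib right_diff_distrib integrable_iexp_mult li)
 define S where "S n x = (\<Sum>k\<in>{- int n..int n}. P k x)" for n x
 have [measurable]: "meas (P k)" for k using lom unfolding Pi[abs_def] ft_def by measurable
 have [measurable]: "meas (S n)" for n unfolding S_def by measurable
 have Se: "S n x = ft (%\<xi>. (sc (int n) (lo \<eta>) \<xi> - sc (- int n - 1) (lo \<eta>) \<xi>) * v \<xi>) x" for n x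
 proof -
  have "S n x = ft (%\<xi>. sc (int n) (lo \<eta>) \<xi> * v \<xi>) x - ft (%\<xi>. sc (- int n - 1) (lo \<eta>) \<xi> * v \<xi>) x"
   unfolding S_def Pi by (rule telescope_int)
  then show ?thesis unfolding ft_def by (simp add: left_diff_distrib right_diff_distrib integrable_iexp_mult li)
 qed
 have lim: "(%n. S n x) \<longlonglongrightarrow> frac_D s \<phi> x" for x unfolding Se ev ft_def
 proof (rule integral_dominated_convergence[where w="%\<xi>. 2 * norm (1 / c) * norm (v \<xi>)"])
  show "integrable lborel (%\<xi>. 2 * norm (1 / c) * norm (v \<xi>))" using vi by (intro integrable_mult_right integrable_norm)
  show "AE \<xi> in lborel. norm (iexp (x \<bullet> \<xi>) * ((sc (int n) (lo \<eta>) \<xi> - sc (- int n - 1) (lo \<eta>) \<xi>) * v \<xi>)) <= 2 * norm (1 / c) * norm (v \<xi>)" for n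
  proof (intro AE_I2)
   fix \<xi>
   have "norm (sc (int n) (lo \<eta>) \<xi> - sc (- int n - 1) (lo \<eta>) \<xi>) <= 2 * norm (1 / c)"
    using norm_triangle_ineq4[of "sc (int n) (lo \<eta>) \<xi>" "sc (- int n - 1) (lo \<eta>) \<xi>"] lob[of "int n" \<xi>] lob[of "- int n - 1" \<xi>] by linarith
   then show "norm (iexp (x \<bullet> \<xi>) * ((sc (int n) (lo \<eta>) \<xi> - sc (- int n - 1) (lo \<eta>) \<xi>) * v \<xi>)) <= 2 * norm (1 / c) * norm (v \<xi>)"
    by (simp only: norm_mult norm_exp_i_times mult_1_left mult_right_mono norm_ge_zero)
  qed
  show "AE \<xi> in lborel. (%n. iexp (x \<bullet> \<xi>) * ((sc (int n) (lo \<eta>) \<xi> - sc (- int n - 1) (lo \<eta>) \<xi>) * v \<xi>))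
   \<longlonglongrightarrow> iexp (x \<bullet> \<xi>) * (1 / c * v \<xi>)"
  proof (intro AE_I2)
   fix \<xi>
   show "(%n. iexp (x \<bullet> \<xi>) * ((sc (int n) (lo \<eta>) \<xi> - sc (- int n - 1) (lo \<eta>) \<xi>) * v \<xi>))
    \<longlonglongrightarrow> iexp (x \<bullet> \<xi>) * (1 / c * v \<xi>)"
   proof (cases "\<xi> = 0")
    case True
    then show ?thesis by (simp add: v_def)
   next
    case False
    obtain N where N: "norm \<xi> + 2 / norm \<xi> < 2 ^ N" using real_arch_pow[of 2 "norm \<xi> + 2 / norm \<xi>"] by auto
    have "sc (int n) (lo \<eta>) \<xi> - sc (- int n - 1) (lo \<eta>) \<xi> = 1 / c" if n: "n >= N" for n
    proof -
     have "(2::real) ^ N <= 2 ^ n" using n by (intro power_increasing) auto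
     then have "norm \<xi> <= 2 ^ n" "2 / norm \<xi> <= 2 ^ n" using N False by (smt (verit) divide_nonneg_nonneg norm_ge_zero)+
     then have "norm (\<xi> /\<^sub>R (2 powi (int n))) <= 1" "norm (\<xi> /\<^sub>R (2 powi (- int n - 1))) > 1.1"
      using False by (auto simp: power_int_diff power_int_minus field_simps)
     then show ?thesis using cutoff_bumps(4)[OF \<eta>] cutoff_bumps(3)[OF \<eta>] by (simp add: sc_def lo_def c_def)
    qed
    then have "\<forall>\<^sub>F n in sequentially. sc (int n) (lo \<eta>) \<xi> - sc (- int n - 1) (lo \<eta>) \<xi> = 1 / c"
     unfolding eventually_sequentially by blast
    then show ?thesis by (intro tendsto_mult tendsto_const tendsto_eventually)
   qed
  qed
 qed (use lom in measurable)
 define D where "D = C0 * (1 / (1 - 2 powr (- s))) + C1 * (1 / (1 - 2 powr (- (2 * real m - s))))"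
 have SL: "(NN x. enorm (S n x)) <= ennreal D" for n
 proof -
  let ?K = "{- int n..int n}"
  have "(NN x. enorm (S n x)) <= (NN x. (\<Sum>k\<in>?K. enorm (P k x)))" unfolding S_def by (intro nn_integral_mono) (simp add: ennreal_leI norm_sum)
  also have "... = (\<Sum>k\<in>?K. (NN x. enorm (P k x)))" by (rule nn_integral_sum) measurable
  also have "... <= (\<Sum>k\<in>?K. ennreal (if k <= 0 then C0 * 2 powr (real_of_int k * s) else C1 * 2 powr (real_of_int k * (s - 2 * real m))))"
   by (intro sum_mono) (auto intro: C0(2) C1(2))
  also have "... = ennreal (\<Sum>k\<in>?K. if k <= 0 then C0 * 2 powr (real_of_int k * s) else C1 * 2 powr (real_of_int k * (s - 2 * real m)))"
   using C0(1) C1(1) by (subst sum_ennreal) auto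
  also have "... <= ennreal D"
  proof (intro ennreal_leI)
   have "(\<Sum>k\<in>?K. if k <= 0 then C0 * 2 powr (real_of_int k * s) else C1 * 2 powr (real_of_int k * (s - 2 * real m)))
    = C0 * (\<Sum>k\<in>?K \<inter> {k. k <= 0}. 2 powr (real_of_int k * s)) + C1 * (\<Sum>k\<in>?K \<inter> - {k. k <= 0}. 2 powr (real_of_int k * (s - 2 * real m)))"
    by (subst sum.If_cases) (simp_all add: sum_distrib_left)
   also have "(\<Sum>k\<in>?K \<inter> - {k. k <= 0}. 2 powr (real_of_int k * (s - 2 * real m)))
    = (\<Sum>k\<in>uminus ` (?K \<inter> - {k. k <= 0}). 2 powr (real_of_int k * (2 * real m - s)))" by (subst sum.reindex) (auto simp: algebra_simps)
   also have "C0 * (\<Sum>k\<in>?K \<inter> {k. k <= 0}. 2 powr (real_of_int k * s)) + C1 * (\<Sum>k\<in>uminus ` (?K \<inter> - {k. k <= 0}). 2 powr (real_of_int k * (2 * real m - s)))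
    <= C0 * (2 powr (real_of_int 0 * s) / (1 - 2 powr (- s))) + C1 * (2 powr (real_of_int 0 * (2 * real m - s)) / (1 - 2 powr (- (2 * real m - s))))"
    using s m C0(1) C1(1) by (intro add_mono mult_left_mono geometric_sum_le) auto
   finally show "(\<Sum>k\<in>?K. if k <= 0 then C0 * 2 powr (real_of_int k * s) else C1 * 2 powr (real_of_int k * (s - 2 * real m))) <= D"
    by (simp add: D_def)
  qed
  finally show ?thesis .
 qed
 have "(NN x. enorm (frac_D s \<phi> x)) = (NN x. liminf (%n. enorm (S n x)))"
  by (intro nn_integral_cong lim_imp_Liminf[symmetric] tendsto_ennrealI tendsto_norm lim) simp
 also have "... <= liminf (%n. (NN x. enorm (S n x)))" by (rule nn_integral_liminf) measurable
 also have "... <= liminf (%n. ennreal D)" by (intro Liminf_mono always_eventually allI SL)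
 also have "... < \<infinity>" by (simp add: Liminf_const)
 finally have "integrable lborel (frac_D s \<phi>)" by (intro integrableI_bounded) auto
 then show ?thesis using bd unfolding nice_def by blast
qed

section \<open>The product estimate\<close>

text \<open>All low-frequency truncations of \<open>f\<close> are controlled by the maximal function of \<open>D\<^sup>s f\<close> up to a
 constant: below frequency one \<open>f\<close> is bounded, and the piece at frequency \<open>2\<^sup>j\<close> costs only \<open>2\<^sup>-\<^sup>j\<^sup>s\<close>.
 This is why \<open>fg\<close> can be paired with integrable bounded functions even when \<open>1/p\<^sub>2 + 1/q\<^sub>1 > 1\<close>.\<close>

lemma truncations_bounded:
 fixes \<eta> :: "'a::euclidean_space => real"
 assumes \<eta>: "lp_cutoff \<eta>" and s: "s > 0" and D: "is_frac_D s f Df" and f: "f \<in> Lp_space p" "p >= 1"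
  and [measurable]: "meas Df"
 shows "\<exists>B\<ge>0. \<exists>C\<ge>0. \<forall>j x. maxf Df x < \<infinity> --> norm (lowp \<eta> j f x) <= B + C * mf Df x"
proof -
 obtain M N where MN: "M >= 0" "N >= 0" "!!e j x. e > 0 ==> norm (lowp \<eta> j f x) <= e * M + (2 powi j) ^ DIM('a) * e powr (1 - p) * N"
  using conv_dk_low_bound[OF lo_bumps[OF \<eta>] f] by blast
 obtain C where C: "C >= 1" "!!w j f x. meas f ==> maxf f x < \<infinity> ==>
  norm (conv (dk (hi \<eta> (- s)) w j) f x) <= C * (1 + norm w) ^ (DIM('a) + 1) * mf f x"
  using conv_dk_le_mf[OF hi_bumps[OF \<eta>], of "- s"] by blast
 define q where "q = 2 powr (- s)"
 have q: "0 < q" "q < 1" using s by (auto simp: q_def powr_less_one)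
 have low: "norm (lowp \<eta> j f x) <= M + N" if "j <= 0" for j x
 proof -
  have "((2::real) powi j) ^ DIM('a) <= 1" using powi_increasing[OF that] by (intro power_le_one) auto
  then have "((2::real) powi j) ^ DIM('a) * N <= 1 * N" by (intro mult_right_mono MN(2))
  then show ?thesis using MN(3)[of 1 j x] by simp
 qed
 have high: "norm (lowp \<eta> (int n) f x) <= M + N + C * mf Df x * (\<Sum>i<Suc n. q ^ i)" if fin: "maxf Df x < \<infinity>" for n x
 proof (induction n)
  case 0
  have "0 <= C * mf Df x" using C(1) by (simp add: mf_nonneg)
  then show ?case using low[of 0 x] by simp
 next
  case (Suc n)
  have "norm (piece \<eta> 0 (int (Suc n)) f x) = q ^ Suc n * norm (piece \<eta> (- s) (int (Suc n)) Df x)"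
  proof -
   have "2 powr (- (real_of_int (int (Suc n)) * s)) = q ^ Suc n" using powr_realpow[OF q(1), of "Suc n"] by (simp add: q_def powr_powr algebra_simps)
   then show ?thesis unfolding frac_D_piece[OF \<eta> D] norm_mult norm_of_real abs_of_nonneg[OF powr_ge_zero] by simp
  qed
  also have "... <= q ^ Suc n * (C * mf Df x)" using C(2)[OF _ fin, of 0 "int (Suc n)"] q by (intro mult_left_mono) auto
  finally have "norm (lowp \<eta> (int (Suc n)) f x) <= norm (lowp \<eta> (int n) f x) + q ^ Suc n * (C * mf Df x)"
   using lo_telescope[OF \<eta> f, of "int (Suc n)" x] norm_triangle_sub[of "lowp \<eta> (int (Suc n)) f x" "lowp \<eta> (int n) f x"] by simp
  then show ?case using Suc by (simp add: algebra_simps)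
 qed
 have "norm (lowp \<eta> j f x) <= (M + N) + C * (1 / (1 - q)) * mf Df x" if fin: "maxf Df x < \<infinity>" for j x
 proof (cases "j <= 0")
  case True
  have "0 <= C * (1 / (1 - q)) * mf Df x" using C(1) q by (intro mult_nonneg_nonneg mf_nonneg) auto
  then show ?thesis using low[OF True, of x] by linarith
 next
  case False
  have "(\<Sum>i<Suc (nat j). q ^ i) <= (\<Sum>i. q ^ i)" using q by (intro sum_le_suminf summable_geometric) auto
  also have "... = 1 / (1 - q)" using q by (intro suminf_geometric) simp
  finally have "C * mf Df x * (\<Sum>i<Suc (nat j). q ^ i) <= C * mf Df x * (1 / (1 - q))" using C(1) by (intro mult_left_mono) (auto simp: mf_nonneg)
  then show ?thesis using high[OF fin, of "nat j"] False by (simp add: mult_ac)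
 qed
 moreover have "C * (1 / (1 - q)) >= 0" using C(1) q by simp
 ultimately show ?thesis using MN(1,2) by (intro exI[of _ "M + N"] conjI exI[of _ "C * (1 / (1 - q))"]) auto
qed

text \<open>The majorant is \<open>(B + C M(D\<^sup>sf)) E Mg\<close> with \<open>M\<close> the maximal function. It is integrable against a bounded
 integrable \<open>\<psi>\<close> because each of its terms is at most a multiple of \<open>1 + M(D\<^sup>sf)\<^sup>p + (Mg)\<^sup>q\<close>.\<close>
lemma product_dominated:
 fixes \<eta> :: "'a::euclidean_space => real"
 assumes \<eta>: "lp_cutoff \<eta>" and s: "s > 0" and p: "1 < p1" "1 < q1" "1 / p1 + 1 / q1 = 1" and p2: "1 < p2"
  and D: "is_frac_D s f Df" and L: "Df \<in> Lp_space p1" "g \<in> Lp_space q1" "f \<in> Lp_space p2"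
 obtains \<Phi> where "meas \<Phi>"
  "AE x in lborel. \<forall>j. norm (lowp \<eta> j f x * lowp \<eta> j g x) <= \<Phi> x"
  "!!\<psi> :: 'a => complex. nice \<psi> ==> integrable lborel (%x. norm (\<psi> x) * \<Phi> x)"
proof -
 have [measurable]: "meas Df" "meas g" using L by (auto simp: Lp_space_iff)
 have p2': "p2 >= 1" using p2 by simp
 obtain B C where BC: "B >= 0" "C >= 0" "!!j x. maxf Df x < \<infinity> ==> norm (lowp \<eta> j f x) <= B + C * mf Df x"
  using truncations_bounded[OF \<eta> s D L(3) p2'] by auto
 obtain E where E: "E >= 1" "!!w j f x. meas f ==> maxf f x < \<infinity> ==>
  norm (conv (dk (lo \<eta>) w j) f x) <= E * (1 + norm w) ^ (DIM('a) + 1) * mf f x" using conv_dk_le_mf[OF lo_bumps[OF \<eta>]] by blast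
 define \<Phi> where "\<Phi> x = (B + C * mf Df x) * (E * mf g x)" for x
 have [measurable]: "meas \<Phi>" unfolding \<Phi>_def by measurable
 have P0: "\<Phi> x >= 0" for x unfolding \<Phi>_def using BC E by (intro mult_nonneg_nonneg add_nonneg_nonneg mf_nonneg) auto
 have A: "AE x in lborel. \<forall>j. norm (lowp \<eta> j f x * lowp \<eta> j g x) <= \<Phi> x"
  using maxf_finite_AE[OF L(1) p(1)] maxf_finite_AE[OF L(2) p(2)]
 proof eventually_elim
  case (elim x)
  have "norm (lowp \<eta> j g x) <= E * mf g x" for j using E(2)[of g x 0 j] elim(2) by simp
  then show ?case unfolding \<Phi>_def norm_mult using BC elim(1) by (intro allI mult_mono) (auto intro!: mult_nonneg_nonneg add_nonneg_nonneg mf_nonneg)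
 qed
 have I: "integrable lborel (%x. norm (\<psi> x) * \<Phi> x)" if \<psi>: "nice \<psi>" for \<psi> :: "'a => complex"
 proof -
  have [measurable]: "meas \<psi>" by (rule nice_measurable[OF \<psi>])
  obtain R where R: "R >= 0" "!!x. norm (\<psi> x) <= R" using nice_bound[OF \<psi>] by blast
  have mi: "integrable lborel (%x. mf h x powr r)" if h: "h \<in> Lp_space r" and r: "r > 1" for h :: "'a => complex" and r
  proof -
   obtain A where "pint r (mf h) <= ennreal ((A * Lp_norm r h) powr r)" using mf_Lp_norm[OF r] h by blast
   then have "(NN x. ennreal (mf h x powr r)) < \<infinity>" unfolding pint_def by (simp add: mf_nonneg le_less_trans[OF _ ennreal_less_top])
   then show ?thesis by (intro integrableI_bounded) auto
  qed
  let ?b = "%x. (B + C) * E * norm (\<psi> x) + (B + C) * E * R * (mf Df x powr p1 + mf g x powr q1)"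
  have "integrable lborel ?b" using mi[OF L(1) p(1)] mi[OF L(2) p(2)] nice_integrable[OF \<psi>]
   by (intro Bochner_Integration.integrable_add integrable_mult_right integrable_norm)
  then show ?thesis
  proof (rule Bochner_Integration.integrable_bound)
   show "AE x in lborel. norm (norm (\<psi> x) * \<Phi> x) <= norm (?b x)"
   proof (intro AE_I2)
    fix x
    let ?u = "mf Df x" and ?v = "mf g x" let ?P = "1 + ?u powr p1 + ?v powr q1"
    have "?v <= 1 + ?v powr q1" using p by (intro le_one_plus_powr mf_nonneg) auto
    also have "... <= ?P" by simp
    finally have 1: "?v <= ?P" .
    have 2: "?u * ?v <= ?P" using p by (intro mult_le_one_plus_powr mf_nonneg) auto
    have "\<Phi> x = E * (B * ?v + C * (?u * ?v))" by (simp add: \<Phi>_def algebra_simps)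
    also have "... <= E * (B * ?P + C * ?P)" using 1 2 BC E by (intro mult_left_mono add_mono) auto
    finally have "norm (\<psi> x) * \<Phi> x <= norm (\<psi> x) * ((B + C) * E * ?P)" by (intro mult_left_mono) (auto simp: algebra_simps)
    also have "... = (B + C) * E * norm (\<psi> x) + (B + C) * E * norm (\<psi> x) * (?u powr p1 + ?v powr q1)" by (simp add: algebra_simps)
    also have "... <= ?b x" using BC E R by (intro add_left_mono mult_right_mono mult_left_mono) auto
    finally show "norm (norm (\<psi> x) * \<Phi> x) <= norm (?b x)" using P0[of x] by simp
   qed
  qed measurable
 qed
 show ?thesis by (rule that[OF _ A I]) measurable
qed

text \<open>Symmetric intervals exhaust the finite sets, which makes monotone convergence applicable.\<close>
lemma SUP_finite_int_sets:
 fixes a :: "int => real"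
 shows "(SUP K\<in>{K. finite K}. ennreal (L2_set a K)) = (SUP n. ennreal (L2_set a {- int n..int n}))"
proof (rule antisym)
 show "(SUP K\<in>{K. finite K}. ennreal (L2_set a K)) <= (SUP n. ennreal (L2_set a {- int n..int n}))"
 proof (rule SUP_least)
  fix K :: "int set" assume "K \<in> {K. finite K}"
  then have K: "finite K" by simp
  obtain n where "!!k. k \<in> K ==> nat \<bar>k\<bar> <= n" using K finite_nat_set_iff_bounded_le[of "(%k. nat \<bar>k\<bar>) ` K"] by auto
  then have "K \<subseteq> {- int n..int n}" by (auto simp: abs_le_iff nat_le_iff) (smt (verit) nat_le_iff)+
  then have "L2_set a K <= L2_set a {- int n..int n}" unfolding L2_set_def by (intro real_sqrt_le_mono sum_mono2) auto
  then show "ennreal (L2_set a K) <= (SUP n. ennreal (L2_set a {- int n..int n}))" by (intro SUP_upper2[of n]) (auto intro: ennreal_leI)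
 qed
 show "(SUP n. ennreal (L2_set a {- int n..int n})) <= (SUP K\<in>{K. finite K}. ennreal (L2_set a K))"
  by (intro SUP_mono) (auto intro!: bexI[of _ "{- int _..int _}"])
qed

theorem lemma2p6:
  fixes \<eta> :: "'a::euclidean_space \<Rightarrow> real"
    and s p1 q1 p2 q2 :: real
  assumes "lp_cutoff \<eta>"
    and "s > 0"
    and "1 < p1" "1 < q1" "1 / p1 + 1 / q1 = 1"
    and "1 < p2" "1 < q2" "1 / p2 + 1 / q2 = 1"
  shows "\<exists>C>0. \<forall>(f :: 'a \<Rightarrow> complex) (g :: 'a \<Rightarrow> complex) (Df :: 'a \<Rightarrow> complex) (Dg :: 'a \<Rightarrow> complex).
    is_frac_D s f Df \<and> is_frac_D s g Dg \<and>
    Df \<in> Lp_space p1 \<and> g \<in> Lp_space q1 \<and> f \<in> Lp_space p2 \<and> Dg \<in> Lp_space q2 \<longrightarrow>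
      has_frac_D_distr s (\<lambda>x. f x * g x) \<and>
      hardy_norm \<eta> (frac_D_distr s (\<lambda>x. f x * g x)) \<le>
        ennreal (C * (Lp_norm p1 Df * Lp_norm q1 g + Lp_norm p2 f * Lp_norm q2 Dg))"
proof -
 note \<eta> = assms(1) and s = assms(2)
 obtain C where C: "C >= 0" "!!f g Df Dg K n. is_frac_D s f Df ==> is_frac_D s g Dg ==>
  Df \<in> Lp_space p1 ==> g \<in> Lp_space q1 ==> f \<in> Lp_space p2 ==> Dg \<in> Lp_space q2 ==> finite K ==>
  mixed K (%k x. cx (2 powr (real_of_int k * s)) * piece \<eta> s k (band \<eta> f g n) x) <= ennreal (C * (Lp_norm p1 Df * Lp_norm q1 g + Lp_norm p2 f * Lp_norm q2 Dg))"
  using paraproduct_bound[OF assms] by blast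
 have "has_frac_D_distr s (%x. f x * g x) & hardy_norm \<eta> (frac_D_distr s (%x. f x * g x)) <=
    ennreal ((C + 1) * (Lp_norm p1 Df * Lp_norm q1 g + Lp_norm p2 f * Lp_norm q2 Dg))"
  if D: "is_frac_D s f Df" "is_frac_D s g Dg" and L: "Df \<in> Lp_space p1" "g \<in> Lp_space q1" "f \<in> Lp_space p2" "Dg \<in> Lp_space q2"
  for f g Df Dg :: "'a => complex"
 proof -
  have [measurable]: "meas g" "meas f" using L by (auto simp: Lp_space_iff)
  have ge1: "q1 >= 1" "p2 >= 1" using assms by auto
  obtain \<Phi> where \<Phi>: "meas \<Phi>"
   "AE x in lborel. \<forall>j. norm (lowp \<eta> j f x * lowp \<eta> j g x) <= \<Phi> x"
   "!!\<psi> :: 'a => complex. nice \<psi> ==> integrable lborel (%x. norm (\<psi> x) * \<Phi> x)"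
   using product_dominated[OF \<eta> s assms(3,4,5,6) D(1) L(1,2,3)] by blast
  note [measurable] = \<Phi>(1)
  have lo1: "cx ((2 * pi) ^ DIM('a)) * lo \<eta> 0 = 1" by (simp add: lo_def cutoff_bumps(4)[OF \<eta>])
  note lb = lo_bumps[OF \<eta>]
  have nh: "nice (dk (hi \<eta> c) 0 k)" and nl: "nice (dk (lo \<eta>) 0 k)" for k c by (intro dk_nice hi_bumps lo_bumps \<eta>)+
  have [measurable]: "meas (dk (hi \<eta> c) 0 j)" "meas (dk (lo \<eta>) 0 j)" for c j by (intro nice_measurable nh nl)+
  define h where "h = band \<eta> f g"
  have [measurable]: "meas (h n)" for n unfolding h_def band_def[abs_def] by measurable
  \<comment> \<open>Domination and convergence of the truncated products, hence the same majorant for \<open>fg\<close>.\<close>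
  have hb: "AE y in lborel. \<forall>n. norm (h n y) <= 2 * \<Phi> y" using \<Phi>(2)
  proof eventually_elim
   case (elim y)
   show ?case
   proof
    fix n
    show "norm (h n y) <= 2 * \<Phi> y"
     using norm_triangle_ineq4 elim[rule_format, of "int n"] elim[rule_format, of "- int n - 1"] unfolding h_def band_def by (smt (verit))
   qed
  qed
  have hl: "AE y in lborel. (%n. h n y) \<longlonglongrightarrow> f y * g y"
   using conv_dk_tendsto_AE[OF lb lo1 L(3) assms(6)] conv_dk_tendsto_AE[OF lb lo1 L(2) assms(4)]
  proof eventually_elim
   case (elim y)
   have "(%n. h n y) \<longlonglongrightarrow> f y * g y - 0 * 0"
    unfolding h_def band_def by (intro tendsto_diff tendsto_mult elim conv_dk_tendsto_0[OF lb L(3) ge1(2)] conv_dk_tendsto_0[OF lb L(2) ge1(1)])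
   then show ?case by simp
  qed
  have fgb: "AE y in lborel. norm (f y * g y) <= 2 * \<Phi> y" using hb hl
  proof eventually_elim
   case (elim y)
   then show ?case by (intro LIMSEQ_le_const2[OF tendsto_norm[OF elim(2)]]) auto
  qed
  have "has_frac_D_distr s (%x. f x * g x)" unfolding has_frac_D_distr_def
  proof
   fix \<phi> :: "'a => complex" assume "\<phi> \<in> schwartz"
   then have n: "nice (frac_D s \<phi>)" by (rule frac_D_nice[OF \<eta> s])
   have [measurable]: "meas (frac_D s \<phi>)" by (rule nice_measurable[OF n])
   show "integrable lborel (%x. f x * g x * frac_D s \<phi> x)"
   proof (rule Bochner_Integration.integrable_bound[OF integrable_mult_right[OF \<Phi>(3)[OF n], of 2]])
    show "AE x in lborel. norm (f x * g x * frac_D s \<phi> x) <= norm (2 * (norm (frac_D s \<phi> x) * \<Phi> x))" using fgb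
    proof eventually_elim
     case (elim x)
     then have "norm (f x * g x) * norm (frac_D s \<phi> x) <= (2 * \<Phi> x) * norm (frac_D s \<phi> x)" by (rule mult_right_mono) simp
     then have "norm (f x * g x * frac_D s \<phi> x) <= 2 * (norm (frac_D s \<phi> x) * \<Phi> x)" by (simp add: norm_mult mult_ac)
     then show ?case unfolding real_norm_def by (rule order_trans[OF _ abs_ge_self])
    qed
   qed measurable
  qed
  moreover have "hardy_norm \<eta> (frac_D_distr s (%x. f x * g x)) <=
    ennreal ((C + 1) * (Lp_norm p1 Df * Lp_norm q1 g + Lp_norm p2 f * Lp_norm q2 Dg))"
  proof -
   let ?X = "Lp_norm p1 Df * Lp_norm q1 g + Lp_norm p2 f * Lp_norm q2 Dg"
   define R where "R k x = norm (cx (2 powr (real_of_int k * s)) * piece \<eta> s k (%y. f y * g y) x)" for k x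
   have [measurable]: "meas (R k)" for k unfolding R_def by measurable
   have "(%n. piece \<eta> s k (h n) x) \<longlonglongrightarrow> piece \<eta> s k (%y. f y * g y) x" for k x unfolding conv_def
   proof (rule integral_dominated_convergence[where w="%y. 2 * (norm (dk (hi \<eta> s) 0 k (x - y)) * \<Phi> y)"])
    have "nice (%y. dk (hi \<eta> s) 0 k (x - y))"
     using nice_integrable[OF nh[of s k]] nice_bound[OF nh[of s k]] unfolding nice_def by (auto simp: integrable_reflect)
    then show "integrable lborel (%y. 2 * (norm (dk (hi \<eta> s) 0 k (x - y)) * \<Phi> y))" by (intro integrable_mult_right \<Phi>(3))
    show "AE y in lborel. (%n. dk (hi \<eta> s) 0 k (x - y) * h n y) \<longlonglongrightarrow> dk (hi \<eta> s) 0 k (x - y) * (f y * g y)"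
     using hl by eventually_elim (intro tendsto_mult tendsto_const)
    show "AE y in lborel. norm (dk (hi \<eta> s) 0 k (x - y) * h n y) <= 2 * (norm (dk (hi \<eta> s) 0 k (x - y)) * \<Phi> y)" for n using hb
    proof eventually_elim
     case (elim y)
     have "norm (dk (hi \<eta> s) 0 k (x - y)) * norm (h n y) <= norm (dk (hi \<eta> s) 0 k (x - y)) * (2 * \<Phi> y)"
      using elim by (intro mult_left_mono) auto
     then show ?case by (simp add: norm_mult mult_ac)
    qed
   qed measurable
   then have Rl: "(%n. norm (cx (2 powr (real_of_int k * s)) * piece \<eta> s k (h n) x)) \<longlonglongrightarrow> R k x" for k x
    unfolding R_def by (intro tendsto_norm tendsto_mult tendsto_const)
   \<comment> \<open>Fatou's lemma, with the bound for the truncated products.\<close>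
   have fin: "(NN x. ennreal (L2_set (%k. R k x) K)) <= ennreal (C * ?X)" if K: "finite K" for K
   proof -
    let ?S = "%n x. L2_set (%k. norm (cx (2 powr (real_of_int k * s)) * piece \<eta> s k (h n) x)) K"
    have "(%n. ennreal (?S n x)) \<longlonglongrightarrow> ennreal (L2_set (%k. R k x) K)" for x
     unfolding L2_set_def by (intro tendsto_ennrealI tendsto_real_sqrt tendsto_sum tendsto_power Rl)
    then have "(NN x. ennreal (L2_set (%k. R k x) K)) = (NN x. liminf (%n. ennreal (?S n x)))"
     by (intro nn_integral_cong lim_imp_Liminf[symmetric]) simp_all
    also have "... <= liminf (%n. (NN x. ennreal (?S n x)))" unfolding L2_set_def by (rule nn_integral_liminf) measurable
    also have "... <= liminf (%n. ennreal (C * ?X))"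
     unfolding h_def using C(2)[OF D L K] by (intro Liminf_mono always_eventually allI) (simp add: mixed_def)
    finally show ?thesis by (simp add: Liminf_const)
   qed
   have "hardy_norm \<eta> (frac_D_distr s (%x. f x * g x)) = (NN x. (SUP n. ennreal (L2_set (%k. R k x) {- int n..int n})))"
    unfolding hardy_norm_def lp_proj_frac_D[OF \<eta>] R_def[symmetric] SUP_finite_int_sets ..
   also have "... = (SUP n. (NN x. ennreal (L2_set (%k. R k x) {- int n..int n})))"
   proof (rule nn_integral_monotone_convergence_SUP)
    show "incseq (%n x. ennreal (L2_set (%k. R k x) {- int n..int n}))"
     unfolding L2_set_def by (intro incseq_SucI le_funI ennreal_leI real_sqrt_le_mono sum_mono2) auto
   qed (unfold L2_set_def, measurable)
   also have "... <= ennreal (C * ?X)" by (intro SUP_least fin) simp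
   also have "... <= ennreal ((C + 1) * ?X)" by (intro ennreal_leI mult_right_mono add_nonneg_nonneg mult_nonneg_nonneg Lp_norm_nonneg) simp
   finally show ?thesis .
  qed
  ultimately show ?thesis by blast
 qed
 then show ?thesis using C(1) by (intro exI[of _ "C + 1"]) auto
qed

end
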